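(* The contravariant functors $\mathcal{C}$ and $\mathcal{X}_c^*$ form a duality between the category of compactological semigroups (respectively, compactological groups) and the category of $K^*$-bialgebras (respectively, Hopf $K^*$-algebras); i.e. they are contravariant functors between these categories, and the composites $\mathcal{X}_c^*\circ\mathcal{C}$ and $\mathcal{C}\circ\mathcal{X}_c^*$ are naturally isomorphic to the respective identity functors.
   Context: Algebras. "Algebra" means commutative associative algebra over $\mathbb{C}$ with unit $1$ (the zero algebra is allowed). An involutive algebra has a conjugate-linear map $x\mapsto x^*$ with $(x^* )^*=x$, $(xy)^*=y^*x^*$. Hermitian morphisms are unit-preserving algebra homomorphisms commuting with the involutions; a hermitian character is a hermitian morphism to $\mathbb{C}$. A $C^*$-seminorm is a seminorm $p$ with $p(xx^* )=p(x)^2$. A $K^*$-algebra is an involutive algebra with a complete Hausdorff topology defined by a family of $C^*$-seminorms; morphisms are continuous hermitian morphisms. Tensor product. For $K^*$-algebras $A_1,A_2$, $A_1\hat{\otimes}_\varepsilon A_2$ is the completion of the involutive algebra $A_1\otimes A_2$ (with $(x_1\otimes x_2)(y_1\otimes y_2)=x_1y_1\otimes x_2y_2$, $(x_1\otimes x_2)^*=x_1^*\otimes x_2^*$) in the injective topology, generated by the seminorms $\sum_j a_{1j}\otimes a_{2j}\mapsto\sup\{|\sum_j w_1(a_{1j})w_2(a_{2j})|: w_i \text{ linear functional on }A_i,\ |w_i|\le p_i\}$, $p_i$ running over continuous $C^*$-seminorms on $A_i$; it is a $K^*$-algebra. Bialgebras. A $K^*$-bialgebra is a $K^*$-algebra $A$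 with a continuous hermitian morphism $\mu\colon A\to A\hat{\otimes}_\varepsilon A$ such that $(\mu\hat\otimes I_A)\circ\mu=(I_A\hat\otimes\mu)\circ\mu$. It is a Hopf $K^*$-algebra if in addition there are continuous hermitian morphisms $\epsilon\colon A\to\mathbb{C}$ and $\sigma\colon A\to A$ with $(\epsilon\hat\otimes I_A)\mu(a)=1\otimes a$, $(I_A\hat\otimes\epsilon)\mu(a)=a\otimes 1$, and $m\circ(\sigma\hat\otimes I_A)\circ\mu=\eta\circ\epsilon=m\circ(I_A\hat\otimes\sigma)\circ\mu$, where $m\colon A\hat\otimes_\varepsilon A\to A$ is the map induced by multiplication and $\eta\colon\mathbb{C}\to A$ is the unique morphism. A morphism $(A_1,\mu_1)\to(A_2,\mu_2)$ of $K^*$-bialgebras (or of Hopf $K^*$-algebras) is a continuous hermitian morphism $u$ with $\mu_2\circ u=(u\hat\otimes u)\circ\mu_1$. Compactological spaces. A compactological space is a set $S$ with a class $\varkappa$ of subsets such that: (a) $\varkappa$ covers $S$ and is upward directed by inclusion; (b) each $K\in\varkappa$ carries a compact Hausdorff topology, and for $K\subset L$ in $\varkappa$ the inclusion $K\to L$ is continuous; (c) if $H\subset L\in\varkappa$, the closure of $H$ in $L$ belongs to $\varkappa$. A morphism $(S,\varkappa)\to(S_1,\varkappa_1)$ is a map $u$ such that for each $K\in\varkappa$ there is $K_1\in\varkappa_1$ with $u[K]\subset K_1$ and $u|_K\colon K\to K_1$ continuous. Morphisms to $\mathbb{C}$ (with all compact subsets as compactology) are the functions continuous on every $K\in\varkappa$;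 $(S,\varkappa)$ is regular if these separate points. A compactological semigroup (group) is a semigroup (group) object in the category of regular compactological spaces, with respect to its categorical products; the product of $S_1,S_2$ is $S_1\times S_2$ with compactology the closed subsets of the products $K_1\times K_2$, $K_i\in\varkappa_i$. Morphisms of compactological semigroups or groups are the compactological morphisms that are multiplicative. Functors. For a regular compactological space $(S,\varkappa)$, $\mathcal{C}(S)$ is the $K^*$-algebra of all morphisms $S\to\mathbb{C}$ with pointwise operations and involution $\varphi^*=\overline{\varphi}$ and the topology of uniform convergence on the members of $\varkappa$; $\mathcal{C}(u)(\varphi)=\varphi\circ u$. For a compactological semigroup $(S,m)$, $\mathcal{C}(S)$ has comultiplication $\Phi^{-1}\circ\mathcal{C}(m)$, where $\Phi\colon\mathcal{C}(S)\hat\otimes_\varepsilon\mathcal{C}(S)\to\mathcal{C}(S\times S)$ is the canonical isomorphism with $\Phi(\varphi\otimes\psi)(s,t)=\varphi(s)\psi(t)$. For a $K^*$-algebra $A$, $\mathcal{X}_c^*(A)$ is the set $X_c^*(A)$ of continuous hermitian characters with compactology consisting of the sets $X_p^*(A)$ of hermitian characters continuous for the single seminorm $p$, $p$ running over all continuous $C^*$-seminorms on $A$, each with the topology of pointwise convergence on $A$; $\mathcal{X}_c^*(u)(\chi)=\chi\circ u$. For a $K^*$-bialgebra $(A,\mu)$, $\mathcal{X}_c^*(A)$ has the multiplication $(\chi_1,\chi_2)\mapsto\hat J(\chi_1,\chi_2)\circ\mu$, where $\hat J(\chi_1,\chi_2)$ is the continuous hermitian character of $A\hat\otimes_\varepsilon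 A$ with $a\otimes b\mapsto\chi_1(a)\chi_2(b)$. *)

theory Defs
  imports "HOL-Analysis.Analysis" "HOL-Algebra.Algebraic_Closure_Type"
begin

section \<open>Involutive algebras and \<open>K\<^sup>*\<close>-algebras\<close>

abbreviation complex_ring :: "complex ring" where
  "complex_ring \<equiv> ring_of_type_algebra"

record 'a kalg = "(complex, 'a) module" +
  invol :: "'a \<Rightarrow> 'a"
  topol :: "'a topology"

locale involutive_algebra = algebra complex_ring A
  for A :: "('a, 'm) kalg_scheme" (structure) +
  assumes invol_closed: "x \<in> carrier A \<Longrightarrow> invol A x \<in> carrier A"
    and invol_add: "\<lbrakk>x \<in> carrier A; y \<in> carrier A\<rbrakk> \<Longrightarrow> invol A (x \<oplus> y) = invol A x \<oplus> invol A y"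
    and invol_smult: "x \<in> carrier A \<Longrightarrow> invol A (c \<odot> x) = cnj c \<odot> invol A x"
    and invol_invol: "x \<in> carrier A \<Longrightarrow> invol A (invol A x) = x"
    and invol_mult: "\<lbrakk>x \<in> carrier A; y \<in> carrier A\<rbrakk> \<Longrightarrow> invol A (x \<otimes> y) = invol A y \<otimes> invol A x"

definition cstar_seminorm :: "('a, 'm) kalg_scheme \<Rightarrow> ('a \<Rightarrow> real) \<Rightarrow> bool" where
  "cstar_seminorm A p \<longleftrightarrow>
     (\<forall>x\<in>carrier A. 0 \<le> p x) \<and>
     (\<forall>x\<in>carrier A. \<forall>y\<in>carrier A. p (x \<oplus>\<^bsub>A\<^esub> y) \<le> p x + p y) \<and>
     (\<forall>c. \<forall>x\<in>carrier A. p (c \<odot>\<^bsub>A\<^esub> x) = norm c * p x) \<and>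
     (\<forall>x\<in>carrier A. p (x \<otimes>\<^bsub>A\<^esub> invol A x) = (p x)\<^sup>2)"

text \<open>The topology on \<open>V\<close> defined by a family \<open>P\<close> of seminorms, where \<open>d\<close> is the subtraction. Inserting
  \<open>V\<close> itself into the subbase matters only when \<open>P\<close> is empty (indiscrete topology).\<close>

definition seminorm_topology :: "'a set \<Rightarrow> ('a \<Rightarrow> 'a \<Rightarrow> 'a) \<Rightarrow> ('a \<Rightarrow> real) set \<Rightarrow> 'a topology" where
  "seminorm_topology V d P =
     topology_generated_by (insert V {{y \<in> V. p (d y x) < e} | p x e. p \<in> P \<and> x \<in> V \<and> 0 < e})"

definition cauchy_filter :: "('a, 'm) kalg_scheme \<Rightarrow> 'a filter \<Rightarrow> bool" where
  "cauchy_filter A F \<longleftrightarrow>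
     F \<noteq> bot \<and> F \<le> principal (carrier A) \<and>
     (\<forall>U. openin (topol A) U \<and> \<zero>\<^bsub>A\<^esub> \<in> U \<longrightarrow>
        (\<exists>M. M \<subseteq> carrier A \<and> eventually (\<lambda>x. x \<in> M) F \<and> (\<forall>x\<in>M. \<forall>y\<in>M. x \<ominus>\<^bsub>A\<^esub> y \<in> U)))"

locale kstar_algebra = involutive_algebra A
  for A :: "('a, 'm) kalg_scheme" (structure) +
  assumes topol_seminorms:
      "\<exists>P. (\<forall>p\<in>P. cstar_seminorm A p) \<and>
           topol A = seminorm_topology (carrier A) (\<lambda>x y. x \<ominus> y) P"
    and topol_Hausdorff: "Hausdorff_space (topol A)"
    and topol_complete: "cauchy_filter A F \<Longrightarrow> \<exists>l. limitin (topol A) (\<lambda>x. x) l F"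

definition cont_cstar_seminorms :: "('a, 'm) kalg_scheme \<Rightarrow> ('a \<Rightarrow> real) set" where
  "cont_cstar_seminorms A = {p. cstar_seminorm A p \<and> continuous_map (topol A) euclideanreal p}"

text \<open>Throughout, maps out of a carrier are represented by functions extensional on that carrier,
  so that equality of morphisms and of characters is equality of functions.\<close>

definition hermitian_hom :: "('a, 'm) kalg_scheme \<Rightarrow> ('b, 'n) kalg_scheme \<Rightarrow> ('a \<Rightarrow> 'b) set" where
  "hermitian_hom A B =
     {u \<in> ring_hom A B. u \<in> extensional (carrier A) \<and>
        (\<forall>c. \<forall>x\<in>carrier A. u (c \<odot>\<^bsub>A\<^esub> x) = c \<odot>\<^bsub>B\<^esub> u x) \<and>
        (\<forall>x\<in>carrier A. u (invol A x) = invol B (u x))}"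

definition kalg_hom :: "('a, 'm) kalg_scheme \<Rightarrow> ('b, 'n) kalg_scheme \<Rightarrow> ('a \<Rightarrow> 'b) set" where
  "kalg_hom A B = {u \<in> hermitian_hom A B. continuous_map (topol A) (topol B) u}"

definition kalg_id :: "('a, 'm) kalg_scheme \<Rightarrow> 'a \<Rightarrow> 'a" where
  "kalg_id A = (\<lambda>x\<in>carrier A. x)"

definition complex_kalg :: "complex kalg" where
  "complex_kalg = \<lparr>carrier = UNIV, mult = (*), one = 1, zero = 0, add = (+),
     smult = (*), invol = cnj, topol = euclidean\<rparr>"


section \<open>The completed injective tensor product\<close>

definition linear_functional :: "('a, 'm) kalg_scheme \<Rightarrow> ('a \<Rightarrow> complex) \<Rightarrow> bool" where
  "linear_functional A w \<longleftrightarrow>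
     w \<in> extensional (carrier A) \<and>
     (\<forall>x\<in>carrier A. \<forall>y\<in>carrier A. w (x \<oplus>\<^bsub>A\<^esub> y) = w x + w y) \<and>
     (\<forall>c. \<forall>x\<in>carrier A. w (c \<odot>\<^bsub>A\<^esub> x) = c * w x)"

definition polar :: "('a, 'm) kalg_scheme \<Rightarrow> ('a \<Rightarrow> real) \<Rightarrow> ('a \<Rightarrow> complex) set" where
  "polar A p = {w. linear_functional A w \<and> (\<forall>x\<in>carrier A. norm (w x) \<le> p x)}"

definition dual_ball :: "('a, 'm) kalg_scheme \<Rightarrow> ('a \<Rightarrow> complex) set" where
  "dual_ball A = (\<Union>p\<in>cont_cstar_seminorms A. polar A p)"

text \<open>A tensor \<open>\<Sum>\<^sub>j a\<^sub>j \<otimes> b\<^sub>j\<close> is represented by the function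
  \<open>(w\<^sub>1, w\<^sub>2) \<mapsto> \<Sum>\<^sub>j w\<^sub>1(a\<^sub>j) w\<^sub>2(b\<^sub>j)\<close> on pairs of functionals dominated by continuous \<open>C\<^sup>*\<close>-seminorms.
  For \<open>K\<^sup>*\<close>-algebras these functionals span the topological duals, which separate points, so this
  is an embedding of the algebraic tensor product; it turns the injective seminorms into suprema
  over the sets \<open>polar A p \<times> polar B q\<close>, and the completion into the set of functions that are
  limits of tensors, uniformly on each of these sets.\<close>

definition tensor_sum ::
  "('a, 'm) kalg_scheme \<Rightarrow> ('b, 'n) kalg_scheme \<Rightarrow> ('a \<times> 'b) list
     \<Rightarrow> ('a \<Rightarrow> complex) \<times> ('b \<Rightarrow> complex) \<Rightarrow> complex" where
  "tensor_sum A B xs =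
     (\<lambda>(w\<^sub>1, w\<^sub>2) \<in> dual_ball A \<times> dual_ball B. \<Sum>(a, b) \<leftarrow> xs. w\<^sub>1 a * w\<^sub>2 b)"

abbreviation elem_tensor ::
  "('a, 'm) kalg_scheme \<Rightarrow> ('b, 'n) kalg_scheme \<Rightarrow> 'a \<Rightarrow> 'b
     \<Rightarrow> ('a \<Rightarrow> complex) \<times> ('b \<Rightarrow> complex) \<Rightarrow> complex" where
  "elem_tensor A B a b \<equiv> tensor_sum A B [(a, b)]"

definition tensor_carrier ::
  "('a, 'm) kalg_scheme \<Rightarrow> ('b, 'n) kalg_scheme
     \<Rightarrow> (('a \<Rightarrow> complex) \<times> ('b \<Rightarrow> complex) \<Rightarrow> complex) set" where
  "tensor_carrier A B =
     {F \<in> extensional (dual_ball A \<times> dual_ball B).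
        \<forall>p\<in>cont_cstar_seminorms A. \<forall>q\<in>cont_cstar_seminorms B. \<forall>e>0.
          \<exists>xs\<in>lists (carrier A \<times> carrier B).
            \<forall>w \<in> polar A p \<times> polar B q. norm (F w - tensor_sum A B xs w) < e}"

text \<open>Inserting \<open>0\<close> gives the supremum over the empty set its intended value.\<close>

definition sup_seminorm :: "'x set \<Rightarrow> ('x \<Rightarrow> complex) \<Rightarrow> real" where
  "sup_seminorm K f = Sup (insert 0 ((\<lambda>x. norm (f x)) ` K))"

definition tensor_topology ::
  "('a, 'm) kalg_scheme \<Rightarrow> ('b, 'n) kalg_scheme
     \<Rightarrow> (('a \<Rightarrow> complex) \<times> ('b \<Rightarrow> complex) \<Rightarrow> complex) topology" where
  "tensor_topology A B =
     seminorm_topology (tensor_carrier A B) (\<lambda>F G w. F w - G w)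
       {sup_seminorm (polar A p \<times> polar B q) | p q.
          p \<in> cont_cstar_seminorms A \<and> q \<in> cont_cstar_seminorms B}"

text \<open>Multiplication and involution of the completion are the unique continuous extensions of
  those of the algebraic tensor product.\<close>

definition tensor_mult ::
  "('a, 'm) kalg_scheme \<Rightarrow> ('b, 'n) kalg_scheme
     \<Rightarrow> (('a \<Rightarrow> complex) \<times> ('b \<Rightarrow> complex) \<Rightarrow> complex)
     \<Rightarrow> (('a \<Rightarrow> complex) \<times> ('b \<Rightarrow> complex) \<Rightarrow> complex)
     \<Rightarrow> (('a \<Rightarrow> complex) \<times> ('b \<Rightarrow> complex) \<Rightarrow> complex)" where
  "tensor_mult A B = curry
     (THE M. M \<in> extensional (tensor_carrier A B \<times> tensor_carrier A B) \<and>
        continuous_map (prod_topology (tensor_topology A B) (tensor_topology A B)) (tensor_topology A B) M \<and>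
        (\<forall>xs\<in>lists (carrier A \<times> carrier B). \<forall>ys\<in>lists (carrier A \<times> carrier B).
           M (tensor_sum A B xs, tensor_sum A B ys) =
           tensor_sum A B [(a \<otimes>\<^bsub>A\<^esub> a', b \<otimes>\<^bsub>B\<^esub> b'). (a, b) \<leftarrow> xs, (a', b') \<leftarrow> ys]))"

definition tensor_invol ::
  "('a, 'm) kalg_scheme \<Rightarrow> ('b, 'n) kalg_scheme
     \<Rightarrow> (('a \<Rightarrow> complex) \<times> ('b \<Rightarrow> complex) \<Rightarrow> complex)
     \<Rightarrow> (('a \<Rightarrow> complex) \<times> ('b \<Rightarrow> complex) \<Rightarrow> complex)" where
  "tensor_invol A B =
     (THE J. J \<in> extensional (tensor_carrier A B) \<and>
        continuous_map (tensor_topology A B) (tensor_topology A B) J \<and>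
        (\<forall>xs\<in>lists (carrier A \<times> carrier B).
           J (tensor_sum A B xs) = tensor_sum A B [(invol A a, invol B b). (a, b) \<leftarrow> xs]))"

definition tensor ::
  "('a, 'm) kalg_scheme \<Rightarrow> ('b, 'n) kalg_scheme
     \<Rightarrow> (('a \<Rightarrow> complex) \<times> ('b \<Rightarrow> complex) \<Rightarrow> complex) kalg" where
  "tensor A B =
     \<lparr>carrier = tensor_carrier A B,
      mult = tensor_mult A B,
      one = elem_tensor A B \<one>\<^bsub>A\<^esub> \<one>\<^bsub>B\<^esub>,
      zero = (\<lambda>w \<in> dual_ball A \<times> dual_ball B. 0),
      add = (\<lambda>F G. \<lambda>w \<in> dual_ball A \<times> dual_ball B. F w + G w),
      smult = (\<lambda>c F. \<lambda>w \<in> dual_ball A \<times> dual_ball B. c * F w),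
      invol = tensor_invol A B,
      topol = tensor_topology A B\<rparr>"

text \<open>The morphism out of the completed tensor product with \<open>a \<otimes> b \<mapsto> \<beta> a b\<close>; it is unique, when it
  exists, because elementary tensors span a dense subspace.\<close>

definition tensor_lift ::
  "('a, 'm) kalg_scheme \<Rightarrow> ('b, 'n) kalg_scheme \<Rightarrow> ('c, 'k) kalg_scheme \<Rightarrow> ('a \<Rightarrow> 'b \<Rightarrow> 'c)
     \<Rightarrow> (('a \<Rightarrow> complex) \<times> ('b \<Rightarrow> complex) \<Rightarrow> complex) \<Rightarrow> 'c" where
  "tensor_lift A B C \<beta> =
     (THE h. h \<in> kalg_hom (tensor A B) C \<and>
        (\<forall>a\<in>carrier A. \<forall>b\<in>carrier B. h (elem_tensor A B a b) = \<beta> a b))"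

definition tensor_map ::
  "('a, 'm) kalg_scheme \<Rightarrow> ('b, 'n) kalg_scheme \<Rightarrow> ('c, 'k) kalg_scheme \<Rightarrow> ('d, 'l) kalg_scheme
     \<Rightarrow> ('a \<Rightarrow> 'c) \<Rightarrow> ('b \<Rightarrow> 'd)
     \<Rightarrow> (('a \<Rightarrow> complex) \<times> ('b \<Rightarrow> complex) \<Rightarrow> complex)
     \<Rightarrow> (('c \<Rightarrow> complex) \<times> ('d \<Rightarrow> complex) \<Rightarrow> complex)" where
  "tensor_map A B C D u v = tensor_lift A B (tensor C D) (\<lambda>a b. elem_tensor C D (u a) (v b))"

text \<open>The canonical identification of the two triple tensor products, implicit in the
  coassociativity axiom.\<close>

definition tensor_assoc ::
  "('a, 'm) kalg_scheme \<Rightarrow> ('b, 'n) kalg_scheme \<Rightarrow> ('c, 'k) kalg_scheme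
     \<Rightarrow> (((('a \<Rightarrow> complex) \<times> ('b \<Rightarrow> complex) \<Rightarrow> complex) \<Rightarrow> complex) \<times> ('c \<Rightarrow> complex) \<Rightarrow> complex)
     \<Rightarrow> (('a \<Rightarrow> complex) \<times> ((('b \<Rightarrow> complex) \<times> ('c \<Rightarrow> complex) \<Rightarrow> complex) \<Rightarrow> complex) \<Rightarrow> complex)" where
  "tensor_assoc A B C =
     (THE h. h \<in> kalg_hom (tensor (tensor A B) C) (tensor A (tensor B C)) \<and>
        (\<forall>a\<in>carrier A. \<forall>b\<in>carrier B. \<forall>c\<in>carrier C.
           h (elem_tensor (tensor A B) C (elem_tensor A B a b) c) =
           elem_tensor A (tensor B C) a (elem_tensor B C b c)))"


section \<open>\<open>K\<^sup>*\<close>-bialgebras and Hopf \<open>K\<^sup>*\<close>-algebras\<close>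

record 'a kbialg = "'a kalg" +
  comult :: "'a \<Rightarrow> (('a \<Rightarrow> complex) \<times> ('a \<Rightarrow> complex) \<Rightarrow> complex)"

locale kstar_bialgebra = kstar_algebra A
  for A :: "('a, 'm) kbialg_scheme" (structure) +
  assumes comult_hom: "comult A \<in> kalg_hom A (tensor A A)"
    and coassoc: "a \<in> carrier A \<Longrightarrow>
      tensor_assoc A A A (tensor_map A A (tensor A A) A (comult A) (kalg_id A) (comult A a)) =
      tensor_map A A A (tensor A A) (kalg_id A) (comult A) (comult A a)"

locale hopf_kstar_algebra = kstar_bialgebra A
  for A :: "('a, 'm) kbialg_scheme" (structure) +
  assumes counit_antipode:
    "\<exists>\<epsilon>\<in>kalg_hom A complex_kalg. \<exists>\<sigma>\<in>kalg_hom A A. \<forall>a\<in>carrier A.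
       tensor_map A A complex_kalg A \<epsilon> (kalg_id A) (comult A a) = elem_tensor complex_kalg A 1 a \<and>
       tensor_map A A A complex_kalg (kalg_id A) \<epsilon> (comult A a) = elem_tensor A complex_kalg a 1 \<and>
       tensor_lift A A A (\<lambda>x y. x \<otimes> y) (tensor_map A A A A \<sigma> (kalg_id A) (comult A a)) = \<epsilon> a \<odot> \<one> \<and>
       tensor_lift A A A (\<lambda>x y. x \<otimes> y) (tensor_map A A A A (kalg_id A) \<sigma> (comult A a)) = \<epsilon> a \<odot> \<one>"

definition kbialg_hom :: "('a, 'm) kbialg_scheme \<Rightarrow> ('b, 'n) kbialg_scheme \<Rightarrow> ('a \<Rightarrow> 'b) set" where
  "kbialg_hom A B =
     {u \<in> kalg_hom A B. \<forall>a\<in>carrier A. comult B (u a) = tensor_map A A B B u u (comult A a)}"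

definition kbialg_iso :: "('a, 'm) kbialg_scheme \<Rightarrow> ('b, 'n) kbialg_scheme \<Rightarrow> ('a \<Rightarrow> 'b) set" where
  "kbialg_iso A B =
     {u \<in> kbialg_hom A B. \<exists>v\<in>kbialg_hom B A.
        compose (carrier A) v u = kalg_id A \<and> compose (carrier B) u v = kalg_id B}"


section \<open>Compactological spaces, semigroups and groups\<close>

record 's compactological =
  points :: "'s set"
  compacta :: "'s set set"
  ktop :: "'s set \<Rightarrow> 's topology"

locale compactological_space =
  fixes S :: "('s, 'm) compactological_scheme" (structure)
  assumes compacta_cover: "\<Union> (compacta S) = points S"
    and compacta_nonempty: "compacta S \<noteq> {}"
    and compacta_directed: "\<lbrakk>K \<in> compacta S; L \<in> compacta S\<rbrakk> \<Longrightarrow> \<exists>M\<in>compacta S. K \<union> L \<subseteq> M"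
    and ktop_topspace: "K \<in> compacta S \<Longrightarrow> topspace (ktop S K) = K"
    and ktop_compact: "K \<in> compacta S \<Longrightarrow> compact_space (ktop S K)"
    and ktop_Hausdorff: "K \<in> compacta S \<Longrightarrow> Hausdorff_space (ktop S K)"
    and ktop_inclusion: "\<lbrakk>K \<in> compacta S; L \<in> compacta S; K \<subseteq> L\<rbrakk> \<Longrightarrow>
          continuous_map (ktop S K) (ktop S L) (\<lambda>x. x)"
    and compacta_closure: "\<lbrakk>L \<in> compacta S; H \<subseteq> L\<rbrakk> \<Longrightarrow> ktop S L closure_of H \<in> compacta S"

definition compactological_hom ::
  "('s, 'm) compactological_scheme \<Rightarrow> ('t, 'n) compactological_scheme \<Rightarrow> ('s \<Rightarrow> 't) set" where
  "compactological_hom S T =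
     {u \<in> points S \<rightarrow>\<^sub>E points T. \<forall>K\<in>compacta S. \<exists>L\<in>compacta T.
        u ` K \<subseteq> L \<and> continuous_map (ktop S K) (ktop T L) u}"

definition compactological_id :: "('s, 'm) compactological_scheme \<Rightarrow> 's \<Rightarrow> 's" where
  "compactological_id S = (\<lambda>x\<in>points S. x)"

definition complex_space :: "complex compactological" where
  "complex_space = \<lparr>points = UNIV, compacta = {K. compact K}, ktop = top_of_set\<rparr>"

locale regular_compactological_space = compactological_space +
  assumes regular: "\<lbrakk>x \<in> points S; y \<in> points S; x \<noteq> y\<rbrakk> \<Longrightarrow>
    \<exists>f\<in>compactological_hom S complex_space. f x \<noteq> f y"

text \<open>If \<open>H\<close> is closed in some \<open>K\<^sub>1 \<times> K\<^sub>2\<close>, then by compactness its projections are closed in \<open>K\<^sub>1\<close>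
  and \<open>K\<^sub>2\<close>, hence are themselves members of the compactologies, and they carry the subspace
  topologies. So the product topology on the projections induces on \<open>H\<close> the topology of \<open>K\<^sub>1 \<times> K\<^sub>2\<close>.\<close>

definition compactological_prod ::
  "('s, 'm) compactological_scheme \<Rightarrow> ('t, 'n) compactological_scheme \<Rightarrow> ('s \<times> 't) compactological" where
  "compactological_prod S T =
     \<lparr>points = points S \<times> points T,
      compacta = {H. \<exists>K\<^sub>1\<in>compacta S. \<exists>K\<^sub>2\<in>compacta T. closedin (prod_topology (ktop S K\<^sub>1) (ktop T K\<^sub>2)) H},
      ktop = (\<lambda>H. subtopology (prod_topology (ktop S (fst ` H)) (ktop T (snd ` H))) H)\<rparr>"

record 's compactological_sgp = "'s compactological" +
  smul :: "'s \<times> 's \<Rightarrow> 's"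

locale compactological_semigroup = regular_compactological_space S
  for S :: "('s, 'm) compactological_sgp_scheme" (structure) +
  assumes smul_hom: "smul S \<in> compactological_hom (compactological_prod S S) S"
    and smul_assoc: "\<lbrakk>x \<in> points S; y \<in> points S; z \<in> points S\<rbrakk> \<Longrightarrow>
      smul S (smul S (x, y), z) = smul S (x, smul S (y, z))"

locale compactological_group = compactological_semigroup S
  for S :: "('s, 'm) compactological_sgp_scheme" (structure) +
  assumes unit_inverse:
    "\<exists>e\<in>points S. \<exists>i\<in>compactological_hom S S. \<forall>x\<in>points S.
       smul S (e, x) = x \<and> smul S (x, e) = x \<and> smul S (i x, x) = e \<and> smul S (x, i x) = e"

definition csgp_hom ::
  "('s, 'm) compactological_sgp_scheme \<Rightarrow> ('t, 'n) compactological_sgp_scheme \<Rightarrow> ('s \<Rightarrow> 't) set" where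
  "csgp_hom S T =
     {u \<in> compactological_hom S T.
        \<forall>x\<in>points S. \<forall>y\<in>points S. u (smul S (x, y)) = smul T (u x, u y)}"

definition csgp_iso ::
  "('s, 'm) compactological_sgp_scheme \<Rightarrow> ('t, 'n) compactological_sgp_scheme \<Rightarrow> ('s \<Rightarrow> 't) set" where
  "csgp_iso S T =
     {u \<in> csgp_hom S T. \<exists>v\<in>csgp_hom T S.
        compose (points S) v u = compactological_id S \<and> compose (points T) u v = compactological_id T}"


section \<open>The functors \<open>\<C>\<close> and \<open>\<X>\<^sub>c\<^sup>*\<close>\<close>

definition C_alg :: "('s, 'm) compactological_scheme \<Rightarrow> ('s \<Rightarrow> complex) kalg" where
  "C_alg S =
     \<lparr>carrier = compactological_hom S complex_space,
      mult = (\<lambda>f g. \<lambda>x\<in>points S. f x * g x),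
      one = (\<lambda>x\<in>points S. 1),
      zero = (\<lambda>x\<in>points S. 0),
      add = (\<lambda>f g. \<lambda>x\<in>points S. f x + g x),
      smult = (\<lambda>c f. \<lambda>x\<in>points S. c * f x),
      invol = (\<lambda>f. \<lambda>x\<in>points S. cnj (f x)),
      topol = seminorm_topology (compactological_hom S complex_space) (\<lambda>f g x. f x - g x)
                (sup_seminorm ` compacta S)\<rparr>"

definition C_map ::
  "('s, 'm) compactological_scheme \<Rightarrow> ('t, 'n) compactological_scheme
     \<Rightarrow> ('s \<Rightarrow> 't) \<Rightarrow> ('t \<Rightarrow> complex) \<Rightarrow> ('s \<Rightarrow> complex)" where
  "C_map S T u = (\<lambda>\<phi>\<in>carrier (C_alg T). compose (points S) \<phi> u)"

text \<open>The canonical map \<open>\<C>(S) \<otimes> \<C>(S) \<rightarrow> \<C>(S \<times> S)\<close> is bijective for regular \<open>S\<close>; the comultiplication of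
  \<open>\<C>(S)\<close> uses its inverse.\<close>

definition C_prod_iso ::
  "('s, 'm) compactological_scheme
     \<Rightarrow> ((('s \<Rightarrow> complex) \<Rightarrow> complex) \<times> (('s \<Rightarrow> complex) \<Rightarrow> complex) \<Rightarrow> complex)
     \<Rightarrow> ('s \<times> 's \<Rightarrow> complex)" where
  "C_prod_iso S =
     tensor_lift (C_alg S) (C_alg S) (C_alg (compactological_prod S S))
       (\<lambda>\<phi> \<psi>. \<lambda>(s, t) \<in> points S \<times> points S. \<phi> s * \<psi> t)"

definition C_bialg :: "('s, 'm) compactological_sgp_scheme \<Rightarrow> ('s \<Rightarrow> complex) kbialg" where
  "C_bialg S = kalg.extend (C_alg S)
     (kbialg.fields
       (compose (carrier (C_alg S))
         (inv_into (carrier (tensor (C_alg S) (C_alg S))) (C_prod_iso S))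
         (C_map (compactological_prod S S) S (smul S))))"

definition X_p :: "('a, 'm) kalg_scheme \<Rightarrow> ('a \<Rightarrow> real) \<Rightarrow> ('a \<Rightarrow> complex) set" where
  "X_p A p =
     {\<xi> \<in> hermitian_hom A complex_kalg.
        continuous_map (seminorm_topology (carrier A) (\<lambda>x y. x \<ominus>\<^bsub>A\<^esub> y) {p}) euclidean \<xi>}"

definition X_space :: "('a, 'm) kalg_scheme \<Rightarrow> ('a \<Rightarrow> complex) compactological" where
  "X_space A =
     \<lparr>points = kalg_hom A complex_kalg,
      compacta = X_p A ` cont_cstar_seminorms A,
      ktop = (\<lambda>K. subtopology (product_topology (\<lambda>_. euclidean) (carrier A)) K)\<rparr>"

definition X_map ::
  "('a, 'm) kalg_scheme \<Rightarrow> ('b, 'n) kalg_scheme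
     \<Rightarrow> ('a \<Rightarrow> 'b) \<Rightarrow> ('b \<Rightarrow> complex) \<Rightarrow> ('a \<Rightarrow> complex)" where
  "X_map A B u = (\<lambda>\<xi>\<in>points (X_space B). compose (carrier A) \<xi> u)"

definition X_sgp :: "('a, 'm) kbialg_scheme \<Rightarrow> ('a \<Rightarrow> complex) compactological_sgp" where
  "X_sgp A = compactological.extend (X_space A)
     (compactological_sgp.fields
       (\<lambda>(\<xi>\<^sub>1, \<xi>\<^sub>2) \<in> points (X_space A) \<times> points (X_space A).
          compose (carrier A)
            (tensor_lift A A complex_kalg (\<lambda>a b. \<xi>\<^sub>1 a * \<xi>\<^sub>2 b)) (comult A)))"

text \<open>The components of the two natural isomorphisms. A family of maps indexed by objects
  over arbitrary types cannot be quantified existentially in HOL, so these are named.\<close>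

definition eval_space :: "('s, 'm) compactological_scheme \<Rightarrow> 's \<Rightarrow> ('s \<Rightarrow> complex) \<Rightarrow> complex" where
  "eval_space S = (\<lambda>s\<in>points S. \<lambda>\<phi>\<in>carrier (C_alg S). \<phi> s)"

definition eval_alg :: "('a, 'm) kalg_scheme \<Rightarrow> 'a \<Rightarrow> ('a \<Rightarrow> complex) \<Rightarrow> complex" where
  "eval_alg A = (\<lambda>a\<in>carrier A. \<lambda>\<xi>\<in>points (X_space A). \<xi> a)"

end

theory Submission
  imports Defs
begin

text \<open>Everything is computed on characters. A commutative \<open>C\<^sup>*\<close>-seminorm is the supremum of \<open>|\<xi>|\<close> over the
  hermitian characters \<open>\<xi>\<close> it dominates, so elements of a \<open>K\<^sup>*\<close>-algebra are determined by their values on continuous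
  characters, and by Stone-Weierstrass and completeness every function on the characters that is continuous on each
  \<open>X\<^sub>p\<close> is such an element. Hence morphisms \<open>A \<rightarrow> B\<close> correspond to maps from the characters of \<open>B\<close> to those of \<open>A\<close>.
  The characters of \<open>\<C>(S)\<close> are the point evaluations, and those of the completed tensor product are the pairs of
  characters. In these terms a comultiplication is a multiplication of characters, coassociativity is its
  associativity, and a counit and an antipode are a unit and an inversion.\<close>

section \<open>C-star seminorms\<close>

text \<open>No seminorm is assumed submultiplicative, and the algebra need not be complete for a
  single seminorm, so spectra and quotient C*-algebras are not at hand. Everything rests on
  squaring: an estimate with a constant, applied to powers of exponent \<open>2 ^ n\<close> of
  self-adjoint elements, loses its constant. This yields submultiplicativity, and it shows that a
  C*-seminorm below a multiple of another one is below it outright. Characters come from minimal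
  C*-seminorms rather than from maximal ideals, since minimality forces multiplicativity. One
  separation argument serves three times: a compact set of characters contains every character
  bounded by its supremum seminorm. It gives the closure axiom for the compactology on characters,
  the characters of function algebras and those of tensor products. The product of the tensor
  product is given by a description and has no known values until existence is proved; elements are
  functions on pairs of functionals, and only at pairs of characters is the product
  pointwise.\<close>

lemma complex_ring_simps [simp]:
  "carrier complex_ring = UNIV" "mult complex_ring = (*)" "one complex_ring = 1"
  "zero complex_ring = 0" "add complex_ring = (+)"
  by (auto simp: ring_of_type_algebra_def)

lemma power_two_tendsto_zero:
  fixes r :: real
  assumes "0 \<le> r" "r < 1"
  shows "(\<lambda>n. r ^ (2 ^ n)) \<longlonglongrightarrow> 0"
proof (rule LIMSEQ_subseq_LIMSEQ[of "\<lambda>n. r ^ n", unfolded o_def])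
  show "(\<lambda>n. r ^ n) \<longlonglongrightarrow> 0" using assms by (intro LIMSEQ_power_zero) auto
  show "strict_mono (\<lambda>n. 2 ^ n :: nat)" by (simp add: strict_mono_def)
qed

text \<open>If \<open>b < a\<close>, dividing by \<open>a ^ (2 ^ n)\<close> bounds 1 by
  \<open>c * (b / a) ^ (2 ^ n)\<close>, which tends to 0. The exponents are powers of two because
  the C*-identity controls squares of self-adjoint elements.\<close>

lemma power_two_limit_le:
  fixes a b c :: real
  assumes "0 \<le> b" and le: "\<And>n. a ^ (2 ^ n) \<le> c * b ^ (2 ^ n)"
  shows "a \<le> b"
proof (rule ccontr)
  assume "\<not> a \<le> b"
  then have ab: "b < a" "0 < a" using \<open>0 \<le> b\<close> by auto
  have "(\<lambda>n. (b / a) ^ (2 ^ n)) \<longlonglongrightarrow> 0"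
    using ab \<open>0 \<le> b\<close> by (intro power_two_tendsto_zero) auto
  then have "(\<lambda>n. c * (b / a) ^ (2 ^ n)) \<longlonglongrightarrow> c * 0" by (intro tendsto_intros)
  moreover have "1 \<le> c * (b / a) ^ (2 ^ n)" for n
    using le[of n] ab by (simp add: power_divide field_simps)
  ultimately have "1 \<le> c * (0::real)"
    by (intro LIMSEQ_le_const) auto
  then show False by simp
qed

context involutive_algebra
begin

definition const :: "complex \<Rightarrow> 'a" where "const c = c \<odot> \<one>"

lemma smult_in [simp, intro]: "x \<in> carrier A \<Longrightarrow> c \<odot> x \<in> carrier A"
  by (rule smult_closed) auto

lemma const_closed [simp, intro]: "const c \<in> carrier A"
  by (simp add: const_def)

lemma smult_add_left: "x \<in> carrier A \<Longrightarrow> (a + b) \<odot> x = a \<odot> x \<oplus> b \<odot> x"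
  using smult_l_distr[of a b x] by simp

lemma smult_add_right: "x \<in> carrier A \<Longrightarrow> y \<in> carrier A \<Longrightarrow> a \<odot> (x \<oplus> y) = a \<odot> x \<oplus> a \<odot> y"
  using smult_r_distr[of a x y] by simp

lemma smult_smult: "x \<in> carrier A \<Longrightarrow> a \<odot> (b \<odot> x) = (a * b) \<odot> x"
  using smult_assoc1[of a b x] by simp

lemma smult_1 [simp]: "x \<in> carrier A \<Longrightarrow> 1 \<odot> x = x"
  using smult_one[of x] by simp

lemma smult_0 [simp]: "x \<in> carrier A \<Longrightarrow> 0 \<odot> x = \<zero>"
  using smult_l_null[of x] by simp

lemma smult_mult_left: "x \<in> carrier A \<Longrightarrow> y \<in> carrier A \<Longrightarrow> (a \<odot> x) \<otimes> y = a \<odot> (x \<otimes> y)"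
  using smult_assoc2[of a x y] by simp

lemma smult_mult_right: "x \<in> carrier A \<Longrightarrow> y \<in> carrier A \<Longrightarrow> x \<otimes> (a \<odot> y) = a \<odot> (x \<otimes> y)"
  by (metis m_comm smult_mult_left smult_in)

lemma neg_eq_smult:
  assumes "x \<in> carrier A" shows "\<ominus> x = (-1) \<odot> x"
proof (rule M.minus_equality)
  have "(-1) \<odot> x \<oplus> x = ((-1) + 1) \<odot> x"
    using assms by (simp only: smult_add_left smult_1)
  then show "(-1) \<odot> x \<oplus> x = \<zero>" using assms by simp
qed (use assms in auto)

lemma diff_eq_smult: "x \<in> carrier A \<Longrightarrow> y \<in> carrier A \<Longrightarrow> x \<ominus> y = x \<oplus> (-1) \<odot> y"
  by (simp add: a_minus_def neg_eq_smult)

lemma invol_in [simp, intro]: "x \<in> carrier A \<Longrightarrow> invol A x \<in> carrier A"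
  by (rule invol_closed)

lemma invol_one [simp]: "invol A \<one> = \<one>"
  by (metis l_one one_closed r_one invol_closed invol_invol invol_mult)

lemma invol_const: "invol A (const c) = const (cnj c)"
  by (simp add: const_def invol_smult)

lemma invol_diff: "x \<in> carrier A \<Longrightarrow> y \<in> carrier A \<Longrightarrow> invol A (x \<ominus> y) = invol A x \<ominus> invol A y"
  by (simp add: diff_eq_smult invol_add invol_smult)

lemma const_add: "const a \<oplus> const b = const (a + b)"
  by (simp add: const_def smult_add_left)

lemma const_0: "const 0 = \<zero>" and const_1: "const 1 = \<one>"
  by (simp_all add: const_def)

end

section \<open>Inequalities for a single C*-seminorm\<close>

locale cstar_seminorm_on = involutive_algebra A for A :: "('a, 'm) kalg_scheme" (structure) +
  fixes p :: "'a \<Rightarrow> real"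
  assumes cstar: "cstar_seminorm A p"
begin

lemma nonneg [simp]: "x \<in> carrier A \<Longrightarrow> 0 \<le> p x"
  and triangle: "x \<in> carrier A \<Longrightarrow> y \<in> carrier A \<Longrightarrow> p (x \<oplus> y) \<le> p x + p y"
  and homogeneous: "x \<in> carrier A \<Longrightarrow> p (c \<odot> x) = norm c * p x"
  and cstar_identity: "x \<in> carrier A \<Longrightarrow> p (x \<otimes> invol A x) = (p x)\<^sup>2"
  using cstar by (auto simp: cstar_seminorm_def)

lemma at_zero [simp]: "p \<zero> = 0"
  using homogeneous[of \<zero> 0] by simp

lemma diff_commute: "x \<in> carrier A \<Longrightarrow> y \<in> carrier A \<Longrightarrow> p (x \<ominus> y) = p (y \<ominus> x)"
  using homogeneous[of "y \<ominus> x" "-1"]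
  by (simp add: diff_eq_smult smult_add_right smult_smult M.a_comm)

lemma diff_triangle:
  assumes "x \<in> carrier A" "y \<in> carrier A" "z \<in> carrier A"
  shows "p (x \<ominus> z) \<le> p (x \<ominus> y) + p (y \<ominus> z)"
proof -
  have "x \<ominus> z = (x \<ominus> y) \<oplus> (y \<ominus> z)"
    using assms by (simp add: a_minus_def M.a_assoc M.r_neg1)
  then show ?thesis using triangle[of "x \<ominus> y" "y \<ominus> z"] assms by simp
qed

lemma le_diff_add:
  assumes "x \<in> carrier A" "y \<in> carrier A"
  shows "p x \<le> p (x \<ominus> y) + p y"
  using diff_triangle[of x y \<zero>] assms by (simp add: a_minus_def)

lemma of_invol: assumes "x \<in> carrier A" shows "p (invol A x) = p x"
proof -
  have "(p (invol A x))\<^sup>2 = (p x)\<^sup>2"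
    using assms cstar_identity[of x] cstar_identity[of "invol A x"]
    by (simp add: invol_invol m_comm)
  then show ?thesis using assms by simp
qed

lemma at_square: "h \<in> carrier A \<Longrightarrow> invol A h = h \<Longrightarrow> p (h \<otimes> h) = (p h)\<^sup>2"
  using cstar_identity[of h] by simp

lemma le_add_add:
  assumes "x \<in> carrier A" "y \<in> carrier A"
  shows "p x \<le> p (x \<oplus> y) + p y"
proof -
  have "p (x \<ominus> ((-1) \<odot> y)) = p (x \<oplus> y)"
    using assms by (simp add: diff_eq_smult smult_smult)
  then show ?thesis
    using le_diff_add[of x "(-1) \<odot> y"] homogeneous[of y "-1"] assms by simp
qed

text \<open>Polarization: \<open>2 \<odot> (h \<otimes> k)\<close> is the square of
  \<open>h \<oplus> k\<close> minus the squares of \<open>h\<close> and \<open>k\<close>, and on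
  squares of self-adjoint elements \<open>p\<close> is known by the C*-identity.\<close>

lemma mult_selfadjoint_le_sum:
  assumes h: "h \<in> carrier A" "invol A h = h" and k: "k \<in> carrier A" "invol A k = k"
  shows "p (h \<otimes> k) \<le> (p h + p k)\<^sup>2"
proof -
  define s where "s = h \<oplus> k"
  have s: "s \<in> carrier A" "invol A s = s" using h k by (auto simp: s_def invol_add)
  have "2 \<odot> (h \<otimes> k) = h \<otimes> k \<oplus> h \<otimes> k"
    using smult_add_left[of "h \<otimes> k" 1 1] h k by simp
  then have eq: "2 \<odot> (h \<otimes> k) \<oplus> (h \<otimes> h \<oplus> k \<otimes> k) = s \<otimes> s"
    using h k by (simp add: s_def l_distr r_distr m_comm M.a_ac)
  have "2 * p (h \<otimes> k) = p (2 \<odot> (h \<otimes> k))"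
    using homogeneous[of "h \<otimes> k" 2] h k by simp
  also have "\<dots> \<le> p (s \<otimes> s) + p (h \<otimes> h \<oplus> k \<otimes> k)"
    using le_add_add[of "2 \<odot> (h \<otimes> k)" "h \<otimes> h \<oplus> k \<otimes> k"] h k unfolding eq by simp
  also have "\<dots> \<le> p (s \<otimes> s) + (p (h \<otimes> h) + p (k \<otimes> k))"
    using triangle h k by simp
  also have "\<dots> = (p s)\<^sup>2 + ((p h)\<^sup>2 + (p k)\<^sup>2)"
    using h k s by (simp add: at_square)
  also have "\<dots> \<le> (p h + p k)\<^sup>2 + (p h + p k)\<^sup>2"
  proof (rule add_mono)
    show "(p s)\<^sup>2 \<le> (p h + p k)\<^sup>2"
      using triangle[of h k] h k s by (intro power_mono) (auto simp: s_def)
    show "(p h)\<^sup>2 + (p k)\<^sup>2 \<le> (p h + p k)\<^sup>2"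
      using h k by (simp add: power2_sum)
  qed
  finally show ?thesis by simp
qed

text \<open>The product does not change when \<open>h\<close> is scaled by \<open>t\<close> and
  \<open>k\<close> by \<open>1 / t\<close>, so the previous bound may be optimized over
  \<open>t\<close>. The optimum makes both summands \<open>sqrt (p h * p k)\<close>, whence the
  factor 4.\<close>

lemma mult_selfadjoint_bound:
  assumes h: "h \<in> carrier A" "invol A h = h" and k: "k \<in> carrier A" "invol A k = k"
  shows "p (h \<otimes> k) \<le> 4 * (p h * p k)"
proof -
  have *: "p (h \<otimes> k) \<le> (t * p h + p k / t)\<^sup>2" if "t > 0" for t :: real
  proof -
    let ?h = "of_real t \<odot> h" and ?k = "of_real (1 / t) \<odot> k"
    have "?h \<otimes> ?k = h \<otimes> k"
      using h k that by (simp add: smult_mult_left smult_mult_right smult_smult flip: of_real_mult)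
    then have "p (h \<otimes> k) \<le> (p ?h + p ?k)\<^sup>2"
      using mult_selfadjoint_le_sum[of ?h ?k] h k by (simp add: invol_smult)
    then show ?thesis using h k that by (simp add: homogeneous norm_divide)
  qed
  show ?thesis
  proof (cases "p h = 0 \<or> p k = 0")
    case True
    have "p (h \<otimes> k) \<le> 0 + e" if "e > 0" for e
    proof -
      \<comment> \<open>One of the two summands is 0 and this \<open>t\<close> makes the other at
        most \<open>sqrt e\<close>; the 1 in the first numerator keeps \<open>t\<close> positive
        when both seminorms vanish.\<close>
      define t where "t = (if p h = 0 then (p k + 1) / sqrt e else sqrt e / (p h + 1))"
      have pos: "0 < p k + 1" "0 < p h + 1" using nonneg[of h] nonneg[of k] h k by linarith+
      then have "t > 0" using that by (simp add: t_def)
      have "t * p h + p k / t \<le> sqrt e"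
      proof (cases "p h = 0")
        case True
        then have "t * p h + p k / t = sqrt e * (p k / (p k + 1))" by (simp add: t_def)
        also have "\<dots> \<le> sqrt e * 1" using pos that by (intro mult_left_mono) auto
        finally show ?thesis by simp
      next
        case False
        then have "p k = 0" using \<open>p h = 0 \<or> p k = 0\<close> by simp
        then have "t * p h + p k / t = sqrt e * (p h / (p h + 1))" using False by (simp add: t_def)
        also have "\<dots> \<le> sqrt e * 1" using pos that by (intro mult_left_mono) auto
        finally show ?thesis by simp
      qed
      then have "(t * p h + p k / t)\<^sup>2 \<le> (sqrt e)\<^sup>2"
        using \<open>t > 0\<close> h k by (intro power_mono) auto
      then show ?thesis using *[OF \<open>t > 0\<close>] that by simp
    qed
    then have "p (h \<otimes> k) \<le> 0" by (rule field_le_epsilon)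
    then show ?thesis using True by auto
  next
    case False
    then have pos: "p h > 0" "p k > 0" using nonneg[of h] nonneg[of k] h k by linarith+
    have "p (h \<otimes> k) \<le> (sqrt (p k / p h) * p h + p k / sqrt (p k / p h))\<^sup>2"
      using pos by (intro *) auto
    also have "sqrt (p k / p h) * p h = sqrt (p h * p k)"
      using pos by (simp add: real_sqrt_divide real_sqrt_mult field_simps)
    also have "p k / sqrt (p k / p h) = sqrt (p h * p k)"
      using pos by (simp add: real_sqrt_divide real_sqrt_mult field_simps)
    also have "(sqrt (p h * p k) + sqrt (p h * p k))\<^sup>2 = 4 * (p h * p k)"
      using pos by (simp add: power2_eq_square)
    finally show ?thesis .
  qed
qed

text \<open>By commutativity the square of \<open>h \<otimes> k\<close> is again a product of two
  self-adjoint elements, the squares of \<open>h\<close> and \<open>k\<close>. Each squaring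
  therefore doubles the exponents while the factor 4 stays as it is.\<close>

lemma mult_selfadjoint_power:
  assumes "h \<in> carrier A" "invol A h = h" "k \<in> carrier A" "invol A k = k"
  shows "p (h \<otimes> k) ^ (2 ^ n) \<le> 4 * (p h * p k) ^ (2 ^ n)"
  using assms
proof (induction n arbitrary: h k)
  case 0
  then show ?case using mult_selfadjoint_bound[of h k] by simp
next
  case (Suc n)
  have "(h \<otimes> k) \<otimes> (h \<otimes> k) = (h \<otimes> h) \<otimes> (k \<otimes> k)"
    using Suc.prems by (simp add: m_ac)
  then have "p (h \<otimes> k) ^ (2 ^ Suc n) = p ((h \<otimes> h) \<otimes> (k \<otimes> k)) ^ (2 ^ n)"
    using Suc.prems at_square[of "h \<otimes> k"] by (simp add: invol_mult m_comm power_mult)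
  also have "\<dots> \<le> 4 * (p (h \<otimes> h) * p (k \<otimes> k)) ^ (2 ^ n)"
    using Suc.prems by (intro Suc.IH) (auto simp: invol_mult)
  also have "\<dots> = 4 * (p h * p k) ^ (2 ^ Suc n)"
    using Suc.prems by (simp add: at_square power_mult power_mult_distrib)
  finally show ?case .
qed

text \<open>Replacing \<open>h\<close> and \<open>k\<close> by their \<open>2\<^sup>n\<close>-th powers turns the crude bound \<open>4 p(h) p(k)\<close> into the sharp one.\<close>

lemma submultiplicative:
  assumes x: "x \<in> carrier A" and y: "y \<in> carrier A"
  shows "p (x \<otimes> y) \<le> p x * p y"
proof -
  \<comment> \<open>The C*-identity for \<open>x \<otimes> y\<close> reduces the general case to
    these two self-adjoint elements.\<close>
  let ?h = "x \<otimes> invol A x" and ?k = "y \<otimes> invol A y"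
  have sa: "invol A ?h = ?h" "invol A ?k = ?k"
    using x y by (auto simp: invol_mult invol_invol m_comm)
  have "(x \<otimes> y) \<otimes> invol A (x \<otimes> y) = ?h \<otimes> ?k"
    using x y by (simp add: invol_mult m_ac)
  then have "(p (x \<otimes> y))\<^sup>2 = p (?h \<otimes> ?k)"
    using cstar_identity[of "x \<otimes> y"] x y by simp
  also have "\<dots> \<le> p ?h * p ?k"
  proof (rule power_two_limit_le)
    show "p (?h \<otimes> ?k) ^ (2 ^ n) \<le> 4 * (p ?h * p ?k) ^ (2 ^ n)" for n
      using x y sa by (intro mult_selfadjoint_power) simp_all
  qed (use x y in simp)
  also have "\<dots> = (p x * p y)\<^sup>2"
    using x y by (simp add: cstar_identity power_mult_distrib)
  finally show ?thesis by (rule power2_le_imp_le) (use x y in simp)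
qed

text \<open>The hypothesis can be applied to all repeated squares of
  \<open>x \<otimes> invol A x\<close> with the same \<open>C\<close>, which then disappears in the
  limit. This is why no constants occur in later statements on continuity.\<close>

lemma le_of_bounded:
  assumes "cstar_seminorm A q" and bound: "\<And>x. x \<in> carrier A \<Longrightarrow> p x \<le> C * q x" and x: "x \<in> carrier A"
  shows "p x \<le> q x"
proof -
  interpret q: cstar_seminorm_on A q by unfold_locales fact
  have sa: "p h ^ (2 ^ n) \<le> C * q h ^ (2 ^ n)" if "h \<in> carrier A" "invol A h = h" for h n
    using that
  proof (induction n arbitrary: h)
    case 0
    then show ?case using bound by simp
  next
    case (Suc n)
    from Suc.IH[of "h \<otimes> h"] Suc.prems show ?case
      by (simp add: at_square q.at_square invol_mult power_mult)
  qed
  let ?h = "x \<otimes> invol A x"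
  have "p ?h \<le> q ?h"
  proof (rule power_two_limit_le)
    show "p ?h ^ (2 ^ n) \<le> C * q ?h ^ (2 ^ n)" for n
      using x by (intro sa) (simp_all add: invol_mult invol_invol)
  qed (use x in simp)
  then have "(p x)\<^sup>2 \<le> (q x)\<^sup>2" using x by (simp add: cstar_identity q.cstar_identity)
  then show ?thesis by (rule power2_le_imp_le) (use x in simp)
qed

lemma at_one: "p \<one> = 0 \<or> p \<one> = 1"
  using at_square[of \<one>] by (simp add: power2_eq_square)

lemma at_const: "p (const c) = norm c * p \<one>"
  by (simp add: const_def homogeneous)

end

section \<open>Characters\<close>

lemma complex_kalg_simps [simp]:
  "carrier complex_kalg = UNIV" "mult complex_kalg = (*)" "one complex_kalg = 1"
  "zero complex_kalg = 0" "add complex_kalg = (+)" "smult complex_kalg = (*)"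
  "invol complex_kalg = cnj" "topol complex_kalg = euclidean"
  by (auto simp: complex_kalg_def)

lemma hermitian_character_iff:
  "\<xi> \<in> hermitian_hom A complex_kalg \<longleftrightarrow>
     \<xi> \<in> extensional (carrier A) \<and> \<xi> \<one>\<^bsub>A\<^esub> = 1 \<and>
     (\<forall>x\<in>carrier A. \<forall>y\<in>carrier A. \<xi> (x \<oplus>\<^bsub>A\<^esub> y) = \<xi> x + \<xi> y) \<and>
     (\<forall>x\<in>carrier A. \<forall>y\<in>carrier A. \<xi> (x \<otimes>\<^bsub>A\<^esub> y) = \<xi> x * \<xi> y) \<and>
     (\<forall>c. \<forall>x\<in>carrier A. \<xi> (c \<odot>\<^bsub>A\<^esub> x) = c * \<xi> x) \<and>
     (\<forall>x\<in>carrier A. \<xi> (invol A x) = cnj (\<xi> x))"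
  by (auto simp: hermitian_hom_def ring_hom_def)

context involutive_algebra
begin

lemma character_diff:
  assumes "\<xi> \<in> hermitian_hom A complex_kalg" "x \<in> carrier A" "y \<in> carrier A"
  shows "\<xi> (x \<ominus> y) = \<xi> x - \<xi> y"
  using assms by (simp add: hermitian_character_iff diff_eq_smult)

text \<open>Supplies the lower bounds of chains for Zorn's lemma. Comparability enters in the
  triangle inequality, where a single member \<open>s\<close> has to lie below \<open>q\<close> at
  \<open>x\<close> and below \<open>r\<close> at \<open>y\<close>.\<close>

lemma cstar_seminorm_chain_Inf:
  assumes "C \<noteq> {}" and cstar: "\<And>q. q \<in> C \<Longrightarrow> cstar_seminorm A q"
    and chain: "\<And>q r. q \<in> C \<Longrightarrow> r \<in> C \<Longrightarrow> (\<forall>x\<in>carrier A. q x \<le> r x) \<or> (\<forall>x\<in>carrier A. r x \<le> q x)"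
  shows "cstar_seminorm A (\<lambda>x. if x \<in> carrier A then INF q\<in>C. q x else 0)"
proof -
  define u where "u x = (INF q\<in>C. q x)" for x
  have on: "cstar_seminorm_on A q" if "q \<in> C" for q
    using cstar[OF that] by unfold_locales
  have bdd: "bdd_below ((\<lambda>q. q x) ` C)" if "x \<in> carrier A" for x
    using cstar_seminorm_on.nonneg[OF on] that by (intro bdd_belowI[of _ 0]) auto
  have lower: "u x \<le> q x" if "q \<in> C" "x \<in> carrier A" for q x
    unfolding u_def using that bdd by (intro cINF_lower) auto
  have greatest: "b \<le> u x" if "\<And>q. q \<in> C \<Longrightarrow> b \<le> q x" for b x
    unfolding u_def using \<open>C \<noteq> {}\<close> that by (intro cINF_greatest) auto
  have nonneg: "0 \<le> u x" if "x \<in> carrier A" for x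
    using cstar_seminorm_on.nonneg[OF on] that by (intro greatest) auto
  have triangle: "u (x \<oplus> y) \<le> u x + u y" if xy: "x \<in> carrier A" "y \<in> carrier A" for x y
  proof -
    have le: "u (x \<oplus> y) \<le> q x + r y" if qr: "q \<in> C" "r \<in> C" for q r
    proof -
      obtain s where s: "s \<in> C" "s x \<le> q x" "s y \<le> r y"
        using chain[OF qr] qr xy by blast
      have "u (x \<oplus> y) \<le> s (x \<oplus> y)" using s xy by (intro lower) auto
      also have "\<dots> \<le> s x + s y" using cstar_seminorm_on.triangle[OF on[OF s(1)]] xy by simp
      finally show ?thesis using s by simp
    qed
    have "u (x \<oplus> y) - r y \<le> u x" if "r \<in> C" for r
      using le[OF _ that] by (intro greatest) (simp add: algebra_simps)
    then have "u (x \<oplus> y) - u x \<le> u y"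
      by (intro greatest) (simp add: algebra_simps)
    then show ?thesis by simp
  qed
  have le_scaled: "u (c \<odot> x) \<le> norm c * u x" if "x \<in> carrier A" for c x
  proof (cases "c = 0")
    case True
    obtain q where "q \<in> C" using \<open>C \<noteq> {}\<close> by blast
    then show ?thesis
      using lower[of q "c \<odot> x"] cstar_seminorm_on.homogeneous[OF on, of q x c] that True by simp
  next
    case False
    have "u (c \<odot> x) / norm c \<le> u x"
    proof (rule greatest)
      fix q assume "q \<in> C"
      then show "u (c \<odot> x) / norm c \<le> q x"
        using lower[of q "c \<odot> x"] cstar_seminorm_on.homogeneous[OF on, of q x c] that False
        by (simp add: field_simps)
    qed
    then show ?thesis using False by (simp add: field_simps)
  qed
  have scaled: "u (c \<odot> x) = norm c * u x" if x: "x \<in> carrier A" for c x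
  proof (cases "c = 0")
    case True
    then show ?thesis using le_scaled[OF x, of 0] nonneg[of "c \<odot> x"] x by simp
  next
    case False
    have "u x \<le> norm (1 / c) * u (c \<odot> x)"
      using le_scaled[of "c \<odot> x" "1 / c"] x False by (simp add: smult_smult)
    then show ?thesis using le_scaled[OF x, of c] False by (simp add: norm_divide field_simps)
  qed
  have identity: "u (x \<otimes> invol A x) = (u x)\<^sup>2" if x: "x \<in> carrier A" for x
  proof (rule antisym)
    have "sqrt (u (x \<otimes> invol A x)) \<le> u x"
    proof (rule greatest)
      fix q assume q: "q \<in> C"
      have "sqrt (u (x \<otimes> invol A x)) \<le> sqrt (q (x \<otimes> invol A x))"
        using lower[OF q] x by simp
      then show "sqrt (u (x \<otimes> invol A x)) \<le> q x"
        using cstar_seminorm_on.cstar_identity[OF on[OF q]] cstar_seminorm_on.nonneg[OF on[OF q]] x by simp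
    qed
    then show "u (x \<otimes> invol A x) \<le> (u x)\<^sup>2"
      by (rule sqrt_le_D)
    show "(u x)\<^sup>2 \<le> u (x \<otimes> invol A x)"
    proof (rule greatest)
      fix q assume q: "q \<in> C"
      show "(u x)\<^sup>2 \<le> q (x \<otimes> invol A x)"
        using lower[OF q x] nonneg[OF x] cstar_seminorm_on.cstar_identity[OF on[OF q] x]
        by (simp add: power_mono)
    qed
  qed
  show ?thesis
    unfolding cstar_seminorm_def u_def[symmetric]
    using nonneg triangle scaled identity by simp
qed

end

section \<open>The Gelfand-Naimark theorem for one C*-seminorm\<close>

context cstar_seminorm_on
begin

text \<open>\<open>q y\<close> is the limit of \<open>p (y \<otimes> (h [^] n))\<close>, a
  decreasing sequence because \<open>p h = 1\<close>. The C*-identity survives since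
  \<open>h\<close> is self-adjoint: the square of the \<open>n\<close>-th term for \<open>x\<close>
  is the term of index \<open>n + n\<close> for \<open>x \<otimes> invol A x\<close>. Multiplication
  by \<open>h\<close> only shifts the sequence, and a \<open>k\<close> that acts isometrically for
  \<open>p\<close> still does so for \<open>q\<close>.\<close>

lemma ex_seminorm_fixing:
  assumes h: "h \<in> carrier A" "invol A h = h" "p h = 1" and one: "p \<one> = 1"
  obtains q where "cstar_seminorm A q" "\<And>x. x \<notin> carrier A \<Longrightarrow> q x = 0"
    "\<And>x. x \<in> carrier A \<Longrightarrow> q x \<le> p x" "\<And>x. x \<in> carrier A \<Longrightarrow> q (x \<otimes> h) = q x" "q \<one> = 1"
    "\<And>k. k \<in> carrier A \<Longrightarrow> \<forall>y\<in>carrier A. p (y \<otimes> k) = p y \<Longrightarrow> \<forall>y\<in>carrier A. q (y \<otimes> k) = q y"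
proof -
  define a where "a y n = p (y \<otimes> (h [^] n))" for y and n :: nat
  have pow: "h [^] n \<in> carrier A" "invol A (h [^] n) = h [^] n" for n :: nat
  proof -
    show "h [^] n \<in> carrier A" for n :: nat using h by simp
    then show "invol A (h [^] n) = h [^] n"
      using h by (induction n) (auto simp: invol_mult m_comm)
  qed
  have step: "a y (Suc n) \<le> a y n" if "y \<in> carrier A" for y n
  proof -
    have "a y (Suc n) = p ((y \<otimes> (h [^] n)) \<otimes> h)"
      using h that pow by (simp add: a_def m_assoc)
    also have "\<dots> \<le> p (y \<otimes> (h [^] n)) * p h"
      using h that pow by (intro submultiplicative) auto
    finally show ?thesis using h by (simp add: a_def)
  qed
  then have dec: "decseq (a y)" if "y \<in> carrier A" for y
    using that by (intro decseq_SucI) auto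
  have a_nonneg: "0 \<le> a y n" if "y \<in> carrier A" for y n
    using that pow by (simp add: a_def)
  define q where "q y = (if y \<in> carrier A then lim (a y) else 0)" for y
  have lim: "a y \<longlonglongrightarrow> q y" and le_a: "q y \<le> a y n" if y: "y \<in> carrier A" for y n
  proof -
    obtain L where L: "a y \<longlonglongrightarrow> L" "\<And>i. L \<le> a y i"
      using decseq_convergent[OF dec[OF y], of 0] a_nonneg[OF y] by metis
    then have "q y = L" using that by (simp add: q_def limI)
    then show "a y \<longlonglongrightarrow> q y" "q y \<le> a y n" using L by auto
  qed
  have q_nonneg: "0 \<le> q y" if "y \<in> carrier A" for y
    using LIMSEQ_le_const[OF lim[OF that]] a_nonneg[OF that] by blast
  \<comment> \<open>At exponents \<open>2 ^ k\<close> the value is exactly 1, by squaring; since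
    \<open>n < 2 ^ n\<close>, monotonicity gives the bound at every index.\<close>
  have one_le: "1 \<le> a \<one> n" for n
  proof -
    have "p (h [^] (2 ^ k :: nat)) = 1" for k :: nat
    proof (induction k)
      case 0
      then show ?case using h by simp
    next
      case (Suc k)
      have "h [^] (2 ^ Suc k :: nat) = (h [^] (2 ^ k :: nat)) \<otimes> (h [^] (2 ^ k :: nat))"
        using h by (simp add: nat_pow_mult mult_2)
      then show ?case using Suc at_square pow by simp
    qed
    then have "a \<one> (2 ^ n) = 1" using pow by (simp add: a_def)
    moreover have "a \<one> (2 ^ n) \<le> a \<one> n"
      using dec[of \<one>] less_exp[of n] by (simp add: decseq_def)
    ultimately show ?thesis by simp
  qed
  have "cstar_seminorm A q"
    unfolding cstar_seminorm_def
  proof (intro conjI ballI allI)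
    fix x y assume xy: "x \<in> carrier A" "y \<in> carrier A"
    have "a (x \<oplus> y) n \<le> a x n + a y n" for n
      using triangle[of "x \<otimes> (h [^] n)" "y \<otimes> (h [^] n)"] xy pow by (simp add: a_def l_distr)
    then show "q (x \<oplus> y) \<le> q x + q y"
      using xy by (intro LIMSEQ_le[OF lim tendsto_add[OF lim lim]]) auto
  next
    fix c x assume x: "x \<in> carrier A"
    have "a (c \<odot> x) = (\<lambda>n. norm c * a x n)"
      using x pow by (auto simp: a_def smult_mult_left homogeneous)
    then have "a (c \<odot> x) \<longlonglongrightarrow> norm c * q x" using lim[OF x] by (auto intro: tendsto_intros)
    then show "q (c \<odot> x) = norm c * q x" using lim[of "c \<odot> x"] x LIMSEQ_unique by blast
  next
    fix x assume x: "x \<in> carrier A"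
    have "a (x \<otimes> invol A x) (n + n) = (a x n)\<^sup>2" for n
    proof -
      have "x \<otimes> invol A x \<otimes> (h [^] (n + n)) = (x \<otimes> (h [^] n)) \<otimes> invol A (x \<otimes> (h [^] n))"
        using x pow h by (simp add: invol_mult m_ac flip: nat_pow_mult)
      then show ?thesis using cstar_identity[of "x \<otimes> (h [^] n)"] x pow by (simp add: a_def)
    qed
    moreover have "(\<lambda>n. a (x \<otimes> invol A x) (n + n)) \<longlonglongrightarrow> q (x \<otimes> invol A x)"
      using LIMSEQ_subseq_LIMSEQ[OF lim, of "x \<otimes> invol A x" "\<lambda>n. n + n"] x
      by (simp add: o_def strict_mono_def)
    moreover have "(\<lambda>n. (a x n)\<^sup>2) \<longlonglongrightarrow> (q x)\<^sup>2"
      by (intro tendsto_intros lim x)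
    ultimately show "q (x \<otimes> invol A x) = (q x)\<^sup>2" using LIMSEQ_unique by simp
  qed (rule q_nonneg)
  moreover have "q x = 0" if "x \<notin> carrier A" for x using that by (simp add: q_def)
  moreover have "q x \<le> p x" if "x \<in> carrier A" for x using le_a[OF that, of 0] that by (simp add: a_def)
  moreover have "q (x \<otimes> h) = q x" if "x \<in> carrier A" for x
  proof -
    have "a (x \<otimes> h) n = a x (Suc n)" for n
      using that h pow m_lcomm[of h x "h [^] n"] by (simp add: a_def m_assoc m_comm)
    then have "a (x \<otimes> h) \<longlonglongrightarrow> q x" using LIMSEQ_Suc[OF lim[OF that]] by presburger
    then show ?thesis using lim[of "x \<otimes> h"] that h LIMSEQ_unique by blast
  qed
  moreover have "q \<one> = 1"
  proof (rule antisym)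
    show "q \<one> \<le> 1" using le_a[of \<one> 0] one by (simp add: a_def)
    show "1 \<le> q \<one>" using LIMSEQ_le_const[OF lim[of \<one>]] one_le by auto
  qed
  moreover have "\<forall>y\<in>carrier A. q (y \<otimes> k) = q y"
    if k: "k \<in> carrier A" "\<forall>y\<in>carrier A. p (y \<otimes> k) = p y" for k
  proof
    fix y assume y: "y \<in> carrier A"
    have "a (y \<otimes> k) n = a y n" for n
    proof -
      have "y \<otimes> k \<otimes> (h [^] n) = (y \<otimes> (h [^] n)) \<otimes> k" using y k pow by (simp add: m_ac)
      then show ?thesis using k y pow by (simp add: a_def)
    qed
    then have "a (y \<otimes> k) = a y" by blast
    then show "q (y \<otimes> k) = q y" using y k by (simp add: q_def)
  qed
  ultimately show thesis by (rule that)
qed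

text \<open>Zorn's lemma gives a minimal \<open>C\<^sup>*\<close>-seminorm \<open>m\<close> on which \<open>h\<close> acts isometrically. If \<open>k\<close> is selfadjoint with
  \<open>m(k) = 1\<close>, the seminorm \<open>lim m(y k\<^sup>n)\<close> of the previous lemma equals \<open>m\<close> by minimality, so \<open>m(y k) = m(y)\<close>;
  multiplicativity follows by the \<open>C\<^sup>*\<close>-identity.\<close>

lemma ex_multiplicative_seminorm:
  assumes h: "h \<in> carrier A" "invol A h = h" "p h = 1" and one: "p \<one> = 1"
  obtains q where "cstar_seminorm A q" "\<And>x. x \<in> carrier A \<Longrightarrow> q x \<le> p x" "q \<one> = 1" "q h = 1"
    "\<And>x y. x \<in> carrier A \<Longrightarrow> y \<in> carrier A \<Longrightarrow> q (x \<otimes> y) = q x * q y"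
proof -
  \<comment> \<open>Values off the carrier are fixed at 0, so that \<open>\<le>\<close> on functions
    compares the seminorms and minimality yields equality of functions.\<close>
  define Q where "Q = {q. cstar_seminorm A q \<and> (\<forall>x. x \<notin> carrier A \<longrightarrow> q x = 0) \<and>
     (\<forall>x\<in>carrier A. q x \<le> p x) \<and> q \<one> = 1 \<and> (\<forall>y\<in>carrier A. q (y \<otimes> h) = q y)}"
  have "\<exists>m\<in>Q. \<forall>q\<in>Q. q \<le> m \<longrightarrow> q = m"
  proof (rule predicate_Zorn)
    show "partial_order_on Q (relation_of (\<lambda>q r. r \<le> q) Q)"
      by (auto simp: partial_order_on_def preorder_on_def refl_on_def trans_def antisym_def relation_of_def)
    fix C assume "C \<in> Chains (relation_of (\<lambda>q r. r \<le> q) Q)"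
    then have CQ: "C \<subseteq> Q" and chain: "\<And>q r. q \<in> C \<Longrightarrow> r \<in> C \<Longrightarrow> q \<le> r \<or> r \<le> q"
      by (auto simp: Chains_def relation_of_def)
    show "\<exists>u\<in>Q. \<forall>q\<in>C. u \<le> q"
    proof (cases "C = {}")
      case True
      have "\<exists>q. q \<in> Q" by (rule ex_seminorm_fixing[OF h one]) (auto simp: Q_def)
      then show ?thesis using True by blast
    next
      case False
      then obtain q0 where q0: "q0 \<in> C" by blast
      define u where "u x = (if x \<in> carrier A then INF q\<in>C. q x else 0)" for x
      have u: "cstar_seminorm A u"
        unfolding u_def[abs_def]
      proof (rule cstar_seminorm_chain_Inf[OF False])
        show "cstar_seminorm A q" if "q \<in> C" for q using that CQ by (auto simp: Q_def)
        show "(\<forall>x\<in>carrier A. q x \<le> r x) \<or> (\<forall>x\<in>carrier A. r x \<le> q x)" if "q \<in> C" "r \<in> C" for q r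
          using chain[OF that] by (auto simp: le_fun_def)
      qed
      have nonneg: "0 \<le> q x" if "q \<in> C" "x \<in> carrier A" for q x
        using that CQ by (auto simp: Q_def cstar_seminorm_def)
      have lower: "u x \<le> q x" if "q \<in> C" for q x
      proof (cases "x \<in> carrier A")
        case True
        then show ?thesis unfolding u_def using that nonneg
          by (auto intro!: cINF_lower bdd_belowI[of _ 0])
      qed (use that CQ in \<open>auto simp: u_def Q_def\<close>)
      have cong: "u x = u y" if "x \<in> carrier A" "y \<in> carrier A" "\<And>q. q \<in> C \<Longrightarrow> q x = q y" for x y
      proof -
        have "(\<lambda>q. q x) ` C = (\<lambda>q. q y) ` C" using that by (intro image_cong) auto
        then show ?thesis using that by (simp add: u_def)
      qed
      have "(\<lambda>q. q \<one>) ` C = {1}" using False CQ by (force simp: Q_def)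
      then have "u \<one> = 1" by (simp add: u_def)
      moreover have "u (y \<otimes> h) = u y" if "y \<in> carrier A" for y
        using that h CQ by (intro cong) (auto simp: Q_def)
      moreover have "u x \<le> p x" if "x \<in> carrier A" for x
        using lower[OF q0, of x] q0 CQ that by (auto simp: Q_def intro: order_trans)
      ultimately have "u \<in> Q" using u by (auto simp: Q_def u_def)
      then show ?thesis using lower by (auto simp: le_fun_def)
    qed
  qed
  then obtain m where mQ: "m \<in> Q" and minimal: "\<And>q. q \<in> Q \<Longrightarrow> q \<le> m \<Longrightarrow> q = m" by blast
  interpret m: cstar_seminorm_on A m using mQ by unfold_locales (auto simp: Q_def)
  have m_one: "m \<one> = 1" and m_h: "\<And>y. y \<in> carrier A \<Longrightarrow> m (y \<otimes> h) = m y"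
    and m_le: "\<And>x. x \<in> carrier A \<Longrightarrow> m x \<le> p x" using mQ by (auto simp: Q_def)
  have sa: "m (y \<otimes> k) = m y * m k" if k: "k \<in> carrier A" "invol A k = k" and y: "y \<in> carrier A" for k y
  proof (cases "m k = 0")
    case True
    then show ?thesis using m.submultiplicative[OF y k(1)] y k by (auto intro: antisym)
  next
    case False
    then have pos: "m k > 0" using m.nonneg[OF k(1)] by linarith
    define k' where "k' = complex_of_real (1 / m k) \<odot> k"
    have k': "k' \<in> carrier A" "invol A k' = k'" "m k' = 1"
      using k pos by (auto simp: k'_def invol_smult m.homogeneous norm_divide)
    obtain q where q: "cstar_seminorm A q" "\<And>x. x \<notin> carrier A \<Longrightarrow> q x = 0"
      "\<And>x. x \<in> carrier A \<Longrightarrow> q x \<le> m x" "\<And>x. x \<in> carrier A \<Longrightarrow> q (x \<otimes> k') = q x" "q \<one> = 1"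
      "\<And>k. k \<in> carrier A \<Longrightarrow> \<forall>y\<in>carrier A. m (y \<otimes> k) = m y \<Longrightarrow> \<forall>y\<in>carrier A. q (y \<otimes> k) = q y"
      using m.ex_seminorm_fixing[OF k' m_one] by blast
    \<comment> \<open>Membership requires that \<open>h\<close> still acts isometrically for
      \<open>q\<close>; this is what the last property in \<open>ex_seminorm_fixing\<close> is
      for.\<close>
    have "q \<in> Q"
      unfolding Q_def using q(1,2,5) q(6)[OF h(1)] m_h order_trans[OF q(3) m_le] by auto
    moreover have "q \<le> m"
    proof (rule le_funI)
      fix x show "q x \<le> m x" using q(2,3) mQ by (cases "x \<in> carrier A") (auto simp: Q_def)
    qed
    ultimately have "q = m" by (rule minimal)
    then have "m y = m (y \<otimes> k')" using q(4)[OF y] by simp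
    also have "\<dots> = m (y \<otimes> k) / m k"
      using y k pos by (simp add: k'_def smult_mult_right m.homogeneous norm_divide)
    finally show ?thesis using pos by (simp add: field_simps)
  qed
  have "m (x \<otimes> y) = m x * m y" if x: "x \<in> carrier A" and y: "y \<in> carrier A" for x y
  proof -
    have "(x \<otimes> y) \<otimes> invol A (x \<otimes> y) = (x \<otimes> invol A x) \<otimes> (y \<otimes> invol A y)"
      using x y by (simp add: invol_mult m_ac)
    then have "(m (x \<otimes> y))\<^sup>2 = m ((x \<otimes> invol A x) \<otimes> (y \<otimes> invol A y))"
      using m.cstar_identity[of "x \<otimes> y"] x y by simp
    also have "\<dots> = (m x)\<^sup>2 * (m y)\<^sup>2"
      using x y by (subst sa) (auto simp: invol_mult invol_invol m.cstar_identity)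
    finally have "(m (x \<otimes> y))\<^sup>2 = (m x * m y)\<^sup>2" by (simp add: power_mult_distrib)
    then show ?thesis using x y by (simp add: power2_eq_iff_nonneg)
  qed
  moreover have "m h = 1" using m_h[of \<one>] m_one h by simp
  ultimately show thesis
    using that[of m] m.cstar m_le m_one by blast
qed

text \<open>Elementary, without holomorphic functions: if the minimum \<open>m\<close> of \<open>f(z) = p(x - z)\<close> were positive and
  attained at \<open>z\<close>, factoring \<open>(x - z)\<^sup>N - w\<^sup>N\<close> with \<open>N = 2\<^sup>n\<close> would give \<open>f(z + w) = m\<close> for all \<open>|w| < m\<close>,
  so that \<open>f\<close> would be constant along a ray, contradicting its growth.\<close>

lemma gelfand_mazur:
  assumes mult: "\<And>x y. x \<in> carrier A \<Longrightarrow> y \<in> carrier A \<Longrightarrow> p (x \<otimes> y) = p x * p y"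
    and one: "p \<one> = 1" and x: "x \<in> carrier A"
  obtains z where "p (x \<ominus> const z) = 0"
proof -
  define f where "f z = p (x \<ominus> const z)" for z
  have const_diff: "p (const z \<ominus> const w) = norm (z - w)" for z w
    using one at_const[of "z - w"] const_add[of z "- w"]
    by (simp add: const_def diff_eq_smult smult_smult)
  have lipschitz: "\<bar>f z - f w\<bar> \<le> norm (z - w)" for z w
    using diff_triangle[of x "const w" "const z"] diff_triangle[of x "const z" "const w"] x
    by (simp add: f_def const_diff norm_minus_commute abs_le_iff)
  have cont: "continuous_on UNIV f"
    unfolding continuous_on_iff
  proof (intro ballI allI impI)
    fix z :: complex and e :: real assume "0 < e"
    then show "\<exists>d>0. \<forall>w\<in>UNIV. dist w z < d \<longrightarrow> dist (f w) (f z) < e"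
      using lipschitz by (intro exI[of _ e]) (auto simp: dist_norm intro: le_less_trans)
  qed
  have growth: "norm z - p x \<le> f z" for z
    using le_diff_add[of "const z" x] diff_commute[of "const z" x] one x by (simp add: f_def at_const)
  obtain z0 where z0: "\<And>z. f z0 \<le> f z"
  proof -
    \<comment> \<open>Outside this ball \<open>norm z - p x\<close> exceeds \<open>p x\<close>, the
      value of \<open>f\<close> at 0, so the minimum over the compact ball is a global one.\<close>
    obtain z0 where z0: "z0 \<in> cball 0 (2 * p x)" "\<And>z. z \<in> cball 0 (2 * p x) \<Longrightarrow> f z0 \<le> f z"
    proof -
      have "cball 0 (2 * p x) \<noteq> ({} :: complex set)" using nonneg[OF x] by simp
      then have "\<exists>z0\<in>cball 0 (2 * p x). \<forall>z\<in>cball 0 (2 * p x). f z0 \<le> f z"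
        by (intro continuous_attains_inf continuous_on_subset[OF cont]) auto
      then show ?thesis using that by (meson bexE)
    qed
    have "f z0 \<le> f 0" using x by (intro z0) simp
    also have "f 0 = p x" using x by (simp add: f_def const_0 a_minus_def)
    finally have "f z0 \<le> f z" if "z \<notin> cball 0 (2 * p x)" for z
      using growth[of z] that by simp
    then show thesis using z0 that by blast
  qed
  have "f z0 = 0"
  proof (rule ccontr)
    assume "f z0 \<noteq> 0"
    define m where "m = f z0"
    have "m > 0" using \<open>f z0 \<noteq> 0\<close> x by (simp add: m_def f_def less_le)
    have step: "f (z + w) = m" if fz: "f z = m" and w: "norm w < m" for z w
    proof -
      define y where "y = x \<ominus> const z"
      have y: "y \<in> carrier A" using x by (simp add: y_def)
      have py: "p y = m" using fz by (simp add: y_def f_def)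
      have shift: "y \<ominus> const v = x \<ominus> const (z + v)" for v
        using x by (simp add: y_def const_def diff_eq_smult smult_add_left smult_smult smult_add_right M.a_assoc flip: distrib_left)
      define s where "s n = y [^] (2 ^ n :: nat)" for n
      have s: "s n \<in> carrier A" for n using y by (simp add: s_def)
      have s_Suc: "s (Suc n) = s n \<otimes> s n" for n using y by (simp add: s_def nat_pow_mult mult_2)
      have factor: "s (Suc n) \<ominus> const (v * v) = (s n \<ominus> const v) \<otimes> (s n \<ominus> const (- v))" for n v
      proof -
        have "(s n \<ominus> const v) \<otimes> (s n \<ominus> const (- v)) =
            s n \<otimes> s n \<oplus> (v \<odot> s n \<oplus> ((-v) \<odot> s n \<oplus> (- (v * v)) \<odot> \<one>))"
          using s[of n] by (simp add: const_def diff_eq_smult l_distr r_distr smult_mult_left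
              smult_mult_right smult_smult smult_add_right M.a_ac)
        also have "v \<odot> s n \<oplus> ((-v) \<odot> s n \<oplus> (- (v * v)) \<odot> \<one>) = (v + (- v)) \<odot> s n \<oplus> (- (v * v)) \<odot> \<one>"
          using s[of n] by (simp only: smult_add_left M.a_assoc smult_in one_closed)
        finally show ?thesis
          using s[of n] by (simp add: s_Suc const_def diff_eq_smult smult_smult)
      qed
      \<comment> \<open>Taking square roots of \<open>v\<close> repeatedly writes
        \<open>s n \<ominus> const v\<close> as a product of \<open>2 ^ n\<close> elements
        \<open>x\<close> minus a scalar, each with value at least the minimum
        \<open>m\<close>.\<close>
      have lower: "m ^ (2 ^ n) \<le> p (s n \<ominus> const v)" for n v
      proof (induction n arbitrary: v)
        case 0
        then show ?case using z0 y by (simp add: s_def shift f_def m_def)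
      next
        case (Suc n)
        have "p (s (Suc n) \<ominus> const v) = p (s n \<ominus> const (csqrt v)) * p (s n \<ominus> const (- csqrt v))"
          using factor[of n "csqrt v"] mult s by (simp flip: power2_eq_square)
        moreover have "m ^ (2 ^ Suc n) = m ^ (2 ^ n) * m ^ (2 ^ n)" by (simp add: mult_2 power_add)
        ultimately show ?case
          using Suc.IH \<open>m > 0\<close> s by (auto intro!: mult_mono)
      qed
      \<comment> \<open>The same factorization for the \<open>2 ^ n\<close>-th roots of
        \<open>w ^ (2 ^ n)\<close>: the factor belonging to \<open>w\<close> is kept, each of the
        others is at least \<open>m\<close>.\<close>
      have upper: "p (y \<ominus> const w) * m ^ (2 ^ n) \<le> m * p (s n \<ominus> const (w ^ (2 ^ n)))" for n
      proof (induction n)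
        case 0
        then show ?case using y by (simp add: s_def)
      next
        case (Suc n)
        have "p (y \<ominus> const w) * m ^ (2 ^ Suc n) = (p (y \<ominus> const w) * m ^ (2 ^ n)) * m ^ (2 ^ n)"
          by (simp add: mult_2 power_add)
        also have "\<dots> \<le> (m * p (s n \<ominus> const (w ^ (2 ^ n)))) * p (s n \<ominus> const (- (w ^ (2 ^ n))))"
          by (rule mult_mono[OF Suc.IH lower]) (use \<open>m > 0\<close> s in auto)
        also have "\<dots> = m * p (s (Suc n) \<ominus> const (w ^ (2 ^ Suc n)))"
          using factor[of n "w ^ (2 ^ n)"] mult s by (simp add: mult_2 power_add)
        finally show ?case .
      qed
      have "f (z + w) \<le> m + m * (norm w / m) ^ (2 ^ n)" for n
      proof -
        have "p (s n) = m ^ (2 ^ n)"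
        proof (induction n)
          case 0
          then show ?case using py y by (simp add: s_def)
        next
          case (Suc n)
          then show ?case using mult s by (simp add: s_Suc mult_2 power_add)
        qed
        then have "p (s n \<ominus> const (w ^ (2 ^ n))) \<le> m ^ (2 ^ n) + norm w ^ (2 ^ n)"
          using triangle[of "s n" "(-1) \<odot> const (w ^ (2 ^ n))"] s one
          by (simp add: diff_eq_smult homogeneous at_const norm_power)
        then have "p (y \<ominus> const w) * m ^ (2 ^ n) \<le> m * (m ^ (2 ^ n) + norm w ^ (2 ^ n))"
          using upper[of n] \<open>m > 0\<close> by (meson dual_order.trans mult_left_mono less_imp_le)
        then have "p (y \<ominus> const w) \<le> m * (m ^ (2 ^ n) + norm w ^ (2 ^ n)) / m ^ (2 ^ n)"
          using \<open>m > 0\<close> by (simp add: pos_le_divide_eq)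
        then show ?thesis using \<open>m > 0\<close>
          by (simp add: shift f_def power_divide add_divide_distrib distrib_left)
      qed
      moreover have "(\<lambda>n. m + m * (norm w / m) ^ (2 ^ n)) \<longlonglongrightarrow> m + m * 0"
        using w \<open>m > 0\<close> by (intro tendsto_intros power_two_tendsto_zero) auto
      ultimately have "f (z + w) \<le> m" using LIMSEQ_le_const by fastforce
      then show ?thesis using z0[of "z + w"] by (simp add: m_def)
    qed
    \<comment> \<open>Increments of length \<open>m / 2\<close> stay inside the radius
      \<open>m\<close> that \<open>step\<close> allows.\<close>
    have all: "f (z0 + of_nat n * of_real (m / 2)) = m" for n
    proof (induction n)
      case 0
      then show ?case by (simp add: m_def)
    next
      case (Suc n)
      then show ?case using step[of "z0 + of_nat n * of_real (m / 2)" "of_real (m / 2)"] \<open>m > 0\<close>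
        by (simp add: algebra_simps norm_divide add_divide_distrib)
    qed
    obtain n :: nat where "real n * (m / 2) > m + p x + norm z0"
      using reals_Archimedean3[of "m / 2"] half_gt_zero[OF \<open>m > 0\<close>] by blast
    moreover have "real n * (m / 2) \<le> norm (z0 + of_nat n * of_real (m / 2)) + norm z0"
    proof -
      have "norm (of_nat n * of_real (m / 2) :: complex) = real n * (m / 2)"
        using \<open>m > 0\<close> by (simp add: norm_mult)
      then show ?thesis using norm_diff_ineq[of "of_nat n * of_real (m / 2)" z0] by (simp add: add.commute)
    qed
    ultimately show False using growth[of "z0 + of_nat n * of_real (m / 2)"] all[of n] by linarith
  qed
  then show thesis using that by (simp add: f_def)
qed

text \<open>Gelfand-Mazur gives a scalar \<open>z\<close> with
  \<open>p (x \<ominus> const z) = 0\<close>; it is unique because \<open>p\<close> restricts to the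
  absolute value on scalars. Uniqueness, in the form \<open>eqI\<close>, reduces each algebraic
  identity for \<open>\<xi>\<close> to a triangle inequality.\<close>

lemma ex_character_of_multiplicative:
  assumes mult: "\<And>x y. x \<in> carrier A \<Longrightarrow> y \<in> carrier A \<Longrightarrow> p (x \<otimes> y) = p x * p y"
    and one: "p \<one> = 1"
  obtains \<xi> where "\<xi> \<in> hermitian_hom A complex_kalg" "\<And>x. x \<in> carrier A \<Longrightarrow> norm (\<xi> x) = p x"
proof -
  have const_diff: "p (const z \<ominus> const w) = norm (z - w)" for z w
    using one at_const[of "z - w"] const_add[of z "- w"]
    by (simp add: const_def diff_eq_smult smult_smult)
  define \<xi> where "\<xi> = (\<lambda>x\<in>carrier A. SOME z. p (x \<ominus> const z) = 0)"
  have ker: "p (x \<ominus> const (\<xi> x)) = 0" if x: "x \<in> carrier A" for x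
  proof -
    have "\<exists>z. p (x \<ominus> const z) = 0" by (rule gelfand_mazur[OF mult one x]) (assumption | rule exI)+
    from someI_ex[OF this] show ?thesis using x by (simp add: \<xi>_def)
  qed
  have eqI: "\<xi> x = z" if x: "x \<in> carrier A" and z: "p (x \<ominus> const z) \<le> 0" for x z
  proof -
    have "norm (\<xi> x - z) \<le> p (const (\<xi> x) \<ominus> x) + p (x \<ominus> const z)"
      using diff_triangle[of "const (\<xi> x)" x "const z"] x by (simp add: const_diff)
    moreover have "p (const (\<xi> x) \<ominus> x) = 0" using ker[OF x] diff_commute[of x "const (\<xi> x)"] x by simp
    ultimately have "norm (\<xi> x - z) \<le> 0" using z by linarith
    then show ?thesis by simp
  qed
  have norm_eq: "norm (\<xi> x) = p x" if x: "x \<in> carrier A" for x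
    using le_diff_add[of x "const (\<xi> x)"] le_diff_add[of "const (\<xi> x)" x] ker[OF x]
      diff_commute[of x "const (\<xi> x)"] x one by (simp add: at_const)
  have "\<xi> \<in> hermitian_hom A complex_kalg"
    unfolding hermitian_character_iff
  proof (intro conjI ballI allI)
    show "\<xi> \<in> extensional (carrier A)" by (simp add: \<xi>_def)
    show "\<xi> \<one> = 1" by (rule eqI) (auto simp: const_1 a_minus_def M.r_neg)
    fix x assume x: "x \<in> carrier A"
    show "\<xi> (invol A x) = cnj (\<xi> x)"
    proof (rule eqI)
      have "p (invol A (x \<ominus> const (\<xi> x))) = 0" using ker[OF x] x by (simp add: of_invol)
      then show "p (invol A x \<ominus> const (cnj (\<xi> x))) \<le> 0" using x by (simp add: invol_diff invol_const)
    qed (use x in simp)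
    fix c :: complex
    show "\<xi> (c \<odot> x) = c * \<xi> x"
    proof (rule eqI)
      have "c \<odot> x \<ominus> const (c * \<xi> x) = c \<odot> (x \<ominus> const (\<xi> x))"
        using x by (simp add: diff_eq_smult smult_add_right smult_smult const_def)
      then show "p (c \<odot> x \<ominus> const (c * \<xi> x)) \<le> 0" using ker[OF x] x by (simp add: homogeneous)
    qed (use x in simp)
  next
    fix x y assume x: "x \<in> carrier A" and y: "y \<in> carrier A"
    show "\<xi> (x \<oplus> y) = \<xi> x + \<xi> y"
    proof (rule eqI)
      have "(x \<oplus> y) \<ominus> const (\<xi> x + \<xi> y) = (x \<ominus> const (\<xi> x)) \<oplus> (y \<ominus> const (\<xi> y))"
        using x y by (simp add: diff_eq_smult smult_add_right smult_smult const_def M.a_ac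
            smult_add_left distrib_left)
      then show "p ((x \<oplus> y) \<ominus> const (\<xi> x + \<xi> y)) \<le> 0"
        using ker[OF x] ker[OF y] x y triangle[of "x \<ominus> const (\<xi> x)" "y \<ominus> const (\<xi> y)"] by simp
    qed (use x y in simp)
    show "\<xi> (x \<otimes> y) = \<xi> x * \<xi> y"
    proof (rule eqI)
      have "(x \<otimes> y) \<ominus> const (\<xi> x * \<xi> y) =
          (x \<otimes> y \<ominus> \<xi> x \<odot> y) \<oplus> (\<xi> x \<odot> y \<ominus> const (\<xi> x * \<xi> y))"
        using x y by (simp add: a_minus_def M.a_assoc M.r_neg1)
      also have "\<dots> = (x \<ominus> const (\<xi> x)) \<otimes> y \<oplus> \<xi> x \<odot> (y \<ominus> const (\<xi> y))"
        using x y by (simp add: diff_eq_smult smult_add_right smult_smult const_def l_distr smult_mult_left)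
      finally show "p (x \<otimes> y \<ominus> const (\<xi> x * \<xi> y)) \<le> 0"
        using triangle[of "(x \<ominus> const (\<xi> x)) \<otimes> y" "\<xi> x \<odot> (y \<ominus> const (\<xi> y))"]
          ker[OF x] ker[OF y] x y by (simp add: homogeneous mult)
    qed (use x y in simp)
  qed
  with norm_eq show thesis using that by blast
qed

text \<open>Normalizing \<open>x \<otimes> invol A x\<close> gives a self-adjoint \<open>h\<close>
  with \<open>p h = 1\<close>. A multiplicative seminorm below \<open>p\<close> with value 1 at
  \<open>h\<close> agrees with \<open>p\<close> at \<open>x\<close> by the C*-identity, and it is
  the modulus of a character.\<close>

theorem gelfand_naimark:
  assumes x: "x \<in> carrier A" and "p x \<noteq> 0"
  obtains \<xi> where "\<xi> \<in> hermitian_hom A complex_kalg" "norm (\<xi> x) = p x"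
    "\<And>y. y \<in> carrier A \<Longrightarrow> norm (\<xi> y) \<le> p y"
proof -
  have pos: "p x > 0" using assms nonneg[OF x] by linarith
  have "p \<one> \<noteq> 0" using submultiplicative[of x \<one>] pos x by auto
  then have one: "p \<one> = 1" using at_one by blast
  define h where "h = complex_of_real (1 / (p x)\<^sup>2) \<odot> (x \<otimes> invol A x)"
  have h: "h \<in> carrier A" "invol A h = h" "p h = 1"
    using x pos by (auto simp: h_def invol_smult invol_mult invol_invol homogeneous cstar_identity norm_divide norm_power)
  obtain q where q: "cstar_seminorm A q" "\<And>x. x \<in> carrier A \<Longrightarrow> q x \<le> p x" "q \<one> = 1" "q h = 1"
    "\<And>x y. x \<in> carrier A \<Longrightarrow> y \<in> carrier A \<Longrightarrow> q (x \<otimes> y) = q x * q y"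
    using ex_multiplicative_seminorm[OF h one] by blast
  interpret q: cstar_seminorm_on A q using q(1) by unfold_locales
  obtain \<xi> where \<xi>: "\<xi> \<in> hermitian_hom A complex_kalg" "\<And>x. x \<in> carrier A \<Longrightarrow> norm (\<xi> x) = q x"
    using q.ex_character_of_multiplicative[OF q(5,3)] by blast
  have "1 = (q x)\<^sup>2 / (p x)\<^sup>2"
    using q(4) x by (simp add: h_def q.homogeneous q.cstar_identity norm_divide norm_power)
  then have "(q x)\<^sup>2 = (p x)\<^sup>2" using pos by (simp add: field_simps)
  then have "q x = p x" using x by (simp add: power2_eq_iff_nonneg)
  then show thesis using that[OF \<xi>(1)] \<xi>(2) x q(2) by simp
qed

end

section \<open>Seminorm topologies\<close>

lemma topspace_seminorm_topology [simp]: "topspace (seminorm_topology V d P) = V"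
  by (auto simp: seminorm_topology_def)

lemma openin_seminorm_ball:
  "p \<in> P \<Longrightarrow> x \<in> V \<Longrightarrow> 0 < e \<Longrightarrow> openin (seminorm_topology V d P) {y \<in> V. p (d y x) < e}"
  unfolding seminorm_topology_def by (rule topology_generated_by_Basis) blast

text \<open>Mediates between two ways of writing the same topology: with pointwise subtraction of
  functions and with the subtraction of the ring.\<close>

lemma seminorm_topology_cong:
  assumes "\<And>p. p \<in> P \<Longrightarrow> \<exists>p'\<in>P'. \<forall>x\<in>V. \<forall>y\<in>V. p (d x y) = p' (d' x y)"
    and "\<And>p'. p' \<in> P' \<Longrightarrow> \<exists>p\<in>P. \<forall>x\<in>V. \<forall>y\<in>V. p (d x y) = p' (d' x y)"
  shows "seminorm_topology V d P = seminorm_topology V d' P'"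
proof -
  have "{{y \<in> V. p (d y x) < e} | p x e. p \<in> P \<and> x \<in> V \<and> 0 < e} =
        {{y \<in> V. p (d' y x) < e} | p x e. p \<in> P' \<and> x \<in> V \<and> 0 < e}" (is "?L = ?R")
  proof (intro equalityI subsetI)
    fix U assume "U \<in> ?L"
    then obtain p x e where U: "U = {y \<in> V. p (d y x) < e}" "p \<in> P" "x \<in> V" "0 < e" by blast
    obtain p' where p': "p' \<in> P'" "\<forall>x\<in>V. \<forall>y\<in>V. p (d x y) = p' (d' x y)"
      using assms(1)[OF U(2)] by blast
    then have "U = {y \<in> V. p' (d' y x) < e}" using U by auto
    then show "U \<in> ?R" using U p' by blast
  next
    fix U assume "U \<in> ?R"
    then obtain p' x e where U: "U = {y \<in> V. p' (d' y x) < e}" "p' \<in> P'" "x \<in> V" "0 < e" by blast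
    obtain p where p: "p \<in> P" "\<forall>x\<in>V. \<forall>y\<in>V. p (d x y) = p' (d' x y)"
      using assms(2)[OF U(2)] by blast
    then have "U = {y \<in> V. p (d y x) < e}" using U by auto
    then show "U \<in> ?L" using U p by blast
  qed
  then show ?thesis by (simp only: seminorm_topology_def)
qed

lemma continuous_map_metric_iff:
  fixes f :: "'x \<Rightarrow> 'b::metric_space"
  shows "continuous_map Z euclidean f \<longleftrightarrow>
    (\<forall>x\<in>topspace Z. \<forall>e>0. \<exists>U. openin Z U \<and> x \<in> U \<and> (\<forall>y\<in>U. dist (f y) (f x) < e))" (is "?L \<longleftrightarrow> ?R")
proof
  assume L: ?L
  show ?R
  proof (intro ballI allI impI)
    fix x and e :: real assume x: "x \<in> topspace Z" and "0 < e"
    have "openin Z {y \<in> topspace Z. f y \<in> ball (f x) e}"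
      using L openin_continuous_map_preimage[of Z euclidean f "ball (f x) e"] by auto
    then show "\<exists>U. openin Z U \<and> x \<in> U \<and> (\<forall>y\<in>U. dist (f y) (f x) < e)"
      using x \<open>0 < e\<close>
      by (intro exI[of _ "{y \<in> topspace Z. f y \<in> ball (f x) e}"]) (auto simp: dist_commute)
  qed
next
  assume R: ?R
  show ?L
    unfolding continuous_map_def
  proof (intro conjI allI impI)
    fix W :: "'b set" assume "openin euclidean W"
    then have W: "open W" by simp
    show "openin Z {x \<in> topspace Z. f x \<in> W}"
    proof (subst openin_subopen, intro ballI)
      fix x assume x: "x \<in> {x \<in> topspace Z. f x \<in> W}"
      then obtain e where e: "e > 0" "ball (f x) e \<subseteq> W"
        using openE[OF W, of "f x"] by blast
      have "x \<in> topspace Z" using x by simp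
      from R[rule_format, OF this e(1)] obtain U
        where U: "openin Z U" "x \<in> U" "\<forall>y\<in>U. dist (f y) (f x) < e" by blast
      then have "U \<subseteq> {x \<in> topspace Z. f x \<in> W}"
        using e openin_subset[OF U(1)] by (auto simp: dist_commute)
      then show "\<exists>T. openin Z T \<and> x \<in> T \<and> T \<subseteq> {x \<in> topspace Z. f x \<in> W}" using U by blast
    qed
  qed simp
qed

context involutive_algebra
begin

abbreviation seminorm_top :: "('a \<Rightarrow> real) set \<Rightarrow> 'a topology" where
  "seminorm_top \<equiv> seminorm_topology (carrier A) (\<lambda>x y. x \<ominus> y)"

lemma diff_zero_right [simp]: "x \<in> carrier A \<Longrightarrow> x \<ominus> \<zero> = x"
  by (simp add: a_minus_def)

lemma diff_self [simp]: "x \<in> carrier A \<Longrightarrow> x \<ominus> x = \<zero>"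
  by (simp add: a_minus_def M.r_neg)

lemma diff_diff_cancel:
  assumes "x \<in> carrier A" "y \<in> carrier A" "z \<in> carrier A"
  shows "y \<ominus> x \<ominus> (z \<ominus> x) = y \<ominus> z"
proof -
  have "y \<ominus> x = (y \<ominus> z) \<oplus> (z \<ominus> x)"
    using assms by (simp add: a_minus_def M.a_assoc M.r_neg1)
  then show ?thesis
    using assms by (simp add: a_minus_def[of A _ "z \<ominus> x"] M.a_assoc M.r_neg)
qed

lemma cstar_on: "cstar_seminorm A p \<Longrightarrow> cstar_seminorm_on A p"
  by unfold_locales

text \<open>The balls in the definition form only a subbase and have arbitrary centres. Directedness
  takes care of intersections, the triangle inequality of moving the centre to
  \<open>x\<close>.\<close>

lemma open_contains_seminorm_ball:
  assumes cs: "\<And>p. p \<in> P \<Longrightarrow> cstar_seminorm A p" and "P \<noteq> {}"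
    and directed: "\<And>p q. p \<in> P \<Longrightarrow> q \<in> P \<Longrightarrow> \<exists>r\<in>P. \<forall>x\<in>carrier A. p x \<le> r x \<and> q x \<le> r x"
    and "openin (seminorm_top P) U" "x \<in> U"
  shows "\<exists>p\<in>P. \<exists>e>0. {y \<in> carrier A. p (y \<ominus> x) < e} \<subseteq> U"
  using assms(4,5) unfolding seminorm_topology_def openin_topology_generated_by_iff
proof (induction U)
  case Empty
  then show ?case by simp
next
  case (Int U V)
  obtain p e where p: "p \<in> P" "e > 0" "{y \<in> carrier A. p (y \<ominus> x) < e} \<subseteq> U" using Int by blast
  obtain q d where q: "q \<in> P" "d > 0" "{y \<in> carrier A. q (y \<ominus> x) < d} \<subseteq> V" using Int by blast
  obtain r where r: "r \<in> P" "\<forall>x\<in>carrier A. p x \<le> r x \<and> q x \<le> r x" using directed p q by blast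
  have "x \<in> carrier A"
    using Int.hyps Int.prems openin_subset[of "seminorm_top P" U]
    by (auto simp: seminorm_topology_def openin_topology_generated_by_iff simp del: topspace_seminorm_topology)
  then have "{y \<in> carrier A. r (y \<ominus> x) < min e d} \<subseteq> U \<inter> V"
    using p(3) q(3) r(2) by (auto simp: subset_eq) (meson M.minus_closed le_less_trans)+
  then show ?case using r(1) p(2) q(2) by (intro bexI[of _ r] exI[of _ "min e d"]) auto
next
  case (UN K)
  then show ?case by blast
next
  case (Basis U)
  show ?case
  proof (cases "U = carrier A")
    case True
    obtain p where "p \<in> P" using \<open>P \<noteq> {}\<close> by blast
    then show ?thesis using True by (intro bexI[of _ p] exI[of _ 1]) auto
  next
    case False
    then obtain p z e where U: "U = {y \<in> carrier A. p (y \<ominus> z) < e}" "p \<in> P" "z \<in> carrier A" "0 < e"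
      using Basis by blast
    interpret p: cstar_seminorm_on A p using cs U cstar_on by blast
    have "{y \<in> carrier A. p (y \<ominus> x) < e - p (x \<ominus> z)} \<subseteq> U"
      using U Basis.prems p.diff_triangle[of _ x z] by fastforce
    then show ?thesis using U Basis.prems by (intro bexI[of _ p] exI[of _ "e - p (x \<ominus> z)"]) auto
  qed
qed

lemma continuous_map_into_seminorm_top:
  assumes cs: "\<And>p. p \<in> P \<Longrightarrow> cstar_seminorm A p" and f: "\<And>x. x \<in> topspace Z \<Longrightarrow> f x \<in> carrier A"
    and nbhd: "\<And>p x e. p \<in> P \<Longrightarrow> x \<in> topspace Z \<Longrightarrow> 0 < e \<Longrightarrow>
      \<exists>U. openin Z U \<and> x \<in> U \<and> (\<forall>y\<in>U. p (f y \<ominus> f x) < e)"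
  shows "continuous_map Z (seminorm_top P) f"
  unfolding seminorm_topology_def
proof (rule continuous_on_generated_topo)
  fix U assume U: "U \<in> insert (carrier A) {{y \<in> carrier A. p (y \<ominus> x) < e} | p x e. p \<in> P \<and> x \<in> carrier A \<and> 0 < e}"
  show "openin Z (f -` U \<inter> topspace Z)"
  proof (cases "U = carrier A")
    case True
    then have "f -` U \<inter> topspace Z = topspace Z" using f by auto
    then show ?thesis by simp
  next
    case False
    then obtain p z e where U: "U = {y \<in> carrier A. p (y \<ominus> z) < e}" "p \<in> P" "z \<in> carrier A" "0 < e"
      using U by blast
    interpret p: cstar_seminorm_on A p using cs U cstar_on by blast
    show ?thesis
    proof (subst openin_subopen, intro ballI)
      fix x assume x: "x \<in> f -` U \<inter> topspace Z"
      then obtain W where W: "openin Z W" "x \<in> W" "\<forall>y\<in>W. p (f y \<ominus> f x) < e - p (f x \<ominus> z)"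
        using nbhd[OF U(2), of x "e - p (f x \<ominus> z)"] U by auto
      have "W \<subseteq> f -` U \<inter> topspace Z"
      proof
        fix y assume y: "y \<in> W"
        then have "y \<in> topspace Z" using W openin_subset by blast
        then show "y \<in> f -` U \<inter> topspace Z"
          using W(3) y f x U p.diff_triangle[of "f y" "f x" z] by fastforce
      qed
      then show "\<exists>T. openin Z T \<and> x \<in> T \<and> T \<subseteq> f -` U \<inter> topspace Z" using W by blast
    qed
  qed
qed (use f in auto)

lemma limitin_seminorm_topI:
  assumes cs: "\<And>p. p \<in> P \<Longrightarrow> cstar_seminorm A p" and l: "l \<in> carrier A"
    and F: "eventually (\<lambda>x. f x \<in> carrier A) F"
    and ev: "\<And>p e. p \<in> P \<Longrightarrow> 0 < e \<Longrightarrow> eventually (\<lambda>x. p (f x \<ominus> l) < e) F"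
  shows "limitin (seminorm_top P) f l F"
  unfolding limitin_def
proof (intro conjI allI impI)
  show "l \<in> topspace (seminorm_top P)" using l by simp
  fix U assume "openin (seminorm_top P) U \<and> l \<in> U"
  then have "generate_topology_on (insert (carrier A)
      {{y \<in> carrier A. p (y \<ominus> x) < e} | p x e. p \<in> P \<and> x \<in> carrier A \<and> 0 < e}) U" "l \<in> U"
    by (auto simp: seminorm_topology_def openin_topology_generated_by_iff)
  then show "eventually (\<lambda>x. f x \<in> U) F"
  proof (induction U)
    case (Int U V)
    then show ?case by (auto intro: eventually_conj)
  next
    case (UN K)
    then obtain U where "U \<in> K" "l \<in> U" "eventually (\<lambda>x. f x \<in> U) F" by blast
    then show ?case by (auto elim: eventually_mono)
  next
    case (Basis U)
    show ?case
    proof (cases "U = carrier A")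
      case False
      then obtain p z e where U: "U = {y \<in> carrier A. p (y \<ominus> z) < e}" "p \<in> P" "z \<in> carrier A" "0 < e"
        using Basis by blast
      interpret p: cstar_seminorm_on A p using cs U cstar_on by blast
      have "eventually (\<lambda>x. p (f x \<ominus> l) < e - p (l \<ominus> z)) F"
        using U Basis.prems by (intro ev) auto
      with F show ?thesis
      proof eventually_elim
        case (elim x)
        then show ?case using U l p.diff_triangle[of "f x" l z] by auto
      qed
    qed (use F in simp)
  qed simp
qed

lemma limitin_seminorm_topD:
  assumes cs: "cstar_seminorm A p" "p \<in> P" and lim: "limitin (seminorm_top P) f l F" and "0 < e"
  shows "eventually (\<lambda>x. f x \<in> carrier A \<and> p (f x \<ominus> l) < e) F"
proof -
  interpret p: cstar_seminorm_on A p using cs cstar_on by blast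
  have l: "l \<in> carrier A" using lim by (auto simp: limitin_def)
  have "openin (seminorm_top P) {y \<in> carrier A. p (y \<ominus> l) < e}"
    using cs l \<open>0 < e\<close> by (intro openin_seminorm_ball)
  moreover have "l \<in> {y \<in> carrier A. p (y \<ominus> l) < e}" using l \<open>0 < e\<close> by simp
  ultimately show ?thesis using lim by (auto simp: limitin_def)
qed

lemma Hausdorff_seminorm_top:
  assumes cs: "\<And>p. p \<in> P \<Longrightarrow> cstar_seminorm A p"
    and sep: "\<And>x. x \<in> carrier A \<Longrightarrow> \<forall>p\<in>P. p x = 0 \<Longrightarrow> x = \<zero>"
  shows "Hausdorff_space (seminorm_top P)"
  unfolding Hausdorff_space_def
proof (intro allI impI, elim conjE)
  fix x y assume "x \<in> topspace (seminorm_top P)" "y \<in> topspace (seminorm_top P)" "x \<noteq> y"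
  then have xy: "x \<in> carrier A" "y \<in> carrier A" by auto
  have "x \<ominus> y \<noteq> \<zero>" using \<open>x \<noteq> y\<close> xy by (metis M.minus_equality M.minus_minus a_minus_def M.a_inv_closed)
  then obtain p where p: "p \<in> P" "p (x \<ominus> y) \<noteq> 0" using sep[of "x \<ominus> y"] xy by auto
  interpret p: cstar_seminorm_on A p using cs p cstar_on by blast
  have pos: "p (x \<ominus> y) > 0" using p xy by (simp add: less_le)
  let ?B = "\<lambda>z. {w \<in> carrier A. p (w \<ominus> z) < p (x \<ominus> y) / 2}"
  have "disjnt (?B x) (?B y)"
  proof -
    have False if w: "w \<in> carrier A" "p (w \<ominus> x) < p (x \<ominus> y) / 2" "p (w \<ominus> y) < p (x \<ominus> y) / 2" for w
      using p.diff_triangle[OF xy(1) w(1) xy(2)] p.diff_commute[OF xy(1) w(1)] w(2,3) by linarith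
    then show ?thesis by (auto simp: disjnt_def)
  qed
  moreover have "x \<in> ?B x" "y \<in> ?B y" using xy pos by auto
  moreover have "openin (seminorm_top P) (?B x)" "openin (seminorm_top P) (?B y)"
    by (rule openin_seminorm_ball[OF p(1) xy(1) half_gt_zero[OF pos]], rule openin_seminorm_ball[OF p(1) xy(2) half_gt_zero[OF pos]])
  ultimately show "\<exists>U V. openin (seminorm_top P) U \<and> openin (seminorm_top P) V \<and> x \<in> U \<and> y \<in> V \<and> disjnt U V"
    by blast
qed

lemma cstar_norm_character:
  assumes "\<xi> \<in> hermitian_hom A complex_kalg"
  shows "cstar_seminorm A (\<lambda>x. norm (\<xi> x))"
  using assms
  by (auto simp: hermitian_character_iff cstar_seminorm_def norm_triangle_ineq norm_mult power2_eq_square)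

lemma cstar_seminorm_max:
  assumes "cstar_seminorm A p" "cstar_seminorm A q"
  shows "cstar_seminorm A (\<lambda>x. max (p x) (q x))"
proof -
  interpret p: cstar_seminorm_on A p using assms cstar_on by blast
  interpret q: cstar_seminorm_on A q using assms cstar_on by blast
  show ?thesis
    unfolding cstar_seminorm_def
  proof (intro conjI ballI allI)
    fix x y assume "x \<in> carrier A" "y \<in> carrier A"
    then show "max (p (x \<oplus> y)) (q (x \<oplus> y)) \<le> max (p x) (q x) + max (p y) (q y)"
      using p.triangle[of x y] q.triangle[of x y] by linarith
  next
    fix x assume x: "x \<in> carrier A"
    show "0 \<le> max (p x) (q x)" using x by (simp add: le_max_iff_disj)
    show "max (p (c \<odot> x)) (q (c \<odot> x)) = norm c * max (p x) (q x)" for c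
      using x by (simp add: p.homogeneous q.homogeneous max_mult_distrib_left)
    show "max (p (x \<otimes> invol A x)) (q (x \<otimes> invol A x)) = (max (p x) (q x))\<^sup>2"
      using x by (simp add: p.cstar_identity q.cstar_identity max_def power2_le_iff_abs_le)
  qed
qed

lemma cstar_seminorm_zero: "cstar_seminorm A (\<lambda>x. 0)"
  by (simp add: cstar_seminorm_def)

end

text \<open>Rescaling to the value 1 of \<open>p\<close> turns continuity at zero into a linear
  bound. Its constant does not matter, as \<open>le_of_bounded\<close> removes it.\<close>

lemma (in cstar_seminorm_on) le_of_nbhd:
  assumes q: "cstar_seminorm A q" and "e > 0"
    and nbhd: "\<And>x. x \<in> carrier A \<Longrightarrow> q x < e \<Longrightarrow> p x < 1" and x: "x \<in> carrier A"
  shows "p x \<le> q x"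
proof (rule le_of_bounded[OF q _ x])
  interpret q: cstar_seminorm_on A q using q cstar_on by blast
  fix x assume x: "x \<in> carrier A"
  show "p x \<le> 2 / e * q x"
  proof (rule ccontr)
    assume "\<not> ?thesis"
    then have less: "2 / e * q x < p x" by simp
    moreover have "0 \<le> 2 / e * q x" using x \<open>e > 0\<close> by simp
    ultimately have pos: "p x > 0" by linarith
    let ?y = "complex_of_real (1 / p x) \<odot> x"
    have "2 * q x < e * p x" using less \<open>e > 0\<close> by (simp add: field_simps)
    then have "q x < e * p x" using pos \<open>e > 0\<close> x q.nonneg[OF x] by linarith
    then have "q ?y < e" using x pos by (simp add: q.homogeneous norm_divide field_simps)
    then have "p ?y < 1" using x by (intro nbhd) auto
    then show False using x pos by (simp add: homogeneous norm_divide)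
  qed
qed

context involutive_algebra
begin

text \<open>The modulus of a hermitian character is itself a C*-seminorm, so continuity for
  \<open>p\<close> amounts to domination by \<open>p\<close> with constant 1.\<close>

lemma X_p_iff:
  assumes p: "cstar_seminorm A p"
  shows "\<xi> \<in> X_p A p \<longleftrightarrow> \<xi> \<in> hermitian_hom A complex_kalg \<and> (\<forall>x\<in>carrier A. norm (\<xi> x) \<le> p x)"
    (is "?L \<longleftrightarrow> ?R")
proof
  assume L: ?L
  then have herm: "\<xi> \<in> hermitian_hom A complex_kalg"
    and cont: "continuous_map (seminorm_top {p}) euclidean \<xi>" by (auto simp: X_p_def)
  interpret p: cstar_seminorm_on A p using p cstar_on by blast
  interpret n: cstar_seminorm_on A "\<lambda>x. norm (\<xi> x)" using cstar_norm_character[OF herm] cstar_on by blast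
  have "\<xi> \<zero> = 0" using n.at_zero unfolding norm_eq_zero .
  then obtain U where U: "openin (seminorm_top {p}) U" "\<zero> \<in> U" "\<forall>y\<in>U. norm (\<xi> y) < 1"
    using cont unfolding continuous_map_metric_iff
    by (metis M.zero_closed diff_zero dist_norm topspace_seminorm_topology zero_less_one)
  obtain e where e: "e > 0" "{y \<in> carrier A. p (y \<ominus> \<zero>) < e} \<subseteq> U"
    using open_contains_seminorm_ball[of "{p}" U \<zero>] U p by auto
  have "norm (\<xi> x) \<le> p x" if "x \<in> carrier A" for x
  proof (rule n.le_of_nbhd[OF p e(1) _ that])
    fix y assume "y \<in> carrier A" "p y < e"
    then have "y \<in> U" using e(2) by auto
    then show "norm (\<xi> y) < 1" using U(3) by blast
  qed
  then show ?R using herm by blast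
next
  assume R: ?R
  interpret p: cstar_seminorm_on A p using p cstar_on by blast
  have "continuous_map (seminorm_top {p}) euclidean \<xi>"
    unfolding continuous_map_metric_iff
  proof (intro ballI allI impI)
    fix x and e :: real assume "x \<in> topspace (seminorm_top {p})" "0 < e"
    then have x: "x \<in> carrier A" by simp
    have "dist (\<xi> y) (\<xi> x) < e" if "y \<in> carrier A" "p (y \<ominus> x) < e" for y
      using R that x character_diff[of \<xi> y x] M.minus_closed[of y x] by (metis dist_norm le_less_trans)
    then show "\<exists>U. openin (seminorm_top {p}) U \<and> x \<in> U \<and> (\<forall>y\<in>U. dist (\<xi> y) (\<xi> x) < e)"
      using x \<open>0 < e\<close> openin_seminorm_ball[of p "{p}" x "carrier A" e "\<lambda>x y. x \<ominus> y"]
      by (intro exI[of _ "{y \<in> carrier A. p (y \<ominus> x) < e}"]) auto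
  qed
  then show ?L using R by (auto simp: X_p_def)
qed

text \<open>Gelfand-Naimark in the form of an upper bound. The condition \<open>0 \<le> c\<close>
  covers \<open>p x = 0\<close>, where \<open>X_p A p\<close> may be empty.\<close>

lemma seminorm_le_of_characters:
  assumes p: "cstar_seminorm A p" and x: "x \<in> carrier A" and "0 \<le> c"
    and le: "\<And>\<xi>. \<xi> \<in> X_p A p \<Longrightarrow> norm (\<xi> x) \<le> c"
  shows "p x \<le> c"
proof (cases "p x = 0")
  case False
  interpret p: cstar_seminorm_on A p using p cstar_on by blast
  obtain \<xi> where "\<xi> \<in> hermitian_hom A complex_kalg" "norm (\<xi> x) = p x"
    "\<And>y. y \<in> carrier A \<Longrightarrow> norm (\<xi> y) \<le> p y"
    using p.gelfand_naimark[OF x False] by blast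
  then show ?thesis using le[of \<xi>] X_p_iff[OF p] by auto
qed (use \<open>0 \<le> c\<close> in simp)

end

section \<open>Continuous C*-seminorms and continuous characters of a K*-algebra\<close>

context kstar_algebra
begin

abbreviation CS :: "('a \<Rightarrow> real) set" where "CS \<equiv> cont_cstar_seminorms A"

abbreviation chars :: "('a \<Rightarrow> complex) set" where "chars \<equiv> kalg_hom A complex_kalg"

lemma CS_cstar: "p \<in> CS \<Longrightarrow> cstar_seminorm A p"
  by (simp add: cont_cstar_seminorms_def)

lemma CS_on: "p \<in> CS \<Longrightarrow> cstar_seminorm_on A p"
  using CS_cstar cstar_on by blast

lemma generating_subset_CS:
  assumes P: "\<And>p. p \<in> P \<Longrightarrow> cstar_seminorm A p" "topol A = seminorm_top P"
  shows "P \<subseteq> CS"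
proof
  fix p assume p: "p \<in> P"
  interpret p: cstar_seminorm_on A p using P p cstar_on by blast
  have "continuous_map (topol A) euclideanreal p"
    unfolding continuous_map_metric_iff P(2)
  proof (intro ballI allI impI)
    fix x and e :: real assume "x \<in> topspace (seminorm_top P)" "0 < e"
    then have x: "x \<in> carrier A" by simp
    have "dist (p y) (p x) < e" if "y \<in> carrier A" "p (y \<ominus> x) < e" for y
      using p.le_diff_add[of y x] p.le_diff_add[of x y] p.diff_commute[of x y] that x
      by (auto simp: dist_real_def)
    then show "\<exists>U. openin (seminorm_top P) U \<and> x \<in> U \<and> (\<forall>y\<in>U. dist (p y) (p x) < e)"
      using x \<open>0 < e\<close> p openin_seminorm_ball[of p P x "carrier A" e "\<lambda>x y. x \<ominus> y"]
      by (intro exI[of _ "{y \<in> carrier A. p (y \<ominus> x) < e}"]) auto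
  qed
  then show "p \<in> CS" using P p by (simp add: cont_cstar_seminorms_def)
qed

lemma topspace_topol [simp]: "topspace (topol A) = carrier A"
  using topol_seminorms by auto

text \<open>The generating family in the definition is arbitrary and need not be directed. The set
  \<open>CS\<close> generates the same topology and is closed under maxima, so it takes the place of
  that family from here on.\<close>

lemma topol_eq: "topol A = seminorm_top CS"
proof -
  obtain P where P: "\<And>p. p \<in> P \<Longrightarrow> cstar_seminorm A p" "topol A = seminorm_top P"
    using topol_seminorms by blast
  have sub: "P \<subseteq> CS" by (rule generating_subset_CS) (use P in auto)
  have "continuous_map (seminorm_top CS) (seminorm_top P) id"
  proof (rule continuous_map_into_seminorm_top)
    fix p x and e :: real assume p: "p \<in> P" and x: "x \<in> topspace (seminorm_top CS)" and "0 < e"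
    then have "openin (seminorm_top CS) {y \<in> carrier A. p (y \<ominus> x) < e}"
      using sub by (intro openin_seminorm_ball) auto
    moreover have "p \<zero> = 0" using P(1)[OF p] cstar_on cstar_seminorm_on.at_zero by blast
    ultimately show "\<exists>U. openin (seminorm_top CS) U \<and> x \<in> U \<and> (\<forall>y\<in>U. p (id y \<ominus> id x) < e)"
      using x \<open>0 < e\<close> by (intro exI[of _ "{y \<in> carrier A. p (y \<ominus> x) < e}"]) auto
  qed (use P in auto)
  moreover have "continuous_map (seminorm_top P) (seminorm_top CS) id"
  proof (rule continuous_map_into_seminorm_top)
    fix q x and e :: real assume q: "q \<in> CS" and "x \<in> topspace (seminorm_top P)" and "0 < e"
    then have x: "x \<in> carrier A" by simp
    interpret q: cstar_seminorm_on A q using CS_on[OF q] .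
    \<comment> \<open>Membership in \<open>CS\<close> is continuity of \<open>q\<close> itself,
      whereas balls around \<open>x\<close> involve \<open>q (y \<ominus> x)\<close>; translations
      have to be known continuous.\<close>
    have translation: "continuous_map (topol A) (topol A) (\<lambda>y. y \<ominus> x)"
      unfolding P(2)
    proof (rule continuous_map_into_seminorm_top)
      fix p z and d :: real assume p: "p \<in> P" and "z \<in> topspace (seminorm_top P)" and "0 < d"
      then have z: "z \<in> carrier A" by simp
      interpret p: cstar_seminorm_on A p using P p cstar_on by blast
      have "y \<ominus> x \<ominus> (z \<ominus> x) = y \<ominus> z" if "y \<in> carrier A" for y
        using that x z by (simp add: diff_diff_cancel)
      moreover have "openin (seminorm_top P) {y \<in> carrier A. p (y \<ominus> z) < d}"
        using p z \<open>0 < d\<close> by (intro openin_seminorm_ball)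
      ultimately show "\<exists>U. openin (seminorm_top P) U \<and> z \<in> U \<and> (\<forall>y\<in>U. p (y \<ominus> x \<ominus> (z \<ominus> x)) < d)"
        using z \<open>0 < d\<close> by (intro exI[of _ "{y \<in> carrier A. p (y \<ominus> z) < d}"]) auto
    qed (use P x in auto)
    have "continuous_map (topol A) euclideanreal q" using q by (simp add: cont_cstar_seminorms_def)
    then have "continuous_map (topol A) euclideanreal (q \<circ> (\<lambda>y. y \<ominus> x))"
      using translation continuous_map_compose by blast
    then have "openin (topol A) {y \<in> topspace (topol A). (q \<circ> (\<lambda>y. y \<ominus> x)) y \<in> {..<e}}"
      by (rule openin_continuous_map_preimage) simp
    then show "\<exists>U. openin (seminorm_top P) U \<and> x \<in> U \<and> (\<forall>y\<in>U. q (id y \<ominus> id x) < e)"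
      unfolding P(2) using x \<open>0 < e\<close>
      by (intro exI[of _ "{y \<in> carrier A. q (y \<ominus> x) < e}"]) auto
  qed (use CS_cstar in auto)
  ultimately show ?thesis
    unfolding P(2) using topology_finer_continuous_id[of "seminorm_top P" "seminorm_top CS"]
      topology_finer_continuous_id[of "seminorm_top CS" "seminorm_top P"]
    by (auto simp: topology_eq)
qed

lemma CS_max:
  assumes "p \<in> CS" "q \<in> CS" shows "(\<lambda>x. max (p x) (q x)) \<in> CS"
  using assms cstar_seminorm_max[of p q]
  by (auto simp: cont_cstar_seminorms_def intro: continuous_map_real_max)

lemma CS_zero: "(\<lambda>x. 0) \<in> CS"
  by (simp add: cont_cstar_seminorms_def cstar_seminorm_zero)

lemma CS_directed: "p \<in> CS \<Longrightarrow> q \<in> CS \<Longrightarrow> \<exists>r\<in>CS. \<forall>x\<in>carrier A. p x \<le> r x \<and> q x \<le> r x"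
  using CS_max by (intro bexI[of _ "\<lambda>x. max (p x) (q x)"]) auto

lemma CS_le:
  assumes q: "cstar_seminorm A q" and p: "p \<in> CS" and le: "\<And>x. x \<in> carrier A \<Longrightarrow> q x \<le> p x"
  shows "q \<in> CS"
proof -
  interpret q: cstar_seminorm_on A q using q cstar_on by blast
  have "continuous_map (topol A) euclideanreal q"
    unfolding continuous_map_metric_iff topol_eq
  proof (intro ballI allI impI)
    fix x and e :: real assume "x \<in> topspace (seminorm_top CS)" "0 < e"
    then have x: "x \<in> carrier A" by simp
    have "dist (q y) (q x) < e" if "y \<in> carrier A" "p (y \<ominus> x) < e" for y
      using q.le_diff_add[of y x] q.le_diff_add[of x y] q.diff_commute[of x y] le[of "y \<ominus> x"] that x
      by (auto simp: dist_real_def)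
    then show "\<exists>U. openin (seminorm_top CS) U \<and> x \<in> U \<and> (\<forall>y\<in>U. dist (q y) (q x) < e)"
      using x \<open>0 < e\<close> p openin_seminorm_ball[of p CS x "carrier A" e "\<lambda>x y. x \<ominus> y"]
        cstar_seminorm_on.at_zero[OF CS_on[OF p]]
      by (intro exI[of _ "{y \<in> carrier A. p (y \<ominus> x) < e}"]) auto
  qed
  then show ?thesis using q by (simp add: cont_cstar_seminorms_def)
qed

text \<open>A neighbourhood of zero with \<open>q < 1\<close> contains a ball of one member of
  \<open>P\<close>, and \<open>le_of_nbhd\<close> makes this domination. It is the means to control
  all continuous seminorms of a concrete algebra by its generating ones.\<close>

lemma CS_dominated:
  assumes P: "\<And>p. p \<in> P \<Longrightarrow> cstar_seminorm A p" "topol A = seminorm_top P" "P \<noteq> {}"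
    and directed: "\<And>p q. p \<in> P \<Longrightarrow> q \<in> P \<Longrightarrow> \<exists>r\<in>P. \<forall>x\<in>carrier A. p x \<le> r x \<and> q x \<le> r x"
    and q: "q \<in> CS"
  shows "\<exists>p\<in>P. \<forall>x\<in>carrier A. q x \<le> p x"
proof -
  interpret q: cstar_seminorm_on A q using CS_on[OF q] .
  have "continuous_map (topol A) euclideanreal q" using q by (simp add: cont_cstar_seminorms_def)
  then obtain U where U: "openin (seminorm_top P) U" "\<zero> \<in> U" "\<forall>y\<in>U. dist (q y) (q \<zero>) < 1"
    unfolding continuous_map_metric_iff P(2)
    by (metis M.zero_closed topspace_seminorm_topology zero_less_one)
  obtain p e where p: "p \<in> P" "e > 0" "{y \<in> carrier A. p (y \<ominus> \<zero>) < e} \<subseteq> U"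
    using open_contains_seminorm_ball[OF P(1,3) directed U(1,2)] by blast
  have "q x \<le> p x" if "x \<in> carrier A" for x
  proof (rule q.le_of_nbhd[OF P(1)[OF p(1)] p(2) _ that])
    fix y assume "y \<in> carrier A" "p y < e"
    then have "y \<in> U" using p(3) by auto
    then show "q y < 1" using U(3) by auto
  qed
  then show ?thesis using p(1) by blast
qed

lemma open_contains_CS_ball:
  assumes "openin (topol A) U" "x \<in> U"
  shows "\<exists>p\<in>CS. \<exists>e>0. {y \<in> carrier A. p (y \<ominus> x) < e} \<subseteq> U"
  using assms CS_zero unfolding topol_eq
  by (intro open_contains_seminorm_ball CS_cstar CS_directed) auto

lemma eq_zeroI:
  assumes x: "x \<in> carrier A" and zero: "\<And>p. p \<in> CS \<Longrightarrow> p x = 0"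
  shows "x = \<zero>"
proof (rule ccontr)
  assume "x \<noteq> \<zero>"
  then obtain U V where UV: "openin (topol A) U" "openin (topol A) V" "x \<in> U" "\<zero> \<in> V" "disjnt U V"
    using topol_Hausdorff x M.zero_closed unfolding Hausdorff_space_def topspace_topol by blast
  obtain p e where p: "p \<in> CS" "e > 0" "{y \<in> carrier A. p (y \<ominus> \<zero>) < e} \<subseteq> V"
    using open_contains_CS_ball[OF UV(2,4)] by blast
  then have "x \<in> V" using zero[OF p(1)] x by auto
  then show False using UV by (auto simp: disjnt_def)
qed

text \<open>A suitable seminorm for \<open>\<xi>\<close> is its own modulus, a C*-seminorm that is
  continuous together with \<open>\<xi>\<close>.\<close>

lemma chars_iff: "\<xi> \<in> chars \<longleftrightarrow> (\<exists>p\<in>CS. \<xi> \<in> X_p A p)"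
proof
  assume \<xi>: "\<xi> \<in> chars"
  then have herm: "\<xi> \<in> hermitian_hom A complex_kalg" by (simp add: kalg_hom_def)
  have "continuous_map (topol A) euclideanreal (\<lambda>x. norm (\<xi> x))"
    using \<xi> by (intro continuous_map_norm) (simp add: kalg_hom_def)
  then have "(\<lambda>x. norm (\<xi> x)) \<in> CS"
    using cstar_norm_character[OF herm] by (simp add: cont_cstar_seminorms_def)
  moreover have "\<xi> \<in> X_p A (\<lambda>x. norm (\<xi> x))"
    using X_p_iff[OF cstar_norm_character[OF herm]] herm by simp
  ultimately show "\<exists>p\<in>CS. \<xi> \<in> X_p A p" by blast
next
  assume "\<exists>p\<in>CS. \<xi> \<in> X_p A p"
  then obtain p where p: "p \<in> CS" "\<xi> \<in> X_p A p" by blast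
  then have \<xi>: "\<xi> \<in> hermitian_hom A complex_kalg" "\<And>x. x \<in> carrier A \<Longrightarrow> norm (\<xi> x) \<le> p x"
    using X_p_iff[OF CS_cstar] by blast+
  have "continuous_map (topol A) euclidean \<xi>"
    unfolding continuous_map_metric_iff topol_eq
  proof (intro ballI allI impI)
    fix x and e :: real assume "x \<in> topspace (seminorm_top CS)" "0 < e"
    then have x: "x \<in> carrier A" by simp
    have "dist (\<xi> y) (\<xi> x) < e" if "y \<in> carrier A" "p (y \<ominus> x) < e" for y
      using \<xi>(2)[of "y \<ominus> x"] character_diff[OF \<xi>(1), of y x] that x by (simp add: dist_norm)
    then show "\<exists>U. openin (seminorm_top CS) U \<and> x \<in> U \<and> (\<forall>y\<in>U. dist (\<xi> y) (\<xi> x) < e)"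
      using x \<open>0 < e\<close> p openin_seminorm_ball[of p CS x "carrier A" e "\<lambda>x y. x \<ominus> y"]
        cstar_seminorm_on.at_zero[OF CS_on[OF p(1)]]
      by (intro exI[of _ "{y \<in> carrier A. p (y \<ominus> x) < e}"]) auto
  qed
  then show "\<xi> \<in> chars" using \<xi> by (simp add: kalg_hom_def)
qed

lemma X_p_subset_chars: "p \<in> CS \<Longrightarrow> X_p A p \<subseteq> chars"
  using chars_iff by blast

lemma norm_le_of_X_p: "p \<in> CS \<Longrightarrow> \<xi> \<in> X_p A p \<Longrightarrow> x \<in> carrier A \<Longrightarrow> norm (\<xi> x) \<le> p x"
  using X_p_iff[OF CS_cstar] by blast

lemma eqI_chars:
  assumes "x \<in> carrier A" "y \<in> carrier A" and eq: "\<And>\<xi>. \<xi> \<in> chars \<Longrightarrow> \<xi> x = \<xi> y"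
  shows "x = y"
proof -
  have "p (x \<ominus> y) \<le> 0" if p: "p \<in> CS" for p
  proof (rule seminorm_le_of_characters[OF CS_cstar[OF p]])
    fix \<xi> assume "\<xi> \<in> X_p A p"
    then have "\<xi> \<in> chars" using p chars_iff by blast
    then show "norm (\<xi> (x \<ominus> y)) \<le> 0"
      using character_diff[of \<xi> x y] eq assms by (simp add: kalg_hom_def)
  qed (use assms in auto)
  then have "x \<ominus> y = \<zero>"
    using assms cstar_seminorm_on.nonneg[OF CS_on] by (intro eq_zeroI) (auto intro: antisym)
  then show ?thesis using assms by (metis M.minus_equality M.minus_minus a_minus_def M.a_inv_closed)
qed

end

lemma hermitian_hom_iff:
  "u \<in> hermitian_hom A B \<longleftrightarrow>
     u \<in> extensional (carrier A) \<and> (\<forall>x\<in>carrier A. u x \<in> carrier B) \<and> u \<one>\<^bsub>A\<^esub> = \<one>\<^bsub>B\<^esub> \<and>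
     (\<forall>x\<in>carrier A. \<forall>y\<in>carrier A. u (x \<oplus>\<^bsub>A\<^esub> y) = u x \<oplus>\<^bsub>B\<^esub> u y) \<and>
     (\<forall>x\<in>carrier A. \<forall>y\<in>carrier A. u (x \<otimes>\<^bsub>A\<^esub> y) = u x \<otimes>\<^bsub>B\<^esub> u y) \<and>
     (\<forall>c. \<forall>x\<in>carrier A. u (c \<odot>\<^bsub>A\<^esub> x) = c \<odot>\<^bsub>B\<^esub> u x) \<and>
     (\<forall>x\<in>carrier A. u (invol A x) = invol B (u x))"
  by (auto simp: hermitian_hom_def ring_hom_def)

lemma kalg_homI:
  fixes A :: "('a, 'm) kalg_scheme" and B :: "('b, 'n) kalg_scheme"
  assumes A: "kstar_algebra A" and B: "involutive_algebra B" and u: "u \<in> hermitian_hom A B"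
    and P: "\<And>r. r \<in> P \<Longrightarrow> cstar_seminorm B r" "topol B = seminorm_topology (carrier B) (\<lambda>x y. x \<ominus>\<^bsub>B\<^esub> y) P"
    and le: "\<And>r. r \<in> P \<Longrightarrow> \<exists>p\<in>cont_cstar_seminorms A. \<forall>x\<in>carrier A. r (u x) \<le> p x"
  shows "u \<in> kalg_hom A B"
proof -
  interpret A: kstar_algebra A by fact
  interpret B: involutive_algebra B by fact
  have closed: "u x \<in> carrier B" if "x \<in> carrier A" for x using u that by (auto simp: hermitian_hom_iff)
  have diff: "u (x \<ominus>\<^bsub>A\<^esub> y) = u x \<ominus>\<^bsub>B\<^esub> u y" if "x \<in> carrier A" "y \<in> carrier A" for x y
    using u that closed by (auto simp: hermitian_hom_iff A.diff_eq_smult B.diff_eq_smult)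
  have "continuous_map (topol A) (topol B) u"
    unfolding P(2)
  proof (rule B.continuous_map_into_seminorm_top)
    fix r x and e :: real assume r: "r \<in> P" and "x \<in> topspace (topol A)" and "0 < e"
    then have x: "x \<in> carrier A" by simp
    obtain p where p: "p \<in> cont_cstar_seminorms A" "\<forall>x\<in>carrier A. r (u x) \<le> p x" using le[OF r] by blast
    have "r (u y \<ominus>\<^bsub>B\<^esub> u x) < e" if "y \<in> carrier A" "p (y \<ominus>\<^bsub>A\<^esub> x) < e" for y
      using p(2)[rule_format, of "y \<ominus>\<^bsub>A\<^esub> x"] that x diff[of y x] by simp
    then show "\<exists>U. openin (topol A) U \<and> x \<in> U \<and> (\<forall>y\<in>U. r (u y \<ominus>\<^bsub>B\<^esub> u x) < e)"
      using x \<open>0 < e\<close> p openin_seminorm_ball[of p A.CS x "carrier A" e "\<lambda>x y. x \<ominus>\<^bsub>A\<^esub> y"]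
        cstar_seminorm_on.at_zero[OF A.CS_on[OF p(1)]]
      unfolding A.topol_eq
      by (intro exI[of _ "{y \<in> carrier A. p (y \<ominus>\<^bsub>A\<^esub> x) < e}"]) auto
  qed (use P closed in auto)
  then show ?thesis using u by (simp add: kalg_hom_def)
qed

lemma kalg_hom_seminorm:
  assumes A: "involutive_algebra A" and u: "u \<in> kalg_hom A B" and r: "r \<in> cont_cstar_seminorms B"
  shows "(\<lambda>x. r (u x)) \<in> cont_cstar_seminorms A"
proof -
  interpret A: involutive_algebra A by fact
  have "continuous_map (topol A) euclideanreal (r \<circ> u)"
    using u r by (intro continuous_map_compose[of _ "topol B"]) (auto simp: kalg_hom_def cont_cstar_seminorms_def)
  moreover have "cstar_seminorm A (\<lambda>x. r (u x))"
    using u r unfolding cstar_seminorm_def cont_cstar_seminorms_def kalg_hom_def hermitian_hom_iff mem_Collect_eq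
    by (simp add: A.invol_in)
  ultimately show ?thesis by (simp add: cont_cstar_seminorms_def o_def)
qed

lemma hermitian_hom_compose:
  assumes "u \<in> hermitian_hom A B" "v \<in> hermitian_hom B C" "involutive_algebra A"
  shows "compose (carrier A) v u \<in> hermitian_hom A C"
proof -
  interpret A: involutive_algebra A by fact
  show ?thesis using assms(1,2) unfolding hermitian_hom_iff by (simp add: compose_def)
qed

lemma kalg_hom_compose:
  assumes u: "u \<in> kalg_hom A B" and v: "v \<in> kalg_hom B C" and A: "kstar_algebra A"
  shows "compose (carrier A) v u \<in> kalg_hom A C"
proof -
  interpret A: kstar_algebra A by fact
  have "continuous_map (topol A) (topol C) (v \<circ> u)"
    using u v by (intro continuous_map_compose) (auto simp: kalg_hom_def)
  then have "continuous_map (topol A) (topol C) (compose (carrier A) v u)"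
    by (rule continuous_map_eq) (simp add: compose_def)
  then show ?thesis
    using u v hermitian_hom_compose[of u A B v C] A.involutive_algebra_axioms by (simp add: kalg_hom_def)
qed

section \<open>Uniform approximation on compact sets of characters\<close>

lemma continuous_on_coordinate [continuous_intros]: "continuous_on S (\<lambda>f. f i :: 'b::topological_space)"
  by (rule continuous_on_subset[OF continuous_on_product_coordinates subset_UNIV])

text \<open>The library has no instance \<open>fun :: (type, t2_space) t2_space\<close>, and the arities of \<open>fun\<close> exclude it. This
  copy of the power \<open>\<complex>\<^sup>I\<close> makes the type-class version of the Stone-Weierstrass theorem applicable.\<close>

typedef 'i complex_power = "UNIV :: ('i \<Rightarrow> complex) set" ..

instantiation complex_power :: (type) t2_space
begin

definition open_complex_power :: "'a complex_power set \<Rightarrow> bool" where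
  "open_complex_power U \<longleftrightarrow> open (Abs_complex_power -` U)"

instance
proof
  show "open (UNIV :: 'a complex_power set)"
    by (simp add: open_complex_power_def)
  show "open (U \<inter> V)" if "open U" "open V" for U V :: "'a complex_power set"
    using that by (simp add: open_complex_power_def open_Int)
  show "open (\<Union>K)" if "\<forall>U\<in>K. open U" for K :: "'a complex_power set set"
    using that by (auto simp: open_complex_power_def vimage_Union)
  show "\<exists>U V. open U \<and> open V \<and> x \<in> U \<and> y \<in> V \<and> U \<inter> V = {}" if "x \<noteq> y" for x y :: "'a complex_power"
  proof -
    obtain i where "Rep_complex_power x i \<noteq> Rep_complex_power y i"
      using \<open>x \<noteq> y\<close> by (metis Rep_complex_power_inject ext)
    then obtain U V where UV: "open U" "open V" "Rep_complex_power x i \<in> U" "Rep_complex_power y i \<in> V" "U \<inter> V = {}"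
      by (meson hausdorff)
    have "open ((\<lambda>z. Rep_complex_power z i) -` W)" if "open W" for W
    proof -
      have "open ((\<lambda>f. f i) -` W)" by (rule open_vimage[OF that]) (rule continuous_on_coordinate)
      moreover have "Abs_complex_power -` (\<lambda>z. Rep_complex_power z i) -` W = (\<lambda>f. f i) -` W"
        by (auto simp: Abs_complex_power_inverse)
      ultimately show ?thesis by (simp add: open_complex_power_def)
    qed
    then show ?thesis
      using UV by (intro exI[of _ "(\<lambda>z. Rep_complex_power z i) -` U"] exI[of _ "(\<lambda>z. Rep_complex_power z i) -` V"]) auto
  qed
qed

end

lemma continuous_on_Abs_complex_power: "continuous_on S Abs_complex_power"
  by (rule continuous_on_subset[of UNIV]) (auto simp: continuous_on_open_vimage open_complex_power_def)

text \<open>Closure under conjugation puts real and imaginary parts of members of \<open>F\<close>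
  into the ring \<open>R\<close> of real functions, which hence still separates points; the real
  theorem is applied to both parts of \<open>f\<close>.\<close>

lemma Stone_Weierstrass_complex_t2:
  fixes K :: "'x::t2_space set" and F :: "('x \<Rightarrow> complex) set"
  assumes K: "compact K" and cont: "\<And>g. g \<in> F \<Longrightarrow> continuous_on K g"
    and add: "\<And>g h. g \<in> F \<Longrightarrow> h \<in> F \<Longrightarrow> (\<lambda>x. g x + h x) \<in> F"
    and mult: "\<And>g h. g \<in> F \<Longrightarrow> h \<in> F \<Longrightarrow> (\<lambda>x. g x * h x) \<in> F"
    and conj: "\<And>g. g \<in> F \<Longrightarrow> (\<lambda>x. cnj (g x)) \<in> F"
    and const: "\<And>c. (\<lambda>_. c) \<in> F"
    and sep: "\<And>x y. x \<in> K \<Longrightarrow> y \<in> K \<Longrightarrow> x \<noteq> y \<Longrightarrow> \<exists>g\<in>F. g x \<noteq> g y"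
    and f: "continuous_on K f" and "0 < e"
  shows "\<exists>g\<in>F. \<forall>x\<in>K. norm (f x - g x) < e"
proof -
  define R where "R = {r. (\<lambda>x. complex_of_real (r x)) \<in> F}"
  have Re_R: "(\<lambda>x. Re (g x)) \<in> R" if "g \<in> F" for g
  proof -
    have "(\<lambda>x. (1 / 2) * (g x + cnj (g x))) \<in> F" using that by (intro mult add conj const)
    moreover have "(\<lambda>x. (1 / 2) * (g x + cnj (g x))) = (\<lambda>x. complex_of_real (Re (g x)))"
      by (simp add: complex_add_cnj)
    ultimately show ?thesis by (simp add: R_def)
  qed
  have Im_R: "(\<lambda>x. Im (g x)) \<in> R" if "g \<in> F" for g
  proof -
    have "(\<lambda>x. Re (- \<i> * g x)) \<in> R" using that by (intro Re_R mult const)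
    then show ?thesis by simp
  qed
  interpret R: function_ring_on R K
  proof
    show "compact K" by fact
    show "continuous_on K r" if "r \<in> R" for r
    proof -
      have "continuous_on K (\<lambda>x. Re (complex_of_real (r x)))"
        using that by (intro continuous_intros cont) (simp add: R_def)
      then show ?thesis by simp
    qed
    show "(\<lambda>x. r x + s x) \<in> R" "(\<lambda>x. r x * s x) \<in> R" if "r \<in> R" "s \<in> R" for r s
      using that add mult by (auto simp: R_def)
    show "(\<lambda>_. c) \<in> R" for c by (simp add: R_def const)
    show "\<exists>r\<in>R. r x \<noteq> r y" if xy: "x \<in> K" "y \<in> K" "x \<noteq> y" for x y
    proof -
      obtain g where "g \<in> F" "g x \<noteq> g y" using sep[OF xy] by blast
      then show ?thesis using Re_R Im_R by (metis complex_eqI)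
    qed
  qed
  obtain r where r: "r \<in> R" "\<forall>x\<in>K. \<bar>Re (f x) - r x\<bar> < e / 2"
    using R.Stone_Weierstrass_basic[of "\<lambda>x. Re (f x)" "e / 2"] f \<open>0 < e\<close>
    by (auto intro: continuous_intros)
  obtain s where s: "s \<in> R" "\<forall>x\<in>K. \<bar>Im (f x) - s x\<bar> < e / 2"
    using R.Stone_Weierstrass_basic[of "\<lambda>x. Im (f x)" "e / 2"] f \<open>0 < e\<close>
    by (auto intro: continuous_intros)
  have "(\<lambda>x. complex_of_real (r x) + \<i> * complex_of_real (s x)) \<in> F"
    using r(1) s(1) by (intro add mult const) (auto simp: R_def)
  moreover have "norm (f x - (complex_of_real (r x) + \<i> * complex_of_real (s x))) < e" if "x \<in> K" for x
  proof -
    have "\<bar>Re (f x) - r x\<bar> < e / 2" "\<bar>Im (f x) - s x\<bar> < e / 2" using r(2) s(2) that by auto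
    then show ?thesis
      using cmod_le[of "f x - (complex_of_real (r x) + \<i> * complex_of_real (s x))"] by simp
  qed
  ultimately show ?thesis
    by (intro bexI[of _ "\<lambda>x. complex_of_real (r x) + \<i> * complex_of_real (s x)"] ballI)
qed

text \<open>The space is arbitrary, but \<open>F\<close> separates the points of \<open>K\<close>.
  Evaluation at the members of \<open>F\<close> thus embeds \<open>K\<close> in a Hausdorff power of
  the complex numbers, homeomorphically by compactness, and the statement is transported along this
  embedding.\<close>

lemma Stone_Weierstrass_complex:
  fixes K :: "'x::topological_space set" and F :: "('x \<Rightarrow> complex) set"
  assumes K: "compact K" and cont: "\<And>g. g \<in> F \<Longrightarrow> continuous_on K g"
    and add: "\<And>g h. g \<in> F \<Longrightarrow> h \<in> F \<Longrightarrow> (\<lambda>x. g x + h x) \<in> F"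
    and mult: "\<And>g h. g \<in> F \<Longrightarrow> h \<in> F \<Longrightarrow> (\<lambda>x. g x * h x) \<in> F"
    and conj: "\<And>g. g \<in> F \<Longrightarrow> (\<lambda>x. cnj (g x)) \<in> F"
    and const: "\<And>c. (\<lambda>_. c) \<in> F"
    and sep: "\<And>x y. x \<in> K \<Longrightarrow> y \<in> K \<Longrightarrow> x \<noteq> y \<Longrightarrow> \<exists>g\<in>F. g x \<noteq> g y"
    and f: "continuous_on K f" and "0 < e"
  shows "\<exists>g\<in>F. \<forall>x\<in>K. norm (f x - g x) < e"
proof -
  \<comment> \<open>The coordinates are indexed by \<open>F\<close> itself, so injectivity of
    \<open>j\<close> on \<open>K\<close> is separation of points by \<open>F\<close>.\<close>
  define j where "j x = Abs_complex_power (\<lambda>g\<in>F. g x)" for x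
  define G where "G = {h. continuous_on (j ` K) h \<and> (\<exists>g\<in>F. \<forall>x\<in>K. h (j x) = g x)}"
  have j_eq: "Rep_complex_power (j x) g = g x" if "g \<in> F" for x g
    using that by (simp add: j_def Abs_complex_power_inverse)
  have "continuous_on K (\<lambda>x. \<lambda>g\<in>F. g x)"
  proof (rule continuous_on_coordinatewise_then_product)
    show "continuous_on K (\<lambda>x. (\<lambda>g\<in>F. g x) g)" for g by (cases "g \<in> F") (auto intro: cont)
  qed
  from continuous_on_compose2[OF continuous_on_Abs_complex_power[of UNIV] this]
  have j_cont: "continuous_on K j" by (simp add: j_def[abs_def])
  have j_inj: "inj_on j K"
    by (rule inj_onI) (metis sep j_eq)
  have coord: "continuous_on (j ` K) (\<lambda>z. Rep_complex_power z g)" for g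
    by (rule continuous_on_subset[of UNIV])
      (auto simp: continuous_on_open_vimage open_complex_power_def vimage_def Abs_complex_power_inverse
        intro: continuous_on_coordinate[of UNIV g, unfolded continuous_on_open_vimage[OF open_UNIV], simplified, rule_format, unfolded vimage_def])
  have inv: "the_inv_into K j (j x) = x" if "x \<in> K" for x
    using that j_inj by (rule the_inv_into_f_f[rotated])
  have "continuous_on (j ` K) (the_inv_into K j)"
    using j_cont K inv by (intro continuous_on_inv) auto
  then have comp: "continuous_on (j ` K) (\<lambda>z. g (the_inv_into K j z))" if "continuous_on K g" for g :: "'x \<Rightarrow> complex"
    by (rule continuous_on_compose2[OF that]) (use inv in auto)
  have "\<exists>h\<in>G. \<forall>z\<in>j ` K. norm (f (the_inv_into K j z) - h z) < e"
  proof (rule Stone_Weierstrass_complex_t2)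
    show "compact (j ` K)" by (rule compact_continuous_image[OF j_cont K])
    show "\<exists>h\<in>G. h x \<noteq> h y" if xy: "x \<in> j ` K" "y \<in> j ` K" "x \<noteq> y" for x y
    proof -
      obtain a b where ab: "a \<in> K" "b \<in> K" "x = j a" "y = j b" using xy by blast
      then obtain g where g: "g \<in> F" "g a \<noteq> g b" using sep xy(3) by blast
      then show ?thesis
        using ab inv comp[OF cont[OF g(1)]] by (intro bexI[of _ "\<lambda>z. g (the_inv_into K j z)"]) (auto simp: G_def)
    qed
    show "(\<lambda>x. g x + h x) \<in> G" "(\<lambda>x. g x * h x) \<in> G" if gh: "g \<in> G" "h \<in> G" for g h
    proof -
      obtain g' h' where "g' \<in> F" "\<forall>x\<in>K. g (j x) = g' x" "h' \<in> F" "\<forall>x\<in>K. h (j x) = h' x"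
        using gh by (auto simp: G_def)
      then show "(\<lambda>x. g x + h x) \<in> G" "(\<lambda>x. g x * h x) \<in> G"
        using gh bexI[OF _ add[of g' h']] bexI[OF _ mult[of g' h']]
        by (auto simp: G_def intro!: continuous_on_add continuous_on_mult)
    qed
    show "(\<lambda>x. cnj (g x)) \<in> G" if "g \<in> G" for g
      using that conj by (force simp: G_def intro: continuous_intros)
    show "(\<lambda>_. c) \<in> G" for c
      using const[of c] by (auto simp: G_def)
  qed (use \<open>0 < e\<close> comp[OF f] in \<open>auto simp: G_def\<close>)
  then obtain h where h: "h \<in> G" "\<forall>z\<in>j ` K. norm (f (the_inv_into K j z) - h z) < e" by blast
  then obtain g where g: "g \<in> F" "\<forall>x\<in>K. h (j x) = g x" by (auto simp: G_def)
  have "norm (f x - g x) < e" if "x \<in> K" for x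
    using h(2) g(2) inv that by force
  then show ?thesis using g(1) by blast
qed

text \<open>Pointwise limits exist by completeness of the complex numbers; letting \<open>g\<close>
  tend to the limit in \<open>norm (f x - g x)\<close> makes the convergence uniform on each
  \<open>K\<close>. Filters are used because the topologies need not be metrizable.\<close>

lemma uniform_Cauchy_filter_limit:
  fixes F :: "('x \<Rightarrow> complex) filter"
  assumes "F \<noteq> bot" and Cauchy: "\<And>K e. K \<in> \<K> \<Longrightarrow> 0 < e \<Longrightarrow>
    \<exists>M. eventually (\<lambda>f. f \<in> M) F \<and> (\<forall>f\<in>M. \<forall>g\<in>M. \<forall>x\<in>K. norm (f x - g x) < e)"
  obtains l where "l \<in> extensional (\<Union>\<K>)"
    "\<And>K e. K \<in> \<K> \<Longrightarrow> 0 < e \<Longrightarrow> eventually (\<lambda>f. \<forall>x\<in>K. norm (f x - l x) < e) F"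
proof -
  have ex: "\<exists>c. ((\<lambda>f. f x) \<longlongrightarrow> c) F" if x: "x \<in> \<Union>\<K>" for x
  proof -
    obtain K where K: "K \<in> \<K>" "x \<in> K" using x by blast
    have "Topological_Spaces.cauchy_filter (filtermap (\<lambda>f. f x) F)"
      unfolding cauchy_filter_metric_filtermap
    proof (intro allI impI)
      fix e :: real assume "0 < e"
      then obtain M where M: "eventually (\<lambda>f. f \<in> M) F" "\<forall>f\<in>M. \<forall>g\<in>M. \<forall>x\<in>K. norm (f x - g x) < e"
        using Cauchy[OF K(1)] by blast
      then show "\<exists>P. eventually P F \<and> (\<forall>f g. P f \<and> P g \<longrightarrow> dist (f x) (g x) < e)"
        using K(2) by (intro exI[of _ "\<lambda>f. f \<in> M"]) (auto simp: dist_norm)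
    qed
    moreover have "filtermap (\<lambda>f. f x) F \<noteq> bot" using \<open>F \<noteq> bot\<close> by (simp add: filtermap_bot_iff)
    ultimately show ?thesis
      using complete_UNIV[where 'a=complex] unfolding complete_uniform filterlim_def by auto
  qed
  define l where "l = (\<lambda>x\<in>\<Union>\<K>. SOME c. ((\<lambda>f. f x) \<longlongrightarrow> c) F)"
  have lim: "((\<lambda>f. f x) \<longlongrightarrow> l x) F" if "x \<in> \<Union>\<K>" for x
    using someI_ex[OF ex[OF that]] that unfolding l_def by (simp only: restrict_apply if_True)
  show thesis
  proof
    show "l \<in> extensional (\<Union>\<K>)" by (simp add: l_def)
    fix K and e :: real assume K: "K \<in> \<K>" and "0 < e"
    then obtain M where M: "eventually (\<lambda>f. f \<in> M) F" "\<forall>f\<in>M. \<forall>g\<in>M. \<forall>x\<in>K. norm (f x - g x) < e / 2"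
      using Cauchy[OF K, of "e / 2"] by auto
    have "norm (f x - l x) < e" if f: "f \<in> M" and x: "x \<in> K" for f x
    proof -
      have "((\<lambda>g. norm (f x - g x)) \<longlongrightarrow> norm (f x - l x)) F"
        using x K by (intro tendsto_intros lim) auto
      moreover have "eventually (\<lambda>g. norm (f x - g x) \<le> e / 2) F"
        using M(1) by eventually_elim (use M(2) f x in \<open>auto intro: less_imp_le\<close>)
      ultimately have "norm (f x - l x) \<le> e / 2" using \<open>F \<noteq> bot\<close> by (intro tendsto_upperbound)
      then show ?thesis using \<open>0 < e\<close> by simp
    qed
    with M(1) show "eventually (\<lambda>f. \<forall>x\<in>K. norm (f x - l x) < e) F"
      by (auto elim: eventually_mono)
  qed
qed

lemma eventually_directed_principal:
  assumes "B \<noteq> {}" and directed: "\<And>a b. a \<in> B \<Longrightarrow> b \<in> B \<Longrightarrow> \<exists>c\<in>B. S c \<subseteq> S a \<inter> S b"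
  shows "eventually P (INF b\<in>B. principal (S b)) \<longleftrightarrow> (\<exists>b\<in>B. \<forall>x\<in>S b. P x)"
  by (subst eventually_INF_base) (use assms in \<open>auto simp: eventually_principal\<close>)

text \<open>All axioms are equations between elements, apart from additive inverses, which are
  \<open>(-1) \<odot> x\<close>. A point-separating family of maps that respect the operations turns
  each equation into one between complex numbers.\<close>

lemma involutive_algebra_by_characters:
  fixes A :: "('a, 'm) kalg_scheme" (structure) and \<Xi> :: "('a \<Rightarrow> complex) set"
  assumes closed: "\<zero> \<in> carrier A" "\<one> \<in> carrier A"
      "\<And>x y. x \<in> carrier A \<Longrightarrow> y \<in> carrier A \<Longrightarrow> x \<oplus> y \<in> carrier A"
      "\<And>x y. x \<in> carrier A \<Longrightarrow> y \<in> carrier A \<Longrightarrow> x \<otimes> y \<in> carrier A"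
      "\<And>c x. x \<in> carrier A \<Longrightarrow> c \<odot> x \<in> carrier A"
      "\<And>x. x \<in> carrier A \<Longrightarrow> invol A x \<in> carrier A"
    and char: "\<And>\<xi>. \<xi> \<in> \<Xi> \<Longrightarrow> \<xi> \<zero> = 0" "\<And>\<xi>. \<xi> \<in> \<Xi> \<Longrightarrow> \<xi> \<one> = 1"
      "\<And>\<xi> x y. \<xi> \<in> \<Xi> \<Longrightarrow> x \<in> carrier A \<Longrightarrow> y \<in> carrier A \<Longrightarrow> \<xi> (x \<oplus> y) = \<xi> x + \<xi> y"
      "\<And>\<xi> x y. \<xi> \<in> \<Xi> \<Longrightarrow> x \<in> carrier A \<Longrightarrow> y \<in> carrier A \<Longrightarrow> \<xi> (x \<otimes> y) = \<xi> x * \<xi> y"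
      "\<And>\<xi> c x. \<xi> \<in> \<Xi> \<Longrightarrow> x \<in> carrier A \<Longrightarrow> \<xi> (c \<odot> x) = c * \<xi> x"
      "\<And>\<xi> x. \<xi> \<in> \<Xi> \<Longrightarrow> x \<in> carrier A \<Longrightarrow> \<xi> (invol A x) = cnj (\<xi> x)"
    and sep: "\<And>x y. x \<in> carrier A \<Longrightarrow> y \<in> carrier A \<Longrightarrow> (\<And>\<xi>. \<xi> \<in> \<Xi> \<Longrightarrow> \<xi> x = \<xi> y) \<Longrightarrow> x = y"
  shows "involutive_algebra A"
proof -
  have group: "abelian_group A"
  proof (rule abelian_groupI)
    show "\<exists>y\<in>carrier A. y \<oplus> x = \<zero>" if "x \<in> carrier A" for x
      using that closed by (intro bexI[of _ "(-1) \<odot> x"] sep) (auto simp: char)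
  qed (auto intro!: sep simp: closed char)
  have monoid: "comm_monoid A"
    by (rule comm_monoidI) (auto intro!: sep simp: closed char)
  have cring: "cring A"
    by (rule cringI[OF group monoid]) (auto intro!: sep simp: closed char distrib_right)
  have "algebra complex_ring A"
    by (rule algebraI[OF cring_from_type_algebra cring])
      (auto intro!: sep simp: closed char algebra_simps)
  then show ?thesis
    by (rule involutive_algebra.intro)
      (unfold_locales, auto intro!: sep simp: closed char algebra_simps)
qed

lemma sup_seminorm_upper:
  assumes "\<And>x. x \<in> K \<Longrightarrow> norm (f x) \<le> c" "x \<in> K"
  shows "norm (f x) \<le> sup_seminorm K f"
proof -
  have "bdd_above (insert 0 ((\<lambda>x. norm (f x)) ` K))"
    using assms(1) by (intro bdd_aboveI[of _ "max 0 c"]) (auto simp: le_max_iff_disj)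
  then show ?thesis unfolding sup_seminorm_def using assms(2) by (intro cSup_upper) auto
qed

lemma sup_seminorm_nonneg:
  assumes "\<And>x. x \<in> K \<Longrightarrow> norm (f x) \<le> c"
  shows "0 \<le> sup_seminorm K f"
proof -
  have "bdd_above (insert 0 ((\<lambda>x. norm (f x)) ` K))"
    using assms(1) by (intro bdd_aboveI[of _ "max 0 c"]) (auto simp: le_max_iff_disj)
  then show ?thesis unfolding sup_seminorm_def by (intro cSup_upper) auto
qed

lemma sup_seminorm_least:
  assumes "0 \<le> c" "\<And>x. x \<in> K \<Longrightarrow> norm (f x) \<le> c"
  shows "sup_seminorm K f \<le> c"
  unfolding sup_seminorm_def using assms by (intro cSup_least) auto

lemma sup_seminorm_cong: "(\<And>x. x \<in> K \<Longrightarrow> f x = g x) \<Longrightarrow> sup_seminorm K f = sup_seminorm K g"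
  unfolding sup_seminorm_def by (metis (no_types, lifting) image_cong)

text \<open>\<open>ev k x\<close> stands for the value of \<open>x\<close> at \<open>k\<close>,
  where \<open>k\<close> may be a character of the algebra or a point at which its elements are
  functions. Multiplicativity is asked only for the products in the C*-identity.\<close>

lemma cstar_seminorm_sup:
  fixes A :: "('a, 'm) kalg_scheme" (structure)
  assumes A: "involutive_algebra A" and bdd: "\<And>x. x \<in> carrier A \<Longrightarrow> \<exists>c. \<forall>k\<in>K. norm (ev k x) \<le> c"
    and add: "\<And>k x y. k \<in> K \<Longrightarrow> x \<in> carrier A \<Longrightarrow> y \<in> carrier A \<Longrightarrow> ev k (x \<oplus> y) = ev k x + ev k y"
    and smult: "\<And>k c x. k \<in> K \<Longrightarrow> x \<in> carrier A \<Longrightarrow> ev k (c \<odot> x) = c * ev k x"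
    and mult: "\<And>k x. k \<in> K \<Longrightarrow> x \<in> carrier A \<Longrightarrow> ev k (x \<otimes> invol A x) = ev k x * cnj (ev k x)"
  shows "cstar_seminorm A (\<lambda>x. sup_seminorm K (\<lambda>k. ev k x))"
proof -
  interpret involutive_algebra A by fact
  let ?s = "\<lambda>x. sup_seminorm K (\<lambda>k. ev k x)"
  have upper: "norm (ev k x) \<le> ?s x" if "k \<in> K" "x \<in> carrier A" for k x
    using bdd[OF that(2)] that(1) by (auto intro: sup_seminorm_upper)
  have nonneg: "0 \<le> ?s x" if "x \<in> carrier A" for x
    using bdd[OF that] by (auto intro: sup_seminorm_nonneg)
  have le_scaled: "?s (c \<odot> x) \<le> norm c * ?s x" if "x \<in> carrier A" for c x
    using upper[OF _ that] nonneg[OF that] that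
    by (intro sup_seminorm_least) (auto simp: smult norm_mult mult_left_mono)
  show ?thesis
    unfolding cstar_seminorm_def
  proof (intro conjI ballI allI)
    fix x y assume xy: "x \<in> carrier A" "y \<in> carrier A"
    show "?s (x \<oplus> y) \<le> ?s x + ?s y"
    proof (rule sup_seminorm_least)
      fix k assume k: "k \<in> K"
      have "norm (ev k (x \<oplus> y)) \<le> norm (ev k x) + norm (ev k y)"
        using k xy by (simp add: add norm_triangle_ineq)
      then show "norm (ev k (x \<oplus> y)) \<le> ?s x + ?s y"
        using upper[OF k xy(1)] upper[OF k xy(2)] by linarith
    qed (use nonneg xy in simp)
  next
    fix c x assume x: "x \<in> carrier A"
    show "?s (c \<odot> x) = norm c * ?s x"
    proof (cases "c = 0")
      case True
      then show ?thesis using le_scaled[OF x, of c] nonneg[of "c \<odot> x"] x by simp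
    next
      case False
      have "?s x \<le> norm (1 / c) * ?s (c \<odot> x)"
        using le_scaled[of "c \<odot> x" "1 / c"] x False by (simp add: smult_smult)
      then show ?thesis using le_scaled[OF x, of c] False by (simp add: norm_divide field_simps)
    qed
  next
    fix x assume x: "x \<in> carrier A"
    show "?s (x \<otimes> invol A x) = (?s x)\<^sup>2"
    proof (rule antisym)
      show "?s (x \<otimes> invol A x) \<le> (?s x)\<^sup>2"
      proof (rule sup_seminorm_least)
        fix k assume k: "k \<in> K"
        have "norm (ev k (x \<otimes> invol A x)) = (norm (ev k x))\<^sup>2"
          using k x by (simp add: mult norm_mult power2_eq_square)
        also have "\<dots> \<le> (?s x)\<^sup>2" using upper[OF k x] by (intro power_mono) auto
        finally show "norm (ev k (x \<otimes> invol A x)) \<le> (?s x)\<^sup>2" .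
      qed simp
      have "?s x \<le> sqrt (?s (x \<otimes> invol A x))"
      proof (rule sup_seminorm_least)
        fix k assume k: "k \<in> K"
        have "(norm (ev k x))\<^sup>2 \<le> ?s (x \<otimes> invol A x)"
          using upper[OF k, of "x \<otimes> invol A x"] k x by (simp add: mult norm_mult power2_eq_square)
        then show "norm (ev k x) \<le> sqrt (?s (x \<otimes> invol A x))" by (rule real_le_rsqrt)
      qed (use nonneg x in simp)
      then have "(?s x)\<^sup>2 \<le> (sqrt (?s (x \<otimes> invol A x)))\<^sup>2"
        using nonneg[OF x] by (intro power_mono)
      then show "(?s x)\<^sup>2 \<le> ?s (x \<otimes> invol A x)" using nonneg[of "x \<otimes> invol A x"] x by simp
    qed
  qed (rule nonneg)
qed

text \<open>Coordinates outside \<open>I\<close> are constantly \<open>undefined\<close> on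
  extensional functions and do not change the topology. Hence \<open>compact\<close> and
  \<open>continuous_on\<close> for the function type can be used for sets of characters.\<close>

lemma subtopology_product_eq_top_of_set:
  fixes K :: "('i \<Rightarrow> 'b::topological_space) set"
  assumes "K \<subseteq> extensional I"
  shows "subtopology (product_topology (\<lambda>_. euclidean) I) K = top_of_set K" (is "?S = ?T")
proof -
  have top: "topspace ?S = topspace ?T" using assms by (auto simp: PiE_def)
  have coord: "continuous_map ?T euclidean (\<lambda>f. f i)" for i :: 'i
    by (simp add: continuous_on_coordinate)
  have "continuous_map ?T (product_topology (\<lambda>_. euclidean) I) id"
    using assms coord by (auto simp: continuous_map_componentwise)
  then have 1: "continuous_map ?T ?S id"
    by (simp add: continuous_map_in_subtopology)
  have "continuous_map ?S euclidean (\<lambda>f. f i)" for i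
  proof (cases "i \<in> I")
    case True
    then show ?thesis
      by (intro continuous_map_from_subtopology continuous_map_product_projection)
  next
    case False
    have "continuous_map ?S euclidean (\<lambda>_. undefined)" by simp
    then show ?thesis
      by (rule continuous_map_eq) (use False assms in \<open>auto simp: extensional_def\<close>)
  qed
  then have "continuous_map ?S (product_topology (\<lambda>_. euclidean) UNIV) id"
    by (auto simp: continuous_map_componentwise)
  then have 2: "continuous_map ?S ?T id"
    using top by (auto simp: euclidean_product_topology continuous_map_in_subtopology)
  show ?thesis
    using topology_finer_continuous_id[OF top] topology_finer_continuous_id[OF top[symmetric]] 1 2
    by (auto simp: topology_eq)
qed

section \<open>Compact sets of hermitian characters\<close>

context involutive_algebra
begin

lemma X_p_extensional: "X_p A p \<subseteq> extensional (carrier A)"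
  by (auto simp: X_p_def hermitian_character_iff)

text \<open>Banach-Alaoglu: the bound by \<open>p\<close> describes a product of discs, compact by
  Tychonoff, and the algebraic identities of a character cut out a closed subset.\<close>

lemma compact_X_p:
  assumes p: "cstar_seminorm A p"
  shows "compact (X_p A p)"
proof -
  \<comment> \<open>Off the carrier an extensional function takes the default value, hence a
    one-point factor there.\<close>
  define S where "S x = (if x \<in> carrier A then cball 0 (p x) else {undefined :: complex})" for x
  have "compactin (product_topology (\<lambda>_. euclidean) UNIV) (PiE UNIV S)"
    unfolding compactin_PiE by (auto simp: S_def)
  then have box: "compact (PiE UNIV S)"
    by (simp add: euclidean_product_topology)
  have eq: "X_p A p = PiE UNIV S \<inter> ({\<xi>. \<xi> \<one> = 1} \<inter>
      (\<Inter>x\<in>carrier A. \<Inter>y\<in>carrier A. {\<xi>. \<xi> (x \<oplus> y) = \<xi> x + \<xi> y}) \<inter>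
      (\<Inter>x\<in>carrier A. \<Inter>y\<in>carrier A. {\<xi>. \<xi> (x \<otimes> y) = \<xi> x * \<xi> y}) \<inter>
      (\<Inter>c. \<Inter>x\<in>carrier A. {\<xi>. \<xi> (c \<odot> x) = c * \<xi> x}) \<inter>
      (\<Inter>x\<in>carrier A. {\<xi>. \<xi> (invol A x) = cnj (\<xi> x)}))" (is "_ = _ \<inter> ?C")
    by (auto simp: X_p_iff[OF p] hermitian_character_iff S_def PiE_iff extensional_def split: if_splits)
  have "closed ?C"
    by (intro closed_Int closed_INT ballI closed_Collect_eq continuous_intros)
  then show ?thesis unfolding eq by (rule compact_Int_closed[OF box])
qed

text \<open>If \<open>\<xi>\<close> is not in \<open>H\<close>, then finitely many elements \<open>(a - \<xi>(a))\<^sup>*(a - \<xi>(a))\<close> sum up to some \<open>b\<close> with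
  \<open>\<xi>(b) = 0\<close> and \<open>b > 0\<close> on \<open>H\<close>; then \<open>M - b\<close> violates the bound, where \<open>M\<close> is the norm of \<open>b\<close> on \<open>H\<close>.\<close>

lemma mem_of_character_le_sup:
  assumes H: "compact H" "H \<subseteq> hermitian_hom A complex_kalg"
    and \<xi>: "\<xi> \<in> hermitian_hom A complex_kalg"
    and le: "\<And>a. a \<in> carrier A \<Longrightarrow> norm (\<xi> a) \<le> sup_seminorm H (\<lambda>\<eta>. \<eta> a)"
  shows "\<xi> \<in> H"
proof (rule ccontr)
  assume "\<xi> \<notin> H"
  have cont: "continuous_on S (\<lambda>\<eta>. \<eta> a)" for a :: 'a and S :: "('a \<Rightarrow> complex) set"
    by (rule continuous_on_coordinate)
  have char: "\<eta> (x \<otimes> y) = \<eta> x * \<eta> y" "\<eta> (x \<oplus> y) = \<eta> x + \<eta> y" "\<eta> (invol A x) = cnj (\<eta> x)"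
      "\<eta> (x \<ominus> y) = \<eta> x - \<eta> y" "\<eta> (const c) = c"
    if "\<eta> \<in> hermitian_hom A complex_kalg" "x \<in> carrier A" "y \<in> carrier A" for \<eta> x y c
    using that character_diff by (auto simp: hermitian_character_iff const_def)
  have "\<exists>b\<in>carrier A. \<xi> b = 0 \<and> (\<forall>\<eta>\<in>hermitian_hom A complex_kalg. \<exists>r\<ge>0. \<eta> b = of_real r) \<and> \<eta> b \<noteq> 0"
    if \<eta>: "\<eta> \<in> H" for \<eta>
  proof -
    have herm: "\<eta> \<in> hermitian_hom A complex_kalg" using \<eta> H by blast
    have "\<eta> \<noteq> \<xi>" using \<eta> \<open>\<xi> \<notin> H\<close> by blast
    then obtain a where a: "a \<in> carrier A" "\<eta> a \<noteq> \<xi> a"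
      using herm \<xi> extensionalityI[of \<eta> "carrier A" \<xi>] by (auto simp: hermitian_character_iff)
    define d where "d = a \<ominus> const (\<xi> a)"
    have d: "d \<in> carrier A" using a by (simp add: d_def)
    have sq: "\<zeta> (d \<otimes> invol A d) = of_real ((norm (\<zeta> d))\<^sup>2)" if "\<zeta> \<in> hermitian_hom A complex_kalg" for \<zeta>
      using that d by (simp add: char complex_norm_square del: of_real_power)
    show ?thesis
    proof (intro bexI[of _ "d \<otimes> invol A d"] conjI ballI)
      show "\<exists>r\<ge>0. \<zeta> (d \<otimes> invol A d) = of_real r" if "\<zeta> \<in> hermitian_hom A complex_kalg" for \<zeta>
        using sq[OF that] by (intro exI[of _ "(norm (\<zeta> d))\<^sup>2"]) simp
      show "\<xi> (d \<otimes> invol A d) = 0" "\<eta> (d \<otimes> invol A d) \<noteq> 0"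
        using sq[OF \<xi>] sq[OF herm] a by (simp_all add: d_def char[OF \<xi>] char[OF herm])
    qed (use d in simp)
  qed
  then have "\<forall>\<eta>\<in>H. \<exists>b. b \<in> carrier A \<and> \<xi> b = 0 \<and>
      (\<forall>\<eta>\<in>hermitian_hom A complex_kalg. \<exists>r\<ge>0. \<eta> b = of_real r) \<and> \<eta> b \<noteq> 0" by blast
  from bchoice[OF this] obtain g where "\<forall>\<eta>\<in>H. g \<eta> \<in> carrier A \<and> \<xi> (g \<eta>) = 0 \<and>
      (\<forall>\<zeta>\<in>hermitian_hom A complex_kalg. \<exists>r\<ge>0. \<zeta> (g \<eta>) = of_real r) \<and> \<eta> (g \<eta>) \<noteq> 0" ..
  then have g: "\<And>\<eta>. \<eta> \<in> H \<Longrightarrow> g \<eta> \<in> carrier A" "\<And>\<eta>. \<eta> \<in> H \<Longrightarrow> \<xi> (g \<eta>) = 0"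
    "\<And>\<eta> \<zeta>. \<eta> \<in> H \<Longrightarrow> \<zeta> \<in> hermitian_hom A complex_kalg \<Longrightarrow> \<exists>r\<ge>0. \<zeta> (g \<eta>) = of_real r"
    "\<And>\<eta>. \<eta> \<in> H \<Longrightarrow> \<eta> (g \<eta>) \<noteq> 0"
    by simp_all
  define U where "U \<eta> = (\<lambda>\<zeta> :: 'a \<Rightarrow> complex. \<zeta> (g \<eta>)) -` (- {0})" for \<eta>
  have "open (U \<eta>)" if "\<eta> \<in> H" for \<eta>
    unfolding U_def by (intro open_vimage cont) auto
  moreover have "H \<subseteq> (\<Union>\<eta>\<in>H. U \<eta>)" using g(4) by (auto simp: U_def)
  ultimately obtain D where D: "D \<subseteq> H" "finite D" "H \<subseteq> (\<Union>\<eta>\<in>D. U \<eta>)"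
    by (rule compactE_image[OF H(1)])
  \<comment> \<open>Nonnegativity at every hermitian character is carried through the induction, so
    that a further summand cannot destroy positivity already gained.\<close>
  have "\<exists>b\<in>carrier A. \<xi> b = 0 \<and> (\<forall>\<zeta>\<in>hermitian_hom A complex_kalg. \<exists>r\<ge>0. \<zeta> b = of_real r \<and>
      (\<forall>\<eta>\<in>D. \<zeta> \<in> U \<eta> \<longrightarrow> r > 0))"
    using D(2,1)
  proof (induction D)
    case empty
    have "\<xi> \<zero> = 0" if "\<xi> \<in> hermitian_hom A complex_kalg" for \<xi>
      using char(5)[OF that, of \<zero> \<zero> 0] by (simp add: const_0)
    then show ?case using \<xi> by (intro bexI[of _ \<zero>]) auto
  next
    case (insert \<eta> D)
    then obtain b where b: "b \<in> carrier A" "\<xi> b = 0"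
      "\<And>\<zeta>. \<zeta> \<in> hermitian_hom A complex_kalg \<Longrightarrow> \<exists>r\<ge>0. \<zeta> b = of_real r \<and> (\<forall>\<eta>\<in>D. \<zeta> \<in> U \<eta> \<longrightarrow> r > 0)"
      by auto
    have \<eta>: "\<eta> \<in> H" using insert by simp
    have "\<exists>r\<ge>0. \<zeta> (b \<oplus> g \<eta>) = of_real r \<and> (\<forall>\<eta>\<in>insert \<eta> D. \<zeta> \<in> U \<eta> \<longrightarrow> r > 0)"
      if \<zeta>: "\<zeta> \<in> hermitian_hom A complex_kalg" for \<zeta>
    proof -
      obtain r where r: "r \<ge> 0" "\<zeta> b = of_real r" "\<forall>\<eta>\<in>D. \<zeta> \<in> U \<eta> \<longrightarrow> r > 0"
        using b(3)[OF \<zeta>] by blast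
      obtain s where s: "s \<ge> 0" "\<zeta> (g \<eta>) = of_real s" using g(3)[OF \<eta> \<zeta>] by blast
      have "s > 0" if "\<zeta> \<in> U \<eta>" using that s by (auto simp: U_def less_le)
      then show ?thesis
        using r s \<zeta> b(1) g(1)[OF \<eta>] by (intro exI[of _ "r + s"]) (auto simp: char add_pos_nonneg add_nonneg_pos)
    qed
    then show ?case using b g(1,2)[OF \<eta>] \<xi> by (intro bexI[of _ "b \<oplus> g \<eta>"]) (auto simp: char)
  qed
  then obtain b where b: "b \<in> carrier A" "\<xi> b = 0"
    "\<forall>\<zeta>\<in>hermitian_hom A complex_kalg. \<exists>r\<ge>0. \<zeta> b = of_real r \<and> (\<forall>\<eta>\<in>D. \<zeta> \<in> U \<eta> \<longrightarrow> r > 0)"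
    by blast
  have pos: "\<exists>r>0. \<zeta> b = of_real r" if \<zeta>: "\<zeta> \<in> H" for \<zeta>
  proof -
    obtain \<eta> where "\<eta> \<in> D" "\<zeta> \<in> U \<eta>" using D(3) \<zeta> by blast
    moreover obtain r where "\<zeta> b = of_real r" "\<forall>\<eta>\<in>D. \<zeta> \<in> U \<eta> \<longrightarrow> r > 0"
      using b(3) H(2) \<zeta> by blast
    ultimately show ?thesis by blast
  qed
  show False
  proof (cases "H = {}")
    \<comment> \<open>For empty \<open>H\<close> the assumed bound at the unit reads 1 at most
      0.\<close>
    case True
    then show False using le[of \<one>] \<xi> by (simp add: sup_seminorm_def hermitian_character_iff)
  next
    case False
    have Re: "continuous_on H (\<lambda>\<eta>. Re (\<eta> b))" by (intro continuous_on_Re cont)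
    obtain \<eta>0 where \<eta>0: "\<eta>0 \<in> H" "\<And>\<eta>. \<eta> \<in> H \<Longrightarrow> Re (\<eta>0 b) \<le> Re (\<eta> b)"
      using continuous_attains_inf[OF H(1) False Re] by blast
    obtain \<eta>1 where \<eta>1: "\<eta>1 \<in> H" "\<And>\<eta>. \<eta> \<in> H \<Longrightarrow> Re (\<eta> b) \<le> Re (\<eta>1 b)"
      using continuous_attains_sup[OF H(1) False Re] by blast
    define M where "M = Re (\<eta>1 b)"
    define m where "m = Re (\<eta>0 b)"
    have m: "m > 0" "m \<le> M" using pos[OF \<eta>0(1)] \<eta>0(1) \<eta>1(2) by (auto simp: m_def M_def)
    have "M = norm (\<xi> (const M \<ominus> b))"
      using \<xi> b(1,2) m by (simp add: char)
    also have "\<dots> \<le> sup_seminorm H (\<lambda>\<eta>. \<eta> (const M \<ominus> b))"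
      using b(1) by (intro le) simp
    also have "\<dots> \<le> M - m"
    proof (rule sup_seminorm_least)
      fix \<eta> assume \<eta>: "\<eta> \<in> H"
      then obtain r where r: "\<eta> b = of_real r" using pos by blast
      have "m \<le> r" "r \<le> M" using \<eta>0(2)[OF \<eta>] \<eta>1(2)[OF \<eta>] r by (auto simp: m_def M_def)
      moreover have "\<eta> (const M \<ominus> b) = of_real (M - r)" using \<eta> H(2) b(1) r by (simp add: char subset_eq)
      ultimately show "norm (\<eta> (const M \<ominus> b)) \<le> M - m" by (simp only: norm_of_real)
    qed (use m in simp)
    finally show False using m by simp
  qed
qed

end

section \<open>Gelfand duality\<close>

lemma characterD:
  assumes "\<xi> \<in> hermitian_hom A complex_kalg"
  shows "\<xi> \<in> extensional (carrier A)" "\<xi> \<one>\<^bsub>A\<^esub> = 1"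
    "\<And>x y. x \<in> carrier A \<Longrightarrow> y \<in> carrier A \<Longrightarrow> \<xi> (x \<oplus>\<^bsub>A\<^esub> y) = \<xi> x + \<xi> y"
    "\<And>x y. x \<in> carrier A \<Longrightarrow> y \<in> carrier A \<Longrightarrow> \<xi> (x \<otimes>\<^bsub>A\<^esub> y) = \<xi> x * \<xi> y"
    "\<And>c x. x \<in> carrier A \<Longrightarrow> \<xi> (c \<odot>\<^bsub>A\<^esub> x) = c * \<xi> x"
    "\<And>x. x \<in> carrier A \<Longrightarrow> \<xi> (invol A x) = cnj (\<xi> x)"
  using assms by (auto simp: hermitian_character_iff)

context compactological_space
begin

lemma hom_complex_iff:
  "f \<in> compactological_hom S complex_space \<longleftrightarrow>
     f \<in> extensional (points S) \<and> (\<forall>K\<in>compacta S. continuous_map (ktop S K) euclidean f)" (is "?L \<longleftrightarrow> ?R")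
proof
  assume L: ?L
  show ?R
  proof (intro conjI ballI)
    show "f \<in> extensional (points S)" using L by (auto simp: compactological_hom_def PiE_def)
    fix K assume "K \<in> compacta S"
    then obtain L where "continuous_map (ktop S K) (top_of_set L) f"
      using L by (auto simp: compactological_hom_def complex_space_def)
    then show "continuous_map (ktop S K) euclidean f" by (simp add: continuous_map_in_subtopology)
  qed
next
  assume R: ?R
  have "\<exists>L. compact L \<and> f ` K \<subseteq> L \<and> continuous_map (ktop S K) (top_of_set L) f" if K: "K \<in> compacta S" for K
  proof (intro exI conjI)
    have cont: "continuous_map (ktop S K) euclidean f" using R K by blast
    have "compactin euclidean (f ` topspace (ktop S K))"
      using image_compactin[OF _ cont] ktop_compact[OF K] by (simp add: compact_space_def)
    then show "compact (f ` K)" using ktop_topspace[OF K] by simp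
    show "continuous_map (ktop S K) (top_of_set (f ` K)) f"
      using cont ktop_topspace[OF K] by (simp add: continuous_map_in_subtopology)
  qed simp
  then show ?L using R by (auto simp: compactological_hom_def complex_space_def PiE_def)
qed

text \<open>The axioms provide just a continuous inclusion. As a continuous bijection from the
  compact \<open>K\<close> onto its image in the Hausdorff space on \<open>L\<close>, it is a
  homeomorphism.\<close>

lemma ktop_subset:
  assumes K: "K \<in> compacta S" and L: "L \<in> compacta S" and sub: "K \<subseteq> L"
  shows "ktop S K = subtopology (ktop S L) K"
proof -
  have "homeomorphic_map (ktop S K) (subtopology (ktop S L) K) id"
  proof (rule continuous_imp_homeomorphic_map)
    show "compact_space (ktop S K)" by (rule ktop_compact[OF K])
    show "Hausdorff_space (subtopology (ktop S L) K)"
      by (rule Hausdorff_space_subtopology[OF ktop_Hausdorff[OF L]])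
    show "continuous_map (ktop S K) (subtopology (ktop S L) K) id"
      using ktop_inclusion[OF K L sub] ktop_topspace[OF K] by (simp add: continuous_map_in_subtopology id_def)
  qed (use ktop_topspace[OF K] ktop_topspace[OF L] sub in auto)
  then show ?thesis by simp
qed

lemma closedin_in_compacta:
  assumes "L \<in> compacta S" "closedin (ktop S L) H" shows "H \<in> compacta S"
  using compacta_closure[OF assms(1), of H] closedin_subset[OF assms(2)] assms
  by (simp add: ktop_topspace closure_of_closedin)

end

lemma X_space_simps [simp]:
  "points (X_space A) = kalg_hom A complex_kalg"
  "compacta (X_space A) = X_p A ` cont_cstar_seminorms A"
  by (simp_all add: X_space_def)

lemma ktop_X_space:
  "K \<subseteq> extensional (carrier A) \<Longrightarrow> ktop (X_space A) K = top_of_set K"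
  by (simp add: X_space_def subtopology_product_eq_top_of_set)

context kstar_algebra
begin

lemma ktop_X_p: "ktop (X_space A) (X_p A p) = top_of_set (X_p A p)"
  by (rule ktop_X_space[OF X_p_extensional])

text \<open>The seminorm is the supremum over \<open>H\<close>, continuous since it lies below
  \<open>p\<close>; that no further character is bounded by it is
  \<open>mem_of_character_le_sup\<close>. This provides the closure axiom for the compactology on
  the characters.\<close>

lemma compact_subset_X_p:
  assumes p: "p \<in> CS" and H: "compact H" "H \<subseteq> X_p A p"
  shows "H \<in> X_p A ` CS"
proof -
  define q where "q a = sup_seminorm H (\<lambda>\<eta>. \<eta> a)" for a
  have herm: "H \<subseteq> hermitian_hom A complex_kalg" using H(2) X_p_iff[OF CS_cstar[OF p]] by blast
  have bound: "norm (\<eta> a) \<le> p a" if "\<eta> \<in> H" "a \<in> carrier A" for \<eta> a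
    using that H(2) norm_le_of_X_p[OF p] by blast
  have q: "cstar_seminorm A q"
    unfolding q_def[abs_def]
  proof (rule cstar_seminorm_sup)
    show "involutive_algebra A" by unfold_locales
    show "\<exists>c. \<forall>\<eta>\<in>H. norm (\<eta> a) \<le> c" if "a \<in> carrier A" for a using bound that by blast
  qed (use herm in \<open>auto simp: hermitian_character_iff subset_eq\<close>)
  have "q a \<le> p a" if "a \<in> carrier A" for a
    unfolding q_def using bound[OF _ that] cstar_seminorm_on.nonneg[OF CS_on[OF p] that]
    by (intro sup_seminorm_least)
  then have qCS: "q \<in> CS" by (rule CS_le[OF q p])
  have "X_p A q = H"
  proof (intro equalityI subsetI)
    fix \<xi> assume "\<xi> \<in> X_p A q"
    then have \<xi>: "\<xi> \<in> hermitian_hom A complex_kalg" "\<forall>a\<in>carrier A. norm (\<xi> a) \<le> q a"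
      unfolding X_p_iff[OF q] by blast+
    show "\<xi> \<in> H"
      by (rule mem_of_character_le_sup[OF H(1) herm \<xi>(1)]) (use \<xi>(2) in \<open>simp add: q_def\<close>)
  next
    fix \<xi> assume \<xi>: "\<xi> \<in> H"
    have "norm (\<xi> a) \<le> q a" if "a \<in> carrier A" for a
      unfolding q_def by (rule sup_seminorm_upper[OF bound[OF _ that] \<xi>])
    then show "\<xi> \<in> X_p A q"
      unfolding X_p_iff[OF q] using herm \<xi> by blast
  qed
  then show ?thesis using qCS by blast
qed

lemma X_space_hom_complex_iff:
  "f \<in> compactological_hom (X_space A) complex_space \<longleftrightarrow>
     f \<in> extensional chars \<and> (\<forall>p\<in>CS. continuous_on (X_p A p) f)"
  if "compactological_space (X_space A)"
  using compactological_space.hom_complex_iff[OF that] by (auto simp: ktop_X_p)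

sublocale X: regular_compactological_space "X_space A"
proof -
  interpret compactological_space "X_space A"
  proof
    show "\<Union> (compacta (X_space A)) = points (X_space A)" using chars_iff by auto
    show "compacta (X_space A) \<noteq> {}" using CS_zero by auto
    show "\<exists>M\<in>compacta (X_space A). K \<union> L \<subseteq> M" if KL: "K \<in> compacta (X_space A)" "L \<in> compacta (X_space A)" for K L
    proof -
      obtain p q where pq: "p \<in> CS" "q \<in> CS" "K = X_p A p" "L = X_p A q" using KL by auto
      obtain r where r: "r \<in> CS" "\<forall>x\<in>carrier A. p x \<le> r x \<and> q x \<le> r x" using CS_directed pq by blast
      then have "K \<union> L \<subseteq> X_p A r"
        using pq CS_cstar by (auto simp: X_p_iff) (meson order_trans)+
      then show ?thesis using r(1) by auto
    qed
    fix K assume "K \<in> compacta (X_space A)"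
    then obtain p where p: "p \<in> CS" "K = X_p A p" by auto
    show "topspace (ktop (X_space A) K) = K" by (simp add: p ktop_X_p)
    show "compact_space (ktop (X_space A) K)"
      using compact_X_p[OF CS_cstar[OF p(1)]] by (simp add: p ktop_X_p compact_space_subtopology)
    show "Hausdorff_space (ktop (X_space A) K)"
      unfolding X_space_def by (simp add: Hausdorff_space_subtopology Hausdorff_space_product_topology)
    show "continuous_map (ktop (X_space A) K) (ktop (X_space A) L) (\<lambda>x. x)"
      if "L \<in> compacta (X_space A)" "K \<subseteq> L" for L
    proof -
      obtain q where "L = X_p A q" using \<open>L \<in> compacta (X_space A)\<close> by auto
      then show ?thesis using p \<open>K \<subseteq> L\<close> by (auto simp: ktop_X_p)
    qed
    show "ktop (X_space A) K closure_of H \<in> compacta (X_space A)" if "H \<subseteq> K" for H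
    proof -
      have "closedin (top_of_set (X_p A p)) (top_of_set (X_p A p) closure_of H)" by simp
      then have "compact (top_of_set (X_p A p) closure_of H)"
        using compact_X_p[OF CS_cstar[OF p(1)]] closedin_compact by blast
      moreover have "top_of_set (X_p A p) closure_of H \<subseteq> X_p A p"
        using closure_of_subset_topspace[of "top_of_set (X_p A p)" H] by simp
      ultimately show ?thesis using compact_subset_X_p[OF p(1)] by (simp add: p ktop_X_p)
    qed
  qed
  show "regular_compactological_space (X_space A)"
  proof
    fix \<xi> \<eta> assume \<xi>: "\<xi> \<in> points (X_space A)" "\<eta> \<in> points (X_space A)" "\<xi> \<noteq> \<eta>"
    have "\<exists>a\<in>carrier A. \<xi> a \<noteq> \<eta> a"
      using \<xi> extensionalityI[of \<xi> "carrier A" \<eta>] by (auto simp: kalg_hom_def hermitian_character_iff)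
    then obtain a where a: "a \<in> carrier A" "\<xi> a \<noteq> \<eta> a" by blast
    have "continuous_on (X_p A p) (\<lambda>\<zeta>\<in>chars. \<zeta> a)" if "p \<in> CS" for p
      using X_p_subset_chars[OF that]
      by (subst continuous_on_cong[OF refl, of _ _ "\<lambda>\<zeta>. \<zeta> a"]) (auto intro: continuous_on_coordinate)
    then have "(\<lambda>\<zeta>\<in>chars. \<zeta> a) \<in> compactological_hom (X_space A) complex_space"
      by (subst X_space_hom_complex_iff) (auto intro: compactological_space_axioms)
    then show "\<exists>f\<in>compactological_hom (X_space A) complex_space. f \<xi> \<noteq> f \<eta>"
      using \<xi> a by (intro bexI[of _ "\<lambda>\<zeta>\<in>chars. \<zeta> a"]) auto
  qed
qed

lemma C_X_iff:
  "f \<in> compactological_hom (X_space A) complex_space \<longleftrightarrow>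
     f \<in> extensional chars \<and> (\<forall>p\<in>CS. continuous_on (X_p A p) f)"
  by (rule X_space_hom_complex_iff[OF X.compactological_space_axioms])

lemma approximation_on_X_p:
  assumes p: "p \<in> CS" and f: "continuous_on (X_p A p) f" and "0 < e"
  obtains a where "a \<in> carrier A" "\<And>\<xi>. \<xi> \<in> X_p A p \<Longrightarrow> norm (f \<xi> - \<xi> a) < e"
proof -
  \<comment> \<open>Agreement with the evaluation at some \<open>a\<close> is required on
    \<open>X_p A p\<close> alone; values elsewhere are left free, which makes the closure properties
    immediate.\<close>
  define F where "F = {g. \<exists>a\<in>carrier A. \<forall>\<xi>\<in>X_p A p. g \<xi> = \<xi> a}"
  have FI: "g \<in> F" if "a \<in> carrier A" "\<And>\<xi>. \<xi> \<in> X_p A p \<Longrightarrow> g \<xi> = \<xi> a" for a g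
    using that by (auto simp: F_def)
  have herm: "\<xi> \<in> hermitian_hom A complex_kalg" if "\<xi> \<in> X_p A p" for \<xi>
    using that X_p_iff[OF CS_cstar[OF p]] by blast
  note char = characterD[OF herm]
  have "\<exists>g\<in>F. \<forall>\<xi>\<in>X_p A p. norm (f \<xi> - g \<xi>) < e"
  proof (rule Stone_Weierstrass_complex)
    show "compact (X_p A p)" by (rule compact_X_p[OF CS_cstar[OF p]])
    show "continuous_on (X_p A p) g" if "g \<in> F" for g
    proof -
      obtain a where "\<forall>\<xi>\<in>X_p A p. g \<xi> = \<xi> a" using \<open>g \<in> F\<close> by (auto simp: F_def)
      then show ?thesis
        using continuous_on_coordinate[of "X_p A p" a] by (simp cong: continuous_on_cong)
    qed
    show "(\<lambda>x. g x + h x) \<in> F" "(\<lambda>x. g x * h x) \<in> F" if gh: "g \<in> F" "h \<in> F" for g h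
    proof -
      obtain a b where ab: "a \<in> carrier A" "\<forall>\<xi>\<in>X_p A p. g \<xi> = \<xi> a" "b \<in> carrier A" "\<forall>\<xi>\<in>X_p A p. h \<xi> = \<xi> b"
        using gh by (auto simp: F_def)
      show "(\<lambda>x. g x + h x) \<in> F" by (rule FI[of "a \<oplus> b"]) (use ab in \<open>auto simp: char\<close>)
      show "(\<lambda>x. g x * h x) \<in> F" by (rule FI[of "a \<otimes> b"]) (use ab in \<open>auto simp: char\<close>)
    qed
    show "(\<lambda>x. cnj (g x)) \<in> F" if "g \<in> F" for g
    proof -
      obtain a where "a \<in> carrier A" "\<forall>\<xi>\<in>X_p A p. g \<xi> = \<xi> a" using \<open>g \<in> F\<close> by (auto simp: F_def)
      then show ?thesis by (intro FI[of "invol A a"]) (auto simp: char)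
    qed
    show "(\<lambda>_. c) \<in> F" for c
      by (rule FI[of "const c"]) (auto simp: char const_def)
    show "\<exists>g\<in>F. g \<xi> \<noteq> g \<eta>" if \<xi>: "\<xi> \<in> X_p A p" "\<eta> \<in> X_p A p" "\<xi> \<noteq> \<eta>" for \<xi> \<eta>
    proof -
      obtain a where "a \<in> carrier A" "\<xi> a \<noteq> \<eta> a"
        using \<xi>(3) extensionalityI[of \<xi> "carrier A" \<eta>] char[OF \<xi>(1)] char[OF \<xi>(2)] by auto
      then show ?thesis by (intro bexI[of _ "\<lambda>\<zeta>. \<zeta> a"] FI[of a]) auto
    qed
  qed (use f \<open>0 < e\<close> in auto)
  then obtain g where g: "g \<in> F" "\<forall>\<xi>\<in>X_p A p. norm (f \<xi> - g \<xi>) < e" by blast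
  then obtain a where "a \<in> carrier A" "\<forall>\<xi>\<in>X_p A p. g \<xi> = \<xi> a" by (auto simp: F_def)
  then show thesis using g by (intro that) auto
qed

text \<open>Approximants to \<open>f\<close> within \<open>e\<close> on \<open>X_p A p\<close> form
  a filter base, directed because the sets of characters are. Since \<open>p\<close> is the supremum
  over \<open>X_p A p\<close>, uniform closeness there is closeness for \<open>p\<close>: the filter
  is Cauchy and its limit represents \<open>f\<close>.\<close>

theorem gelfand_representation_surj:
  assumes f: "\<And>p. p \<in> CS \<Longrightarrow> continuous_on (X_p A p) f"
  obtains a where "a \<in> carrier A" "\<And>\<xi>. \<xi> \<in> chars \<Longrightarrow> \<xi> a = f \<xi>"
proof -
  define N where "N = (\<lambda>(p, e). {a \<in> carrier A. \<forall>\<xi>\<in>X_p A p. norm (f \<xi> - \<xi> a) < e})"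
  define B where "B = CS \<times> {0::real<..}"
  define F where "F = (INF b\<in>B. principal (N b))"
  have ev: "eventually P F \<longleftrightarrow> (\<exists>b\<in>B. \<forall>a\<in>N b. P a)" for P
    unfolding F_def
  proof (rule eventually_directed_principal)
    show "B \<noteq> {}" using CS_zero by (auto simp: B_def intro: gt_ex)
    fix b c assume bc: "b \<in> B" "c \<in> B"
    obtain p d where b: "b = (p, d)" "p \<in> CS" "d > 0" using bc by (auto simp: B_def)
    obtain q e where c: "c = (q, e)" "q \<in> CS" "e > 0" using bc by (auto simp: B_def)
    obtain M where "M \<in> compacta (X_space A)" "X_p A p \<union> X_p A q \<subseteq> M"
      using X.compacta_directed[of "X_p A p" "X_p A q"] b c by auto
    then obtain r where r: "r \<in> CS" "X_p A p \<union> X_p A q \<subseteq> X_p A r" by auto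
    then have "N (r, min d e) \<subseteq> N b \<inter> N c" using b c by (auto simp: N_def)
    then show "\<exists>a\<in>B. N a \<subseteq> N b \<inter> N c"
      using r b c by (intro bexI[of _ "(r, min d e)"]) (auto simp: B_def)
  qed
  have nonempty: "N b \<noteq> {}" if b: "b \<in> B" for b
  proof -
    obtain p e where pe: "b = (p, e)" "p \<in> CS" "e > 0" using b by (auto simp: B_def)
    obtain a where "a \<in> carrier A" "\<And>\<xi>. \<xi> \<in> X_p A p \<Longrightarrow> norm (f \<xi> - \<xi> a) < e"
      using approximation_on_X_p[OF pe(2) f[OF pe(2)] pe(3)] by blast
    then show ?thesis using pe by (auto simp: N_def)
  qed
  have nontrivial: "F \<noteq> bot"
    using nonempty by (auto simp: trivial_limit_def ev)
  have "cauchy_filter A F"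
    unfolding cauchy_filter_def
  proof (intro conjI allI impI)
    show "F \<noteq> bot" by (rule nontrivial)
    have "eventually (\<lambda>a. a \<in> carrier A) F"
      unfolding ev using CS_zero by (intro bexI[of _ "(\<lambda>_. 0, 1)"]) (auto simp: N_def B_def)
    then show "F \<le> principal (carrier A)" by (simp add: le_principal)
    fix U assume "openin (topol A) U \<and> \<zero> \<in> U"
    then obtain p e where pe: "p \<in> CS" "e > 0" "{y \<in> carrier A. p (y \<ominus> \<zero>) < e} \<subseteq> U"
      using open_contains_CS_ball by blast
    \<comment> \<open>Characters only yield a non-strict bound for \<open>p\<close>; two errors of
      \<open>e / 3\<close> leave room for the strict one.\<close>
    have "x \<ominus> y \<in> U" if xy: "x \<in> N (p, e / 3)" "y \<in> N (p, e / 3)" for x y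
    proof -
      have carr: "x \<in> carrier A" "y \<in> carrier A" using xy by (auto simp: N_def)
      have "p (x \<ominus> y) \<le> 2 * (e / 3)"
      proof (rule seminorm_le_of_characters[OF CS_cstar[OF pe(1)]])
        fix \<xi> assume \<xi>: "\<xi> \<in> X_p A p"
        then have "\<xi> (x \<ominus> y) = (f \<xi> - \<xi> y) - (f \<xi> - \<xi> x)"
          using carr character_diff[of \<xi> x y] X_p_iff[OF CS_cstar[OF pe(1)]] by simp
        then have "norm (\<xi> (x \<ominus> y)) \<le> norm (f \<xi> - \<xi> y) + norm (f \<xi> - \<xi> x)"
          by (metis norm_triangle_ineq4)
        also have "\<dots> \<le> e / 3 + e / 3"
          using xy \<xi> by (intro add_mono) (auto simp: N_def intro: less_imp_le)
        finally show "norm (\<xi> (x \<ominus> y)) \<le> 2 * (e / 3)" by simp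
      qed (use carr pe in auto)
      then have "p (x \<ominus> y) < e" using pe by simp
      then show ?thesis using pe(3) carr by auto
    qed
    moreover have "eventually (\<lambda>x. x \<in> N (p, e / 3)) F"
      unfolding ev using pe by (intro bexI[of _ "(p, e / 3)"]) (auto simp: B_def)
    moreover have "N (p, e / 3) \<subseteq> carrier A" by (auto simp: N_def)
    ultimately show "\<exists>M\<subseteq>carrier A. eventually (\<lambda>x. x \<in> M) F \<and> (\<forall>x\<in>M. \<forall>y\<in>M. x \<ominus> y \<in> U)" by blast
  qed
  then obtain l where l: "limitin (topol A) (\<lambda>x. x) l F" using topol_complete by blast
  then have lA: "l \<in> carrier A" by (auto simp: limitin_def)
  have "\<xi> l = f \<xi>" if "\<xi> \<in> chars" for \<xi>
  proof -
    obtain p where p: "p \<in> CS" "\<xi> \<in> X_p A p" using \<open>\<xi> \<in> chars\<close> chars_iff by blast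
    have "norm (\<xi> l - f \<xi>) \<le> 0 + e" if "e > 0" for e
    proof -
      have "eventually (\<lambda>x. x \<in> carrier A \<and> p (x \<ominus> l) < e / 2) F"
        using l that p unfolding topol_eq by (intro limitin_seminorm_topD CS_cstar) auto
      moreover have "eventually (\<lambda>x. x \<in> N (p, e / 2)) F"
        unfolding ev using p that by (intro bexI[of _ "(p, e / 2)"]) (auto simp: B_def)
      ultimately have "eventually (\<lambda>x. x \<in> N (p, e / 2) \<and> p (x \<ominus> l) < e / 2) F"
        by eventually_elim simp
      then have "\<exists>x. x \<in> N (p, e / 2) \<and> p (x \<ominus> l) < e / 2"
        by (rule eventually_happens'[OF nontrivial])
      then obtain x where x: "x \<in> N (p, e / 2)" "p (x \<ominus> l) < e / 2" by blast
      have xA: "x \<in> carrier A" using x by (simp add: N_def)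
      have "norm (\<xi> x - \<xi> l) \<le> e / 2"
        using norm_le_of_X_p[OF p, of "x \<ominus> l"] character_diff[of \<xi> x l] X_p_iff[OF CS_cstar[OF p(1)]] p(2) x xA lA
        by simp
      moreover have "norm (f \<xi> - \<xi> x) \<le> e / 2" using x p(2) by (auto simp: N_def intro: less_imp_le)
      ultimately have "norm (\<xi> x - \<xi> l) + norm (f \<xi> - \<xi> x) \<le> e" by simp
      moreover have "norm (\<xi> l - f \<xi>) \<le> norm (\<xi> x - \<xi> l) + norm (f \<xi> - \<xi> x)"
        using norm_triangle_ineq[of "\<xi> x - \<xi> l" "f \<xi> - \<xi> x"] by (simp add: norm_minus_commute)
      ultimately show ?thesis by simp
    qed
    then have "norm (\<xi> l - f \<xi>) \<le> 0" by (rule field_le_epsilon)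
    then show ?thesis by simp
  qed
  then show thesis using lA that by blast
qed

end

lemma kalg_hom_eqI:
  assumes B: "kstar_algebra B" and u: "u \<in> kalg_hom A B" and v: "v \<in> kalg_hom A B"
    and eq: "\<And>\<eta> a. \<eta> \<in> kalg_hom B complex_kalg \<Longrightarrow> a \<in> carrier A \<Longrightarrow> \<eta> (u a) = \<eta> (v a)"
  shows "u = v"
proof (rule extensionalityI)
  show "u \<in> extensional (carrier A)" "v \<in> extensional (carrier A)"
    using u v by (auto simp: kalg_hom_def hermitian_hom_iff)
  fix a assume "a \<in> carrier A"
  then show "u a = v a"
    using u v eq by (intro kstar_algebra.eqI_chars[OF B]) (auto simp: kalg_hom_def hermitian_hom_iff)
qed

lemma compose_character:
  assumes A: "kstar_algebra A" and u: "u \<in> kalg_hom A B" and \<eta>: "\<eta> \<in> kalg_hom B complex_kalg"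
  shows "compose (carrier A) \<eta> u \<in> kalg_hom A complex_kalg"
  by (rule kalg_hom_compose[OF u \<eta> A])

lemma compose_character_X_p:
  assumes A: "kstar_algebra A" and B: "kstar_algebra B" and u: "u \<in> kalg_hom A B"
    and r: "r \<in> cont_cstar_seminorms B" and \<eta>: "\<eta> \<in> X_p B r"
  shows "compose (carrier A) \<eta> u \<in> X_p A (\<lambda>a. r (u a))"
proof -
  interpret A: kstar_algebra A by fact
  interpret B: kstar_algebra B by fact
  have cs: "cstar_seminorm A (\<lambda>a. r (u a))"
    using kalg_hom_seminorm[OF _ u r] A.involutive_algebra_axioms A.CS_cstar by blast
  have "\<eta> \<in> hermitian_hom B complex_kalg" using \<eta> B.X_p_iff[OF B.CS_cstar[OF r]] by blast
  then have "compose (carrier A) \<eta> u \<in> hermitian_hom A complex_kalg"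
    using u A.involutive_algebra_axioms by (intro hermitian_hom_compose) (auto simp: kalg_hom_def)
  moreover have "norm (compose (carrier A) \<eta> u a) \<le> r (u a)" if "a \<in> carrier A" for a
    using that u B.norm_le_of_X_p[OF r \<eta>, of "u a"]
    by (simp add: compose_def kalg_hom_def hermitian_hom_iff)
  ultimately show ?thesis using A.X_p_iff[OF cs] by blast
qed

text \<open>The general tool for constructing morphisms, where \<open>\<phi> \<eta>\<close> is to
  become \<eta> composed with \<open>h\<close>. The element \<open>h a\<close> is the one
  represented by the function \<open>\<eta> \<mapsto> \<phi> \<eta> a\<close>; \<open>maps\<close>
  makes the \<open>\<phi> \<eta>\<close> characters, which gives the algebraic laws, and yields the
  seminorm estimate for continuity.\<close>

theorem kalg_hom_of_character_map:
  fixes A :: "('a, 'm) kalg_scheme" and B :: "('b, 'n) kalg_scheme"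
  assumes A: "kstar_algebra A" and B: "kstar_algebra B"
    and maps: "\<And>r. r \<in> cont_cstar_seminorms B \<Longrightarrow> \<exists>p\<in>cont_cstar_seminorms A. \<phi> ` X_p B r \<subseteq> X_p A p"
    and cont: "\<And>r a. r \<in> cont_cstar_seminorms B \<Longrightarrow> a \<in> carrier A \<Longrightarrow> continuous_on (X_p B r) (\<lambda>\<eta>. \<phi> \<eta> a)"
  obtains h where "h \<in> kalg_hom A B"
    "\<And>\<eta> a. \<eta> \<in> kalg_hom B complex_kalg \<Longrightarrow> a \<in> carrier A \<Longrightarrow> \<eta> (h a) = \<phi> \<eta> a"
proof -
  interpret A: kstar_algebra A by fact
  interpret B: kstar_algebra B by fact
  have "\<exists>b. b \<in> carrier B \<and> (\<forall>\<eta>\<in>B.chars. \<eta> b = \<phi> \<eta> a)" if a: "a \<in> carrier A" for a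
    by (rule B.gelfand_representation_surj[of "\<lambda>\<eta>. \<phi> \<eta> a"]) (use cont a in auto)
  then have "\<forall>a\<in>carrier A. \<exists>b. b \<in> carrier B \<and> (\<forall>\<eta>\<in>B.chars. \<eta> b = \<phi> \<eta> a)" by blast
  from bchoice[OF this] obtain h0
    where h0: "\<forall>a\<in>carrier A. h0 a \<in> carrier B \<and> (\<forall>\<eta>\<in>B.chars. \<eta> (h0 a) = \<phi> \<eta> a)" ..
  define h where "h = restrict h0 (carrier A)"
  have h: "h a \<in> carrier B" "\<And>\<eta>. \<eta> \<in> B.chars \<Longrightarrow> \<eta> (h a) = \<phi> \<eta> a" if "a \<in> carrier A" for a
    using h0 that by (auto simp: h_def)
  have char_B: "\<eta> \<in> hermitian_hom B complex_kalg" if "\<eta> \<in> B.chars" for \<eta>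
    using that by (simp add: kalg_hom_def)
  have char_A: "\<phi> \<eta> \<in> hermitian_hom A complex_kalg" if \<eta>: "\<eta> \<in> B.chars" for \<eta>
  proof -
    obtain r where r: "r \<in> B.CS" "\<eta> \<in> X_p B r" using \<eta> B.chars_iff by blast
    then obtain p where "p \<in> A.CS" "\<phi> \<eta> \<in> X_p A p" using maps[OF r(1)] by blast
    then show ?thesis using A.X_p_iff[OF A.CS_cstar] by blast
  qed
  have herm: "h \<in> hermitian_hom A B"
    unfolding hermitian_hom_iff
  proof (intro conjI ballI allI)
    show "h \<in> extensional (carrier A)" by (simp add: h_def)
    show "h \<one>\<^bsub>A\<^esub> = \<one>\<^bsub>B\<^esub>"
      by (rule B.eqI_chars) (simp_all add: h characterD[OF char_A] characterD[OF char_B])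
    fix x assume x: "x \<in> carrier A"
    show "h x \<in> carrier B" using h x by blast
    show "h (invol A x) = invol B (h x)"
      by (rule B.eqI_chars) (simp_all add: h x characterD[OF char_A] characterD[OF char_B])
    show "h (c \<odot>\<^bsub>A\<^esub> x) = c \<odot>\<^bsub>B\<^esub> h x" for c
      by (rule B.eqI_chars) (simp_all add: h x characterD[OF char_A] characterD[OF char_B])
    fix y assume y: "y \<in> carrier A"
    show "h (x \<oplus>\<^bsub>A\<^esub> y) = h x \<oplus>\<^bsub>B\<^esub> h y"
      by (rule B.eqI_chars) (simp_all add: h x y characterD[OF char_A] characterD[OF char_B])
    show "h (x \<otimes>\<^bsub>A\<^esub> y) = h x \<otimes>\<^bsub>B\<^esub> h y"
      by (rule B.eqI_chars) (simp_all add: h x y characterD[OF char_A] characterD[OF char_B])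
  qed
  have "h \<in> kalg_hom A B"
  proof (rule kalg_homI[OF A _ herm])
    show "involutive_algebra B" by unfold_locales
    show "topol B = B.seminorm_top B.CS" by (rule B.topol_eq)
    fix r assume r: "r \<in> B.CS"
    then show "cstar_seminorm B r" by (rule B.CS_cstar)
    obtain p where p: "p \<in> A.CS" "\<phi> ` X_p B r \<subseteq> X_p A p" using maps[OF r] by blast
    have "r (h x) \<le> p x" if x: "x \<in> carrier A" for x
    proof (rule B.seminorm_le_of_characters[OF B.CS_cstar[OF r]])
      fix \<eta> assume \<eta>: "\<eta> \<in> X_p B r"
      then have "\<eta> \<in> B.chars" using r B.chars_iff by blast
      then show "norm (\<eta> (h x)) \<le> p x"
        using h x p \<eta> A.norm_le_of_X_p[OF p(1), of "\<phi> \<eta>" x] by auto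
    qed (use h x A.CS_on[OF p(1)] cstar_seminorm_on.nonneg in auto)
    then show "\<exists>p\<in>A.CS. \<forall>x\<in>carrier A. r (h x) \<le> p x" using p by blast
  qed
  then show thesis using h that by blast
qed

section \<open>Algebras of functions\<close>

lemma (in involutive_algebra) X_p_mono:
  assumes "cstar_seminorm A p" "cstar_seminorm A q" "\<And>x. x \<in> carrier A \<Longrightarrow> p x \<le> q x"
  shows "X_p A p \<subseteq> X_p A q"
proof
  fix \<xi> assume "\<xi> \<in> X_p A p"
  then show "\<xi> \<in> X_p A q"
    unfolding X_p_iff[OF assms(1)] X_p_iff[OF assms(2)] using assms(3) order_trans by blast
qed

text \<open>Common frame for the algebra of functions on a compactological space and for the tensor
  product. Multiplication and involution are not assumed pointwise, because in the tensor product
  they are so only at pairs of characters; \<open>cstar_sup\<close> takes over their role.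
  Completeness comes from \<open>locally_uniform_limit\<close>.\<close>

locale function_algebra = involutive_algebra A for A :: "('x \<Rightarrow> complex, 'm) kalg_scheme" (structure) +
  fixes \<K> :: "'x set set"
  assumes carrier_extensional: "carrier A \<subseteq> extensional (\<Union>\<K>)"
    and add_apply: "f \<in> carrier A \<Longrightarrow> g \<in> carrier A \<Longrightarrow> x \<in> \<Union>\<K> \<Longrightarrow> (f \<oplus> g) x = f x + g x"
    and smult_apply: "f \<in> carrier A \<Longrightarrow> x \<in> \<Union>\<K> \<Longrightarrow> (c \<odot> f) x = c * f x"
    and bounded: "f \<in> carrier A \<Longrightarrow> K \<in> \<K> \<Longrightarrow> \<exists>c. \<forall>x\<in>K. norm (f x) \<le> c"
    and cstar_sup: "K \<in> \<K> \<Longrightarrow> cstar_seminorm A (sup_seminorm K)"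
    and topol_pointwise: "topol A = seminorm_topology (carrier A) (\<lambda>f g x. f x - g x) (sup_seminorm ` \<K>)"
    and locally_uniform_limit: "f \<in> extensional (\<Union>\<K>) \<Longrightarrow>
      (\<And>K e. K \<in> \<K> \<Longrightarrow> 0 < e \<Longrightarrow> \<exists>g\<in>carrier A. \<forall>x\<in>K. norm (f x - g x) < e) \<Longrightarrow> f \<in> carrier A"
begin

lemma diff_apply: "f \<in> carrier A \<Longrightarrow> g \<in> carrier A \<Longrightarrow> x \<in> \<Union>\<K> \<Longrightarrow> (f \<ominus> g) x = f x - g x"
  by (simp add: diff_eq_smult add_apply smult_apply)

lemma zero_apply: "x \<in> \<Union>\<K> \<Longrightarrow> \<zero> x = 0"
  using smult_apply[of \<zero> x 0] by simp

lemma norm_le_sup: "f \<in> carrier A \<Longrightarrow> K \<in> \<K> \<Longrightarrow> x \<in> K \<Longrightarrow> norm (f x) \<le> sup_seminorm K f"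
  using bounded[of f K] by (auto intro: sup_seminorm_upper)

lemma topol_sup: "topol A = seminorm_top (sup_seminorm ` \<K>)"
  unfolding topol_pointwise
proof (rule seminorm_topology_cong)
  have eq: "sup_seminorm K (\<lambda>x. f x - g x) = sup_seminorm K (f \<ominus> g)"
    if "K \<in> \<K>" "f \<in> carrier A" "g \<in> carrier A" for K f g
  proof (rule sup_seminorm_cong)
    fix x assume "x \<in> K"
    then have "x \<in> \<Union>\<K>" using that by blast
    then show "f x - g x = (f \<ominus> g) x" using that by (simp only: diff_apply)
  qed
  fix p assume "p \<in> sup_seminorm ` \<K>"
  then obtain K where K: "K \<in> \<K>" "p = sup_seminorm K" by blast
  have *: "\<forall>f\<in>carrier A. \<forall>g\<in>carrier A. sup_seminorm K (\<lambda>x. f x - g x) = sup_seminorm K (f \<ominus> g)"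
    using eq[OF K(1)] by blast
  show "\<exists>p'\<in>sup_seminorm ` \<K>. \<forall>f\<in>carrier A. \<forall>g\<in>carrier A. p (\<lambda>x. f x - g x) = p' (f \<ominus> g)"
    using K * by blast
  show "\<exists>p'\<in>sup_seminorm ` \<K>. \<forall>f\<in>carrier A. \<forall>g\<in>carrier A. p' (\<lambda>x. f x - g x) = p (f \<ominus> g)"
    using K * by blast
qed

sublocale kstar_algebra A
proof
  show "\<exists>P. (\<forall>p\<in>P. cstar_seminorm A p) \<and> topol A = seminorm_top P"
    using topol_sup cstar_sup by (intro exI[of _ "sup_seminorm ` \<K>"]) auto
  show "Hausdorff_space (topol A)"
    unfolding topol_sup
  proof (rule Hausdorff_seminorm_top)
    fix f assume f: "f \<in> carrier A" and zero: "\<forall>p\<in>sup_seminorm ` \<K>. p f = 0"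
    show "f = \<zero>"
    proof (rule extensionalityI)
      show "f \<in> extensional (\<Union>\<K>)" "\<zero> \<in> extensional (\<Union>\<K>)"
        using f carrier_extensional by auto
      fix x assume "x \<in> \<Union>\<K>"
      then obtain K where K: "K \<in> \<K>" "x \<in> K" by blast
      have "norm (f x) \<le> 0" using norm_le_sup[OF f K] zero K(1) by simp
      then show "f x = \<zero> x" using zero_apply[OF \<open>x \<in> \<Union>\<K>\<close>] by simp
    qed
  qed (use cstar_sup in auto)
  fix F assume F: "cauchy_filter A F"
  have nontrivial: "F \<noteq> bot" and F_carrier: "eventually (\<lambda>f. f \<in> carrier A) F"
    and Cauchy: "\<And>U. openin (topol A) U \<Longrightarrow> \<zero> \<in> U \<Longrightarrow>
      \<exists>M. M \<subseteq> carrier A \<and> eventually (\<lambda>f. f \<in> M) F \<and> (\<forall>f\<in>M. \<forall>g\<in>M. f \<ominus> g \<in> U)"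
    using F unfolding cauchy_filter_def le_principal by blast+
  have Cauchy_sup: "\<exists>M. eventually (\<lambda>f. f \<in> M) F \<and> (\<forall>f\<in>M. \<forall>g\<in>M. \<forall>x\<in>K. norm (f x - g x) < e)"
    if K: "K \<in> \<K>" and "0 < e" for K e
  proof -
    define U where "U = {f \<in> carrier A. sup_seminorm K (f \<ominus> \<zero>) < e}"
    have "openin (topol A) U"
      unfolding topol_sup U_def using that by (intro openin_seminorm_ball) auto
    moreover have "\<zero> \<in> U"
      using cstar_seminorm_on.at_zero[OF cstar_on[OF cstar_sup[OF K]]] \<open>0 < e\<close> by (simp add: U_def)
    ultimately have "\<exists>M. M \<subseteq> carrier A \<and> eventually (\<lambda>f. f \<in> M) F \<and> (\<forall>f\<in>M. \<forall>g\<in>M. f \<ominus> g \<in> U)"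
      by (rule Cauchy)
    then obtain M where M: "M \<subseteq> carrier A" "eventually (\<lambda>f. f \<in> M) F" "\<forall>f\<in>M. \<forall>g\<in>M. f \<ominus> g \<in> U"
      by blast
    have "norm (f x - g x) < e" if fg: "f \<in> M" "g \<in> M" and x: "x \<in> K" for f g x
    proof -
      have "norm ((f \<ominus> g) x) \<le> sup_seminorm K (f \<ominus> g)"
        using M(1) fg K x by (intro norm_le_sup) auto
      moreover have "sup_seminorm K (f \<ominus> g) < e"
        using bspec[OF bspec[OF M(3) fg(1)] fg(2)] M(1) fg by (auto simp: U_def subset_eq)
      moreover have "(f \<ominus> g) x = f x - g x" using M(1) fg K x by (intro diff_apply) auto
      ultimately show ?thesis by simp
    qed
    then show ?thesis using M(2) by blast
  qed
  obtain l where l: "l \<in> extensional (\<Union>\<K>)"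
    "\<And>K e. K \<in> \<K> \<Longrightarrow> 0 < e \<Longrightarrow> eventually (\<lambda>f. \<forall>x\<in>K. norm (f x - l x) < e) F"
    using uniform_Cauchy_filter_limit[OF nontrivial, of \<K>] Cauchy_sup by blast
  have lA: "l \<in> carrier A"
  proof (rule locally_uniform_limit[OF l(1)])
    fix K and e :: real assume "K \<in> \<K>" "0 < e"
    from eventually_conj[OF F_carrier l(2)[OF this]]
    have "\<exists>f. f \<in> carrier A \<and> (\<forall>x\<in>K. norm (f x - l x) < e)"
      by (rule eventually_happens'[OF nontrivial])
    then show "\<exists>g\<in>carrier A. \<forall>x\<in>K. norm (l x - g x) < e" by (auto simp: norm_minus_commute)
  qed
  have "limitin (topol A) (\<lambda>x. x) l F"
    unfolding topol_sup
  proof (rule limitin_seminorm_topI[OF _ lA F_carrier])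
    fix p and e :: real assume "p \<in> sup_seminorm ` \<K>" and "0 < e"
    then obtain K where K: "K \<in> \<K>" "p = sup_seminorm K" by blast
    have "eventually (\<lambda>f. \<forall>x\<in>K. norm (f x - l x) < e / 2) F"
      by (rule l(2)[OF K(1) half_gt_zero[OF \<open>0 < e\<close>]])
    with F_carrier show "eventually (\<lambda>f. p (f \<ominus> l) < e) F"
    proof eventually_elim
      case (elim f)
      have "(f \<ominus> l) x = f x - l x" if "x \<in> K" for x
        using diff_apply[OF elim(1) lA] K(1) that by blast
      then have "sup_seminorm K (f \<ominus> l) \<le> e / 2"
        using elim(2) \<open>0 < e\<close> by (intro sup_seminorm_least) (auto intro: less_imp_le)
      then show ?case using K \<open>0 < e\<close> by simp
    qed
  qed (use cstar_sup in auto)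
  then show "\<exists>l. limitin (topol A) (\<lambda>x. x) l F" by blast
qed

lemma kstar: "kstar_algebra A"
  by (rule kstar_algebra_axioms)

text \<open>For directed \<K> the suprema form a directed generating family, to which
  \<open>CS_dominated\<close> applies. The characters continuous for any seminorm are thereby
  confined to those bounded on one \<open>K\<close>.\<close>

lemma continuous_characters_dominated:
  assumes "\<K> \<noteq> {}" and directed: "\<And>K L. K \<in> \<K> \<Longrightarrow> L \<in> \<K> \<Longrightarrow> \<exists>M\<in>\<K>. K \<union> L \<subseteq> M" and q: "q \<in> CS"
  shows "\<exists>K\<in>\<K>. \<forall>f\<in>carrier A. q f \<le> sup_seminorm K f"
proof -
  have "\<exists>p\<in>sup_seminorm ` \<K>. \<forall>f\<in>carrier A. q f \<le> p f"
  proof (rule CS_dominated[OF _ topol_sup _ _ q])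
    show "\<exists>r\<in>sup_seminorm ` \<K>. \<forall>f\<in>carrier A. p f \<le> r f \<and> q f \<le> r f"
      if pq: "p \<in> sup_seminorm ` \<K>" "q \<in> sup_seminorm ` \<K>" for p q
    proof -
      obtain K L where KL: "K \<in> \<K>" "L \<in> \<K>" "p = sup_seminorm K" "q = sup_seminorm L" using pq by blast
      obtain M where M: "M \<in> \<K>" "K \<union> L \<subseteq> M" using directed[OF KL(1,2)] by blast
      have "sup_seminorm N f \<le> sup_seminorm M f" if "N \<subseteq> M" "f \<in> carrier A" for N f
        using that norm_le_sup[OF that(2) M(1)] cstar_seminorm_on.nonneg[OF cstar_on[OF cstar_sup[OF M(1)]]]
        by (intro sup_seminorm_least) auto
      then show ?thesis using M KL by (intro bexI[of _ "sup_seminorm M"]) auto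
    qed
  qed (use cstar_sup \<open>\<K> \<noteq> {}\<close> in auto)
  then show ?thesis by blast
qed

lemma sup_seminorm_in_CS: "K \<in> \<K> \<Longrightarrow> sup_seminorm K \<in> CS"
  using generating_subset_CS[OF _ topol_sup] cstar_sup by blast

end

lemma involutive_algebra_complex: "involutive_algebra complex_kalg"
  by (rule involutive_algebra_by_characters[of _ "{\<lambda>z. z}"]) auto

lemma kstar_algebra_complex: "kstar_algebra complex_kalg"
proof -
  interpret involutive_algebra complex_kalg by (rule involutive_algebra_complex)
  have diff: "x \<ominus>\<^bsub>complex_kalg\<^esub> y = x - y" for x y by (simp add: diff_eq_smult)
  have cs: "cstar_seminorm complex_kalg norm"
    by (auto simp: cstar_seminorm_def norm_triangle_ineq norm_mult power2_eq_square)
  have "continuous_map euclidean (seminorm_top {norm}) id"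
  proof (rule continuous_map_into_seminorm_top)
    fix p x and e :: real assume "p \<in> {norm :: complex \<Rightarrow> real}" "0 < e"
    then show "\<exists>U. openin euclidean U \<and> x \<in> U \<and> (\<forall>y\<in>U. p (id y \<ominus>\<^bsub>complex_kalg\<^esub> id x) < e)"
      by (intro exI[of _ "ball x e"]) (auto simp: diff dist_norm norm_minus_commute)
  qed (auto simp: cs)
  moreover have "continuous_map (seminorm_top {norm}) euclidean id"
    unfolding continuous_map_metric_iff
  proof (intro ballI allI impI)
    fix x :: complex and e :: real assume "0 < e"
    then show "\<exists>U. openin (seminorm_top {norm}) U \<and> x \<in> U \<and> (\<forall>y\<in>U. dist (id y) (id x) < e)"
      using openin_seminorm_ball[of norm "{norm}" x UNIV e "\<lambda>x y. x \<ominus>\<^bsub>complex_kalg\<^esub> y"]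
      by (intro exI[of _ "{y. norm (y - x) < e}"]) (auto simp: diff dist_norm)
  qed
  ultimately have top: "euclidean = seminorm_top {norm}"
    using topology_finer_continuous_id[of euclidean "seminorm_top {norm}"]
      topology_finer_continuous_id[of "seminorm_top {norm}" euclidean]
    by (auto simp: topology_eq)
  show ?thesis
  proof
    show "\<exists>P. (\<forall>p\<in>P. cstar_seminorm complex_kalg p) \<and> topol complex_kalg = seminorm_top P"
      using top cs by (intro exI[of _ "{norm}"]) simp
    show "Hausdorff_space (topol complex_kalg)" by simp
    fix F assume F: "cauchy_filter complex_kalg F"
    have "Topological_Spaces.cauchy_filter F"
      unfolding cauchy_filter_metric
    proof (intro allI impI)
      fix e :: real assume "0 < e"
      then have "openin (topol complex_kalg) (ball 0 e) \<and> \<zero>\<^bsub>complex_kalg\<^esub> \<in> ball 0 e" by simp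
      then obtain M where "eventually (\<lambda>x. x \<in> M) F" "\<forall>x\<in>M. \<forall>y\<in>M. x \<ominus>\<^bsub>complex_kalg\<^esub> y \<in> ball 0 e"
        using F unfolding cauchy_filter_def by blast
      then show "\<exists>P. eventually P F \<and> (\<forall>x y. P x \<and> P y \<longrightarrow> dist x y < e)"
        by (intro exI[of _ "\<lambda>x. x \<in> M"]) (auto simp: diff dist_norm)
    qed
    moreover have "F \<noteq> bot" using F by (simp add: cauchy_filter_def)
    ultimately obtain l where "F \<le> nhds l"
      using complete_UNIV[where 'a=complex] unfolding complete_uniform by auto
    then show "\<exists>l. limitin (topol complex_kalg) (\<lambda>x. x) l F"
      by (intro exI[of _ l]) (simp add: filterlim_def)
  qed
qed

lemma complex_character_eq:
  assumes "\<xi> \<in> kalg_hom complex_kalg complex_kalg" shows "\<xi> = (\<lambda>z. z)"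
proof
  fix z
  have herm: "\<xi> \<in> hermitian_hom complex_kalg complex_kalg" using assms by (simp add: kalg_hom_def)
  have "\<xi> (z * 1) = z * \<xi> 1" using characterD(5)[OF herm, of 1 z] by simp
  then show "\<xi> z = z" using characterD(2)[OF herm] by simp
qed

lemma continuous_map_uniform_approx:
  fixes f :: "'x \<Rightarrow> 'b::real_normed_vector"
  assumes approx: "\<And>e. 0 < e \<Longrightarrow> \<exists>g. continuous_map Z euclidean g \<and> (\<forall>x\<in>topspace Z. norm (f x - g x) < e)"
  shows "continuous_map Z euclidean f"
  unfolding continuous_map_metric_iff
proof (intro ballI allI impI)
  fix x and e :: real assume x: "x \<in> topspace Z" and "0 < e"
  obtain g where g: "continuous_map Z euclidean g" "\<forall>x\<in>topspace Z. norm (f x - g x) < e / 3"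
    using approx[of "e / 3"] \<open>0 < e\<close> by auto
  obtain U where U: "openin Z U" "x \<in> U" "\<forall>y\<in>U. dist (g y) (g x) < e / 3"
    using g(1)[unfolded continuous_map_metric_iff, rule_format, OF x, of "e / 3"] \<open>0 < e\<close> by auto
  have "dist (f y) (f x) < e" if y: "y \<in> U" for y
  proof -
    have "dist (f y) (g y) < e / 3" "dist (f x) (g x) < e / 3"
      using openin_subset[OF U(1)] y x g(2) by (auto simp: dist_norm)
    moreover have "dist (g y) (g x) < e / 3" using U(3) y by blast
    ultimately show ?thesis
      using dist_triangle[of "f y" "f x" "g y"] dist_triangle[of "g y" "f x" "g x"]
      by (simp add: dist_commute)
  qed
  then show "\<exists>U. openin Z U \<and> x \<in> U \<and> (\<forall>y\<in>U. dist (f y) (f x) < e)" using U by blast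
qed

lemma continuous_map_euclidean_compose2:
  fixes h :: "'b::topological_space \<times> 'c::topological_space \<Rightarrow> 'd::topological_space"
  assumes "continuous_map Z euclidean f" "continuous_map Z euclidean g" "continuous_on UNIV h"
  shows "continuous_map Z euclidean (\<lambda>x. h (f x, g x))"
proof -
  have "continuous_map Z (prod_topology euclidean euclidean) (\<lambda>x. (f x, g x))"
    by (intro continuous_map_pairedI assms)
  then have "continuous_map Z euclidean (\<lambda>x. (f x, g x))" by simp
  then show ?thesis
    using continuous_map_compose[of Z euclidean "\<lambda>x. (f x, g x)" euclidean h] assms(3) by (simp add: o_def)
qed

section \<open>The algebra of continuous functions and its characters\<close>

lemma C_alg_simps [simp]:
  "carrier (C_alg S) = compactological_hom S complex_space"
  "mult (C_alg S) = (\<lambda>f g. \<lambda>x\<in>points S. f x * g x)"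
  "one (C_alg S) = (\<lambda>x\<in>points S. 1)"
  "zero (C_alg S) = (\<lambda>x\<in>points S. 0)"
  "add (C_alg S) = (\<lambda>f g. \<lambda>x\<in>points S. f x + g x)"
  "smult (C_alg S) = (\<lambda>c f. \<lambda>x\<in>points S. c * f x)"
  "invol (C_alg S) = (\<lambda>f. \<lambda>x\<in>points S. cnj (f x))"
  "topol (C_alg S) = seminorm_topology (compactological_hom S complex_space) (\<lambda>f g x. f x - g x)
                (sup_seminorm ` compacta S)"
  by (simp_all add: C_alg_def)

lemma compactological_hom_in_points:
  "u \<in> compactological_hom S T \<Longrightarrow> x \<in> points S \<Longrightarrow> u x \<in> points T"
  by (auto simp: compactological_hom_def)

lemma compactological_hom_extensional:
  "u \<in> compactological_hom S T \<Longrightarrow> u \<in> extensional (points S)"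
  by (auto simp: compactological_hom_def PiE_def)

context compactological_space
begin

lemma compacta_subset_points: "K \<in> compacta S \<Longrightarrow> K \<subseteq> points S"
  using compacta_cover by blast

lemma C_algI:
  assumes "f \<in> extensional (points S)" "\<And>K. K \<in> compacta S \<Longrightarrow> continuous_map (ktop S K) euclidean f"
  shows "f \<in> compactological_hom S complex_space"
  using assms by (simp add: hom_complex_iff)

lemma C_alg_continuous:
  "f \<in> compactological_hom S complex_space \<Longrightarrow> K \<in> compacta S \<Longrightarrow> continuous_map (ktop S K) euclidean f"
  by (simp add: hom_complex_iff)

lemma C_alg_restrictI:
  assumes "\<And>K. K \<in> compacta S \<Longrightarrow> continuous_map (ktop S K) euclidean f"
  shows "(\<lambda>x\<in>points S. f x) \<in> compactological_hom S complex_space"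
proof (rule C_algI)
  fix K assume K: "K \<in> compacta S"
  show "continuous_map (ktop S K) euclidean (\<lambda>x\<in>points S. f x)"
    by (rule continuous_map_eq[OF assms[OF K]])
      (use K in \<open>auto simp: ktop_topspace dest: compacta_subset_points\<close>)
qed simp

lemma C_alg_bounded:
  assumes "f \<in> compactological_hom S complex_space" "K \<in> compacta S"
  shows "\<exists>c. \<forall>x\<in>K. norm (f x) \<le> c"
proof -
  obtain L where "compact L" "f ` K \<subseteq> L"
    using assms by (auto simp: compactological_hom_def complex_space_def)
  then have "bounded (f ` K)" using compact_imp_bounded bounded_subset by blast
  then show ?thesis by (auto simp: bounded_iff)
qed

lemma involutive_algebra_C: "involutive_algebra (C_alg S)"
proof (rule involutive_algebra_by_characters[of _ "(\<lambda>s f. f s) ` points S"])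
  fix f g assume f: "f \<in> carrier (C_alg S)" and g: "g \<in> carrier (C_alg S)"
  have cont: "continuous_map (ktop S K) euclidean f" "continuous_map (ktop S K) euclidean g"
    if "K \<in> compacta S" for K using f g C_alg_continuous that by auto
  have op: "(\<lambda>x\<in>points S. h (f x, g x)) \<in> compactological_hom S complex_space"
    if "continuous_on UNIV h" for h :: "complex \<times> complex \<Rightarrow> complex"
    by (intro C_alg_restrictI continuous_map_euclidean_compose2 cont that)
  have cont_op: "continuous_on UNIV (\<lambda>z :: complex \<times> complex. fst z + snd z)"
    "continuous_on UNIV (\<lambda>z :: complex \<times> complex. fst z * snd z)"
    "continuous_on UNIV (\<lambda>z :: complex \<times> complex. c * fst z)"
    "continuous_on UNIV (\<lambda>z :: complex \<times> complex. cnj (fst z))"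
    for c :: complex
    by (auto intro!: continuous_intros)
  show "f \<oplus>\<^bsub>C_alg S\<^esub> g \<in> carrier (C_alg S)" "f \<otimes>\<^bsub>C_alg S\<^esub> g \<in> carrier (C_alg S)"
    "invol (C_alg S) f \<in> carrier (C_alg S)"
    using op[OF cont_op(1)] op[OF cont_op(2)] op[OF cont_op(4)] by simp_all
  show "c \<odot>\<^bsub>C_alg S\<^esub> f \<in> carrier (C_alg S)" for c
    using op[OF cont_op(3)[of c]] by simp
  show "f = g" if "\<And>\<xi>. \<xi> \<in> (\<lambda>s f. f s) ` points S \<Longrightarrow> \<xi> f = \<xi> g"
    using that f g by (intro extensionalityI[of f "points S" g]) (auto dest: compactological_hom_extensional)
qed (auto intro!: C_alg_restrictI)

lemma function_algebra_C: "function_algebra (C_alg S) (compacta S)"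
proof (rule function_algebra.intro[OF involutive_algebra_C], unfold_locales)
  show "carrier (C_alg S) \<subseteq> extensional (\<Union>(compacta S))"
    by (auto simp: compacta_cover dest: compactological_hom_extensional)
  fix f and K :: "'s set"
  {
    fix g x assume "f \<in> carrier (C_alg S)" "g \<in> carrier (C_alg S)" "x \<in> \<Union>(compacta S)"
    then show "(f \<oplus>\<^bsub>C_alg S\<^esub> g) x = f x + g x" by (simp add: compacta_cover)
  next
    fix x c assume "x \<in> \<Union>(compacta S)"
    then show "(c \<odot>\<^bsub>C_alg S\<^esub> f) x = c * f x" by (simp add: compacta_cover)
  next
    assume "f \<in> carrier (C_alg S)" "K \<in> compacta S"
    then show "\<exists>c. \<forall>x\<in>K. norm (f x) \<le> c" by (simp add: C_alg_bounded)
  next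
    assume K: "K \<in> compacta S"
    have "cstar_seminorm (C_alg S) (\<lambda>f. sup_seminorm K (\<lambda>x. f x))"
      by (rule cstar_seminorm_sup[OF involutive_algebra_C])
        (use K C_alg_bounded compacta_subset_points[OF K] in auto)
    then show "cstar_seminorm (C_alg S) (sup_seminorm K)" by simp
  next
    assume f: "f \<in> extensional (\<Union>(compacta S))"
      and approx: "\<And>K e. K \<in> compacta S \<Longrightarrow> 0 < e \<Longrightarrow> \<exists>g\<in>carrier (C_alg S). \<forall>x\<in>K. norm (f x - g x) < e"
    show "f \<in> carrier (C_alg S)"
      unfolding C_alg_simps
    proof (rule C_algI)
      show "f \<in> extensional (points S)" using f by (simp add: compacta_cover)
      fix K assume K: "K \<in> compacta S"
      show "continuous_map (ktop S K) euclidean f"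
      proof (rule continuous_map_uniform_approx)
        fix e :: real assume "0 < e"
        then obtain g where "g \<in> compactological_hom S complex_space" "\<forall>x\<in>K. norm (f x - g x) < e"
          using approx[OF K] by auto
        then show "\<exists>g. continuous_map (ktop S K) euclidean g \<and> (\<forall>x\<in>topspace (ktop S K). norm (f x - g x) < e)"
          using C_alg_continuous K by (auto simp: ktop_topspace)
      qed
    qed
  }
qed (simp add: C_alg_def)

lemma kstar_algebra_C: "kstar_algebra (C_alg S)"
  by (rule function_algebra.kstar[OF function_algebra_C])

interpretation C: function_algebra "C_alg S" "compacta S"
  by (rule function_algebra_C)

lemma eval_space_apply [simp]:
  "s \<in> points S \<Longrightarrow> f \<in> compactological_hom S complex_space \<Longrightarrow> eval_space S s f = f s"
  by (simp add: eval_space_def)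

lemma eval_space_hermitian:
  assumes "s \<in> points S" shows "eval_space S s \<in> hermitian_hom (C_alg S) complex_kalg"
proof -
  interpret A: involutive_algebra "C_alg S" by (rule involutive_algebra_C)
  have "\<one>\<^bsub>C_alg S\<^esub> \<in> carrier (C_alg S)"
    "\<And>f g. f \<in> carrier (C_alg S) \<Longrightarrow> g \<in> carrier (C_alg S) \<Longrightarrow> f \<oplus>\<^bsub>C_alg S\<^esub> g \<in> carrier (C_alg S)"
    "\<And>f g. f \<in> carrier (C_alg S) \<Longrightarrow> g \<in> carrier (C_alg S) \<Longrightarrow> f \<otimes>\<^bsub>C_alg S\<^esub> g \<in> carrier (C_alg S)"
    "\<And>c f. f \<in> carrier (C_alg S) \<Longrightarrow> c \<odot>\<^bsub>C_alg S\<^esub> f \<in> carrier (C_alg S)"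
    "\<And>f. f \<in> carrier (C_alg S) \<Longrightarrow> invol (C_alg S) f \<in> carrier (C_alg S)"
    by (simp_all del: C_alg_simps)
  note closed = this
  show ?thesis
    unfolding hermitian_character_iff
    using assms closed[unfolded C_alg_simps] by (auto simp: eval_space_def)
qed

lemma eval_space_continuous:
  assumes K: "K \<in> compacta S" shows "continuous_map (ktop S K) euclidean (eval_space S)"
proof -
  have "continuous_map (ktop S K) euclidean (\<lambda>s. eval_space S s f)" for f
  proof (cases "f \<in> compactological_hom S complex_space")
    case True
    then show ?thesis
      using K compacta_subset_points[OF K] ktop_topspace[OF K]
      by (intro continuous_map_eq[OF C_alg_continuous[OF True K]]) auto
  next
    case False
    have "continuous_map (ktop S K) euclidean (\<lambda>_. undefined :: complex)" by simp
    then show ?thesis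
      by (rule continuous_map_eq)
        (use False K compacta_subset_points[OF K] ktop_topspace[OF K] in \<open>auto simp: eval_space_def\<close>)
  qed
  then have "continuous_map (ktop S K) (product_topology (\<lambda>_. euclidean) UNIV) (eval_space S)"
    by (auto simp: continuous_map_componentwise)
  then show ?thesis by (simp add: euclidean_product_topology)
qed

text \<open>The evaluations at points of \<open>K\<close> form a compact set of characters with
  supremum seminorm \<open>sup_seminorm K\<close>, so \<open>mem_of_character_le_sup\<close> leaves
  no other character bounded by it.\<close>

lemma X_p_sup_seminorm:
  assumes K: "K \<in> compacta S"
  shows "X_p (C_alg S) (sup_seminorm K) = eval_space S ` K"
proof (intro equalityI subsetI)
  have cs: "cstar_seminorm (C_alg S) (sup_seminorm K)" by (rule C.cstar_sup[OF K])
  have sub: "K \<subseteq> points S" by (rule compacta_subset_points[OF K])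
  fix \<xi> assume "\<xi> \<in> X_p (C_alg S) (sup_seminorm K)"
  then have \<xi>: "\<xi> \<in> hermitian_hom (C_alg S) complex_kalg"
    "\<forall>f\<in>carrier (C_alg S). norm (\<xi> f) \<le> sup_seminorm K f"
    unfolding C.X_p_iff[OF cs] by blast+
  show "\<xi> \<in> eval_space S ` K"
  proof (rule C.mem_of_character_le_sup[OF _ _ \<xi>(1)])
    have "compactin euclidean (eval_space S ` topspace (ktop S K))"
      using ktop_compact[OF K] by (intro image_compactin[OF _ eval_space_continuous[OF K]]) (simp add: compact_space_def)
    then show "compact (eval_space S ` K)" using ktop_topspace[OF K] by simp
    show "eval_space S ` K \<subseteq> hermitian_hom (C_alg S) complex_kalg"
      using eval_space_hermitian sub by blast
    fix f assume f: "f \<in> carrier (C_alg S)"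
    have "(\<lambda>\<eta>. norm (\<eta> f)) ` eval_space S ` K = (\<lambda>s. norm (f s)) ` K"
      unfolding image_image using f sub by (intro image_cong) auto
    then have "sup_seminorm (eval_space S ` K) (\<lambda>\<eta>. \<eta> f) = sup_seminorm K f"
      by (simp only: sup_seminorm_def)
    then show "norm (\<xi> f) \<le> sup_seminorm (eval_space S ` K) (\<lambda>\<eta>. \<eta> f)" using \<xi>(2) f by simp
  qed
next
  fix \<xi> assume "\<xi> \<in> eval_space S ` K"
  then obtain s where s: "s \<in> K" "\<xi> = eval_space S s" by blast
  have sS: "s \<in> points S" using s K compacta_subset_points by blast
  have "norm (\<xi> f) \<le> sup_seminorm K f" if "f \<in> carrier (C_alg S)" for f
    using C.norm_le_sup[OF that K s(1)] that s sS by simp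
  then show "\<xi> \<in> X_p (C_alg S) (sup_seminorm K)"
    unfolding C.X_p_iff[OF C.cstar_sup[OF K]] using eval_space_hermitian[OF sS] s by blast
qed

lemma X_p_C_alg_subset:
  assumes p: "p \<in> cont_cstar_seminorms (C_alg S)"
  obtains K where "K \<in> compacta S" "X_p (C_alg S) p \<subseteq> eval_space S ` K"
proof -
  obtain K where K: "K \<in> compacta S" "\<forall>f\<in>carrier (C_alg S). p f \<le> sup_seminorm K f"
    using C.continuous_characters_dominated[OF compacta_nonempty compacta_directed p] by blast
  have "X_p (C_alg S) p \<subseteq> X_p (C_alg S) (sup_seminorm K)"
    using K(2) by (intro C.X_p_mono C.CS_cstar[OF p] C.cstar_sup[OF K(1)]) auto
  then show thesis using that K(1) X_p_sup_seminorm[OF K(1)] by simp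
qed

lemma chars_C_alg: "kalg_hom (C_alg S) complex_kalg = eval_space S ` points S"
proof (intro equalityI subsetI)
  fix \<xi> assume "\<xi> \<in> kalg_hom (C_alg S) complex_kalg"
  then obtain p where p: "p \<in> C.CS" "\<xi> \<in> X_p (C_alg S) p" using C.chars_iff by blast
  obtain K where "K \<in> compacta S" "X_p (C_alg S) p \<subseteq> eval_space S ` K" using X_p_C_alg_subset[OF p(1)] by blast
  then show "\<xi> \<in> eval_space S ` points S" using p(2) compacta_subset_points by blast
next
  fix \<xi> assume "\<xi> \<in> eval_space S ` points S"
  then obtain s where s: "s \<in> points S" "\<xi> = eval_space S s" by blast
  obtain K where K: "K \<in> compacta S" "s \<in> K" using s compacta_cover by blast
  then have "\<xi> \<in> X_p (C_alg S) (sup_seminorm K)" using s X_p_sup_seminorm[OF K(1)] by blast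
  then show "\<xi> \<in> kalg_hom (C_alg S) complex_kalg"
    using C.chars_iff C.sup_seminorm_in_CS[OF K(1)] by blast
qed

end

section \<open>The completed injective tensor product\<close>

lemma cstar_seminorm_cong:
  assumes "involutive_algebra A" "\<And>x. x \<in> carrier A \<Longrightarrow> p x = q x" "cstar_seminorm A q"
  shows "cstar_seminorm A p"
proof -
  interpret involutive_algebra A by fact
  show ?thesis using assms(2,3) by (simp add: cstar_seminorm_def)
qed

context involutive_algebra
begin

lemma linear_functionalD:
  assumes "linear_functional A w"
  shows "x \<in> carrier A \<Longrightarrow> y \<in> carrier A \<Longrightarrow> w (x \<oplus> y) = w x + w y"
    and "x \<in> carrier A \<Longrightarrow> w (c \<odot> x) = c * w x" and "w \<zero> = 0"
proof -
  show *: "x \<in> carrier A \<Longrightarrow> w (c \<odot> x) = c * w x" for c x using assms by (simp add: linear_functional_def)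
  show "w \<zero> = 0" using *[of \<zero> 0] by simp
qed (use assms in \<open>simp add: linear_functional_def\<close>)

lemma X_p_subset_polar: "cstar_seminorm A p \<Longrightarrow> X_p A p \<subseteq> polar A p"
  by (auto simp: X_p_iff polar_def linear_functional_def hermitian_character_iff)

text \<open>The slice map: the tensor given by \<open>xs\<close> with \<open>v\<close> applied to
  its second factor.\<close>

definition lin_comb :: "('b \<Rightarrow> complex) \<Rightarrow> ('a \<times> 'b) list \<Rightarrow> 'a" where
  "lin_comb v xs = foldr (\<lambda>(a, b) s. v b \<odot> a \<oplus> s) xs \<zero>"

lemma lin_comb:
  assumes "fst ` set xs \<subseteq> carrier A"
  shows "lin_comb v xs \<in> carrier A"
    and "linear_functional A w \<Longrightarrow> w (lin_comb v xs) = (\<Sum>(a, b)\<leftarrow>xs. w a * v b)"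
proof -
  have *: "lin_comb v xs \<in> carrier A \<and>
      (linear_functional A w \<longrightarrow> w (lin_comb v xs) = (\<Sum>(a, b)\<leftarrow>xs. w a * v b))"
    using assms by (induction xs) (auto simp: lin_comb_def linear_functionalD)
  then show "lin_comb v xs \<in> carrier A"
    "linear_functional A w \<Longrightarrow> w (lin_comb v xs) = (\<Sum>(a, b)\<leftarrow>xs. w a * v b)" by auto
qed

lemma continuous_map_mult_seminorm_top:
  assumes cs: "\<And>p. p \<in> P \<Longrightarrow> cstar_seminorm A p"
  shows "continuous_map (prod_topology (seminorm_top P) (seminorm_top P)) (seminorm_top P) (\<lambda>(x, y). x \<otimes> y)"
proof (rule continuous_map_into_seminorm_top[OF cs])
  fix p z and e :: real
  assume p: "p \<in> P" and z: "z \<in> topspace (prod_topology (seminorm_top P) (seminorm_top P))" and "0 < e"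
  obtain x y where xy: "z = (x, y)" "x \<in> carrier A" "y \<in> carrier A" using z by auto
  interpret p: cstar_seminorm_on A p using cs[OF p] cstar_on by blast
  \<comment> \<open>The difference of the products is at most
    \<open>d * (p y + 1) + p x * d\<close>, where \<open>d \<le> 1\<close> bounds
    \<open>p y'\<close> by \<open>p y + 1\<close>; the second argument of \<open>min\<close> keeps
    this below \<open>e\<close>.\<close>
  define d where "d = min 1 (e / (2 * (p x + p y + 2)))"
  have pos: "p x + p y + 2 > 0" using p.nonneg[OF xy(2)] p.nonneg[OF xy(3)] by linarith
  have d: "d > 0" "d \<le> 1" using \<open>0 < e\<close> pos by (auto simp: d_def)
  have d_le: "d * (p x + p y + 2) \<le> e / 2"
  proof -
    have "d \<le> e / (2 * (p x + p y + 2))" by (simp add: d_def)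
    then show ?thesis using pos by (simp add: field_simps)
  qed
  let ?U = "{w \<in> carrier A. p (w \<ominus> x) < d} \<times> {w \<in> carrier A. p (w \<ominus> y) < d}"
  have "p (x' \<otimes> y' \<ominus> x \<otimes> y) < e"
    if x': "x' \<in> carrier A" "p (x' \<ominus> x) < d" and y': "y' \<in> carrier A" "p (y' \<ominus> y) < d" for x' y'
  proof -
    have eq: "x' \<otimes> y' \<ominus> x \<otimes> y = (x' \<ominus> x) \<otimes> y' \<oplus> x \<otimes> (y' \<ominus> y)"
      using x' y' xy by (simp add: a_minus_def l_distr r_distr l_minus r_minus M.a_assoc M.r_neg1)
    have "p y' \<le> p y + 1" using p.le_diff_add[OF y'(1) xy(3)] y' d by linarith
    then have "p (x' \<ominus> x) * p y' \<le> d * (p y + 1)"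
      using x' y' xy d by (intro mult_mono) auto
    moreover have "p x * p (y' \<ominus> y) \<le> p x * d" using x' y' xy by (intro mult_left_mono) auto
    moreover have "p (x' \<otimes> y' \<ominus> x \<otimes> y) \<le> p (x' \<ominus> x) * p y' + p x * p (y' \<ominus> y)"
      unfolding eq using p.triangle[of "(x' \<ominus> x) \<otimes> y'" "x \<otimes> (y' \<ominus> y)"]
        p.submultiplicative[of "x' \<ominus> x" y'] p.submultiplicative[of x "y' \<ominus> y"] x' y' xy by simp
    ultimately have "p (x' \<otimes> y' \<ominus> x \<otimes> y) \<le> d * (p x + p y + 2) - d"
      by (simp add: algebra_simps)
    then show ?thesis using d_le d \<open>0 < e\<close> by linarith
  qed
  moreover have "openin (prod_topology (seminorm_top P) (seminorm_top P)) ?U"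
    unfolding openin_prod_Times_iff using p xy d by (auto intro!: openin_seminorm_ball)
  ultimately show "\<exists>U. openin (prod_topology (seminorm_top P) (seminorm_top P)) U \<and> z \<in> U \<and>
      (\<forall>w\<in>U. p ((case w of (x, y) \<Rightarrow> x \<otimes> y) \<ominus> (case z of (x, y) \<Rightarrow> x \<otimes> y)) < e)"
    using xy d by (intro exI[of _ ?U]) auto
qed auto

lemma continuous_map_invol_seminorm_top:
  assumes cs: "\<And>p. p \<in> P \<Longrightarrow> cstar_seminorm A p"
  shows "continuous_map (seminorm_top P) (seminorm_top P) (invol A)"
proof (rule continuous_map_into_seminorm_top[OF cs])
  fix p x and e :: real assume p: "p \<in> P" and "x \<in> topspace (seminorm_top P)" and "0 < e"
  then have x: "x \<in> carrier A" by simp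
  interpret p: cstar_seminorm_on A p using cs[OF p] cstar_on by blast
  have "p (invol A y \<ominus> invol A x) = p (y \<ominus> x)" if "y \<in> carrier A" for y
    using that x p.of_invol[of "y \<ominus> x"] by (simp add: invol_diff)
  then show "\<exists>U. openin (seminorm_top P) U \<and> x \<in> U \<and> (\<forall>y\<in>U. p (invol A y \<ominus> invol A x) < e)"
    using x \<open>0 < e\<close> p openin_seminorm_ball[OF p x \<open>0 < e\<close>, of "\<lambda>x y. x \<ominus> y"]
    by (intro exI[of _ "{y \<in> carrier A. p (y \<ominus> x) < e}"]) auto
qed auto

end

lemma tensor_simps [simp]:
  "carrier (tensor A B) = tensor_carrier A B"
  "one (tensor A B) = elem_tensor A B \<one>\<^bsub>A\<^esub> \<one>\<^bsub>B\<^esub>"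
  "zero (tensor A B) = (\<lambda>w\<in>dual_ball A \<times> dual_ball B. 0)"
  "add (tensor A B) = (\<lambda>F G. \<lambda>w\<in>dual_ball A \<times> dual_ball B. F w + G w)"
  "smult (tensor A B) = (\<lambda>c F. \<lambda>w\<in>dual_ball A \<times> dual_ball B. c * F w)"
  "mult (tensor A B) = tensor_mult A B" "invol (tensor A B) = tensor_invol A B"
  "topol (tensor A B) = tensor_topology A B"
  by (simp_all add: tensor_def)

lemma tensor_sum_apply:
  "w \<in> dual_ball A \<Longrightarrow> v \<in> dual_ball B \<Longrightarrow> tensor_sum A B xs (w, v) = (\<Sum>(a, b)\<leftarrow>xs. w a * v b)"
  by (simp add: tensor_sum_def)

lemma tensor_sum_extensional: "tensor_sum A B xs \<in> extensional (dual_ball A \<times> dual_ball B)"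
  by (simp add: tensor_sum_def)

lemma tensor_carrier_extensional: "F \<in> tensor_carrier A B \<Longrightarrow> F \<in> extensional (dual_ball A \<times> dual_ball B)"
  by (simp add: tensor_carrier_def)

definition polar_products :: "('a, 'm) kalg_scheme \<Rightarrow> ('b, 'n) kalg_scheme \<Rightarrow> (('a \<Rightarrow> complex) \<times> ('b \<Rightarrow> complex)) set set" where
  "polar_products A B = {polar A p \<times> polar B q | p q. p \<in> cont_cstar_seminorms A \<and> q \<in> cont_cstar_seminorms B}"

text \<open>At a pair of characters this is the character of the completed tensor product with a
  \<otimes> b \<mapsto> \<xi>(a) \<eta>(b).\<close>

definition pair_char :: "('a, 'm) kalg_scheme \<Rightarrow> ('b, 'n) kalg_scheme \<Rightarrow> ('a \<Rightarrow> complex) \<times> ('b \<Rightarrow> complex)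
    \<Rightarrow> (('a \<Rightarrow> complex) \<times> ('b \<Rightarrow> complex) \<Rightarrow> complex) \<Rightarrow> complex" where
  "pair_char A B w = (\<lambda>F\<in>tensor_carrier A B. F w)"

lemma Union_polar_products: "\<Union>(polar_products A B) = dual_ball A \<times> dual_ball B"
  by (auto simp: polar_products_def dual_ball_def)

lemma sum_list_product_list:
  fixes \<xi> :: "'a \<Rightarrow> complex" and \<eta> :: "'b \<Rightarrow> complex"
  assumes "\<And>a a'. a \<in> fst ` set xs \<Longrightarrow> a' \<in> fst ` set ys \<Longrightarrow> \<xi> (f a a') = \<xi> a * \<xi> a'"
    and "\<And>b b'. b \<in> snd ` set xs \<Longrightarrow> b' \<in> snd ` set ys \<Longrightarrow> \<eta> (g b b') = \<eta> b * \<eta> b'"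
  shows "(\<Sum>(a, b)\<leftarrow>[(f a a', g b b'). (a, b) \<leftarrow> xs, (a', b') \<leftarrow> ys]. \<xi> a * \<eta> b) =
    (\<Sum>(a, b)\<leftarrow>xs. \<xi> a * \<eta> b) * (\<Sum>(a, b)\<leftarrow>ys. \<xi> a * \<eta> b)"
  using assms
proof (induction xs)
  case (Cons x xs)
  note outer = Cons.prems
  obtain a b where x: "x = (a, b)" by (cases x)
  have inner: "(\<Sum>(a, b)\<leftarrow>map (\<lambda>(a', b'). (f a a', g b b')) zs. \<xi> a * \<eta> b) =
      \<xi> a * \<eta> b * (\<Sum>(a, b)\<leftarrow>zs. \<xi> a * \<eta> b)" if "set zs \<subseteq> set ys" for zs
    using that
  proof (induction zs)
    case (Cons z zs)
    obtain a' b' where z: "z = (a', b')" by (cases z)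
    have "(a', b') \<in> set ys" using Cons.prems z by simp
    then have "a' \<in> fst ` set ys" "b' \<in> snd ` set ys" by force+
    then show ?case
      using Cons.IH Cons.prems outer(1)[of a a'] outer(2)[of b b'] by (simp add: x z distrib_left)
  qed simp
  have IH: "(\<Sum>(a, b)\<leftarrow>[(f a a', g b b'). (a, b) \<leftarrow> xs, (a', b') \<leftarrow> ys]. \<xi> a * \<eta> b) =
    (\<Sum>(a, b)\<leftarrow>xs. \<xi> a * \<eta> b) * (\<Sum>(a, b)\<leftarrow>ys. \<xi> a * \<eta> b)"
    using Cons.prems by (intro Cons.IH) auto
  show ?case using inner[OF subset_refl] IH by (simp add: x distrib_right del: map_map)
qed simp

locale kstar_pair = A: kstar_algebra A + B: kstar_algebra B
  for A :: "('a, 'm) kalg_scheme" and B :: "('b, 'n) kalg_scheme"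
begin

abbreviation tensors where "tensors \<equiv> lists (carrier A \<times> carrier B)"

lemma tensorsD:
  assumes "xs \<in> tensors"
  shows "fst ` set xs \<subseteq> carrier A" "fst ` set (map prod.swap xs) \<subseteq> carrier B" "snd ` set xs \<subseteq> carrier B"
  using assms by (auto simp: in_lists_conv_set)

lemma polar_dual_ball: "p \<in> A.CS \<Longrightarrow> polar A p \<subseteq> dual_ball A" "q \<in> B.CS \<Longrightarrow> polar B q \<subseteq> dual_ball B"
  by (auto simp: dual_ball_def)

lemma X_p_polar: "p \<in> A.CS \<Longrightarrow> X_p A p \<subseteq> polar A p" "q \<in> B.CS \<Longrightarrow> X_p B q \<subseteq> polar B q"
  using A.X_p_subset_polar A.CS_cstar B.X_p_subset_polar B.CS_cstar by blast+

lemma X_p_dual_ball: "p \<in> A.CS \<Longrightarrow> X_p A p \<subseteq> dual_ball A" "q \<in> B.CS \<Longrightarrow> X_p B q \<subseteq> dual_ball B"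
  using X_p_polar polar_dual_ball by blast+

lemma chars_dual_ball: "A.chars \<subseteq> dual_ball A" "B.chars \<subseteq> dual_ball B"
  using X_p_dual_ball A.chars_iff B.chars_iff by blast+

lemma chars_X_p:
  assumes "\<xi> \<in> A.chars" "\<eta> \<in> B.chars"
  obtains p q where "p \<in> A.CS" "q \<in> B.CS" "\<xi> \<in> X_p A p" "\<eta> \<in> X_p B q"
  using assms A.chars_iff B.chars_iff by blast

lemma polar_products_nonempty: "polar_products A B \<noteq> {}"
  using A.CS_zero B.CS_zero by (auto simp: polar_products_def)

lemma CS_pair_directed:
  assumes "p \<in> A.CS" "q \<in> B.CS" "p' \<in> A.CS" "q' \<in> B.CS"
  obtains r s where "r \<in> A.CS" "s \<in> B.CS" "polar A p \<times> polar B q \<union> polar A p' \<times> polar B q' \<subseteq> polar A r \<times> polar B s"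
    "X_p A p \<times> X_p B q \<union> X_p A p' \<times> X_p B q' \<subseteq> X_p A r \<times> X_p B s"
proof -
  obtain r where r: "r \<in> A.CS" "\<forall>x\<in>carrier A. p x \<le> r x \<and> p' x \<le> r x" using A.CS_directed assms by blast
  obtain s where s: "s \<in> B.CS" "\<forall>x\<in>carrier B. q x \<le> s x \<and> q' x \<le> s x" using B.CS_directed assms by blast
  have "polar A p \<subseteq> polar A r" "polar A p' \<subseteq> polar A r" "polar B q \<subseteq> polar B s" "polar B q' \<subseteq> polar B s"
    using r(2) s(2) unfolding polar_def by (auto intro: order_trans)
  moreover have "X_p A p \<subseteq> X_p A r"
    by (rule A.X_p_mono[OF A.CS_cstar[OF assms(1)] A.CS_cstar[OF r(1)]]) (use r(2) in blast)
  moreover have "X_p A p' \<subseteq> X_p A r"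
    by (rule A.X_p_mono[OF A.CS_cstar[OF assms(3)] A.CS_cstar[OF r(1)]]) (use r(2) in blast)
  moreover have "X_p B q \<subseteq> X_p B s"
    by (rule B.X_p_mono[OF B.CS_cstar[OF assms(2)] B.CS_cstar[OF s(1)]]) (use s(2) in blast)
  moreover have "X_p B q' \<subseteq> X_p B s"
    by (rule B.X_p_mono[OF B.CS_cstar[OF assms(4)] B.CS_cstar[OF s(1)]]) (use s(2) in blast)
  ultimately have "polar A p \<times> polar B q \<union> polar A p' \<times> polar B q' \<subseteq> polar A r \<times> polar B s"
    "X_p A p \<times> X_p B q \<union> X_p A p' \<times> X_p B q' \<subseteq> X_p A r \<times> X_p B s" by blast+
  then show thesis using that r(1) s(1) by blast
qed

lemma polar_products_directed:
  "K \<in> polar_products A B \<Longrightarrow> L \<in> polar_products A B \<Longrightarrow> \<exists>M\<in>polar_products A B. K \<union> L \<subseteq> M"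
  by (clarsimp simp: polar_products_def) (metis CS_pair_directed Un_subset_iff)

text \<open>The norm in \<open>A\<close> of \<open>\<Sum> v(b\<^sub>j) a\<^sub>j\<close> is attained on characters, and then so is that of \<open>\<Sum> \<xi>(a\<^sub>j) b\<^sub>j\<close>
  in \<open>B\<close>; so the injective norm is a supremum over pairs of characters.\<close>

lemma tensor_sum_bound:
  assumes p: "p \<in> A.CS" and q: "q \<in> B.CS" and xs: "xs \<in> tensors" and "0 \<le> c"
    and le: "\<And>\<xi> \<eta>. \<xi> \<in> X_p A p \<Longrightarrow> \<eta> \<in> X_p B q \<Longrightarrow> norm (tensor_sum A B xs (\<xi>, \<eta>)) \<le> c"
    and w: "w \<in> polar A p" and v: "v \<in> polar B q"
  shows "norm (tensor_sum A B xs (w, v)) \<le> c"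
proof -
  let ?ys = "map prod.swap xs"
  have swap: "(\<Sum>(b, a)\<leftarrow>?ys. y b * x a) = (\<Sum>(a, b)\<leftarrow>xs. x a * y b)" for x :: "'a \<Rightarrow> complex" and y :: "'b \<Rightarrow> complex"
    by (induction xs) (auto simp: mult.commute)
  have lf: "linear_functional A u" if "u \<in> polar A p" for u using that by (simp add: polar_def)
  have lf': "linear_functional B u" if "u \<in> polar B q" for u using that by (simp add: polar_def)
  have "p (A.lin_comb v xs) \<le> c"
  proof (rule A.seminorm_le_of_characters[OF A.CS_cstar[OF p]])
    fix \<xi> assume \<xi>: "\<xi> \<in> X_p A p"
    have "q (B.lin_comb \<xi> ?ys) \<le> c"
    proof (rule B.seminorm_le_of_characters[OF B.CS_cstar[OF q]])
      fix \<eta> assume \<eta>: "\<eta> \<in> X_p B q"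
      have "\<eta> (B.lin_comb \<xi> ?ys) = (\<Sum>(b, a)\<leftarrow>?ys. \<eta> b * \<xi> a)"
        using \<eta> X_p_polar(2)[OF q] by (intro B.lin_comb(2) tensorsD(2)[OF xs] lf') blast
      also have "\<dots> = tensor_sum A B xs (\<xi>, \<eta>)"
        using \<xi> \<eta> X_p_dual_ball(1)[OF p] X_p_dual_ball(2)[OF q] unfolding swap
        by (subst tensor_sum_apply) auto
      finally show "norm (\<eta> (B.lin_comb \<xi> ?ys)) \<le> c" using le[OF \<xi> \<eta>] by simp
    qed (use \<open>0 \<le> c\<close> B.lin_comb(1)[OF tensorsD(2)[OF xs]] in auto)
    moreover have "norm (v (B.lin_comb \<xi> ?ys)) \<le> q (B.lin_comb \<xi> ?ys)"
      using v B.lin_comb(1)[OF tensorsD(2)[OF xs]] by (simp add: polar_def)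
    moreover have "v (B.lin_comb \<xi> ?ys) = (\<Sum>(a, b)\<leftarrow>xs. \<xi> a * v b)"
      by (subst B.lin_comb(2)[OF tensorsD(2)[OF xs] lf'[OF v]]) (rule swap)
    moreover have "\<xi> (A.lin_comb v xs) = (\<Sum>(a, b)\<leftarrow>xs. \<xi> a * v b)"
      using \<xi> X_p_polar(1)[OF p] by (intro A.lin_comb(2) tensorsD(1)[OF xs] lf) blast
    ultimately show "norm (\<xi> (A.lin_comb v xs)) \<le> c" by simp
  qed (use \<open>0 \<le> c\<close> A.lin_comb(1)[OF tensorsD(1)[OF xs]] in auto)
  moreover have "norm (w (A.lin_comb v xs)) \<le> p (A.lin_comb v xs)"
    using w A.lin_comb(1)[OF tensorsD(1)[OF xs]] by (simp add: polar_def)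
  moreover have "w (A.lin_comb v xs) = tensor_sum A B xs (w, v)"
    using w v polar_dual_ball(1)[OF p] polar_dual_ball(2)[OF q]
    by (subst A.lin_comb(2)[OF tensorsD(1)[OF xs] lf[OF w]], subst tensor_sum_apply) auto
  ultimately show ?thesis by simp
qed

lemma approximation_by_tensors:
  assumes "F \<in> tensor_carrier A B" "p \<in> A.CS" "q \<in> B.CS" "0 < e"
  obtains xs where "xs \<in> tensors" "\<And>w. w \<in> polar A p \<times> polar B q \<Longrightarrow> norm (F w - tensor_sum A B xs w) < e"
proof -
  have "\<exists>xs\<in>tensors. \<forall>w\<in>polar A p \<times> polar B q. norm (F w - tensor_sum A B xs w) < e"
    using assms unfolding tensor_carrier_def by blast
  then show thesis using that by blast
qed

lemma tensor_carrierI: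
  assumes "F \<in> extensional (dual_ball A \<times> dual_ball B)"
    and "\<And>p q e. p \<in> A.CS \<Longrightarrow> q \<in> B.CS \<Longrightarrow> 0 < e \<Longrightarrow>
      \<exists>xs\<in>tensors. \<forall>w\<in>polar A p \<times> polar B q. norm (F w - tensor_sum A B xs w) < e"
  shows "F \<in> tensor_carrier A B"
  using assms unfolding tensor_carrier_def by blast

text \<open>Carries \<open>tensor_sum_bound\<close> to the completion: approximating within
  \<open>e / 2\<close> costs \<open>e / 2\<close> at the pairs of characters and again at
  \<open>w\<close>.\<close>

lemma tensor_bound:
  assumes F: "F \<in> tensor_carrier A B" and p: "p \<in> A.CS" and q: "q \<in> B.CS" and "0 \<le> c"
    and le: "\<And>\<xi> \<eta>. \<xi> \<in> X_p A p \<Longrightarrow> \<eta> \<in> X_p B q \<Longrightarrow> norm (F (\<xi>, \<eta>)) \<le> c"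
    and w: "w \<in> polar A p \<times> polar B q"
  shows "norm (F w) \<le> c"
proof (rule field_le_epsilon)
  fix e :: real assume "0 < e"
  then obtain xs where xs: "xs \<in> tensors"
    "\<And>w. w \<in> polar A p \<times> polar B q \<Longrightarrow> norm (F w - tensor_sum A B xs w) < e / 2"
    using approximation_by_tensors[OF F p q half_gt_zero] by blast
  obtain w1 w2 where w12: "w = (w1, w2)" "w1 \<in> polar A p" "w2 \<in> polar B q" using w by blast
  have "norm (tensor_sum A B xs (w1, w2)) \<le> c + e / 2"
  proof (rule tensor_sum_bound[OF p q xs(1) _ _ w12(2,3)])
    fix \<xi> \<eta> assume \<xi>: "\<xi> \<in> X_p A p" "\<eta> \<in> X_p B q"
    then have "(\<xi>, \<eta>) \<in> polar A p \<times> polar B q" using X_p_polar p q by blast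
    from xs(2)[OF this] le[OF \<xi>] show "norm (tensor_sum A B xs (\<xi>, \<eta>)) \<le> c + e / 2"
      using norm_triangle_ineq2[of "tensor_sum A B xs (\<xi>, \<eta>)" "F (\<xi>, \<eta>)"] by (simp add: norm_minus_commute)
  qed (use \<open>0 \<le> c\<close> \<open>0 < e\<close> in simp)
  then show "norm (F w) \<le> c + e"
    using xs(2)[OF w] norm_triangle_ineq2[of "F w" "tensor_sum A B xs w"] by (simp add: w12(1))
qed

lemma tensor_sum_in_carrier: "xs \<in> tensors \<Longrightarrow> tensor_sum A B xs \<in> tensor_carrier A B"
  by (rule tensor_carrierI[OF tensor_sum_extensional]) (auto intro!: bexI[of _ xs])

lemma tensor_add_in_carrier:
  assumes F: "F \<in> tensor_carrier A B" and G: "G \<in> tensor_carrier A B"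
  shows "(\<lambda>w\<in>dual_ball A \<times> dual_ball B. F w + G w) \<in> tensor_carrier A B"
proof (rule tensor_carrierI)
  fix p q and e :: real assume pq: "p \<in> A.CS" "q \<in> B.CS" and "0 < e"
  obtain xs where xs: "xs \<in> tensors" "\<And>w. w \<in> polar A p \<times> polar B q \<Longrightarrow> norm (F w - tensor_sum A B xs w) < e / 2"
    using approximation_by_tensors[OF F pq half_gt_zero[OF \<open>0 < e\<close>]] by blast
  obtain ys where ys: "ys \<in> tensors" "\<And>w. w \<in> polar A p \<times> polar B q \<Longrightarrow> norm (G w - tensor_sum A B ys w) < e / 2"
    using approximation_by_tensors[OF G pq half_gt_zero[OF \<open>0 < e\<close>]] by blast
  have "norm ((\<lambda>w\<in>dual_ball A \<times> dual_ball B. F w + G w) w - tensor_sum A B (xs @ ys) w) < e"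
    if w: "w \<in> polar A p \<times> polar B q" for w
  proof -
    have wD: "w \<in> dual_ball A \<times> dual_ball B" using w polar_dual_ball pq by blast
    then have eq: "(\<lambda>w\<in>dual_ball A \<times> dual_ball B. F w + G w) w - tensor_sum A B (xs @ ys) w =
        (F w - tensor_sum A B xs w) + (G w - tensor_sum A B ys w)"
      by (auto simp: tensor_sum_def)
    show ?thesis
      unfolding eq
      using xs(2)[OF w] ys(2)[OF w] norm_triangle_ineq[of "F w - tensor_sum A B xs w" "G w - tensor_sum A B ys w"]
      by linarith
  qed
  then show "\<exists>xs\<in>tensors. \<forall>w\<in>polar A p \<times> polar B q.
      norm ((\<lambda>w\<in>dual_ball A \<times> dual_ball B. F w + G w) w - tensor_sum A B xs w) < e"
    using xs(1) ys(1) by (intro bexI[of _ "xs @ ys"]) auto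
qed simp

lemma tensor_smult_in_carrier:
  assumes F: "F \<in> tensor_carrier A B"
  shows "(\<lambda>w\<in>dual_ball A \<times> dual_ball B. c * F w) \<in> tensor_carrier A B"
proof (rule tensor_carrierI)
  fix p q and e :: real assume pq: "p \<in> A.CS" "q \<in> B.CS" and "0 < e"
  have pos: "0 < e / (norm c + 1)" using \<open>0 < e\<close> by (intro divide_pos_pos add_nonneg_pos) auto
  obtain xs where xs: "xs \<in> tensors"
    "\<And>w. w \<in> polar A p \<times> polar B q \<Longrightarrow> norm (F w - tensor_sum A B xs w) < e / (norm c + 1)"
    using approximation_by_tensors[OF F pq pos] by blast
  let ?ys = "map (\<lambda>(a, b). (c \<odot>\<^bsub>A\<^esub> a, b)) xs"
  have "norm ((\<lambda>w\<in>dual_ball A \<times> dual_ball B. c * F w) w - tensor_sum A B ?ys w) < e"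
    if w: "w \<in> polar A p \<times> polar B q" for w
  proof -
    obtain w1 w2 where w12: "w = (w1, w2)" "w1 \<in> polar A p" "w2 \<in> polar B q" using w by blast
    have wD: "w1 \<in> dual_ball A" "w2 \<in> dual_ball B" using w12 polar_dual_ball pq by blast+
    have "(\<Sum>(a, b)\<leftarrow>?ys. w1 a * w2 b) = c * (\<Sum>(a, b)\<leftarrow>xs. w1 a * w2 b)"
      using xs(1) w12(2) by (induction xs) (auto simp: polar_def linear_functional_def distrib_left)
    then have "(\<lambda>w\<in>dual_ball A \<times> dual_ball B. c * F w) w - tensor_sum A B ?ys w = c * (F w - tensor_sum A B xs w)"
      using wD w12 by (simp add: tensor_sum_apply right_diff_distrib)
    then have "norm ((\<lambda>w\<in>dual_ball A \<times> dual_ball B. c * F w) w - tensor_sum A B ?ys w) =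
        norm c * norm (F w - tensor_sum A B xs w)" by (simp only: norm_mult)
    also have "\<dots> \<le> norm c * (e / (norm c + 1))" using xs(2)[OF w] by (intro mult_left_mono) auto
    also have "\<dots> < e" using \<open>0 < e\<close> by (simp add: field_simps add_pos_nonneg)
    finally show ?thesis .
  qed
  moreover have "?ys \<in> tensors" using xs(1) by (auto simp: in_lists_conv_set)
  ultimately show "\<exists>xs\<in>tensors. \<forall>w\<in>polar A p \<times> polar B q.
      norm ((\<lambda>w\<in>dual_ball A \<times> dual_ball B. c * F w) w - tensor_sum A B xs w) < e"
    by blast
qed simp

lemma tensor_diff_bound:
  assumes F: "F \<in> tensor_carrier A B" and G: "G \<in> tensor_carrier A B"
    and p: "p \<in> A.CS" and q: "q \<in> B.CS" and "0 \<le> c"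
    and le: "\<And>\<xi> \<eta>. \<xi> \<in> X_p A p \<Longrightarrow> \<eta> \<in> X_p B q \<Longrightarrow> norm (F (\<xi>, \<eta>) - G (\<xi>, \<eta>)) \<le> c"
    and w: "w \<in> polar A p \<times> polar B q"
  shows "norm (F w - G w) \<le> c"
proof -
  define H where "H = (\<lambda>w\<in>dual_ball A \<times> dual_ball B. F w + (\<lambda>w\<in>dual_ball A \<times> dual_ball B. (-1) * G w) w)"
  have H: "H \<in> tensor_carrier A B" unfolding H_def by (intro tensor_add_in_carrier tensor_smult_in_carrier F G)
  have "norm (H w) \<le> c"
  proof (rule tensor_bound[OF H p q \<open>0 \<le> c\<close> _ w])
    fix \<xi> \<eta> assume "\<xi> \<in> X_p A p" "\<eta> \<in> X_p B q"
    then show "norm (H (\<xi>, \<eta>)) \<le> c"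
      using le X_p_dual_ball(1)[OF p] X_p_dual_ball(2)[OF q] by (auto simp: H_def subset_eq)
  qed
  moreover have "w \<in> dual_ball A \<times> dual_ball B" using w polar_dual_ball p q by blast
  ultimately show ?thesis by (simp add: H_def)
qed

text \<open>The case of bound 0 in \<open>tensor_diff_bound\<close>. Although elements are functions
  on all pairs of functionals, pairs of characters suffice to identify them, so operations may be
  specified there.\<close>

lemma tensor_eqI:
  assumes F: "F \<in> tensor_carrier A B" and G: "G \<in> tensor_carrier A B"
    and eq: "\<And>\<xi> \<eta>. \<xi> \<in> A.chars \<Longrightarrow> \<eta> \<in> B.chars \<Longrightarrow> F (\<xi>, \<eta>) = G (\<xi>, \<eta>)"
  shows "F = G"
proof (rule extensionalityI)
  show "F \<in> extensional (dual_ball A \<times> dual_ball B)" "G \<in> extensional (dual_ball A \<times> dual_ball B)"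
    using F G by (auto dest: tensor_carrier_extensional)
  fix w assume "w \<in> dual_ball A \<times> dual_ball B"
  then obtain p q where pq: "p \<in> A.CS" "q \<in> B.CS" "w \<in> polar A p \<times> polar B q" by (auto simp: dual_ball_def)
  have "norm (F w - G w) \<le> 0"
  proof (rule tensor_diff_bound[OF F G pq(1,2) _ _ pq(3)])
    fix \<xi> \<eta> assume "\<xi> \<in> X_p A p" "\<eta> \<in> X_p B q"
    then have "F (\<xi>, \<eta>) = G (\<xi>, \<eta>)"
      using A.X_p_subset_chars[OF pq(1)] B.X_p_subset_chars[OF pq(2)] by (intro eq) blast+
    then show "norm (F (\<xi>, \<eta>) - G (\<xi>, \<eta>)) \<le> 0" by simp
  qed simp
  then show "F w = G w" by simp
qed

lemma tensor_continuous:
  assumes F: "F \<in> tensor_carrier A B" and p: "p \<in> A.CS" and q: "q \<in> B.CS"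
  shows "continuous_on (X_p A p \<times> X_p B q) F"
proof -
  have "continuous_map (top_of_set (X_p A p \<times> X_p B q)) euclidean F"
  proof (rule continuous_map_uniform_approx)
    fix e :: real assume "0 < e"
    then obtain xs where xs: "xs \<in> tensors"
      "\<And>w. w \<in> polar A p \<times> polar B q \<Longrightarrow> norm (F w - tensor_sum A B xs w) < e"
      using approximation_by_tensors[OF F p q] by blast
    have "continuous_on (X_p A p \<times> X_p B q) (\<lambda>w. \<Sum>(a, b)\<leftarrow>xs. fst w a * snd w b)"
    proof (induction xs)
      case (Cons x xs)
      have fst: "continuous_on S (\<lambda>w. fst w a)" and snd: "continuous_on S (\<lambda>w. snd w b)"
        for a b and S :: "(('a \<Rightarrow> complex) \<times> ('b \<Rightarrow> complex)) set"
        using continuous_on_compose2[OF continuous_on_coordinate[of UNIV a] continuous_on_fst[OF continuous_on_id, of S]]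
          continuous_on_compose2[OF continuous_on_coordinate[of UNIV b] continuous_on_snd[OF continuous_on_id, of S]] by auto
      show ?case
        using Cons by (cases x) (auto intro!: continuous_on_add continuous_on_mult fst snd)
    qed auto
    then have "continuous_on (X_p A p \<times> X_p B q) (tensor_sum A B xs)"
      by (rule continuous_on_cong[OF refl, THEN iffD1, rotated])
        (use X_p_dual_ball(1)[OF p] X_p_dual_ball(2)[OF q] in \<open>auto simp: tensor_sum_def subset_eq\<close>)
    moreover have "norm (F w - tensor_sum A B xs w) < e" if "w \<in> X_p A p \<times> X_p B q" for w
      using that X_p_polar p q by (intro xs(2)) blast
    ultimately show "\<exists>g. continuous_map (top_of_set (X_p A p \<times> X_p B q)) euclidean g \<and>
        (\<forall>w\<in>topspace (top_of_set (X_p A p \<times> X_p B q)). norm (F w - g w) < e)"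
      by (intro exI[of _ "tensor_sum A B xs"]) auto
  qed
  then show ?thesis by simp
qed

lemma tensor_sum_product:
  assumes xs: "xs \<in> tensors" and ys: "ys \<in> tensors" and \<xi>: "\<xi> \<in> A.chars" and \<eta>: "\<eta> \<in> B.chars"
  shows "tensor_sum A B [(a \<otimes>\<^bsub>A\<^esub> a', b \<otimes>\<^bsub>B\<^esub> b'). (a, b) \<leftarrow> xs, (a', b') \<leftarrow> ys] (\<xi>, \<eta>) =
    tensor_sum A B xs (\<xi>, \<eta>) * tensor_sum A B ys (\<xi>, \<eta>)"
proof -
  have herm: "\<xi> \<in> hermitian_hom A complex_kalg" "\<eta> \<in> hermitian_hom B complex_kalg"
    using \<xi> \<eta> by (auto simp: kalg_hom_def)
  have D: "\<xi> \<in> dual_ball A" "\<eta> \<in> dual_ball B" using \<xi> \<eta> chars_dual_ball by blast+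
  show ?thesis
    unfolding tensor_sum_apply[OF D]
  proof (rule sum_list_product_list)
    fix a a' assume "a \<in> fst ` set xs" "a' \<in> fst ` set ys"
    then have "a \<in> carrier A" "a' \<in> carrier A" using tensorsD(1)[OF xs] tensorsD(1)[OF ys] by blast+
    then show "\<xi> (a \<otimes>\<^bsub>A\<^esub> a') = \<xi> a * \<xi> a'" by (rule characterD(4)[OF herm(1)])
  next
    fix b b' assume "b \<in> snd ` set xs" "b' \<in> snd ` set ys"
    then have "b \<in> carrier B" "b' \<in> carrier B" using tensorsD(3)[OF xs] tensorsD(3)[OF ys] by blast+
    then show "\<eta> (b \<otimes>\<^bsub>B\<^esub> b') = \<eta> b * \<eta> b'" by (rule characterD(4)[OF herm(2)])
  qed
qed

lemma tensor_product_list: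
  "xs \<in> tensors \<Longrightarrow> ys \<in> tensors \<Longrightarrow> [(a \<otimes>\<^bsub>A\<^esub> a', b \<otimes>\<^bsub>B\<^esub> b'). (a, b) \<leftarrow> xs, (a', b') \<leftarrow> ys] \<in> tensors"
  by (fastforce simp: in_lists_conv_set)

lemma tensor_sum_invol:
  assumes xs: "xs \<in> tensors" and \<xi>: "\<xi> \<in> A.chars" and \<eta>: "\<eta> \<in> B.chars"
  shows "tensor_sum A B [(invol A a, invol B b). (a, b) \<leftarrow> xs] (\<xi>, \<eta>) = cnj (tensor_sum A B xs (\<xi>, \<eta>))"
proof -
  have herm: "\<xi> \<in> hermitian_hom A complex_kalg" "\<eta> \<in> hermitian_hom B complex_kalg"
    using \<xi> \<eta> by (auto simp: kalg_hom_def)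
  have D: "\<xi> \<in> dual_ball A" "\<eta> \<in> dual_ball B" using \<xi> \<eta> chars_dual_ball by blast+
  show ?thesis
    unfolding tensor_sum_apply[OF D] using xs
    by (induction xs) (auto simp: characterD(6)[OF herm(1)] characterD(6)[OF herm(2)])
qed

lemma tensor_invol_list: "xs \<in> tensors \<Longrightarrow> [(invol A a, invol B b). (a, b) \<leftarrow> xs] \<in> tensors"
  by (fastforce simp: in_lists_conv_set)

end

section \<open>Functions on pairs of characters, and the algebra structure they induce\<close>

context kstar_pair
begin

lemma char_one: "\<xi> \<in> A.chars \<Longrightarrow> \<xi> \<one>\<^bsub>A\<^esub> = 1" "\<eta> \<in> B.chars \<Longrightarrow> \<eta> \<one>\<^bsub>B\<^esub> = 1"
  by (auto simp: kalg_hom_def hermitian_character_iff)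

lemma elem_tensor_in_carrier: "a \<in> carrier A \<Longrightarrow> b \<in> carrier B \<Longrightarrow> elem_tensor A B a b \<in> tensor_carrier A B"
  by (rule tensor_sum_in_carrier) simp

lemma elem_tensor_apply: "\<xi> \<in> A.chars \<Longrightarrow> \<eta> \<in> B.chars \<Longrightarrow> elem_tensor A B a b (\<xi>, \<eta>) = \<xi> a * \<eta> b"
  using chars_dual_ball by (subst tensor_sum_apply) auto

lemma approximation_on_products:
  assumes p: "p \<in> A.CS" and q: "q \<in> B.CS" and f: "continuous_on (X_p A p \<times> X_p B q) f" and "0 < e"
  obtains xs where "xs \<in> tensors" "\<And>w. w \<in> X_p A p \<times> X_p B q \<Longrightarrow> norm (f w - tensor_sum A B xs w) < e"
proof -
  let ?K = "X_p A p \<times> X_p B q"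
  define F where "F = {g. \<exists>xs\<in>tensors. \<forall>w\<in>?K. g w = tensor_sum A B xs w}"
  have FI: "g \<in> F" if "xs \<in> tensors" "\<And>\<xi> \<eta>. \<xi> \<in> A.chars \<Longrightarrow> \<eta> \<in> B.chars \<Longrightarrow> (\<xi>, \<eta>) \<in> ?K \<Longrightarrow> g (\<xi>, \<eta>) = tensor_sum A B xs (\<xi>, \<eta>)" for xs g
    using that A.X_p_subset_chars[OF p] B.X_p_subset_chars[OF q] unfolding F_def by blast
  have chars: "\<xi> \<in> A.chars" "\<eta> \<in> B.chars" if "(\<xi>, \<eta>) \<in> ?K" for \<xi> \<eta>
    using that A.X_p_subset_chars[OF p] B.X_p_subset_chars[OF q] by blast+
  have "\<exists>g\<in>F. \<forall>w\<in>?K. norm (f w - g w) < e"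
  proof (rule Stone_Weierstrass_complex)
    show "compact ?K"
      by (intro compact_Times A.compact_X_p B.compact_X_p A.CS_cstar B.CS_cstar p q)
    show "continuous_on ?K g" if "g \<in> F" for g
    proof -
      obtain xs where "xs \<in> tensors" "\<forall>w\<in>?K. g w = tensor_sum A B xs w" using \<open>g \<in> F\<close> by (auto simp: F_def)
      then show ?thesis
        by (intro continuous_on_eq[OF tensor_continuous[OF tensor_sum_in_carrier p q]]) auto
    qed
    show "(\<lambda>w. g w + h w) \<in> F" "(\<lambda>w. g w * h w) \<in> F" if gh: "g \<in> F" "h \<in> F" for g h
    proof -
      obtain xs where xs: "xs \<in> tensors" "\<forall>w\<in>?K. g w = tensor_sum A B xs w" using gh(1) by (auto simp: F_def)
      obtain ys where ys: "ys \<in> tensors" "\<forall>w\<in>?K. h w = tensor_sum A B ys w" using gh(2) by (auto simp: F_def)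
      show "(\<lambda>w. g w + h w) \<in> F"
      proof (rule FI[of "xs @ ys"])
        fix \<xi> \<eta> assume "\<xi> \<in> A.chars" "\<eta> \<in> B.chars" "(\<xi>, \<eta>) \<in> ?K"
        then show "g (\<xi>, \<eta>) + h (\<xi>, \<eta>) = tensor_sum A B (xs @ ys) (\<xi>, \<eta>)"
          using xs(2) ys(2) chars_dual_ball by (auto simp: tensor_sum_apply subset_eq)
      qed (use xs ys in auto)
      show "(\<lambda>w. g w * h w) \<in> F"
        by (rule FI[OF tensor_product_list[OF xs(1) ys(1)]])
          (use xs(2) ys(2) tensor_sum_product[OF xs(1) ys(1)] in auto)
    qed
    show "(\<lambda>w. cnj (g w)) \<in> F" if "g \<in> F" for g
    proof -
      obtain xs where xs: "xs \<in> tensors" "\<forall>w\<in>?K. g w = tensor_sum A B xs w" using \<open>g \<in> F\<close> by (auto simp: F_def)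
      show ?thesis
        by (rule FI[OF tensor_invol_list[OF xs(1)]]) (use xs(2) tensor_sum_invol[OF xs(1)] in auto)
    qed
    show "(\<lambda>_. c) \<in> F" for c
    proof (rule FI[of "[(A.const c, \<one>\<^bsub>B\<^esub>)]"])
      fix \<xi> \<eta> assume ch: "\<xi> \<in> A.chars" "\<eta> \<in> B.chars"
      then have herm: "\<xi> \<in> hermitian_hom A complex_kalg" by (simp add: kalg_hom_def)
      show "c = elem_tensor A B (A.const c) \<one>\<^bsub>B\<^esub> (\<xi>, \<eta>)"
        unfolding elem_tensor_apply[OF ch] by (simp add: A.const_def characterD(2,5)[OF herm] char_one(2)[OF ch(2)])
    qed simp
    show "\<exists>g\<in>F. g x \<noteq> g y" if xy: "x \<in> ?K" "y \<in> ?K" "x \<noteq> y" for x y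
    proof -
      obtain \<xi> \<eta> where x: "x = (\<xi>, \<eta>)" by (cases x)
      obtain \<xi>' \<eta>' where y: "y = (\<xi>', \<eta>')" by (cases y)
      have ch: "\<xi> \<in> A.chars" "\<eta> \<in> B.chars" "\<xi>' \<in> A.chars" "\<eta>' \<in> B.chars" using chars xy x y by blast+
      have elem: "elem_tensor A B a b \<in> F" if "a \<in> carrier A" "b \<in> carrier B" for a b
        using that by (intro FI[of "[(a, b)]"]) auto
      show ?thesis
      proof (cases "\<xi> = \<xi>'")
        case False
        then obtain a where a: "a \<in> carrier A" "\<xi> a \<noteq> \<xi>' a"
          using ch extensionalityI[of \<xi> "carrier A" \<xi>'] by (auto simp: kalg_hom_def hermitian_character_iff)
        then show ?thesis
          using ch by (intro bexI[OF _ elem[OF a(1) B.one_closed]]) (simp add: x y elem_tensor_apply char_one)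
      next
        case True
        then have "\<eta> \<noteq> \<eta>'" using xy x y by blast
        then obtain b where b: "b \<in> carrier B" "\<eta> b \<noteq> \<eta>' b"
          using ch extensionalityI[of \<eta> "carrier B" \<eta>'] by (auto simp: kalg_hom_def hermitian_character_iff)
        then show ?thesis
          using ch by (intro bexI[OF _ elem[OF A.one_closed b(1)]]) (simp add: x y elem_tensor_apply char_one)
      qed
    qed
  qed (use f \<open>0 < e\<close> in auto)
  then obtain g where g: "g \<in> F" "\<forall>w\<in>?K. norm (f w - g w) < e" by blast
  then obtain xs where "xs \<in> tensors" "\<forall>w\<in>?K. g w = tensor_sum A B xs w" by (auto simp: F_def)
  then show thesis using g by (intro that[of xs]) auto
qed

text \<open>The analogue of \<open>gelfand_representation_surj\<close>, which cannot be quoted: the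
  algebra structure of the tensor product is itself built from this result. The limit is therefore
  taken directly among functions on pairs of functionals.\<close>

theorem tensor_of_function:
  assumes f: "\<And>p q. p \<in> A.CS \<Longrightarrow> q \<in> B.CS \<Longrightarrow> continuous_on (X_p A p \<times> X_p B q) f"
  shows "\<exists>F\<in>tensor_carrier A B. \<forall>\<xi>\<in>A.chars. \<forall>\<eta>\<in>B.chars. F (\<xi>, \<eta>) = f (\<xi>, \<eta>)"
proof -
  define N where "N = (\<lambda>(p, q, e). tensor_sum A B ` {xs \<in> tensors. \<forall>w\<in>X_p A p \<times> X_p B q. norm (f w - tensor_sum A B xs w) < e})"
  define I where "I = A.CS \<times> B.CS \<times> {0::real<..}"
  define F where "F = (INF i\<in>I. principal (N i))"
  have ev: "eventually P F \<longleftrightarrow> (\<exists>i\<in>I. \<forall>t\<in>N i. P t)" for P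
    unfolding F_def
  proof (rule eventually_directed_principal)
    show "I \<noteq> {}" using A.CS_zero B.CS_zero by (auto simp: I_def intro: gt_ex)
    fix i j assume ij: "i \<in> I" "j \<in> I"
    obtain p q d where i: "i = (p, q, d)" "p \<in> A.CS" "q \<in> B.CS" "d > 0" using ij by (auto simp: I_def)
    obtain p' q' e where j: "j = (p', q', e)" "p' \<in> A.CS" "q' \<in> B.CS" "e > 0" using ij by (auto simp: I_def)
    obtain r s where rs: "r \<in> A.CS" "s \<in> B.CS"
      "polar A p \<times> polar B q \<union> polar A p' \<times> polar B q' \<subseteq> polar A r \<times> polar B s"
      "X_p A p \<times> X_p B q \<union> X_p A p' \<times> X_p B q' \<subseteq> X_p A r \<times> X_p B s"
      by (rule CS_pair_directed[OF i(2,3) j(2,3)])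
    have "N (r, s, min d e) \<subseteq> N i \<inter> N j"
    proof
      fix t assume "t \<in> N (r, s, min d e)"
      then obtain xs where xs: "t = tensor_sum A B xs" "xs \<in> tensors"
        "\<forall>w\<in>X_p A r \<times> X_p B s. norm (f w - t w) < min d e" by (auto simp: N_def)
      have "\<forall>w\<in>X_p A p \<times> X_p B q. norm (f w - t w) < d" "\<forall>w\<in>X_p A p' \<times> X_p B q'. norm (f w - t w) < e"
        using xs(3) rs(4) by (meson UnI1 UnI2 min_less_iff_conj subsetD)+
      then show "t \<in> N i \<inter> N j" using xs(1,2) unfolding N_def i j by blast
    qed
    then show "\<exists>k\<in>I. N k \<subseteq> N i \<inter> N j"
      using rs i j by (intro bexI[of _ "(r, s, min d e)"]) (auto simp: I_def)
  qed
  have nontrivial: "F \<noteq> bot"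
  proof -
    have "N i \<noteq> {}" if iI: "i \<in> I" for i
    proof -
      obtain p q e where i: "i = (p, q, e)" "p \<in> A.CS" "q \<in> B.CS" "e > 0" using iI by (auto simp: I_def)
      obtain xs where "xs \<in> tensors" "\<And>w. w \<in> X_p A p \<times> X_p B q \<Longrightarrow> norm (f w - tensor_sum A B xs w) < e"
        using approximation_on_products[OF i(2,3) f[OF i(2,3)] i(4)] by blast
      then show ?thesis unfolding N_def i by auto
    qed
    then show ?thesis by (auto simp: trivial_limit_def ev)
  qed
  have N_tensor: "\<exists>xs\<in>tensors. t = tensor_sum A B xs" if "t \<in> N i" for t i
    using that by (cases i) (auto simp: N_def)
  have N_bound: "norm (f w - t w) < e" if "t \<in> N (p, q, e)" "w \<in> X_p A p \<times> X_p B q" for t p q e w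
    using that by (auto simp: N_def)
  have N_ev: "eventually (\<lambda>t. t \<in> N (p, q, e)) F" if "p \<in> A.CS" "q \<in> B.CS" "0 < e" for p q e
    unfolding ev using that by (intro bexI[of _ "(p, q, e)"]) (auto simp: I_def)
  have Cauchy: "\<exists>M. eventually (\<lambda>t. t \<in> M) F \<and> (\<forall>t\<in>M. \<forall>u\<in>M. \<forall>w\<in>K. norm (t w - u w) < e)"
    if "K \<in> polar_products A B" "0 < e" for K e
  proof -
    obtain p q where K: "K = polar A p \<times> polar B q" "p \<in> A.CS" "q \<in> B.CS"
      using \<open>K \<in> polar_products A B\<close> by (auto simp: polar_products_def)
    \<comment> \<open>The members of \<open>N\<close> are near \<open>f\<close> at pairs of
      characters only; \<open>tensor_diff_bound\<close> extends their mutual closeness to the whole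
      polar product.\<close>
    have "norm (t w - u w) < e" if t: "t \<in> N (p, q, e / 3)" and u: "u \<in> N (p, q, e / 3)" and w: "w \<in> K" for t u w
    proof -
      have "norm (t w - u w) \<le> 2 * (e / 3)"
      proof (rule tensor_diff_bound[OF _ _ K(2,3) _ _ w[unfolded K(1)]])
        show "t \<in> tensor_carrier A B" "u \<in> tensor_carrier A B"
          using N_tensor[OF t] N_tensor[OF u] tensor_sum_in_carrier by auto
        fix \<xi> \<eta> assume "\<xi> \<in> X_p A p" "\<eta> \<in> X_p B q"
        then have "(\<xi>, \<eta>) \<in> X_p A p \<times> X_p B q" by blast
        from N_bound[OF t this] N_bound[OF u this]
        show "norm (t (\<xi>, \<eta>) - u (\<xi>, \<eta>)) \<le> 2 * (e / 3)"
          using norm_triangle_ineq4[of "f (\<xi>, \<eta>) - u (\<xi>, \<eta>)" "f (\<xi>, \<eta>) - t (\<xi>, \<eta>)"] by simp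
      qed (use \<open>0 < e\<close> in simp)
      then show ?thesis using \<open>0 < e\<close> by simp
    qed
    moreover have "0 < e / 3" using \<open>0 < e\<close> by simp
    ultimately show ?thesis
      using N_ev[OF K(2,3)] by (intro exI[of _ "N (p, q, e / 3)"]) blast
  qed
  obtain l where l: "l \<in> extensional (\<Union>(polar_products A B))"
    "\<And>K e. K \<in> polar_products A B \<Longrightarrow> 0 < e \<Longrightarrow> eventually (\<lambda>t. \<forall>w\<in>K. norm (t w - l w) < e) F"
    using uniform_Cauchy_filter_limit[OF nontrivial, of "polar_products A B"] Cauchy by blast
  have lT: "l \<in> tensor_carrier A B"
  proof (rule tensor_carrierI)
    show "l \<in> extensional (dual_ball A \<times> dual_ball B)" using l(1) by (simp add: Union_polar_products)
    fix p q and e :: real assume pq: "p \<in> A.CS" "q \<in> B.CS" and "0 < e"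
    then have "polar A p \<times> polar B q \<in> polar_products A B" by (auto simp: polar_products_def)
    from eventually_conj[OF l(2)[OF this \<open>0 < e\<close>] N_ev[OF pq \<open>0 < e\<close>]]
    have "\<exists>t. (\<forall>w\<in>polar A p \<times> polar B q. norm (t w - l w) < e) \<and> t \<in> N (p, q, e)"
      by (rule eventually_happens'[OF nontrivial])
    then obtain t where t: "\<forall>w\<in>polar A p \<times> polar B q. norm (t w - l w) < e" "t \<in> N (p, q, e)" by blast
    obtain xs where "xs \<in> tensors" "t = tensor_sum A B xs" using N_tensor[OF t(2)] by blast
    then show "\<exists>xs\<in>tensors. \<forall>w\<in>polar A p \<times> polar B q. norm (l w - tensor_sum A B xs w) < e"
      using t(1) by (intro bexI[of _ xs]) (auto simp: norm_minus_commute)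
  qed
  have "l (\<xi>, \<eta>) = f (\<xi>, \<eta>)" if \<xi>: "\<xi> \<in> A.chars" and \<eta>: "\<eta> \<in> B.chars" for \<xi> \<eta>
  proof -
    obtain p q where pq: "p \<in> A.CS" "q \<in> B.CS" "\<xi> \<in> X_p A p" "\<eta> \<in> X_p B q" using chars_X_p[OF \<xi> \<eta>] by blast
    have K: "polar A p \<times> polar B q \<in> polar_products A B" using pq by (auto simp: polar_products_def)
    have w: "(\<xi>, \<eta>) \<in> X_p A p \<times> X_p B q" "(\<xi>, \<eta>) \<in> polar A p \<times> polar B q" using pq X_p_polar by blast+
    have "norm (l (\<xi>, \<eta>) - f (\<xi>, \<eta>)) \<le> 0 + e" if "0 < e" for e
    proof -
      from eventually_conj[OF l(2)[OF K half_gt_zero[OF that]] N_ev[OF pq(1,2) half_gt_zero[OF that]]]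
      have "\<exists>t. (\<forall>w\<in>polar A p \<times> polar B q. norm (t w - l w) < e / 2) \<and> t \<in> N (p, q, e / 2)"
        by (rule eventually_happens'[OF nontrivial])
      then obtain t where t: "\<forall>w\<in>polar A p \<times> polar B q. norm (t w - l w) < e / 2" "t \<in> N (p, q, e / 2)" by blast
      then have "norm (t (\<xi>, \<eta>) - l (\<xi>, \<eta>)) < e / 2" using w(2) by blast
      with N_bound[OF t(2) w(1)] show ?thesis
        using norm_triangle_ineq[of "t (\<xi>, \<eta>) - l (\<xi>, \<eta>)" "f (\<xi>, \<eta>) - t (\<xi>, \<eta>)"]
        by (simp add: norm_minus_commute)
    qed
    then have "norm (l (\<xi>, \<eta>) - f (\<xi>, \<eta>)) \<le> 0" by (rule field_le_epsilon)
    then show ?thesis by simp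
  qed
  then show ?thesis using lT by blast
qed

lemma ex1_tensor_of_function:
  assumes "\<And>p q. p \<in> A.CS \<Longrightarrow> q \<in> B.CS \<Longrightarrow> continuous_on (X_p A p \<times> X_p B q) f"
  shows "\<exists>!F. F \<in> tensor_carrier A B \<and> (\<forall>\<xi>\<in>A.chars. \<forall>\<eta>\<in>B.chars. F (\<xi>, \<eta>) = f (\<xi>, \<eta>))"
proof (rule ex_ex1I)
  show "\<exists>F. F \<in> tensor_carrier A B \<and> (\<forall>\<xi>\<in>A.chars. \<forall>\<eta>\<in>B.chars. F (\<xi>, \<eta>) = f (\<xi>, \<eta>))"
    using tensor_of_function[OF assms] by blast
  fix F G assume "F \<in> tensor_carrier A B \<and> (\<forall>\<xi>\<in>A.chars. \<forall>\<eta>\<in>B.chars. F (\<xi>, \<eta>) = f (\<xi>, \<eta>))"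
    "G \<in> tensor_carrier A B \<and> (\<forall>\<xi>\<in>A.chars. \<forall>\<eta>\<in>B.chars. G (\<xi>, \<eta>) = f (\<xi>, \<eta>))"
  then show "F = G" by (intro tensor_eqI) simp_all
qed

text \<open>The pointwise product on all pairs of functionals would be wrong, since functionals are
  not multiplicative. The product is prescribed at pairs of characters, and the unique tensor with
  these values is taken.\<close>

definition pointwise_mult where
  "pointwise_mult F G = (THE H. H \<in> tensor_carrier A B \<and> (\<forall>\<xi>\<in>A.chars. \<forall>\<eta>\<in>B.chars. H (\<xi>, \<eta>) = F (\<xi>, \<eta>) * G (\<xi>, \<eta>)))"

definition pointwise_invol where
  "pointwise_invol F = (THE H. H \<in> tensor_carrier A B \<and> (\<forall>\<xi>\<in>A.chars. \<forall>\<eta>\<in>B.chars. H (\<xi>, \<eta>) = cnj (F (\<xi>, \<eta>))))"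

lemma pointwise_mult:
  assumes F: "F \<in> tensor_carrier A B" and G: "G \<in> tensor_carrier A B"
  shows "pointwise_mult F G \<in> tensor_carrier A B"
    "\<And>\<xi> \<eta>. \<xi> \<in> A.chars \<Longrightarrow> \<eta> \<in> B.chars \<Longrightarrow> pointwise_mult F G (\<xi>, \<eta>) = F (\<xi>, \<eta>) * G (\<xi>, \<eta>)"
proof -
  have "\<exists>!H. H \<in> tensor_carrier A B \<and> (\<forall>\<xi>\<in>A.chars. \<forall>\<eta>\<in>B.chars. H (\<xi>, \<eta>) = F (\<xi>, \<eta>) * G (\<xi>, \<eta>))"
    by (rule ex1_tensor_of_function[of "\<lambda>w. F w * G w"]) (intro continuous_on_mult tensor_continuous F G)
  from theI'[OF this] show "pointwise_mult F G \<in> tensor_carrier A B"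
    "\<And>\<xi> \<eta>. \<xi> \<in> A.chars \<Longrightarrow> \<eta> \<in> B.chars \<Longrightarrow> pointwise_mult F G (\<xi>, \<eta>) = F (\<xi>, \<eta>) * G (\<xi>, \<eta>)"
    by (simp_all add: pointwise_mult_def)
qed

lemma pointwise_invol:
  assumes F: "F \<in> tensor_carrier A B"
  shows "pointwise_invol F \<in> tensor_carrier A B"
    "\<And>\<xi> \<eta>. \<xi> \<in> A.chars \<Longrightarrow> \<eta> \<in> B.chars \<Longrightarrow> pointwise_invol F (\<xi>, \<eta>) = cnj (F (\<xi>, \<eta>))"
proof -
  have "\<exists>!H. H \<in> tensor_carrier A B \<and> (\<forall>\<xi>\<in>A.chars. \<forall>\<eta>\<in>B.chars. H (\<xi>, \<eta>) = cnj (F (\<xi>, \<eta>)))"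
    by (rule ex1_tensor_of_function[of "\<lambda>w. cnj (F w)"]) (intro continuous_on_cnj tensor_continuous F)
  from theI'[OF this] show "pointwise_invol F \<in> tensor_carrier A B"
    "\<And>\<xi> \<eta>. \<xi> \<in> A.chars \<Longrightarrow> \<eta> \<in> B.chars \<Longrightarrow> pointwise_invol F (\<xi>, \<eta>) = cnj (F (\<xi>, \<eta>))"
    by (simp_all add: pointwise_invol_def)
qed

text \<open>The tensor product with explicit operations. That they satisfy the descriptions which define
  \<open>tensor_mult\<close> and \<open>tensor_invol\<close> is shown by means of the topology of this algebra.\<close>

definition tensor' where
  "tensor' = (tensor A B)
     \<lparr>mult := curry (\<lambda>(F, G)\<in>tensor_carrier A B \<times> tensor_carrier A B. pointwise_mult F G),
      invol := (\<lambda>F\<in>tensor_carrier A B. pointwise_invol F)\<rparr>"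

lemma tensor'_simps [simp]:
  "carrier tensor' = tensor_carrier A B"
  "one tensor' = elem_tensor A B \<one>\<^bsub>A\<^esub> \<one>\<^bsub>B\<^esub>"
  "zero tensor' = (\<lambda>w\<in>dual_ball A \<times> dual_ball B. 0)"
  "add tensor' = (\<lambda>F G. \<lambda>w\<in>dual_ball A \<times> dual_ball B. F w + G w)"
  "smult tensor' = (\<lambda>c F. \<lambda>w\<in>dual_ball A \<times> dual_ball B. c * F w)"
  "mult tensor' = curry (\<lambda>(F, G)\<in>tensor_carrier A B \<times> tensor_carrier A B. pointwise_mult F G)"
  "invol tensor' = (\<lambda>F\<in>tensor_carrier A B. pointwise_invol F)"
  "topol tensor' = tensor_topology A B"
  by (simp_all add: tensor'_def)

lemma involutive_algebra_tensor': "involutive_algebra tensor'"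
proof (rule involutive_algebra_by_characters[of _ "{\<lambda>F. F (\<xi>, \<eta>) | \<xi> \<eta>. \<xi> \<in> A.chars \<and> \<eta> \<in> B.chars}"])
  have D: "(\<xi>, \<eta>) \<in> dual_ball A \<times> dual_ball B" if "\<xi> \<in> A.chars" "\<eta> \<in> B.chars" for \<xi> \<eta>
    using that chars_dual_ball by blast
  have "tensor_sum A B [] \<in> tensor_carrier A B" by (rule tensor_sum_in_carrier) simp
  then show "\<zero>\<^bsub>tensor'\<^esub> \<in> carrier tensor'" by (simp add: tensor_sum_def case_prod_unfold)
  show "\<one>\<^bsub>tensor'\<^esub> \<in> carrier tensor'" by (simp add: elem_tensor_in_carrier)
  {
    fix F G assume F: "F \<in> carrier tensor'" and G: "G \<in> carrier tensor'"
    show "F \<oplus>\<^bsub>tensor'\<^esub> G \<in> carrier tensor'" using F G by (simp add: tensor_add_in_carrier)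
    show "F \<otimes>\<^bsub>tensor'\<^esub> G \<in> carrier tensor'" using F G by (simp add: pointwise_mult)
    show "F = G" if "\<And>\<tau>. \<tau> \<in> {\<lambda>F. F (\<xi>, \<eta>) | \<xi> \<eta>. \<xi> \<in> A.chars \<and> \<eta> \<in> B.chars} \<Longrightarrow> \<tau> F = \<tau> G"
      using F G that by (intro tensor_eqI) auto
  }
  fix F assume F: "F \<in> carrier tensor'"
  show "c \<odot>\<^bsub>tensor'\<^esub> F \<in> carrier tensor'" for c using F by (simp add: tensor_smult_in_carrier)
  show "invol tensor' F \<in> carrier tensor'" using F by (simp add: pointwise_invol)
next
  fix \<tau> :: "(('a \<Rightarrow> complex) \<times> ('b \<Rightarrow> complex) \<Rightarrow> complex) \<Rightarrow> complex"
  assume "\<tau> \<in> {\<lambda>F. F (\<xi>, \<eta>) | \<xi> \<eta>. \<xi> \<in> A.chars \<and> \<eta> \<in> B.chars}"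
  then obtain \<xi> \<eta> where \<tau>: "\<tau> = (\<lambda>F. F (\<xi>, \<eta>) :: complex)" "\<xi> \<in> A.chars" "\<eta> \<in> B.chars" by blast
  have D: "\<xi> \<in> dual_ball A" "\<eta> \<in> dual_ball B" using \<tau> chars_dual_ball by blast+
  show "\<tau> \<zero>\<^bsub>tensor'\<^esub> = 0" using D by (simp add: \<tau>(1))
  show "\<tau> \<one>\<^bsub>tensor'\<^esub> = 1" using \<tau>(2,3) by (simp add: \<tau>(1) elem_tensor_apply char_one)
  fix F assume F: "F \<in> carrier tensor'"
  show "\<tau> (c \<odot>\<^bsub>tensor'\<^esub> F) = c * \<tau> F" for c using D by (simp add: \<tau>(1))
  show "\<tau> (invol tensor' F) = cnj (\<tau> F)" using F \<tau>(2,3) by (simp add: \<tau>(1) pointwise_invol)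
  fix G assume G: "G \<in> carrier tensor'"
  show "\<tau> (F \<oplus>\<^bsub>tensor'\<^esub> G) = \<tau> F + \<tau> G" using D by (simp add: \<tau>(1))
  show "\<tau> (F \<otimes>\<^bsub>tensor'\<^esub> G) = \<tau> F * \<tau> G" using F G \<tau>(2,3) by (simp add: \<tau>(1) pointwise_mult)
qed

lemma tensor_bounded:
  assumes F: "F \<in> tensor_carrier A B" and p: "p \<in> A.CS" and q: "q \<in> B.CS"
  obtains c where "0 \<le> c" "\<And>w. w \<in> polar A p \<times> polar B q \<Longrightarrow> norm (F w) \<le> c"
proof -
  have "compact (X_p A p \<times> X_p B q)"
    by (intro compact_Times A.compact_X_p B.compact_X_p A.CS_cstar B.CS_cstar p q)
  then have "bounded (F ` (X_p A p \<times> X_p B q))"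
    by (intro compact_imp_bounded compact_continuous_image tensor_continuous F p q)
  then obtain c where c: "\<forall>w\<in>X_p A p \<times> X_p B q. norm (F w) \<le> c" by (auto simp: bounded_iff)
  have "norm (F w) \<le> max 0 c" if "w \<in> polar A p \<times> polar B q" for w
    by (rule tensor_bound[OF F p q _ _ that]) (use c in \<open>auto simp: le_max_iff_disj\<close>)
  then show thesis by (intro that[of "max 0 c"]) auto
qed

text \<open>Replaces the injective seminorm by a supremum over pairs of characters, where the
  product is pointwise. This is the reason why it is a C*-seminorm.\<close>

lemma sup_polar_eq:
  assumes F: "F \<in> tensor_carrier A B" and p: "p \<in> A.CS" and q: "q \<in> B.CS"
  shows "sup_seminorm (polar A p \<times> polar B q) F = sup_seminorm (X_p A p \<times> X_p B q) F"
proof -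
  obtain c where c: "0 \<le> c" "\<And>w. w \<in> polar A p \<times> polar B q \<Longrightarrow> norm (F w) \<le> c"
    using tensor_bounded[OF F p q] by blast
  have sub: "X_p A p \<times> X_p B q \<subseteq> polar A p \<times> polar B q" using X_p_polar p q by blast
  then have c': "norm (F w) \<le> c" if "w \<in> X_p A p \<times> X_p B q" for w using c(2) that by blast
  show ?thesis
  proof (rule antisym)
    show "sup_seminorm (polar A p \<times> polar B q) F \<le> sup_seminorm (X_p A p \<times> X_p B q) F"
    proof (rule sup_seminorm_least)
      show "0 \<le> sup_seminorm (X_p A p \<times> X_p B q) F" by (rule sup_seminorm_nonneg[OF c'])
      fix w assume w: "w \<in> polar A p \<times> polar B q"
      show "norm (F w) \<le> sup_seminorm (X_p A p \<times> X_p B q) F"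
      proof (rule tensor_bound[OF F p q _ _ w])
        fix \<xi> \<eta> assume "\<xi> \<in> X_p A p" "\<eta> \<in> X_p B q"
        then have "(\<xi>, \<eta>) \<in> X_p A p \<times> X_p B q" by blast
        then show "norm (F (\<xi>, \<eta>)) \<le> sup_seminorm (X_p A p \<times> X_p B q) F"
          using sup_seminorm_upper[of "X_p A p \<times> X_p B q" F c "(\<xi>, \<eta>)"] c' by blast
      qed (rule sup_seminorm_nonneg[OF c'])
    qed
    show "sup_seminorm (X_p A p \<times> X_p B q) F \<le> sup_seminorm (polar A p \<times> polar B q) F"
    proof (rule sup_seminorm_least)
      show "0 \<le> sup_seminorm (polar A p \<times> polar B q) F" by (rule sup_seminorm_nonneg[OF c(2)])
      fix w assume "w \<in> X_p A p \<times> X_p B q"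
      then have "w \<in> polar A p \<times> polar B q" using sub by blast
      then show "norm (F w) \<le> sup_seminorm (polar A p \<times> polar B q) F"
        using sup_seminorm_upper[of "polar A p \<times> polar B q" F c w] c(2) by blast
    qed
  qed
qed

lemma function_algebra_tensor': "function_algebra tensor' (polar_products A B)"
proof (rule function_algebra.intro[OF involutive_algebra_tensor'], unfold_locales)
  show "carrier tensor' \<subseteq> extensional (\<Union>(polar_products A B))"
    by (auto simp: Union_polar_products dest: tensor_carrier_extensional)
  show "topol tensor' = seminorm_topology (carrier tensor') (\<lambda>F G w. F w - G w) (sup_seminorm ` polar_products A B)"
  proof -
    have "{sup_seminorm (polar A p \<times> polar B q) | p q. p \<in> A.CS \<and> q \<in> B.CS} = sup_seminorm ` polar_products A B"
      by (auto simp: polar_products_def)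
    then show ?thesis by (simp add: tensor_topology_def)
  qed
  fix F and K :: "(('a \<Rightarrow> complex) \<times> ('b \<Rightarrow> complex)) set"
  {
    fix G w assume "w \<in> \<Union>(polar_products A B)"
    then show "(F \<oplus>\<^bsub>tensor'\<^esub> G) w = F w + G w" by (simp add: Union_polar_products)
  next
    fix w c assume "w \<in> \<Union>(polar_products A B)"
    then show "(c \<odot>\<^bsub>tensor'\<^esub> F) w = c * F w" by (simp add: Union_polar_products)
  next
    assume F: "F \<in> carrier tensor'" and "K \<in> polar_products A B"
    then obtain p q where K: "K = polar A p \<times> polar B q" "p \<in> A.CS" "q \<in> B.CS" by (auto simp: polar_products_def)
    have "F \<in> tensor_carrier A B" using F by simp
    from tensor_bounded[OF this K(2,3)]
    obtain c where "\<And>w. w \<in> polar A p \<times> polar B q \<Longrightarrow> norm (F w) \<le> c" by blast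
    then show "\<exists>c. \<forall>w\<in>K. norm (F w) \<le> c" using K(1) by blast
  next
    assume "K \<in> polar_products A B"
    then obtain p q where K: "K = polar A p \<times> polar B q" "p \<in> A.CS" "q \<in> B.CS" by (auto simp: polar_products_def)
    have sub: "X_p A p \<times> X_p B q \<subseteq> polar A p \<times> polar B q" using X_p_polar K by blast
    have ch: "\<xi> \<in> A.chars" "\<eta> \<in> B.chars" if "(\<xi>, \<eta>) \<in> X_p A p \<times> X_p B q" for \<xi> \<eta>
      using that A.X_p_subset_chars[OF K(2)] B.X_p_subset_chars[OF K(3)] by blast+
    have D: "w \<in> dual_ball A \<times> dual_ball B" if "w \<in> X_p A p \<times> X_p B q" for w
      using that X_p_dual_ball(1)[OF K(2)] X_p_dual_ball(2)[OF K(3)] by blast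
    show "cstar_seminorm tensor' (sup_seminorm K)"
    proof (rule cstar_seminorm_cong[OF involutive_algebra_tensor'])
      show "sup_seminorm K F = sup_seminorm (X_p A p \<times> X_p B q) (\<lambda>w. F w)" if "F \<in> carrier tensor'" for F
        using sup_polar_eq[of F p q] that K by simp
      show "cstar_seminorm tensor' (\<lambda>F. sup_seminorm (X_p A p \<times> X_p B q) (\<lambda>w. F w))"
      proof (rule cstar_seminorm_sup[OF involutive_algebra_tensor'])
        show "\<exists>c. \<forall>w\<in>X_p A p \<times> X_p B q. norm (F w) \<le> c" if F: "F \<in> carrier tensor'" for F
        proof -
          have "F \<in> tensor_carrier A B" using F by simp
          from tensor_bounded[OF this K(2,3)]
          obtain c where "\<And>w. w \<in> polar A p \<times> polar B q \<Longrightarrow> norm (F w) \<le> c" by blast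
          then show ?thesis using sub by blast
        qed
        fix w F assume w: "w \<in> X_p A p \<times> X_p B q" and F: "F \<in> carrier tensor'"
        show "(F \<oplus>\<^bsub>tensor'\<^esub> G) w = F w + G w" for G using D[OF w] by simp
        show "(c \<odot>\<^bsub>tensor'\<^esub> F) w = c * F w" for c using D[OF w] by simp
        obtain \<xi> \<eta> where w': "w = (\<xi>, \<eta>)" by (cases w)
        show "(F \<otimes>\<^bsub>tensor'\<^esub> invol tensor' F) w = F w * cnj (F w)"
          using F ch[of \<xi> \<eta>] w unfolding w' by (simp add: pointwise_mult pointwise_invol)
      qed
    qed
  next
    assume F: "F \<in> extensional (\<Union>(polar_products A B))"
      and approx: "\<And>K e. K \<in> polar_products A B \<Longrightarrow> 0 < e \<Longrightarrow> \<exists>G\<in>carrier tensor'. \<forall>w\<in>K. norm (F w - G w) < e"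
    have "F \<in> tensor_carrier A B"
    proof (rule tensor_carrierI)
      show "F \<in> extensional (dual_ball A \<times> dual_ball B)" using F by (simp add: Union_polar_products)
      fix p q and e :: real assume pq: "p \<in> A.CS" "q \<in> B.CS" and "0 < e"
      then have "polar A p \<times> polar B q \<in> polar_products A B" by (auto simp: polar_products_def)
      from approx[OF this half_gt_zero[OF \<open>0 < e\<close>]] obtain G
        where G: "G \<in> tensor_carrier A B" "\<forall>w\<in>polar A p \<times> polar B q. norm (F w - G w) < e / 2" by auto
      obtain xs where xs: "xs \<in> tensors" "\<And>w. w \<in> polar A p \<times> polar B q \<Longrightarrow> norm (G w - tensor_sum A B xs w) < e / 2"
        using approximation_by_tensors[OF G(1) pq half_gt_zero[OF \<open>0 < e\<close>]] by blast
      have "norm (F w - tensor_sum A B xs w) < e" if w: "w \<in> polar A p \<times> polar B q" for w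
      proof -
        have "norm (F w - G w) < e / 2" using G(2) w by blast
        with xs(2)[OF w] show ?thesis
          using norm_triangle_ineq[of "F w - G w" "G w - tensor_sum A B xs w"] by simp
      qed
      then show "\<exists>xs\<in>tensors. \<forall>w\<in>polar A p \<times> polar B q. norm (F w - tensor_sum A B xs w) < e"
        using xs(1) by blast
    qed
    then show "F \<in> carrier tensor'" by simp
  }
qed

text \<open>Gives the uniqueness in the descriptions that define \<open>tensor_mult\<close> and
  \<open>tensor_invol\<close>.\<close>

lemma tensor_sums_dense:
  assumes F: "F \<in> tensor_carrier A B"
  shows "F \<in> tensor_topology A B closure_of (tensor_sum A B ` tensors)"
proof -
  interpret T: function_algebra tensor' "polar_products A B" by (rule function_algebra_tensor')
  have top: "tensor_topology A B = T.seminorm_top (sup_seminorm ` polar_products A B)"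
    using T.topol_sup by simp
  show ?thesis
    unfolding in_closure_of
  proof (intro conjI allI impI)
    show "F \<in> topspace (tensor_topology A B)" using F by (simp add: top)
    fix U assume U: "F \<in> U \<and> openin (tensor_topology A B) U"
    have "\<exists>r\<in>T.CS. \<exists>e>0. {G \<in> carrier tensor'. r (G \<ominus>\<^bsub>tensor'\<^esub> F) < e} \<subseteq> U"
      using U by (intro T.open_contains_CS_ball) auto
    then obtain r e where r: "r \<in> T.CS" "e > 0" "{G \<in> carrier tensor'. r (G \<ominus>\<^bsub>tensor'\<^esub> F) < e} \<subseteq> U" by blast
    obtain K where K: "K \<in> polar_products A B" "\<forall>G\<in>carrier tensor'. r G \<le> sup_seminorm K G"
      using T.continuous_characters_dominated[OF polar_products_nonempty polar_products_directed r(1)] by blast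
    then obtain p q where pq: "K = polar A p \<times> polar B q" "p \<in> A.CS" "q \<in> B.CS" by (auto simp: polar_products_def)
    obtain xs where xs: "xs \<in> tensors" "\<And>w. w \<in> polar A p \<times> polar B q \<Longrightarrow> norm (F w - tensor_sum A B xs w) < e / 2"
      using approximation_by_tensors[OF F pq(2,3) half_gt_zero[OF r(2)]] by blast
    have t: "tensor_sum A B xs \<in> carrier tensor'" using tensor_sum_in_carrier[OF xs(1)] by simp
    have F': "F \<in> carrier tensor'" using F by simp
    have "sup_seminorm K (tensor_sum A B xs \<ominus>\<^bsub>tensor'\<^esub> F) \<le> e / 2"
    proof (rule sup_seminorm_least)
      fix w assume w: "w \<in> K"
      have "(tensor_sum A B xs \<ominus>\<^bsub>tensor'\<^esub> F) w = tensor_sum A B xs w - F w"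
        using w K(1) by (intro T.diff_apply[OF t F']) blast
      then show "norm ((tensor_sum A B xs \<ominus>\<^bsub>tensor'\<^esub> F) w) \<le> e / 2"
        using xs(2)[OF w[unfolded pq(1)]] by (simp add: norm_minus_commute)
    qed (use r(2) in simp)
    moreover have "r (tensor_sum A B xs \<ominus>\<^bsub>tensor'\<^esub> F) \<le> sup_seminorm K (tensor_sum A B xs \<ominus>\<^bsub>tensor'\<^esub> F)"
      using K(2) T.M.minus_closed[OF t F'] by blast
    ultimately have "r (tensor_sum A B xs \<ominus>\<^bsub>tensor'\<^esub> F) < e" using r(2) by linarith
    then have "tensor_sum A B xs \<in> U" using r(3) t by blast
    then show "\<exists>y. y \<in> tensor_sum A B ` tensors \<and> y \<in> U" using xs(1) by blast
  qed
qed

text \<open>The product of \<open>tensor'\<close> is jointly continuous because C*-seminorms are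
  submultiplicative, so it meets the description. Any other candidate agrees with it on a dense set
  of pairs, and the topology is Hausdorff.\<close>

lemma tensor_mult_eq: "tensor_mult A B = mult tensor'"
  unfolding tensor_mult_def tensor'_simps
proof (rule arg_cong[where f = curry], rule the_equality)
  interpret T: function_algebra tensor' "polar_products A B" by (rule function_algebra_tensor')
  have top: "tensor_topology A B = T.seminorm_top (sup_seminorm ` polar_products A B)"
    using T.topol_sup by simp
  let ?M = "\<lambda>(F, G)\<in>tensor_carrier A B \<times> tensor_carrier A B. pointwise_mult F G"
  let ?prod = "\<lambda>xs ys. [(a \<otimes>\<^bsub>A\<^esub> a', b \<otimes>\<^bsub>B\<^esub> b'). (a, b) \<leftarrow> xs, (a', b') \<leftarrow> ys]"
  have cont: "continuous_map (prod_topology (tensor_topology A B) (tensor_topology A B)) (tensor_topology A B) ?M"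
  proof (rule continuous_map_eq)
    show "continuous_map (prod_topology (tensor_topology A B) (tensor_topology A B)) (tensor_topology A B) (\<lambda>(F, G). F \<otimes>\<^bsub>tensor'\<^esub> G)"
      unfolding top by (rule T.continuous_map_mult_seminorm_top) (use T.cstar_sup in auto)
  qed (auto simp: top)
  have vals: "?M (tensor_sum A B xs, tensor_sum A B ys) = tensor_sum A B (?prod xs ys)"
    if xs: "xs \<in> tensors" and ys: "ys \<in> tensors" for xs ys
  proof (rule tensor_eqI)
    have t: "tensor_sum A B xs \<in> tensor_carrier A B" "tensor_sum A B ys \<in> tensor_carrier A B"
      using xs ys tensor_sum_in_carrier by auto
    then show "?M (tensor_sum A B xs, tensor_sum A B ys) \<in> tensor_carrier A B" by (simp add: pointwise_mult)
    show "tensor_sum A B (?prod xs ys) \<in> tensor_carrier A B"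
      by (rule tensor_sum_in_carrier[OF tensor_product_list[OF xs ys]])
    fix \<xi> \<eta> assume ch: "\<xi> \<in> A.chars" "\<eta> \<in> B.chars"
    show "?M (tensor_sum A B xs, tensor_sum A B ys) (\<xi>, \<eta>) = tensor_sum A B (?prod xs ys) (\<xi>, \<eta>)"
      unfolding tensor_sum_product[OF xs ys ch] using t ch by (simp add: pointwise_mult)
  qed
  show "?M \<in> extensional (tensor_carrier A B \<times> tensor_carrier A B) \<and>
      continuous_map (prod_topology (tensor_topology A B) (tensor_topology A B)) (tensor_topology A B) ?M \<and>
      (\<forall>xs\<in>tensors. \<forall>ys\<in>tensors. ?M (tensor_sum A B xs, tensor_sum A B ys) = tensor_sum A B (?prod xs ys))"
    using cont vals by blast
  fix M assume M: "M \<in> extensional (tensor_carrier A B \<times> tensor_carrier A B) \<and>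
      continuous_map (prod_topology (tensor_topology A B) (tensor_topology A B)) (tensor_topology A B) M \<and>
      (\<forall>xs\<in>tensors. \<forall>ys\<in>tensors. M (tensor_sum A B xs, tensor_sum A B ys) = tensor_sum A B (?prod xs ys))"
  show "M = ?M"
  proof (rule extensionalityI)
    show "M \<in> extensional (tensor_carrier A B \<times> tensor_carrier A B)" using M by blast
    fix z assume "z \<in> tensor_carrier A B \<times> tensor_carrier A B"
    then have z: "z \<in> prod_topology (tensor_topology A B) (tensor_topology A B) closure_of
        (tensor_sum A B ` tensors \<times> tensor_sum A B ` tensors)"
      using tensor_sums_dense by (auto simp: closure_of_Times)
    show "M z = ?M z"
    proof (rule forall_in_closure_of_eq[where f = M and g = ?M, OF z])
      show "Hausdorff_space (tensor_topology A B)" using T.topol_Hausdorff by simp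
      show "M y = ?M y" if y: "y \<in> tensor_sum A B ` tensors \<times> tensor_sum A B ` tensors" for y
      proof -
        obtain xs ys where xs: "y = (tensor_sum A B xs, tensor_sum A B ys)" "xs \<in> tensors" "ys \<in> tensors"
          using y by blast
        have "M y = tensor_sum A B (?prod xs ys)" unfolding xs(1) using M xs(2,3) by blast
        then show ?thesis unfolding xs(1) vals[OF xs(2,3)] .
      qed
      show "continuous_map (prod_topology (tensor_topology A B) (tensor_topology A B)) (tensor_topology A B) M"
        using M by blast
    qed (rule cont)
  qed simp
qed

lemma tensor_invol_eq: "tensor_invol A B = invol tensor'"
  unfolding tensor_invol_def tensor'_simps
proof (rule the_equality)
  interpret T: function_algebra tensor' "polar_products A B" by (rule function_algebra_tensor')
  have top: "tensor_topology A B = T.seminorm_top (sup_seminorm ` polar_products A B)"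
    using T.topol_sup by simp
  let ?J = "\<lambda>F\<in>tensor_carrier A B. pointwise_invol F"
  let ?inv = "\<lambda>xs. [(invol A a, invol B b). (a, b) \<leftarrow> xs]"
  have cont: "continuous_map (tensor_topology A B) (tensor_topology A B) ?J"
    using T.continuous_map_invol_seminorm_top[of "sup_seminorm ` polar_products A B"] T.cstar_sup
    unfolding top by auto
  have vals: "?J (tensor_sum A B xs) = tensor_sum A B (?inv xs)" if xs: "xs \<in> tensors" for xs
  proof (rule tensor_eqI)
    have t: "tensor_sum A B xs \<in> tensor_carrier A B" using xs tensor_sum_in_carrier by auto
    then show "?J (tensor_sum A B xs) \<in> tensor_carrier A B" by (simp add: pointwise_invol)
    show "tensor_sum A B (?inv xs) \<in> tensor_carrier A B"
      by (rule tensor_sum_in_carrier[OF tensor_invol_list[OF xs]])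
    fix \<xi> \<eta> assume ch: "\<xi> \<in> A.chars" "\<eta> \<in> B.chars"
    show "?J (tensor_sum A B xs) (\<xi>, \<eta>) = tensor_sum A B (?inv xs) (\<xi>, \<eta>)"
      unfolding tensor_sum_invol[OF xs ch] using t ch by (simp add: pointwise_invol)
  qed
  show "?J \<in> extensional (tensor_carrier A B) \<and>
      continuous_map (tensor_topology A B) (tensor_topology A B) ?J \<and>
      (\<forall>xs\<in>tensors. ?J (tensor_sum A B xs) = tensor_sum A B (?inv xs))"
    using cont vals by blast
  fix J assume J: "J \<in> extensional (tensor_carrier A B) \<and>
      continuous_map (tensor_topology A B) (tensor_topology A B) J \<and>
      (\<forall>xs\<in>tensors. J (tensor_sum A B xs) = tensor_sum A B (?inv xs))"
  show "J = ?J"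
  proof (rule extensionalityI)
    show "J \<in> extensional (tensor_carrier A B)" using J by blast
    fix F assume F: "F \<in> tensor_carrier A B"
    show "J F = ?J F"
    proof (rule forall_in_closure_of_eq[where f = J and g = ?J, OF tensor_sums_dense[OF F]])
      show "Hausdorff_space (tensor_topology A B)" using T.topol_Hausdorff by simp
      show "J y = ?J y" if y: "y \<in> tensor_sum A B ` tensors" for y
      proof -
        obtain xs where xs: "y = tensor_sum A B xs" "xs \<in> tensors" using y by blast
        have "J y = tensor_sum A B (?inv xs)" unfolding xs(1) using J xs(2) by blast
        then show ?thesis unfolding xs(1) vals[OF xs(2)] .
      qed
      show "continuous_map (tensor_topology A B) (tensor_topology A B) J" using J by blast
    qed (rule cont)
  qed simp
qed

lemma tensor_eq_tensor': "tensor A B = tensor'"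
  by (simp add: tensor'_def tensor_def tensor_mult_eq[unfolded tensor'_simps] tensor_invol_eq[unfolded tensor'_simps])

lemma function_algebra_tensor: "function_algebra (tensor A B) (polar_products A B)"
  unfolding tensor_eq_tensor' by (rule function_algebra_tensor')

lemma kstar_algebra_tensor: "kstar_algebra (tensor A B)"
  by (rule function_algebra.kstar[OF function_algebra_tensor])

end

section \<open>Morphisms out of the tensor product\<close>

definition incl_left :: "('a, 'm) kalg_scheme \<Rightarrow> ('b, 'n) kalg_scheme \<Rightarrow> 'a \<Rightarrow> ('a \<Rightarrow> complex) \<times> ('b \<Rightarrow> complex) \<Rightarrow> complex" where
  "incl_left A B = (\<lambda>a\<in>carrier A. elem_tensor A B a \<one>\<^bsub>B\<^esub>)"

lemma incl_left_apply: "a \<in> carrier A \<Longrightarrow> incl_left A B a = elem_tensor A B a \<one>\<^bsub>B\<^esub>"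
  by (simp add: incl_left_def)

definition incl_right :: "('a, 'm) kalg_scheme \<Rightarrow> ('b, 'n) kalg_scheme \<Rightarrow> 'b \<Rightarrow> ('a \<Rightarrow> complex) \<times> ('b \<Rightarrow> complex) \<Rightarrow> complex" where
  "incl_right A B = (\<lambda>b\<in>carrier B. elem_tensor A B \<one>\<^bsub>A\<^esub> b)"

context kstar_pair
begin

interpretation T: function_algebra "tensor A B" "polar_products A B"
  by (rule function_algebra_tensor)

lemma tensor_mult_apply:
  assumes "F \<in> tensor_carrier A B" "G \<in> tensor_carrier A B" "\<xi> \<in> A.chars" "\<eta> \<in> B.chars"
  shows "tensor_mult A B F G (\<xi>, \<eta>) = F (\<xi>, \<eta>) * G (\<xi>, \<eta>)"
  using assms by (simp add: tensor_mult_eq pointwise_mult)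

lemma tensor_invol_apply:
  assumes "F \<in> tensor_carrier A B" "\<xi> \<in> A.chars" "\<eta> \<in> B.chars"
  shows "tensor_invol A B F (\<xi>, \<eta>) = cnj (F (\<xi>, \<eta>))"
  using assms by (simp add: tensor_invol_eq pointwise_invol)

lemma tensor_closed:
  "F \<in> tensor_carrier A B \<Longrightarrow> G \<in> tensor_carrier A B \<Longrightarrow> tensor_mult A B F G \<in> tensor_carrier A B"
  "F \<in> tensor_carrier A B \<Longrightarrow> tensor_invol A B F \<in> tensor_carrier A B"
  by (simp_all add: tensor_mult_eq pointwise_mult tensor_invol_eq pointwise_invol)

lemma pair_char_hermitian:
  assumes \<xi>: "\<xi> \<in> A.chars" and \<eta>: "\<eta> \<in> B.chars"
  shows "pair_char A B (\<xi>, \<eta>) \<in> hermitian_hom (tensor A B) complex_kalg"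
proof -
  have D: "(\<xi>, \<eta>) \<in> dual_ball A \<times> dual_ball B" using \<xi> \<eta> chars_dual_ball by blast
  show ?thesis
    unfolding hermitian_character_iff
    using D \<xi> \<eta> by (simp add: pair_char_def tensor_closed tensor_add_in_carrier tensor_smult_in_carrier
        elem_tensor_in_carrier elem_tensor_apply char_one tensor_mult_apply tensor_invol_apply)
qed

lemma pair_char_continuous:
  assumes p: "p \<in> A.CS" and q: "q \<in> B.CS"
  shows "continuous_on (X_p A p \<times> X_p B q) (pair_char A B)"
proof (rule continuous_on_coordinatewise_then_product)
  fix F :: "('a \<Rightarrow> complex) \<times> ('b \<Rightarrow> complex) \<Rightarrow> complex"
  show "continuous_on (X_p A p \<times> X_p B q) (\<lambda>w. pair_char A B w F)"
    using tensor_continuous[OF _ p q, of F] by (cases "F \<in> tensor_carrier A B") (auto simp: pair_char_def)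
qed

text \<open>By \<open>sup_polar_eq\<close> the seminorm is the supremum over the compact set of
  these pair characters, so \<open>mem_of_character_le_sup\<close> excludes all others.\<close>

lemma X_p_tensor:
  assumes p: "p \<in> A.CS" and q: "q \<in> B.CS"
  shows "X_p (tensor A B) (sup_seminorm (polar A p \<times> polar B q)) = pair_char A B ` (X_p A p \<times> X_p B q)"
    (is "X_p _ ?s = _ ` ?K")
proof (intro equalityI subsetI)
  have K: "polar A p \<times> polar B q \<in> polar_products A B" using p q by (auto simp: polar_products_def)
  have cs: "cstar_seminorm (tensor A B) ?s" by (rule T.cstar_sup[OF K])
  have herm: "pair_char A B ` ?K \<subseteq> hermitian_hom (tensor A B) complex_kalg"
    using pair_char_hermitian A.X_p_subset_chars[OF p] B.X_p_subset_chars[OF q] by auto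
  fix \<tau> assume "\<tau> \<in> X_p (tensor A B) ?s"
  then have \<tau>: "\<tau> \<in> hermitian_hom (tensor A B) complex_kalg" "\<forall>F\<in>carrier (tensor A B). norm (\<tau> F) \<le> ?s F"
    unfolding T.X_p_iff[OF cs] by blast+
  show "\<tau> \<in> pair_char A B ` ?K"
  proof (rule T.mem_of_character_le_sup[OF _ herm \<tau>(1)])
    show "compact (pair_char A B ` ?K)"
      by (intro compact_continuous_image pair_char_continuous p q compact_Times A.compact_X_p B.compact_X_p
          A.CS_cstar B.CS_cstar)
    fix F assume F: "F \<in> carrier (tensor A B)"
    have "(\<lambda>\<eta>. norm (\<eta> F)) ` pair_char A B ` ?K = (\<lambda>w. norm (F w)) ` ?K"
      unfolding image_image using F by (intro image_cong) (auto simp: pair_char_def)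
    then have "sup_seminorm (pair_char A B ` ?K) (\<lambda>\<eta>. \<eta> F) = sup_seminorm ?K F"
      by (simp only: sup_seminorm_def)
    then show "norm (\<tau> F) \<le> sup_seminorm (pair_char A B ` ?K) (\<lambda>\<eta>. \<eta> F)"
      using bspec[OF \<tau>(2) F] sup_polar_eq[OF F[simplified] p q] by simp
  qed
next
  have K: "polar A p \<times> polar B q \<in> polar_products A B" using p q by (auto simp: polar_products_def)
  have cs: "cstar_seminorm (tensor A B) ?s" by (rule T.cstar_sup[OF K])
  fix \<tau> assume "\<tau> \<in> pair_char A B ` ?K"
  then obtain \<xi> \<eta> where \<tau>: "\<tau> = pair_char A B (\<xi>, \<eta>)" "\<xi> \<in> X_p A p" "\<eta> \<in> X_p B q" by blast
  have w: "(\<xi>, \<eta>) \<in> polar A p \<times> polar B q" using \<tau> X_p_polar p q by blast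
  have "norm (\<tau> F) \<le> ?s F" if "F \<in> carrier (tensor A B)" for F
    using T.norm_le_sup[OF that K w] that by (simp add: \<tau>(1) pair_char_def)
  moreover have "\<tau> \<in> hermitian_hom (tensor A B) complex_kalg"
    unfolding \<tau>(1) using \<tau>(2,3) A.X_p_subset_chars[OF p] B.X_p_subset_chars[OF q]
    by (intro pair_char_hermitian) blast+
  ultimately show "\<tau> \<in> X_p (tensor A B) ?s"
    unfolding T.X_p_iff[OF cs] by blast
qed

lemma X_p_tensor_subset:
  assumes r: "r \<in> cont_cstar_seminorms (tensor A B)"
  obtains p q where "p \<in> A.CS" "q \<in> B.CS" "X_p (tensor A B) r \<subseteq> pair_char A B ` (X_p A p \<times> X_p B q)"
proof -
  obtain K where K: "K \<in> polar_products A B" "\<forall>F\<in>carrier (tensor A B). r F \<le> sup_seminorm K F"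
    using T.continuous_characters_dominated[OF polar_products_nonempty polar_products_directed r] by blast
  obtain p q where pq: "K = polar A p \<times> polar B q" "p \<in> A.CS" "q \<in> B.CS"
    using K(1) by (auto simp: polar_products_def)
  have "X_p (tensor A B) r \<subseteq> X_p (tensor A B) (sup_seminorm K)"
    by (rule T.X_p_mono[OF T.CS_cstar[OF r] T.cstar_sup[OF K(1)]]) (use K(2) in blast)
  then show thesis using that[OF pq(2,3)] X_p_tensor[OF pq(2,3)] pq(1) by simp
qed

lemma sup_polar_in_CS:
  "p \<in> A.CS \<Longrightarrow> q \<in> B.CS \<Longrightarrow> sup_seminorm (polar A p \<times> polar B q) \<in> cont_cstar_seminorms (tensor A B)"
  by (rule T.sup_seminorm_in_CS) (auto simp: polar_products_def)

lemma chars_tensor: "kalg_hom (tensor A B) complex_kalg = pair_char A B ` (A.chars \<times> B.chars)"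
proof (intro equalityI subsetI)
  fix \<tau> assume "\<tau> \<in> kalg_hom (tensor A B) complex_kalg"
  then obtain r where r: "r \<in> T.CS" "\<tau> \<in> X_p (tensor A B) r" using T.chars_iff by blast
  obtain p q where pq: "p \<in> A.CS" "q \<in> B.CS" "X_p (tensor A B) r \<subseteq> pair_char A B ` (X_p A p \<times> X_p B q)"
    by (rule X_p_tensor_subset[OF r(1)])
  then show "\<tau> \<in> pair_char A B ` (A.chars \<times> B.chars)"
    using r(2) A.X_p_subset_chars[OF pq(1)] B.X_p_subset_chars[OF pq(2)] by blast
next
  fix \<tau> assume "\<tau> \<in> pair_char A B ` (A.chars \<times> B.chars)"
  then obtain \<xi> \<eta> where \<tau>: "\<tau> = pair_char A B (\<xi>, \<eta>)" "\<xi> \<in> A.chars" "\<eta> \<in> B.chars" by blast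
  obtain p q where pq: "p \<in> A.CS" "q \<in> B.CS" "\<xi> \<in> X_p A p" "\<eta> \<in> X_p B q"
    by (rule chars_X_p[OF \<tau>(2,3)])
  have "\<tau> \<in> X_p (tensor A B) (sup_seminorm (polar A p \<times> polar B q))"
    unfolding X_p_tensor[OF pq(1,2)] \<tau>(1) using pq(3,4) by blast
  then show "\<tau> \<in> kalg_hom (tensor A B) complex_kalg"
    using T.chars_iff sup_polar_in_CS[OF pq(1,2)] by blast
qed

lemma pair_char_in_chars: "\<xi> \<in> A.chars \<Longrightarrow> \<eta> \<in> B.chars \<Longrightarrow> pair_char A B (\<xi>, \<eta>) \<in> kalg_hom (tensor A B) complex_kalg"
  by (auto simp: chars_tensor)

lemma pair_char_apply [simp]: "F \<in> tensor_carrier A B \<Longrightarrow> pair_char A B w F = F w"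
  by (simp add: pair_char_def)

lemma incl_left: "incl_left A B \<in> kalg_hom A (tensor A B)"
proof (rule kalg_homI[OF A.kstar_algebra_axioms T.involutive_algebra_axioms _ _ T.topol_sup])
  have char: "\<xi> \<in> hermitian_hom A complex_kalg" if "\<xi> \<in> A.chars" for \<xi> using that by (simp add: kalg_hom_def)
  have D: "\<xi> \<in> dual_ball A" "\<eta> \<in> dual_ball B" if "\<xi> \<in> A.chars" "\<eta> \<in> B.chars" for \<xi> \<eta>
    using that chars_dual_ball by blast+
  show "incl_left A B \<in> hermitian_hom A (tensor A B)"
    unfolding hermitian_hom_iff tensor_simps
    by (intro conjI ballI allI tensor_eqI)
      (simp_all add: incl_left_def elem_tensor_in_carrier tensor_closed tensor_add_in_carrier tensor_smult_in_carrier
        elem_tensor_apply tensor_mult_apply tensor_invol_apply D char_one characterD[OF char] distrib_right)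
  fix r assume "r \<in> sup_seminorm ` polar_products A B"
  then obtain K where K: "K \<in> polar_products A B" "r = sup_seminorm K" by blast
  then show "cstar_seminorm (tensor A B) r" using T.cstar_sup by blast
  obtain p q where pq: "K = polar A p \<times> polar B q" "p \<in> A.CS" "q \<in> B.CS"
    using K(1) by (auto simp: polar_products_def)
  have "r (incl_left A B a) \<le> p a" if a: "a \<in> carrier A" for a
  proof -
    have "sup_seminorm (X_p A p \<times> X_p B q) (elem_tensor A B a \<one>\<^bsub>B\<^esub>) \<le> p a"
    proof (rule sup_seminorm_least)
      fix w assume "w \<in> X_p A p \<times> X_p B q"
      then obtain \<xi> \<eta> where w: "w = (\<xi>, \<eta>)" "\<xi> \<in> X_p A p" "\<eta> \<in> X_p B q" by blast
      then have "\<xi> \<in> A.chars" "\<eta> \<in> B.chars"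
        using A.X_p_subset_chars[OF pq(2)] B.X_p_subset_chars[OF pq(3)] by blast+
      then show "norm (elem_tensor A B a \<one>\<^bsub>B\<^esub> w) \<le> p a"
        using A.norm_le_of_X_p[OF pq(2) w(2) a] by (simp add: w(1) elem_tensor_apply char_one)
    qed (rule cstar_seminorm_on.nonneg[OF A.CS_on[OF pq(2)] a])
    then show ?thesis
      using sup_polar_eq[OF elem_tensor_in_carrier[OF a B.one_closed] pq(2,3)] a by (simp add: K(2) pq(1) incl_left_def)
  qed
  then show "\<exists>p\<in>A.CS. \<forall>a\<in>carrier A. r (incl_left A B a) \<le> p a" using pq(2) by blast
qed

lemma incl_right: "incl_right A B \<in> kalg_hom B (tensor A B)"
proof (rule kalg_homI[OF B.kstar_algebra_axioms T.involutive_algebra_axioms _ _ T.topol_sup])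
  have char: "\<eta> \<in> hermitian_hom B complex_kalg" if "\<eta> \<in> B.chars" for \<eta> using that by (simp add: kalg_hom_def)
  have D: "\<xi> \<in> dual_ball A" "\<eta> \<in> dual_ball B" if "\<xi> \<in> A.chars" "\<eta> \<in> B.chars" for \<xi> \<eta>
    using that chars_dual_ball by blast+
  show "incl_right A B \<in> hermitian_hom B (tensor A B)"
    unfolding hermitian_hom_iff tensor_simps
    by (intro conjI ballI allI tensor_eqI)
      (simp_all add: incl_right_def elem_tensor_in_carrier tensor_closed tensor_add_in_carrier tensor_smult_in_carrier
        elem_tensor_apply tensor_mult_apply tensor_invol_apply D char_one characterD[OF char] distrib_left)
  fix r assume "r \<in> sup_seminorm ` polar_products A B"
  then obtain K where K: "K \<in> polar_products A B" "r = sup_seminorm K" by blast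
  then show "cstar_seminorm (tensor A B) r" using T.cstar_sup by blast
  obtain p q where pq: "K = polar A p \<times> polar B q" "p \<in> A.CS" "q \<in> B.CS"
    using K(1) by (auto simp: polar_products_def)
  have "r (incl_right A B b) \<le> q b" if b: "b \<in> carrier B" for b
  proof -
    have "sup_seminorm (X_p A p \<times> X_p B q) (elem_tensor A B \<one>\<^bsub>A\<^esub> b) \<le> q b"
    proof (rule sup_seminorm_least)
      fix w assume "w \<in> X_p A p \<times> X_p B q"
      then obtain \<xi> \<eta> where w: "w = (\<xi>, \<eta>)" "\<xi> \<in> X_p A p" "\<eta> \<in> X_p B q" by blast
      then have "\<xi> \<in> A.chars" "\<eta> \<in> B.chars"
        using A.X_p_subset_chars[OF pq(2)] B.X_p_subset_chars[OF pq(3)] by blast+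
      then show "norm (elem_tensor A B \<one>\<^bsub>A\<^esub> b w) \<le> q b"
        using B.norm_le_of_X_p[OF pq(3) w(3) b] by (simp add: w(1) elem_tensor_apply char_one)
    qed (rule cstar_seminorm_on.nonneg[OF B.CS_on[OF pq(3)] b])
    then show ?thesis
      using sup_polar_eq[OF elem_tensor_in_carrier[OF A.one_closed b] pq(2,3)] b by (simp add: K(2) pq(1) incl_right_def)
  qed
  then show "\<exists>q\<in>B.CS. \<forall>b\<in>carrier B. r (incl_right A B b) \<le> q b" using pq(3) by blast
qed

lemma incl_mult:
  assumes "a \<in> carrier A" "b \<in> carrier B"
  shows "incl_left A B a \<otimes>\<^bsub>tensor A B\<^esub> incl_right A B b = elem_tensor A B a b"
proof (rule tensor_eqI)
  show "incl_left A B a \<otimes>\<^bsub>tensor A B\<^esub> incl_right A B b \<in> tensor_carrier A B"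
    using assms by (simp add: incl_left_def incl_right_def tensor_closed elem_tensor_in_carrier)
  fix \<xi> \<eta> assume "\<xi> \<in> A.chars" "\<eta> \<in> B.chars"
  then show "(incl_left A B a \<otimes>\<^bsub>tensor A B\<^esub> incl_right A B b) (\<xi>, \<eta>) = elem_tensor A B a b (\<xi>, \<eta>)"
    using assms by (simp add: incl_left_def incl_right_def elem_tensor_in_carrier tensor_mult_apply elem_tensor_apply char_one)
qed (use assms in \<open>simp add: elem_tensor_in_carrier\<close>)

text \<open>Composed with a character of \<open>C\<close>, either morphism becomes a pair of
  characters, and such a pair is read off from its values on a \<otimes> 1 and 1 \<otimes>
  b.\<close>

lemma kalg_hom_tensor_eqI:
  assumes C: "kstar_algebra C" and h: "h \<in> kalg_hom (tensor A B) C" and h': "h' \<in> kalg_hom (tensor A B) C"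
    and left: "\<And>a. a \<in> carrier A \<Longrightarrow> h (elem_tensor A B a \<one>\<^bsub>B\<^esub>) = h' (elem_tensor A B a \<one>\<^bsub>B\<^esub>)"
    and right: "\<And>b. b \<in> carrier B \<Longrightarrow> h (elem_tensor A B \<one>\<^bsub>A\<^esub> b) = h' (elem_tensor A B \<one>\<^bsub>A\<^esub> b)"
  shows "h = h'"
proof (rule kalg_hom_eqI[OF C h h'])
  fix \<tau> F assume \<tau>: "\<tau> \<in> kalg_hom C complex_kalg" and F: "F \<in> carrier (tensor A B)"
  have "compose (carrier (tensor A B)) \<tau> h \<in> kalg_hom (tensor A B) complex_kalg"
    by (rule compose_character[OF kstar_algebra_tensor h \<tau>])
  then obtain \<xi> \<eta> where 1: "\<xi> \<in> A.chars" "\<eta> \<in> B.chars" "compose (carrier (tensor A B)) \<tau> h = pair_char A B (\<xi>, \<eta>)"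
    by (auto simp: chars_tensor)
  have "compose (carrier (tensor A B)) \<tau> h' \<in> kalg_hom (tensor A B) complex_kalg"
    by (rule compose_character[OF kstar_algebra_tensor h' \<tau>])
  then obtain \<xi>' \<eta>' where 2: "\<xi>' \<in> A.chars" "\<eta>' \<in> B.chars" "compose (carrier (tensor A B)) \<tau> h' = pair_char A B (\<xi>', \<eta>')"
    by (auto simp: chars_tensor)
  have h_eq: "\<tau> (h G) = G (\<xi>, \<eta>)" "\<tau> (h' G) = G (\<xi>', \<eta>')" if "G \<in> tensor_carrier A B" for G
    using fun_cong[OF 1(3), of G] fun_cong[OF 2(3), of G] that by (simp_all add: compose_def)
  have "\<xi> = \<xi>'"
  proof (rule extensionalityI)
    show "\<xi> \<in> extensional (carrier A)" "\<xi>' \<in> extensional (carrier A)"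
      using 1 2 by (auto simp: kalg_hom_def hermitian_character_iff)
    show "\<xi> a = \<xi>' a" if "a \<in> carrier A" for a
      using h_eq[of "elem_tensor A B a \<one>\<^bsub>B\<^esub>"] left[OF that] that 1 2
      by (simp add: elem_tensor_in_carrier elem_tensor_apply char_one)
  qed
  moreover have "\<eta> = \<eta>'"
  proof (rule extensionalityI)
    show "\<eta> \<in> extensional (carrier B)" "\<eta>' \<in> extensional (carrier B)"
      using 1 2 by (auto simp: kalg_hom_def hermitian_character_iff)
    show "\<eta> b = \<eta>' b" if "b \<in> carrier B" for b
      using h_eq[of "elem_tensor A B \<one>\<^bsub>A\<^esub> b"] right[OF that] that 1 2
      by (simp add: elem_tensor_in_carrier elem_tensor_apply char_one)
  qed
  ultimately show "\<tau> (h F) = \<tau> (h' F)" using h_eq[of F] F by simp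
qed

text \<open>The morphism dual to \<tau> \<mapsto> (\<tau> composed with \<open>u\<close>, \<tau>
  composed with \<open>v\<close>), obtained from \<open>kalg_hom_of_character_map\<close>. The
  second claim is the form in which every map out of a tensor product is evaluated later on.\<close>

theorem tensor_lift_hom:
  assumes C: "kstar_algebra C" and u: "u \<in> kalg_hom A C" and v: "v \<in> kalg_hom B C"
    and \<beta>: "\<And>a b. a \<in> carrier A \<Longrightarrow> b \<in> carrier B \<Longrightarrow> \<beta> a b = u a \<otimes>\<^bsub>C\<^esub> v b"
  shows "tensor_lift A B C \<beta> \<in> kalg_hom (tensor A B) C"
    and "\<And>\<tau> F. \<tau> \<in> kalg_hom C complex_kalg \<Longrightarrow> F \<in> tensor_carrier A B \<Longrightarrow>
      \<tau> (tensor_lift A B C \<beta> F) = F (compose (carrier A) \<tau> u, compose (carrier B) \<tau> v)"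
proof -
  interpret C: kstar_algebra C by fact
  let ?w = "\<lambda>\<tau>. (compose (carrier A) \<tau> u, compose (carrier B) \<tau> v)"
  define \<phi> where "\<phi> \<tau> = pair_char A B (?w \<tau>)" for \<tau>
  have chars: "compose (carrier A) \<tau> u \<in> A.chars" "compose (carrier B) \<tau> v \<in> B.chars"
    if "\<tau> \<in> C.chars" for \<tau>
    using compose_character[OF A.kstar_algebra_axioms u that] compose_character[OF B.kstar_algebra_axioms v that] .
  have CS: "(\<lambda>a. r (u a)) \<in> A.CS" "(\<lambda>b. r (v b)) \<in> B.CS" if "r \<in> C.CS" for r
    using kalg_hom_seminorm[OF A.involutive_algebra_axioms u that]
      kalg_hom_seminorm[OF B.involutive_algebra_axioms v that] .
  have w: "?w \<tau> \<in> X_p A (\<lambda>a. r (u a)) \<times> X_p B (\<lambda>b. r (v b))" if "r \<in> C.CS" "\<tau> \<in> X_p C r" for r \<tau>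
    using compose_character_X_p[OF A.kstar_algebra_axioms C u that]
      compose_character_X_p[OF B.kstar_algebra_axioms C v that] by blast
  have w_cont: "continuous_on S ?w" for S
  proof (intro continuous_on_Pair continuous_on_coordinatewise_then_product)
    show "continuous_on S (\<lambda>\<tau>. compose (carrier A) \<tau> u a)" for a
      by (cases "a \<in> carrier A") (auto simp: compose_def intro: continuous_on_coordinate)
    show "continuous_on S (\<lambda>\<tau>. compose (carrier B) \<tau> v b)" for b
      by (cases "b \<in> carrier B") (auto simp: compose_def intro: continuous_on_coordinate)
  qed
  obtain h where h: "h \<in> kalg_hom (tensor A B) C"
    "\<And>\<tau> F. \<tau> \<in> C.chars \<Longrightarrow> F \<in> carrier (tensor A B) \<Longrightarrow> \<tau> (h F) = \<phi> \<tau> F"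
  proof (rule kalg_hom_of_character_map[OF kstar_algebra_tensor C, of \<phi>])
    fix r assume r: "r \<in> C.CS"
    have "\<phi> ` X_p C r \<subseteq> X_p (tensor A B) (sup_seminorm (polar A (\<lambda>a. r (u a)) \<times> polar B (\<lambda>b. r (v b))))"
      unfolding X_p_tensor[OF CS[OF r]] \<phi>_def using w[OF r] by blast
    then show "\<exists>p\<in>cont_cstar_seminorms (tensor A B). \<phi> ` X_p C r \<subseteq> X_p (tensor A B) p"
      using sup_polar_in_CS[OF CS[OF r]] by blast
    fix F assume F: "F \<in> carrier (tensor A B)"
    then have F': "F \<in> tensor_carrier A B" by simp
    have "continuous_on (X_p C r) (\<lambda>\<tau>. F (?w \<tau>))"
      by (rule continuous_on_compose2[OF tensor_continuous[OF F' CS[OF r]] w_cont]) (use w[OF r] in blast)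
    then show "continuous_on (X_p C r) (\<lambda>\<tau>. \<phi> \<tau> F)" using F by (simp add: \<phi>_def)
  qed (rule that)
  have hF: "\<tau> (h F) = F (?w \<tau>)" if "\<tau> \<in> C.chars" "F \<in> tensor_carrier A B" for \<tau> F
    using h(2)[OF that(1), of F] that(2) by (simp add: \<phi>_def)
  have uv: "u a \<in> carrier C" "v b \<in> carrier C" if "a \<in> carrier A" "b \<in> carrier B" for a b
    using that u v by (auto simp: kalg_hom_def hermitian_hom_iff)
  have herm: "\<tau> \<in> hermitian_hom C complex_kalg" if "\<tau> \<in> C.chars" for \<tau> using that by (simp add: kalg_hom_def)
  have h_elem: "h (elem_tensor A B a b) = \<beta> a b" if a: "a \<in> carrier A" and b: "b \<in> carrier B" for a b
  proof (rule C.eqI_chars)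
    show "h (elem_tensor A B a b) \<in> carrier C"
      using h(1) elem_tensor_in_carrier[OF a b] by (simp add: kalg_hom_def hermitian_hom_iff)
    show "\<beta> a b \<in> carrier C" using a b uv by (simp add: \<beta>)
    fix \<tau> assume \<tau>: "\<tau> \<in> C.chars"
    show "\<tau> (h (elem_tensor A B a b)) = \<tau> (\<beta> a b)"
      unfolding hF[OF \<tau> elem_tensor_in_carrier[OF a b]] elem_tensor_apply[OF chars[OF \<tau>]]
      using a b uv by (simp add: \<beta> characterD(4)[OF herm[OF \<tau>]] compose_def)
  qed
  have "tensor_lift A B C \<beta> = h"
    unfolding tensor_lift_def
  proof (rule the_equality)
    show "h \<in> kalg_hom (tensor A B) C \<and> (\<forall>a\<in>carrier A. \<forall>b\<in>carrier B. h (elem_tensor A B a b) = \<beta> a b)"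
      using h(1) h_elem by blast
    fix h' assume h': "h' \<in> kalg_hom (tensor A B) C \<and> (\<forall>a\<in>carrier A. \<forall>b\<in>carrier B. h' (elem_tensor A B a b) = \<beta> a b)"
    then have h'_hom: "h' \<in> kalg_hom (tensor A B) C" by blast
    show "h' = h"
      by (rule kalg_hom_tensor_eqI[OF C h'_hom h(1)]) (use h' h_elem in auto)
  qed
  then show "tensor_lift A B C \<beta> \<in> kalg_hom (tensor A B) C"
    and "\<And>\<tau> F. \<tau> \<in> kalg_hom C complex_kalg \<Longrightarrow> F \<in> tensor_carrier A B \<Longrightarrow>
      \<tau> (tensor_lift A B C \<beta> F) = F (compose (carrier A) \<tau> u, compose (carrier B) \<tau> v)"
    using h(1) hF by simp_all
qed

end

lemma kalg_id_hom:
  assumes "kstar_algebra A" shows "kalg_id A \<in> kalg_hom A A"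
proof -
  interpret kstar_algebra A by fact
  have "continuous_map (topol A) (topol A) (kalg_id A)"
    by (rule continuous_map_eq[OF continuous_map_id]) (simp add: kalg_id_def)
  then show ?thesis by (simp add: kalg_hom_def hermitian_hom_iff kalg_id_def)
qed

lemma compose_kalg_id: "\<xi> \<in> extensional (carrier A) \<Longrightarrow> compose (carrier A) \<xi> (kalg_id A) = \<xi>"
  by (auto simp: compose_def kalg_id_def restrict_def extensional_def)

lemma kalg_hom_extensional: "u \<in> kalg_hom A B \<Longrightarrow> u \<in> extensional (carrier A)"
  by (simp add: kalg_hom_def hermitian_hom_iff)

lemma kalg_hom_closed: "u \<in> kalg_hom A B \<Longrightarrow> x \<in> carrier A \<Longrightarrow> u x \<in> carrier B"
  by (simp add: kalg_hom_def hermitian_hom_iff)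

lemma kstar_pairI: "kstar_algebra A \<Longrightarrow> kstar_algebra B \<Longrightarrow> kstar_pair A B"
  by (rule kstar_pair.intro)

text \<open>a \<otimes> b goes to the product of u(a) \<otimes> 1 and 1 \<otimes> v(b), so the map
  is the lift of two morphisms into \<open>tensor C D\<close>. On characters it pulls back each
  component separately.\<close>

theorem tensor_map_hom:
  assumes A: "kstar_algebra A" and B: "kstar_algebra B" and C: "kstar_algebra C" and D: "kstar_algebra D"
    and u: "u \<in> kalg_hom A C" and v: "v \<in> kalg_hom B D"
  shows "tensor_map A B C D u v \<in> kalg_hom (tensor A B) (tensor C D)"
    and "\<And>\<gamma> \<delta> F. \<gamma> \<in> kalg_hom C complex_kalg \<Longrightarrow> \<delta> \<in> kalg_hom D complex_kalg \<Longrightarrow> F \<in> tensor_carrier A B \<Longrightarrow>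
      tensor_map A B C D u v F (\<gamma>, \<delta>) = F (compose (carrier A) \<gamma> u, compose (carrier B) \<delta> v)"
proof -
  interpret AB: kstar_pair A B by (rule kstar_pairI[OF A B])
  interpret CD: kstar_pair C D by (rule kstar_pairI[OF C D])
  let ?u = "compose (carrier A) (incl_left C D) u" and ?v = "compose (carrier B) (incl_right C D) v"
  have u': "?u \<in> kalg_hom A (tensor C D)" by (rule kalg_hom_compose[OF u CD.incl_left A])
  have v': "?v \<in> kalg_hom B (tensor C D)" by (rule kalg_hom_compose[OF v CD.incl_right B])
  have \<beta>: "elem_tensor C D (u a) (v b) = ?u a \<otimes>\<^bsub>tensor C D\<^esub> ?v b" if "a \<in> carrier A" "b \<in> carrier B" for a b
    using that CD.incl_mult[OF kalg_hom_closed[OF u that(1)] kalg_hom_closed[OF v that(2)]] by (simp add: compose_def)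
  show hom: "tensor_map A B C D u v \<in> kalg_hom (tensor A B) (tensor C D)"
    unfolding tensor_map_def by (rule AB.tensor_lift_hom(1)[OF CD.kstar_algebra_tensor u' v']) (rule \<beta>)
  fix \<gamma> \<delta> F assume \<gamma>: "\<gamma> \<in> kalg_hom C complex_kalg" and \<delta>: "\<delta> \<in> kalg_hom D complex_kalg" and F: "F \<in> tensor_carrier A B"
  let ?\<tau> = "pair_char C D (\<gamma>, \<delta>)"
  have "tensor_map A B C D u v F \<in> tensor_carrier C D" using kalg_hom_closed[OF hom, of F] F by simp
  then have "tensor_map A B C D u v F (\<gamma>, \<delta>) = ?\<tau> (tensor_map A B C D u v F)" by simp
  also have "\<dots> = F (compose (carrier A) ?\<tau> ?u, compose (carrier B) ?\<tau> ?v)"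
    unfolding tensor_map_def
    by (rule AB.tensor_lift_hom(2)[OF CD.kstar_algebra_tensor u' v' _ CD.pair_char_in_chars[OF \<gamma> \<delta>] F]) (rule \<beta>)
  also have "compose (carrier A) ?\<tau> ?u = compose (carrier A) \<gamma> u"
    using kalg_hom_closed[OF u] \<gamma> \<delta>
    by (auto simp: compose_def restrict_def incl_left_def CD.elem_tensor_in_carrier CD.elem_tensor_apply CD.char_one)
  also have "compose (carrier B) ?\<tau> ?v = compose (carrier B) \<delta> v"
    using kalg_hom_closed[OF v] \<gamma> \<delta>
    by (auto simp: compose_def restrict_def incl_right_def CD.elem_tensor_in_carrier CD.elem_tensor_apply CD.char_one)
  finally show "tensor_map A B C D u v F (\<gamma>, \<delta>) = F (compose (carrier A) \<gamma> u, compose (carrier B) \<delta> v)" .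
qed

text \<open>Existence comes from two nested lifts, first out of \<open>tensor A B\<close>, then out
  of the triple product. On characters the result merely regroups the triple.\<close>

theorem tensor_assoc_hom:
  assumes A: "kstar_algebra A" and B: "kstar_algebra B" and C: "kstar_algebra C"
  shows "tensor_assoc A B C \<in> kalg_hom (tensor (tensor A B) C) (tensor A (tensor B C))"
    and "\<And>\<xi> \<eta> \<zeta> F. \<xi> \<in> kalg_hom A complex_kalg \<Longrightarrow> \<eta> \<in> kalg_hom B complex_kalg \<Longrightarrow> \<zeta> \<in> kalg_hom C complex_kalg \<Longrightarrow>
      F \<in> tensor_carrier (tensor A B) C \<Longrightarrow>
      tensor_assoc A B C F (\<xi>, pair_char B C (\<eta>, \<zeta>)) = F (pair_char A B (\<xi>, \<eta>), \<zeta>)"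
proof -
  interpret AB: kstar_pair A B by (rule kstar_pairI[OF A B])
  interpret BC: kstar_pair B C by (rule kstar_pairI[OF B C])
  interpret AB_C: kstar_pair "tensor A B" C by (rule kstar_pairI[OF AB.kstar_algebra_tensor C])
  interpret A_BC: kstar_pair A "tensor B C" by (rule kstar_pairI[OF A BC.kstar_algebra_tensor])
  let ?T = "tensor A (tensor B C)"
  note T = A_BC.kstar_algebra_tensor
  let ?u1 = "incl_left A (tensor B C)"
  let ?u2 = "compose (carrier B) (incl_right A (tensor B C)) (incl_left B C)"
  let ?v = "compose (carrier C) (incl_right A (tensor B C)) (incl_right B C)"
  have u1: "?u1 \<in> kalg_hom A ?T" by (rule A_BC.incl_left)
  have u2: "?u2 \<in> kalg_hom B ?T" by (rule kalg_hom_compose[OF BC.incl_left A_BC.incl_right B])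
  have v: "?v \<in> kalg_hom C ?T" by (rule kalg_hom_compose[OF BC.incl_right A_BC.incl_right C])
  let ?u = "tensor_lift A B ?T (\<lambda>a b. ?u1 a \<otimes>\<^bsub>?T\<^esub> ?u2 b)"
  note lift_u = AB.tensor_lift_hom[OF T u1 u2, of "\<lambda>a b. ?u1 a \<otimes>\<^bsub>?T\<^esub> ?u2 b", OF refl]
  let ?h = "tensor_lift (tensor A B) C ?T (\<lambda>F c. ?u F \<otimes>\<^bsub>?T\<^esub> ?v c)"
  note lift_h = AB_C.tensor_lift_hom[OF T lift_u(1) v, of "\<lambda>F c. ?u F \<otimes>\<^bsub>?T\<^esub> ?v c", OF refl]
  have h: "?h F (\<xi>, pair_char B C (\<eta>, \<zeta>)) = F (pair_char A B (\<xi>, \<eta>), \<zeta>)"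
    if \<xi>: "\<xi> \<in> AB.A.chars" and \<eta>: "\<eta> \<in> AB.B.chars" and \<zeta>: "\<zeta> \<in> BC.B.chars"
      and F: "F \<in> tensor_carrier (tensor A B) C" for \<xi> \<eta> \<zeta> F
  proof -
    \<comment> \<open>Evaluation at the triple is a character of the target; its pullbacks along the
      three inclusions are the three given characters again.\<close>
    let ?\<sigma> = "pair_char B C (\<eta>, \<zeta>)"
    let ?\<tau> = "pair_char A (tensor B C) (\<xi>, ?\<sigma>)"
    have \<sigma>: "?\<sigma> \<in> kalg_hom (tensor B C) complex_kalg" by (rule BC.pair_char_in_chars[OF \<eta> \<zeta>])
    have \<tau>: "?\<tau> \<in> kalg_hom ?T complex_kalg" by (rule A_BC.pair_char_in_chars[OF \<xi> \<sigma>])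
    have ext: "\<xi> \<in> extensional (carrier A)" "\<eta> \<in> extensional (carrier B)" "\<zeta> \<in> extensional (carrier C)"
      using \<xi> \<eta> \<zeta> kalg_hom_extensional by auto
    have 1: "compose (carrier A) ?\<tau> ?u1 = \<xi>"
      using A_BC.char_one(2)[OF \<sigma>] \<xi> \<sigma> A_BC.elem_tensor_in_carrier[OF _ A_BC.B.one_closed]
      by (intro extensionalityI[OF _ ext(1)]) (simp_all add: compose_def incl_left_def A_BC.elem_tensor_apply)
    have 2: "compose (carrier B) ?\<tau> ?u2 = \<eta>"
      using A_BC.char_one(1)[OF \<xi>] \<xi> \<eta> \<zeta> \<sigma> BC.elem_tensor_in_carrier[OF _ BC.B.one_closed]
        A_BC.elem_tensor_in_carrier[OF AB.A.one_closed]
      by (intro extensionalityI[OF _ ext(2)])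
        (simp_all add: compose_def incl_left_def incl_right_def A_BC.elem_tensor_apply BC.elem_tensor_apply BC.char_one)
    have 3: "compose (carrier C) ?\<tau> ?v = \<zeta>"
      using A_BC.char_one(1)[OF \<xi>] \<xi> \<eta> \<zeta> \<sigma> BC.elem_tensor_in_carrier[OF AB.B.one_closed]
        A_BC.elem_tensor_in_carrier[OF AB.A.one_closed]
      by (intro extensionalityI[OF _ ext(3)])
        (simp_all add: compose_def incl_right_def A_BC.elem_tensor_apply BC.elem_tensor_apply BC.char_one)
    have 4: "compose (carrier (tensor A B)) ?\<tau> ?u = pair_char A B (\<xi>, \<eta>)"
    proof
      fix G show "compose (carrier (tensor A B)) ?\<tau> ?u G = pair_char A B (\<xi>, \<eta>) G"
      proof (cases "G \<in> tensor_carrier A B")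
        case True
        then have "compose (carrier (tensor A B)) ?\<tau> ?u G = ?\<tau> (?u G)" by (intro compose_eq) simp
        also have "\<dots> = G (compose (carrier A) ?\<tau> ?u1, compose (carrier B) ?\<tau> ?u2)"
          by (rule lift_u(2)[OF \<tau> True])
        also have "\<dots> = pair_char A B (\<xi>, \<eta>) G" unfolding 1 2 using True by simp
        finally show ?thesis .
      qed (simp add: compose_def pair_char_def)
    qed
    have "?h F \<in> tensor_carrier A (tensor B C)" using kalg_hom_closed[OF lift_h(1), of F] F by simp
    then have "?h F (\<xi>, ?\<sigma>) = ?\<tau> (?h F)" by simp
    also have "\<dots> = F (compose (carrier (tensor A B)) ?\<tau> ?u, compose (carrier C) ?\<tau> ?v)"
      by (rule lift_h(2)[OF \<tau> F])
    finally show ?thesis by (simp only: 3 4)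
  qed
  have h_elem: "?h (elem_tensor (tensor A B) C (elem_tensor A B a b) c) = elem_tensor A (tensor B C) a (elem_tensor B C b c)"
    if abc: "a \<in> carrier A" "b \<in> carrier B" "c \<in> carrier C" for a b c
  proof (rule A_BC.tensor_eqI)
    have ab: "elem_tensor A B a b \<in> carrier (tensor A B)" using abc by (simp add: AB.elem_tensor_in_carrier)
    have bc: "elem_tensor B C b c \<in> carrier (tensor B C)" using abc by (simp add: BC.elem_tensor_in_carrier)
    have e: "elem_tensor (tensor A B) C (elem_tensor A B a b) c \<in> tensor_carrier (tensor A B) C"
      by (rule AB_C.elem_tensor_in_carrier[OF ab abc(3)])
    show "?h (elem_tensor (tensor A B) C (elem_tensor A B a b) c) \<in> tensor_carrier A (tensor B C)"
      using kalg_hom_closed[OF lift_h(1)] e by simp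
    show "elem_tensor A (tensor B C) a (elem_tensor B C b c) \<in> tensor_carrier A (tensor B C)"
      by (rule A_BC.elem_tensor_in_carrier[OF abc(1) bc])
    fix \<xi> \<sigma> assume \<xi>: "\<xi> \<in> AB.A.chars" and \<sigma>: "\<sigma> \<in> A_BC.B.chars"
    then obtain \<eta> \<zeta> where \<eta>: "\<eta> \<in> AB.B.chars" "\<zeta> \<in> BC.B.chars" "\<sigma> = pair_char B C (\<eta>, \<zeta>)"
      unfolding BC.chars_tensor by blast
    have \<tau>: "pair_char A B (\<xi>, \<eta>) \<in> AB_C.A.chars" by (rule AB.pair_char_in_chars[OF \<xi> \<eta>(1)])
    have "?h (elem_tensor (tensor A B) C (elem_tensor A B a b) c) (\<xi>, \<sigma>) = \<xi> a * \<eta> b * \<zeta> c"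
      unfolding \<eta>(3) h[OF \<xi> \<eta>(1,2) e] AB_C.elem_tensor_apply[OF \<tau> \<eta>(2)]
      using ab by (simp add: AB.elem_tensor_apply[OF \<xi> \<eta>(1)])
    moreover have "elem_tensor A (tensor B C) a (elem_tensor B C b c) (\<xi>, \<sigma>) = \<xi> a * (\<eta> b * \<zeta> c)"
      unfolding A_BC.elem_tensor_apply[OF \<xi> \<sigma>] using bc by (simp add: \<eta>(3) BC.elem_tensor_apply[OF \<eta>(1,2)])
    ultimately show "?h (elem_tensor (tensor A B) C (elem_tensor A B a b) c) (\<xi>, \<sigma>) =
        elem_tensor A (tensor B C) a (elem_tensor B C b c) (\<xi>, \<sigma>)" by simp
  qed
  have eq: "tensor_assoc A B C = ?h"
    unfolding tensor_assoc_def
  proof (rule the_equality)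
    show "?h \<in> kalg_hom (tensor (tensor A B) C) ?T \<and> (\<forall>a\<in>carrier A. \<forall>b\<in>carrier B. \<forall>c\<in>carrier C.
        ?h (elem_tensor (tensor A B) C (elem_tensor A B a b) c) = elem_tensor A (tensor B C) a (elem_tensor B C b c))"
      using lift_h(1) h_elem by blast
    fix h' assume h': "h' \<in> kalg_hom (tensor (tensor A B) C) ?T \<and> (\<forall>a\<in>carrier A. \<forall>b\<in>carrier B. \<forall>c\<in>carrier C.
        h' (elem_tensor (tensor A B) C (elem_tensor A B a b) c) = elem_tensor A (tensor B C) a (elem_tensor B C b c))"
    then have h'_hom: "h' \<in> kalg_hom (tensor (tensor A B) C) ?T" by blast
    have agree: "h' (elem_tensor (tensor A B) C (elem_tensor A B a b) c) = ?h (elem_tensor (tensor A B) C (elem_tensor A B a b) c)"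
      if "a \<in> carrier A" "b \<in> carrier B" "c \<in> carrier C" for a b c
      using h' h_elem[OF that] that by metis
    \<comment> \<open>The description prescribes values on elementary triples only. Restricting to F
      \<otimes> 1 first settles agreement for all \<open>F\<close> in \<open>tensor A B\<close>, by
      uniqueness for that tensor product.\<close>
    let ?l = "compose (carrier (tensor A B)) h' (incl_left (tensor A B) C)"
    let ?m = "compose (carrier (tensor A B)) ?h (incl_left (tensor A B) C)"
    have "?l = ?m"
    proof (rule AB.kalg_hom_tensor_eqI[OF T])
      show "?l \<in> kalg_hom (tensor A B) ?T"
        by (rule kalg_hom_compose[OF AB_C.incl_left h'_hom AB.kstar_algebra_tensor])
      show "?m \<in> kalg_hom (tensor A B) ?T"
        by (rule kalg_hom_compose[OF AB_C.incl_left lift_h(1) AB.kstar_algebra_tensor])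
      show "?l (elem_tensor A B a \<one>\<^bsub>B\<^esub>) = ?m (elem_tensor A B a \<one>\<^bsub>B\<^esub>)" if "a \<in> carrier A" for a
        using agree[OF that AB.B.one_closed BC.B.one_closed] AB.elem_tensor_in_carrier[OF that AB.B.one_closed]
        by (simp add: compose_def incl_left_def)
      show "?l (elem_tensor A B \<one>\<^bsub>A\<^esub> b) = ?m (elem_tensor A B \<one>\<^bsub>A\<^esub> b)" if "b \<in> carrier B" for b
        using agree[OF AB.A.one_closed that BC.B.one_closed] AB.elem_tensor_in_carrier[OF AB.A.one_closed that]
        by (simp add: compose_def incl_left_def)
    qed
    then have left: "h' (elem_tensor (tensor A B) C F \<one>\<^bsub>C\<^esub>) = ?h (elem_tensor (tensor A B) C F \<one>\<^bsub>C\<^esub>)"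
      if "F \<in> carrier (tensor A B)" for F
      using fun_cong[OF \<open>?l = ?m\<close>, of F] unfolding compose_eq[OF that] incl_left_apply[OF that] by -
    show "h' = ?h"
    proof (rule AB_C.kalg_hom_tensor_eqI[OF T h'_hom lift_h(1) left])
      fix c assume "c \<in> carrier C"
      then show "h' (elem_tensor (tensor A B) C \<one>\<^bsub>tensor A B\<^esub> c) = ?h (elem_tensor (tensor A B) C \<one>\<^bsub>tensor A B\<^esub> c)"
        using agree[OF AB.A.one_closed AB.B.one_closed, of c] by simp
    qed
  qed
  show "tensor_assoc A B C \<in> kalg_hom (tensor (tensor A B) C) ?T" unfolding eq by (rule lift_h(1))
  show "tensor_assoc A B C F (\<xi>, pair_char B C (\<eta>, \<zeta>)) = F (pair_char A B (\<xi>, \<eta>), \<zeta>)"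
    if "\<xi> \<in> kalg_hom A complex_kalg" "\<eta> \<in> kalg_hom B complex_kalg" "\<zeta> \<in> kalg_hom C complex_kalg"
      "F \<in> tensor_carrier (tensor A B) C" for \<xi> \<eta> \<zeta> F
    unfolding eq by (rule h[OF that])
qed

section \<open>Evaluation maps\<close>

lemma compactological_hom_compose:
  assumes u: "u \<in> compactological_hom S T" and v: "v \<in> compactological_hom T R"
    and S: "compactological_space S"
  shows "compose (points S) v u \<in> compactological_hom S R"
proof -
  interpret compactological_space S by fact
  have "\<exists>M\<in>compacta R. compose (points S) v u ` K \<subseteq> M \<and> continuous_map (ktop S K) (ktop R M) (compose (points S) v u)"
    if K: "K \<in> compacta S" for K
  proof -
    obtain L where L: "L \<in> compacta T" "u ` K \<subseteq> L" "continuous_map (ktop S K) (ktop T L) u"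
      using u K by (auto simp: compactological_hom_def)
    obtain M where M: "M \<in> compacta R" "v ` L \<subseteq> M" "continuous_map (ktop T L) (ktop R M) v"
      using v L(1) by (auto simp: compactological_hom_def)
    have sub: "K \<subseteq> points S" by (rule compacta_subset_points[OF K])
    have "continuous_map (ktop S K) (ktop R M) (compose (points S) v u)"
      by (rule continuous_map_eq[OF continuous_map_compose[OF L(3) M(3)]])
        (use sub ktop_topspace[OF K] in \<open>auto simp: compose_def\<close>)
    moreover have "compose (points S) v u ` K \<subseteq> M" using L(2) M(2) sub by (auto simp: compose_def)
    ultimately show ?thesis using M(1) by blast
  qed
  moreover have "compose (points S) v u \<in> points S \<rightarrow>\<^sub>E points R"
    using u v by (auto simp: compactological_hom_def compose_def)
  ultimately show ?thesis by (simp add: compactological_hom_def)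
qed

lemma C_map_apply: "f \<in> compactological_hom T complex_space \<Longrightarrow> C_map S T u f = compose (points S) f u"
  by (simp add: C_map_def)

lemma C_map_kalg_hom:
  assumes S: "compactological_space S" and T: "compactological_space T" and u: "u \<in> compactological_hom S T"
  shows "C_map S T u \<in> kalg_hom (C_alg T) (C_alg S)"
proof -
  interpret S: compactological_space S by fact
  interpret T: compactological_space T by fact
  interpret CS: function_algebra "C_alg S" "compacta S" by (rule S.function_algebra_C)
  interpret CT: function_algebra "C_alg T" "compacta T" by (rule T.function_algebra_C)
  have in_T: "u x \<in> points T" if "x \<in> points S" for x using u that by (rule compactological_hom_in_points)
  have closed: "compose (points S) f u \<in> compactological_hom S complex_space"
    if "f \<in> compactological_hom T complex_space" for f
    by (rule compactological_hom_compose[OF u that S])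
  have CT_closed: "\<one>\<^bsub>C_alg T\<^esub> \<in> carrier (C_alg T)"
    "\<And>f g. f \<in> carrier (C_alg T) \<Longrightarrow> g \<in> carrier (C_alg T) \<Longrightarrow> f \<oplus>\<^bsub>C_alg T\<^esub> g \<in> carrier (C_alg T)"
    "\<And>f g. f \<in> carrier (C_alg T) \<Longrightarrow> g \<in> carrier (C_alg T) \<Longrightarrow> f \<otimes>\<^bsub>C_alg T\<^esub> g \<in> carrier (C_alg T)"
    "\<And>c f. f \<in> carrier (C_alg T) \<Longrightarrow> c \<odot>\<^bsub>C_alg T\<^esub> f \<in> carrier (C_alg T)"
    "\<And>f. f \<in> carrier (C_alg T) \<Longrightarrow> invol (C_alg T) f \<in> carrier (C_alg T)"
    by (simp_all del: C_alg_simps)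
  show ?thesis
  proof (rule kalg_homI[OF T.kstar_algebra_C CS.involutive_algebra_axioms _ _ CS.topol_sup])
    show "C_map S T u \<in> hermitian_hom (C_alg T) (C_alg S)"
      unfolding hermitian_hom_iff
      using CT_closed[unfolded C_alg_simps] closed in_T
      by (auto simp: C_map_def compose_def restrict_def fun_eq_iff extensional_def)
    fix r assume "r \<in> sup_seminorm ` compacta S"
    then obtain K where K: "K \<in> compacta S" "r = sup_seminorm K" by blast
    then show "cstar_seminorm (C_alg S) r" using CS.cstar_sup by blast
    obtain L where L: "L \<in> compacta T" "u ` K \<subseteq> L" using u K(1) by (auto simp: compactological_hom_def)
    have "r (C_map S T u f) \<le> sup_seminorm L f" if f: "f \<in> carrier (C_alg T)" for f
    proof -
      have "sup_seminorm K (C_map S T u f) \<le> sup_seminorm L f"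
      proof (rule sup_seminorm_least)
        show "0 \<le> sup_seminorm L f" by (rule cstar_seminorm_on.nonneg[OF CT.cstar_on[OF CT.cstar_sup[OF L(1)]] f])
        fix x assume x: "x \<in> K"
        then have "x \<in> points S" "u x \<in> L" using S.compacta_subset_points[OF K(1)] L(2) by auto
        then show "norm (C_map S T u f x) \<le> sup_seminorm L f"
          using CT.norm_le_sup[OF f L(1), of "u x"] f by (simp add: C_map_apply compose_def)
      qed
      then show ?thesis by (simp add: K(2))
    qed
    then show "\<exists>p\<in>CT.CS. \<forall>f\<in>carrier (C_alg T). r (C_map S T u f) \<le> p f"
      using CT.sup_seminorm_in_CS[OF L(1)] by blast
  qed
qed

lemma X_map_apply: "\<xi> \<in> kalg_hom B complex_kalg \<Longrightarrow> X_map A B u \<xi> = compose (carrier A) \<xi> u"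
  by (simp add: X_map_def)

lemma X_map_hom:
  assumes A: "kstar_algebra A" and B: "kstar_algebra B" and u: "u \<in> kalg_hom A B"
  shows "X_map A B u \<in> compactological_hom (X_space B) (X_space A)"
proof -
  interpret A: kstar_algebra A by fact
  interpret B: kstar_algebra B by fact
  have "\<exists>L\<in>compacta (X_space A). X_map A B u ` K \<subseteq> L \<and> continuous_map (ktop (X_space B) K) (ktop (X_space A) L) (X_map A B u)"
    if "K \<in> compacta (X_space B)" for K
  proof -
    obtain r where r: "r \<in> B.CS" "K = X_p B r" using \<open>K \<in> compacta (X_space B)\<close> by auto
    let ?p = "\<lambda>a. r (u a)"
    have p: "?p \<in> A.CS" by (rule kalg_hom_seminorm[OF A.involutive_algebra_axioms u r(1)])
    have eq: "X_map A B u \<eta> = compose (carrier A) \<eta> u" if "\<eta> \<in> X_p B r" for \<eta>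
      using that B.X_p_subset_chars[OF r(1)] by (intro X_map_apply) blast
    have maps: "X_map A B u ` X_p B r \<subseteq> X_p A ?p"
      using eq compose_character_X_p[OF A B u r(1)] by auto
    have "continuous_on (X_p B r) (X_map A B u)"
    proof (rule continuous_on_coordinatewise_then_product)
      fix a
      have "continuous_on (X_p B r) (\<lambda>\<eta>. compose (carrier A) \<eta> u a)"
        by (cases "a \<in> carrier A") (auto simp: compose_def intro: continuous_on_coordinate)
      then show "continuous_on (X_p B r) (\<lambda>\<eta>. X_map A B u \<eta> a)"
        by (rule continuous_on_eq) (simp add: eq)
    qed
    then have "continuous_map (ktop (X_space B) K) (ktop (X_space A) (X_p A ?p)) (X_map A B u)"
      using maps by (simp add: r(2) A.ktop_X_p B.ktop_X_p continuous_map_in_subtopology image_subset_iff_funcset)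
    then show ?thesis using maps p r(2) by (intro bexI[of _ "X_p A ?p"]) auto
  qed
  moreover have "X_map A B u \<in> points (X_space B) \<rightarrow>\<^sub>E points (X_space A)"
    using compose_character[OF A u] by (auto simp: X_map_def)
  ultimately show ?thesis by (simp add: compactological_hom_def)
qed

context compactological_space
begin

interpretation C: function_algebra "C_alg S" "compacta S"
  by (rule function_algebra_C)

lemma eval_space_in_chars: "s \<in> points S \<Longrightarrow> eval_space S s \<in> kalg_hom (C_alg S) complex_kalg"
  by (simp add: chars_C_alg)

lemma eval_space_hom: "eval_space S \<in> compactological_hom S (X_space (C_alg S))"
proof -
  have "\<exists>L\<in>compacta (X_space (C_alg S)). eval_space S ` K \<subseteq> L \<and>
      continuous_map (ktop S K) (ktop (X_space (C_alg S)) L) (eval_space S)" if K: "K \<in> compacta S" for K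
  proof (intro bexI conjI)
    show "eval_space S ` K \<subseteq> X_p (C_alg S) (sup_seminorm K)" by (simp add: X_p_sup_seminorm[OF K])
    then show "continuous_map (ktop S K) (ktop (X_space (C_alg S)) (X_p (C_alg S) (sup_seminorm K))) (eval_space S)"
      using eval_space_continuous[OF K] ktop_topspace[OF K]
      by (simp add: C.ktop_X_p continuous_map_in_subtopology image_subset_iff_funcset)
    show "X_p (C_alg S) (sup_seminorm K) \<in> compacta (X_space (C_alg S))"
      using C.sup_seminorm_in_CS[OF K] by simp
  qed
  moreover have "eval_space S \<in> points S \<rightarrow>\<^sub>E points (X_space (C_alg S))"
    using eval_space_in_chars by (auto simp: eval_space_def)
  ultimately show ?thesis by (simp add: compactological_hom_def)
qed

end

definition eval_space_inv :: "('s, 'm) compactological_scheme \<Rightarrow> (('s \<Rightarrow> complex) \<Rightarrow> complex) \<Rightarrow> 's" where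
  "eval_space_inv S = restrict (the_inv_into (points S) (eval_space S)) (points (X_space (C_alg S)))"

context regular_compactological_space
begin

interpretation C: function_algebra "C_alg S" "compacta S"
  by (rule function_algebra_C)

lemma inj_on_eval_space: "inj_on (eval_space S) (points S)"
proof (rule inj_onI, rule ccontr)
  fix s t assume st: "s \<in> points S" "t \<in> points S" "eval_space S s = eval_space S t" "s \<noteq> t"
  then obtain f where f: "f \<in> compactological_hom S complex_space" "f s \<noteq> f t" using regular by blast
  have "eval_space S s f = eval_space S t f" using st(3) by simp
  then show False using f st(1,2) by simp
qed

lemma eval_space_inv [simp]: "s \<in> points S \<Longrightarrow> eval_space_inv S (eval_space S s) = s"
  using the_inv_into_f_f[OF inj_on_eval_space] by (simp add: eval_space_inv_def chars_C_alg)

text \<open>Regularity makes \<open>eval_space S\<close> injective, and a continuous injection of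
  the compact \<open>K\<close> into a Hausdorff space is a homeomorphism onto its image.\<close>

lemma eval_space_inv_continuous:
  assumes K: "K \<in> compacta S"
  shows "continuous_map (top_of_set (eval_space S ` K)) (ktop S K) (eval_space_inv S)"
proof -
  have sub: "K \<subseteq> points S" by (rule compacta_subset_points[OF K])
  have "homeomorphic_map (ktop S K) (top_of_set (eval_space S ` K)) (eval_space S)"
  proof (rule continuous_imp_homeomorphic_map)
    show "continuous_map (ktop S K) (top_of_set (eval_space S ` K)) (eval_space S)"
      using eval_space_continuous[OF K] ktop_topspace[OF K] by (simp add: continuous_map_in_subtopology)
    have "Hausdorff_space (ktop (X_space (C_alg S)) (X_p (C_alg S) (sup_seminorm K)))"
      by (rule C.X.ktop_Hausdorff) (use C.sup_seminorm_in_CS[OF K] in simp)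
    then show "Hausdorff_space (top_of_set (eval_space S ` K))"
      unfolding C.ktop_X_p unfolding X_p_sup_seminorm[OF K] .
    show "inj_on (eval_space S) (topspace (ktop S K))"
      using inj_on_subset[OF inj_on_eval_space sub] by (simp add: ktop_topspace[OF K])
  qed (use ktop_compact[OF K] ktop_topspace[OF K] in auto)
  then obtain g where g: "homeomorphic_maps (ktop S K) (top_of_set (eval_space S ` K)) (eval_space S) g"
    using homeomorphic_map_maps by blast
  show ?thesis
  proof (rule continuous_map_eq)
    show "continuous_map (top_of_set (eval_space S ` K)) (ktop S K) g" using g by (simp add: homeomorphic_maps_def)
    fix \<xi> assume "\<xi> \<in> topspace (top_of_set (eval_space S ` K))"
    then obtain s where s: "s \<in> K" "\<xi> = eval_space S s" by auto
    then show "g \<xi> = eval_space_inv S \<xi>" using g sub ktop_topspace[OF K] by (auto simp: homeomorphic_maps_def)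
  qed
qed

text \<open>Each \<open>X_p\<close> lies in the image of one member of \<open>compacta S\<close>, on
  which the inverse is already known to be continuous.\<close>

lemma eval_space_inv_hom: "eval_space_inv S \<in> compactological_hom (X_space (C_alg S)) S"
proof -
  have "\<exists>L\<in>compacta S. eval_space_inv S ` K \<subseteq> L \<and> continuous_map (ktop (X_space (C_alg S)) K) (ktop S L) (eval_space_inv S)"
    if "K \<in> compacta (X_space (C_alg S))" for K
  proof -
    obtain p where p: "p \<in> C.CS" "K = X_p (C_alg S) p" using \<open>K \<in> compacta (X_space (C_alg S))\<close> by auto
    obtain L where L: "L \<in> compacta S" "X_p (C_alg S) p \<subseteq> eval_space S ` L" by (rule X_p_C_alg_subset[OF p(1)])
    have "continuous_map (subtopology (top_of_set (eval_space S ` L)) K) (ktop S L) (eval_space_inv S)"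
      by (rule continuous_map_from_subtopology[OF eval_space_inv_continuous[OF L(1)]])
    moreover have "subtopology (top_of_set (eval_space S ` L)) K = top_of_set K"
      using L(2) p(2) by (simp add: subtopology_subtopology inf_absorb2)
    moreover have "eval_space_inv S ` K \<subseteq> L"
    proof -
      have "eval_space_inv S ` eval_space S ` L = L"
        using compacta_subset_points[OF L(1)] by (force simp: image_image subset_iff)
      then show ?thesis using L(2) p(2) by blast
    qed
    ultimately show ?thesis using L(1) p(2) C.ktop_X_p by auto
  qed
  moreover have "eval_space_inv S \<in> points (X_space (C_alg S)) \<rightarrow>\<^sub>E points S"
    by (auto simp: eval_space_inv_def chars_C_alg the_inv_into_f_f[OF inj_on_eval_space])
  ultimately show ?thesis by (simp add: compactological_hom_def)
qed

end

section \<open>Products of compactological spaces\<close>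

lemma compactological_prod_simps [simp]:
  "points (compactological_prod S T) = points S \<times> points T"
  by (simp add: compactological_prod_def)

locale compactological_pair = S: compactological_space S + T: compactological_space T
  for S :: "('s, 'm) compactological_scheme" and T :: "('t, 'n) compactological_scheme"
begin

abbreviation product_top where "product_top K L \<equiv> prod_topology (ktop S K) (ktop T L)"

lemma compacta_prod_iff:
  "H \<in> compacta (compactological_prod S T) \<longleftrightarrow>
     (\<exists>K\<in>compacta S. \<exists>L\<in>compacta T. closedin (product_top K L) H)"
  by (simp add: compactological_prod_def)

lemma topspace_product_top: "K \<in> compacta S \<Longrightarrow> L \<in> compacta T \<Longrightarrow> topspace (product_top K L) = K \<times> L"
  by (simp add: S.ktop_topspace T.ktop_topspace)

lemma compact_product_top: "K \<in> compacta S \<Longrightarrow> L \<in> compacta T \<Longrightarrow> compact_space (product_top K L)"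
  by (simp add: compact_space_prod_topology S.ktop_compact T.ktop_compact)

lemma Hausdorff_product_top: "K \<in> compacta S \<Longrightarrow> L \<in> compacta T \<Longrightarrow> Hausdorff_space (product_top K L)"
  by (simp add: Hausdorff_space_prod_topology S.ktop_Hausdorff T.ktop_Hausdorff)

text \<open>The definition of the topology uses the projections of \<open>H\<close>. By compactness
  they are closed, and \<open>ktop_subset\<close> then allows any \<open>K\<close> and
  \<open>L\<close> with \<open>H\<close> closed in their product to be used instead.\<close>

lemma ktop_prod:
  assumes K: "K \<in> compacta S" and L: "L \<in> compacta T" and H: "closedin (product_top K L) H"
  shows "fst ` H \<in> compacta S" "snd ` H \<in> compacta T"
    "ktop (compactological_prod S T) H = subtopology (product_top K L) H"
proof -
  have sub: "H \<subseteq> K \<times> L" using closedin_subset[OF H] unfolding topspace_product_top[OF K L] .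
  have compact: "compactin (product_top K L) H"
    by (rule closedin_compact_space[OF compact_product_top[OF K L] H])
  have "compactin (ktop S K) (fst ` H)" by (rule image_compactin[OF compact continuous_map_fst])
  then have "closedin (ktop S K) (fst ` H)" by (rule compactin_imp_closedin[OF S.ktop_Hausdorff[OF K]])
  then show 1: "fst ` H \<in> compacta S" by (rule S.closedin_in_compacta[OF K])
  have "compactin (ktop T L) (snd ` H)" by (rule image_compactin[OF compact continuous_map_snd])
  then have "closedin (ktop T L) (snd ` H)" by (rule compactin_imp_closedin[OF T.ktop_Hausdorff[OF L]])
  then show 2: "snd ` H \<in> compacta T" by (rule T.closedin_in_compacta[OF L])
  have "fst ` H \<subseteq> K" "snd ` H \<subseteq> L" using sub by auto
  then have "product_top (fst ` H) (snd ` H) = subtopology (product_top K L) (fst ` H \<times> snd ` H)"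
    using S.ktop_subset[OF 1 K] T.ktop_subset[OF 2 L] by (simp add: subtopology_Times)
  moreover have "(fst ` H \<times> snd ` H) \<inter> H = H" by force
  ultimately show "ktop (compactological_prod S T) H = subtopology (product_top K L) H"
    by (simp add: compactological_prod_def subtopology_subtopology)
qed

lemma Times_compacta:
  assumes K: "K \<in> compacta S" and L: "L \<in> compacta T"
  shows "K \<times> L \<in> compacta (compactological_prod S T)" "ktop (compactological_prod S T) (K \<times> L) = product_top K L"
proof -
  have closed: "closedin (product_top K L) (K \<times> L)"
    using closedin_topspace[of "product_top K L"] unfolding topspace_product_top[OF K L] .
  then show "K \<times> L \<in> compacta (compactological_prod S T)" using K L compacta_prod_iff by blast
  show "ktop (compactological_prod S T) (K \<times> L) = product_top K L"
    unfolding ktop_prod(3)[OF K L closed]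
    by (rule subtopology_superset) (simp only: topspace_product_top[OF K L] order_refl)
qed

lemma compactological_space_prod: "compactological_space (compactological_prod S T)" (is "compactological_space ?P")
proof
  have Times_sub: "H \<subseteq> K \<times> L" if "K \<in> compacta S" "L \<in> compacta T" "closedin (product_top K L) H" for K L H
    using closedin_subset[OF that(3)] unfolding topspace_product_top[OF that(1,2)] .
  have sub: "H \<subseteq> points S \<times> points T" if H: "H \<in> compacta ?P" for H
  proof -
    obtain K L where KL: "K \<in> compacta S" "L \<in> compacta T" "closedin (product_top K L) H"
      using H compacta_prod_iff by blast
    then show ?thesis
      using Times_sub[OF KL] S.compacta_subset_points[OF KL(1)] T.compacta_subset_points[OF KL(2)] by blast
  qed
  show "\<Union>(compacta ?P) = points ?P"
  proof
    show "\<Union>(compacta ?P) \<subseteq> points ?P" using sub by auto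
    show "points ?P \<subseteq> \<Union>(compacta ?P)"
    proof
      fix z assume "z \<in> points ?P"
      then obtain s t where z: "z = (s, t)" "s \<in> points S" "t \<in> points T" by auto
      obtain K where K: "K \<in> compacta S" "s \<in> K" using z(2) S.compacta_cover by blast
      obtain L where L: "L \<in> compacta T" "t \<in> L" using z(3) T.compacta_cover by blast
      show "z \<in> \<Union>(compacta ?P)" using Times_compacta(1)[OF K(1) L(1)] K(2) L(2) z(1) by blast
    qed
  qed
  obtain K0 L0 where "K0 \<in> compacta S" "L0 \<in> compacta T" using S.compacta_nonempty T.compacta_nonempty by blast
  then show "compacta ?P \<noteq> {}" using Times_compacta(1) by blast
  fix H assume H: "H \<in> compacta ?P"
  then obtain K L where KL: "K \<in> compacta S" "L \<in> compacta T" "closedin (product_top K L) H"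
    using compacta_prod_iff by blast
  have ktop: "ktop ?P H = subtopology (product_top K L) H" by (rule ktop_prod(3)[OF KL])
  have HKL: "H \<subseteq> K \<times> L" by (rule Times_sub[OF KL])
  show "topspace (ktop ?P H) = H" using HKL by (simp only: ktop topspace_subtopology topspace_product_top[OF KL(1,2)]) blast
  show "compact_space (ktop ?P H)"
    unfolding ktop by (rule compact_space_subtopology[OF closedin_compact_space[OF compact_product_top[OF KL(1,2)] KL(3)]])
  show "Hausdorff_space (ktop ?P H)"
    unfolding ktop by (rule Hausdorff_space_subtopology[OF Hausdorff_product_top[OF KL(1,2)]])
  show "ktop ?P H closure_of G \<in> compacta ?P" if "G \<subseteq> H" for G
  proof -
    have "closedin (ktop ?P H) (ktop ?P H closure_of G)" by simp
    then have "closedin (product_top K L) (ktop ?P H closure_of G)"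
      unfolding ktop by (rule closedin_trans_full) (rule KL(3))
    then show ?thesis using KL(1,2) compacta_prod_iff by blast
  qed
  fix H' assume H': "H' \<in> compacta ?P"
  then obtain K' L' where KL': "K' \<in> compacta S" "L' \<in> compacta T" "closedin (product_top K' L') H'"
    using compacta_prod_iff by blast
  show "\<exists>M\<in>compacta ?P. H \<union> H' \<subseteq> M"
  proof -
    obtain M where M: "M \<in> compacta S" "K \<union> K' \<subseteq> M" using S.compacta_directed KL KL' by blast
    obtain N where N: "N \<in> compacta T" "L \<union> L' \<subseteq> N" using T.compacta_directed KL KL' by blast
    have "H \<union> H' \<subseteq> M \<times> N" using Times_sub[OF KL] Times_sub[OF KL'] M(2) N(2) by blast
    then show ?thesis using Times_compacta(1)[OF M(1) N(1)] by blast
  qed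
  show "continuous_map (ktop ?P H) (ktop ?P H') (\<lambda>x. x)" if HH': "H \<subseteq> H'"
  proof -
    have fst': "fst ` H \<in> compacta S" "snd ` H \<in> compacta T" by (rule ktop_prod(1,2)[OF KL])+
    have fst'': "fst ` H' \<in> compacta S" "snd ` H' \<in> compacta T" by (rule ktop_prod(1,2)[OF KL'])+
    have "continuous_map (product_top (fst ` H) (snd ` H)) (product_top (fst ` H') (snd ` H')) (\<lambda>x. x)"
    proof -
      have "continuous_map (product_top (fst ` H) (snd ` H)) (product_top (fst ` H') (snd ` H')) (\<lambda>x. (fst x, snd x))"
        using continuous_map_compose[OF continuous_map_fst S.ktop_inclusion[OF fst'(1) fst''(1) image_mono[OF HH']]]
          continuous_map_compose[OF continuous_map_snd T.ktop_inclusion[OF fst'(2) fst''(2) image_mono[OF HH']]]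
        by (intro continuous_map_pairedI) (simp_all add: o_def)
      then show ?thesis by simp
    qed
    then show ?thesis
      using HH' unfolding compactological_prod_def
      by (simp add: continuous_map_in_subtopology continuous_map_from_subtopology) auto
  qed
qed

lemma fst_hom: "(\<lambda>z\<in>points S \<times> points T. fst z) \<in> compactological_hom (compactological_prod S T) S"
proof -
  interpret P: compactological_space "compactological_prod S T" by (rule compactological_space_prod)
  have "\<exists>L\<in>compacta S. (\<lambda>z\<in>points S \<times> points T. fst z) ` H \<subseteq> L \<and>
      continuous_map (ktop (compactological_prod S T) H) (ktop S L) (\<lambda>z\<in>points S \<times> points T. fst z)"
    if H: "H \<in> compacta (compactological_prod S T)" for H
  proof -
    obtain K L where KL: "K \<in> compacta S" "L \<in> compacta T" "closedin (product_top K L) H"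
      using H compacta_prod_iff by blast
    have sub: "H \<subseteq> K \<times> L" "H \<subseteq> points S \<times> points T"
      using closedin_subset[OF KL(3)] P.compacta_subset_points[OF H] by (simp_all only: topspace_product_top[OF KL(1,2)] compactological_prod_simps)
    have "continuous_map (ktop (compactological_prod S T) H) (ktop S K) (\<lambda>z\<in>points S \<times> points T. fst z)"
      unfolding ktop_prod(3)[OF KL]
      by (rule continuous_map_eq[OF continuous_map_from_subtopology[OF continuous_map_fst]]) (use sub in auto)
    moreover have "(\<lambda>z\<in>points S \<times> points T. fst z) ` H \<subseteq> K" using sub by auto
    ultimately show ?thesis using KL(1) by blast
  qed
  then show ?thesis by (auto simp: compactological_hom_def)
qed

lemma snd_hom: "(\<lambda>z\<in>points S \<times> points T. snd z) \<in> compactological_hom (compactological_prod S T) T"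
proof -
  interpret P: compactological_space "compactological_prod S T" by (rule compactological_space_prod)
  have "\<exists>L\<in>compacta T. (\<lambda>z\<in>points S \<times> points T. snd z) ` H \<subseteq> L \<and>
      continuous_map (ktop (compactological_prod S T) H) (ktop T L) (\<lambda>z\<in>points S \<times> points T. snd z)"
    if H: "H \<in> compacta (compactological_prod S T)" for H
  proof -
    obtain K L where KL: "K \<in> compacta S" "L \<in> compacta T" "closedin (product_top K L) H"
      using H compacta_prod_iff by blast
    have sub: "H \<subseteq> K \<times> L" "H \<subseteq> points S \<times> points T"
      using closedin_subset[OF KL(3)] P.compacta_subset_points[OF H] by (simp_all only: topspace_product_top[OF KL(1,2)] compactological_prod_simps)
    have "continuous_map (ktop (compactological_prod S T) H) (ktop T L) (\<lambda>z\<in>points S \<times> points T. snd z)"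
      unfolding ktop_prod(3)[OF KL]
      by (rule continuous_map_eq[OF continuous_map_from_subtopology[OF continuous_map_snd]]) (use sub in auto)
    moreover have "(\<lambda>z\<in>points S \<times> points T. snd z) ` H \<subseteq> L" using sub by auto
    ultimately show ?thesis using KL(2) by blast
  qed
  then show ?thesis by (auto simp: compactological_hom_def)
qed

end

section \<open>Reducts of bialgebras and semigroups\<close>

lemma C_bialg_simps [simp]:
  "carrier (C_bialg S) = carrier (C_alg S)" "mult (C_bialg S) = mult (C_alg S)"
  "one (C_bialg S) = one (C_alg S)" "zero (C_bialg S) = zero (C_alg S)" "add (C_bialg S) = add (C_alg S)"
  "smult (C_bialg S) = smult (C_alg S)" "invol (C_bialg S) = invol (C_alg S)" "topol (C_bialg S) = topol (C_alg S)"
  by (simp_all add: C_bialg_def kalg.defs del: C_alg_simps)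

lemma comult_C_bialg:
  "comult (C_bialg S) = compose (carrier (C_alg S))
     (inv_into (carrier (tensor (C_alg S) (C_alg S))) (C_prod_iso S))
     (C_map (compactological_prod S S) S (smul S))"
  by (simp add: C_bialg_def kalg.defs kbialg.defs del: C_alg_simps)

lemma minus_C_bialg: "a_minus (C_bialg S) = a_minus (C_alg S)"
  by (simp add: fun_eq_iff a_minus_def a_inv_def m_inv_def del: C_alg_simps)

text \<open>The two records have different types and cannot be identified by an equation. Every
  notion is therefore unfolded to the fields, which coincide; the same holds for the transfer lemmas
  that follow.\<close>

lemma kstar_algebra_C_bialg_iff: "kstar_algebra (C_bialg S) \<longleftrightarrow> kstar_algebra (C_alg S)"
  unfolding kstar_algebra_def involutive_algebra_def algebra_def cring_def ring_def abelian_group_def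
    abelian_monoid_def comm_monoid_def monoid_def comm_monoid_axioms_def abelian_group_axioms_def
    comm_group_def group_def group_axioms_def Units_def ring_axioms_def module_def module_axioms_def algebra_axioms_def
    involutive_algebra_axioms_def kstar_algebra_axioms_def cstar_seminorm_def cauchy_filter_def
  by (simp only: minus_C_bialg C_bialg_simps monoid.simps partial_object.simps)

lemma kalg_hom_C_bialg [simp]:
  "kalg_hom (C_bialg S) B = kalg_hom (C_alg S) B" "kalg_hom A (C_bialg S) = kalg_hom A (C_alg S)"
  by (simp_all only: kalg_hom_def hermitian_hom_def ring_hom_def C_bialg_simps)

lemma cont_cstar_seminorms_C_bialg [simp]: "cont_cstar_seminorms (C_bialg S) = cont_cstar_seminorms (C_alg S)"
  by (simp only: cont_cstar_seminorms_def cstar_seminorm_def C_bialg_simps)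

lemma X_p_C_bialg [simp]: "X_p (C_bialg S) = X_p (C_alg S)"
  by (simp only: fun_eq_iff X_p_def hermitian_hom_def ring_hom_def minus_C_bialg C_bialg_simps) simp

lemma X_space_C_bialg [simp]: "X_space (C_bialg S) = X_space (C_alg S)"
  by (simp only: X_space_def C_bialg_simps kalg_hom_C_bialg cont_cstar_seminorms_C_bialg X_p_C_bialg)

lemma polar_C_bialg [simp]: "polar (C_bialg S) = polar (C_alg S)"
  by (simp only: fun_eq_iff polar_def linear_functional_def C_bialg_simps) simp

lemma dual_ball_C_bialg [simp]: "dual_ball (C_bialg S) = dual_ball (C_alg S)"
  by (simp only: dual_ball_def cont_cstar_seminorms_C_bialg polar_C_bialg)

lemma tensor_sum_C_bialg [simp]: "tensor_sum (C_bialg S) (C_bialg T) = tensor_sum (C_alg S) (C_alg T)"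
  by (simp only: fun_eq_iff tensor_sum_def dual_ball_C_bialg) simp

lemma tensor_carrier_C_bialg [simp]: "tensor_carrier (C_bialg S) (C_bialg T) = tensor_carrier (C_alg S) (C_alg T)"
  by (simp only: tensor_carrier_def dual_ball_C_bialg cont_cstar_seminorms_C_bialg polar_C_bialg tensor_sum_C_bialg
      C_bialg_simps)

lemma tensor_C_bialg [simp]: "tensor (C_bialg S) (C_bialg T) = tensor (C_alg S) (C_alg T)"
  by (simp only: tensor_def tensor_mult_def tensor_invol_def tensor_topology_def dual_ball_C_bialg
      cont_cstar_seminorms_C_bialg polar_C_bialg tensor_sum_C_bialg tensor_carrier_C_bialg C_bialg_simps)

lemma X_sgp_simps [simp]:
  "points (X_sgp A) = points (X_space A)" "compacta (X_sgp A) = compacta (X_space A)" "ktop (X_sgp A) = ktop (X_space A)"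
  by (simp_all add: X_sgp_def compactological.defs del: X_space_simps)

lemma smul_X_sgp:
  "smul (X_sgp A) = (\<lambda>(\<xi>, \<eta>) \<in> points (X_space A) \<times> points (X_space A).
     compose (carrier A) (tensor_lift A A complex_kalg (\<lambda>a b. \<xi> a * \<eta> b)) (comult A))"
  by (simp add: X_sgp_def compactological.defs compactological_sgp.defs del: X_space_simps)

lemma compactological_hom_X_sgp [simp]:
  "compactological_hom (X_sgp A) T = compactological_hom (X_space A) T"
  "compactological_hom S (X_sgp B) = compactological_hom S (X_space B)"
  by (simp_all only: compactological_hom_def X_sgp_simps)

lemma compactological_prod_X_sgp [simp]:
  "compactological_prod (X_sgp A) (X_sgp B) = compactological_prod (X_space A) (X_space B)"
  by (simp only: compactological_prod_def X_sgp_simps)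

lemma regular_compactological_space_X_sgp_iff:
  "regular_compactological_space (X_sgp A) \<longleftrightarrow> regular_compactological_space (X_space A)"
  by (simp only: regular_compactological_space_def regular_compactological_space_axioms_def
      compactological_space_def X_sgp_simps compactological_hom_X_sgp)

lemma C_alg_X_sgp [simp]: "C_alg (X_sgp A) = C_alg (X_space A)"
  by (simp only: C_alg_def X_sgp_simps compactological_hom_X_sgp)

section \<open>Convolution of characters\<close>

lemma kalg_id_complex_char: "(\<lambda>z. z) \<in> kalg_hom complex_kalg complex_kalg"
  using kalg_id_hom[OF kstar_algebra_complex] by (simp add: kalg_id_def restrict_UNIV)

lemma compose_identity: "\<xi> \<in> extensional A \<Longrightarrow> compose A (\<lambda>z. z) \<xi> = \<xi>"
  by (auto simp: compose_def restrict_def extensional_def)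

text \<open>A bialgebra short of coassociativity. The convolution of characters is already defined
  here, so coassociativity can be characterized and then proved for function algebras.\<close>

locale kstar_comultiplication = kstar_algebra A
  for A :: "('a, 'm) kbialg_scheme" (structure) +
  assumes comult_hom: "comult A \<in> kalg_hom A (tensor A A)"
begin

interpretation AA: kstar_pair A A ..

lemma comult_closed: "a \<in> carrier A \<Longrightarrow> comult A a \<in> tensor_carrier A A"
  using kalg_hom_closed[OF comult_hom] by simp

lemma smul_eq:
  assumes \<xi>: "\<xi> \<in> chars" and \<eta>: "\<eta> \<in> chars"
  shows "smul (X_sgp A) (\<xi>, \<eta>) = compose (carrier A) (pair_char A A (\<xi>, \<eta>)) (comult A)"
proof
  fix a
  have ext: "\<xi> \<in> extensional (carrier A)" "\<eta> \<in> extensional (carrier A)"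
    using \<xi> \<eta> kalg_hom_extensional by auto
  \<comment> \<open>The formula for lifts speaks about characters of the target; at the identity
    character of \<open>complex_kalg\<close> it becomes a formula for the value itself.\<close>
  have "tensor_lift A A complex_kalg (\<lambda>a b. \<xi> a * \<eta> b) F = F (\<xi>, \<eta>)" if "F \<in> tensor_carrier A A" for F
    using AA.tensor_lift_hom(2)[OF kstar_algebra_complex \<xi> \<eta> _ kalg_id_complex_char that, of "\<lambda>a b. \<xi> a * \<eta> b"]
    by (simp add: compose_identity ext)
  then show "smul (X_sgp A) (\<xi>, \<eta>) a = compose (carrier A) (pair_char A A (\<xi>, \<eta>)) (comult A) a"
    using \<xi> \<eta> comult_closed by (simp add: smul_X_sgp compose_def)
qed

lemma smul_apply:
  "\<xi> \<in> chars \<Longrightarrow> \<eta> \<in> chars \<Longrightarrow> a \<in> carrier A \<Longrightarrow> smul (X_sgp A) (\<xi>, \<eta>) a = comult A a (\<xi>, \<eta>)"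
  using comult_closed by (simp add: smul_eq compose_def)

lemma smul_in_chars: "\<xi> \<in> chars \<Longrightarrow> \<eta> \<in> chars \<Longrightarrow> smul (X_sgp A) (\<xi>, \<eta>) \<in> chars"
  by (simp add: smul_eq compose_character[OF kstar_algebra_axioms comult_hom AA.pair_char_in_chars])

lemma smul_X_p:
  assumes p: "p \<in> CS" and q: "q \<in> CS" and \<xi>: "\<xi> \<in> X_p A p" and \<eta>: "\<eta> \<in> X_p A q"
  shows "smul (X_sgp A) (\<xi>, \<eta>) \<in> X_p A (\<lambda>a. sup_seminorm (polar A p \<times> polar A q) (comult A a))"
proof -
  have chars: "\<xi> \<in> chars" "\<eta> \<in> chars" using X_p_subset_chars[OF p] X_p_subset_chars[OF q] \<xi> \<eta> by auto
  have "pair_char A A (\<xi>, \<eta>) \<in> X_p (tensor A A) (sup_seminorm (polar A p \<times> polar A q))"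
    unfolding AA.X_p_tensor[OF p q] using \<xi> \<eta> by blast
  then show ?thesis
    unfolding smul_eq[OF chars]
    by (rule compose_character_X_p[OF kstar_algebra_axioms AA.kstar_algebra_tensor comult_hom AA.sup_polar_in_CS[OF p q]])
qed

lemma smul_hom: "smul (X_sgp A) \<in> compactological_hom (compactological_prod (X_space A) (X_space A)) (X_space A)"
proof -
  interpret XX: compactological_pair "X_space A" "X_space A" ..
  let ?P = "compactological_prod (X_space A) (X_space A)"
  have "\<exists>L\<in>compacta (X_space A). smul (X_sgp A) ` H \<subseteq> L \<and> continuous_map (ktop ?P H) (ktop (X_space A) L) (smul (X_sgp A))"
    if "H \<in> compacta ?P" for H
  proof -
    obtain K L where KL: "K \<in> compacta (X_space A)" "L \<in> compacta (X_space A)" "closedin (XX.product_top K L) H"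
      using \<open>H \<in> compacta ?P\<close> XX.compacta_prod_iff by blast
    obtain p q where pq: "p \<in> CS" "q \<in> CS" "K = X_p A p" "L = X_p A q" using KL(1,2) by auto
    let ?r = "\<lambda>a. sup_seminorm (polar A p \<times> polar A q) (comult A a)"
    have r: "?r \<in> CS"
      by (rule kalg_hom_seminorm[OF involutive_algebra_axioms comult_hom AA.sup_polar_in_CS[OF pq(1,2)]])
    have top: "XX.product_top K L = top_of_set (X_p A p \<times> X_p A q)"
      by (simp add: pq(3,4) ktop_X_p prod_topology_subtopology_eu)
    have H: "H \<subseteq> X_p A p \<times> X_p A q" using closedin_subset[OF KL(3)] by (simp add: top)
    have maps: "smul (X_sgp A) ` (X_p A p \<times> X_p A q) \<subseteq> X_p A ?r"
      using smul_X_p[OF pq(1,2)] by auto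
    have chars: "\<xi> \<in> chars" "\<eta> \<in> chars" if "(\<xi>, \<eta>) \<in> X_p A p \<times> X_p A q" for \<xi> \<eta>
      using X_p_subset_chars[OF pq(1)] X_p_subset_chars[OF pq(2)] that by auto
    have "continuous_on (X_p A p \<times> X_p A q) (smul (X_sgp A))"
    proof (rule continuous_on_coordinatewise_then_product)
      fix a
      have "continuous_on (X_p A p \<times> X_p A q) (\<lambda>w. compose (carrier A) (pair_char A A w) (comult A) a)"
        using AA.tensor_continuous[OF comult_closed pq(1,2), of a] comult_closed[of a]
        by (cases "a \<in> carrier A") (simp_all add: compose_def)
      then show "continuous_on (X_p A p \<times> X_p A q) (\<lambda>w. smul (X_sgp A) w a)"
        by (rule continuous_on_eq) (use chars smul_eq in auto)
    qed
    then have "continuous_map (XX.product_top K L) (ktop (X_space A) (X_p A ?r)) (smul (X_sgp A))"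
      using maps by (simp add: top ktop_X_p continuous_map_in_subtopology image_subset_iff_funcset)
    then have "continuous_map (ktop ?P H) (ktop (X_space A) (X_p A ?r)) (smul (X_sgp A))"
      unfolding XX.ktop_prod(3)[OF KL] by (rule continuous_map_from_subtopology)
    moreover have "smul (X_sgp A) ` H \<subseteq> X_p A ?r" using maps H by blast
    ultimately show ?thesis using r by (intro bexI[of _ "X_p A ?r"]) auto
  qed
  moreover have "smul (X_sgp A) \<in> points ?P \<rightarrow>\<^sub>E points (X_space A)"
    using smul_in_chars by (auto simp: smul_X_sgp)
  ultimately show ?thesis by (simp add: compactological_hom_def)
qed

text \<open>Each application of the comultiplication pulls a pair of characters back to their
  convolution. Applied twice, with the first two characters grouped, this gives the left-bracketed
  product.\<close>

lemma comult_left_apply: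
  assumes chars: "\<xi> \<in> chars" "\<eta> \<in> chars" "\<zeta> \<in> chars" and a: "a \<in> carrier A"
  shows "tensor_assoc A A A (tensor_map A A (tensor A A) A (comult A) (kalg_id A) (comult A a)) (\<xi>, pair_char A A (\<eta>, \<zeta>)) =
    smul (X_sgp A) (smul (X_sgp A) (\<xi>, \<eta>), \<zeta>) a"
proof -
  note map = tensor_map_hom[OF kstar_algebra_axioms kstar_algebra_axioms AA.kstar_algebra_tensor kstar_algebra_axioms
      comult_hom kalg_id_hom[OF kstar_algebra_axioms]]
  have F: "tensor_map A A (tensor A A) A (comult A) (kalg_id A) (comult A a) \<in> tensor_carrier (tensor A A) A"
    using kalg_hom_closed[OF map(1)] comult_closed[OF a] by simp
  show ?thesis
    unfolding tensor_assoc_hom(2)[OF kstar_algebra_axioms kstar_algebra_axioms kstar_algebra_axioms chars F]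
      map(2)[OF AA.pair_char_in_chars[OF chars(1,2)] chars(3) comult_closed[OF a]]
      smul_eq[OF chars(1,2), symmetric] compose_kalg_id[OF kalg_hom_extensional[OF chars(3)]]
    by (rule smul_apply[OF smul_in_chars[OF chars(1,2)] chars(3) a, symmetric])
qed

lemma comult_right_apply:
  assumes chars: "\<xi> \<in> chars" "\<eta> \<in> chars" "\<zeta> \<in> chars" and a: "a \<in> carrier A"
  shows "tensor_map A A A (tensor A A) (kalg_id A) (comult A) (comult A a) (\<xi>, pair_char A A (\<eta>, \<zeta>)) =
    smul (X_sgp A) (\<xi>, smul (X_sgp A) (\<eta>, \<zeta>)) a"
  unfolding tensor_map_hom(2)[OF kstar_algebra_axioms kstar_algebra_axioms kstar_algebra_axioms AA.kstar_algebra_tensor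
      kalg_id_hom[OF kstar_algebra_axioms] comult_hom chars(1) AA.pair_char_in_chars[OF chars(2,3)] comult_closed[OF a]]
    smul_eq[OF chars(2,3), symmetric] compose_kalg_id[OF kalg_hom_extensional[OF chars(1)]]
  by (rule smul_apply[OF chars(1) smul_in_chars[OF chars(2,3)] a, symmetric])

text \<open>The two sides of coassociativity lie in \<open>tensor A (tensor A A)\<close>, where
  triples of characters separate elements; at such a triple they are the two bracketings.\<close>

theorem kstar_bialgebra_iff:
  "kstar_bialgebra A \<longleftrightarrow>
     (\<forall>\<xi>\<in>chars. \<forall>\<eta>\<in>chars. \<forall>\<zeta>\<in>chars.
        smul (X_sgp A) (smul (X_sgp A) (\<xi>, \<eta>), \<zeta>) = smul (X_sgp A) (\<xi>, smul (X_sgp A) (\<eta>, \<zeta>)))"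
    (is "_ \<longleftrightarrow> ?assoc")
proof
  assume "kstar_bialgebra A"
  then interpret kstar_bialgebra A .
  show ?assoc
  proof (intro ballI)
    fix \<xi> \<eta> \<zeta> assume chars: "\<xi> \<in> chars" "\<eta> \<in> chars" "\<zeta> \<in> chars"
    show "smul (X_sgp A) (smul (X_sgp A) (\<xi>, \<eta>), \<zeta>) = smul (X_sgp A) (\<xi>, smul (X_sgp A) (\<eta>, \<zeta>))"
    proof (rule extensionalityI)
      show "smul (X_sgp A) (smul (X_sgp A) (\<xi>, \<eta>), \<zeta>) \<in> extensional (carrier A)"
        "smul (X_sgp A) (\<xi>, smul (X_sgp A) (\<eta>, \<zeta>)) \<in> extensional (carrier A)"
        using chars smul_in_chars kalg_hom_extensional by blast+
      show "smul (X_sgp A) (smul (X_sgp A) (\<xi>, \<eta>), \<zeta>) a = smul (X_sgp A) (\<xi>, smul (X_sgp A) (\<eta>, \<zeta>)) a"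
        if "a \<in> carrier A" for a
        unfolding comult_left_apply[OF chars that, symmetric] comult_right_apply[OF chars that, symmetric]
          coassoc[OF that] ..
    qed
  qed
next
  assume assoc: ?assoc
  interpret A_AA: kstar_pair A "tensor A A" by (rule kstar_pairI[OF kstar_algebra_axioms AA.kstar_algebra_tensor])
  note map_left = tensor_map_hom(1)[OF kstar_algebra_axioms kstar_algebra_axioms AA.kstar_algebra_tensor
      kstar_algebra_axioms comult_hom kalg_id_hom[OF kstar_algebra_axioms]]
  note map_right = tensor_map_hom(1)[OF kstar_algebra_axioms kstar_algebra_axioms kstar_algebra_axioms
      AA.kstar_algebra_tensor kalg_id_hom[OF kstar_algebra_axioms] comult_hom]
  note assoc_hom = tensor_assoc_hom(1)[OF kstar_algebra_axioms kstar_algebra_axioms kstar_algebra_axioms]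
  show "kstar_bialgebra A"
  proof
    fix a assume a: "a \<in> carrier A"
    note F = comult_closed[OF a]
    show "tensor_assoc A A A (tensor_map A A (tensor A A) A (comult A) (kalg_id A) (comult A a)) =
        tensor_map A A A (tensor A A) (kalg_id A) (comult A) (comult A a)"
    proof (rule A_AA.tensor_eqI)
      show "tensor_assoc A A A (tensor_map A A (tensor A A) A (comult A) (kalg_id A) (comult A a)) \<in> tensor_carrier A (tensor A A)"
        using kalg_hom_closed[OF assoc_hom] kalg_hom_closed[OF map_left] F by simp
      show "tensor_map A A A (tensor A A) (kalg_id A) (comult A) (comult A a) \<in> tensor_carrier A (tensor A A)"
        using kalg_hom_closed[OF map_right] F by simp
      fix \<xi> \<tau> assume \<xi>: "\<xi> \<in> chars" and "\<tau> \<in> A_AA.B.chars"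
      then obtain \<eta> \<zeta> where \<tau>: "\<eta> \<in> chars" "\<zeta> \<in> chars" "\<tau> = pair_char A A (\<eta>, \<zeta>)"
        unfolding AA.chars_tensor by blast
      show "tensor_assoc A A A (tensor_map A A (tensor A A) A (comult A) (kalg_id A) (comult A a)) (\<xi>, \<tau>) =
          tensor_map A A A (tensor A A) (kalg_id A) (comult A) (comult A a) (\<xi>, \<tau>)"
        unfolding \<tau>(3) comult_left_apply[OF \<xi> \<tau>(1,2) a] comult_right_apply[OF \<xi> \<tau>(1,2) a]
        using assoc \<xi> \<tau>(1,2) by simp
    qed
  qed (rule comult_hom)
qed

end

sublocale kstar_bialgebra \<subseteq> kstar_comultiplication
  by unfold_locales (rule comult_hom)

theorem (in kstar_bialgebra) compactological_semigroup_X: "compactological_semigroup (X_sgp A)"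
proof -
  interpret X: regular_compactological_space "X_sgp A"
    using X.regular_compactological_space_axioms by (simp only: regular_compactological_space_X_sgp_iff)
  show ?thesis
  proof
    show "smul (X_sgp A) \<in> compactological_hom (compactological_prod (X_sgp A) (X_sgp A)) (X_sgp A)"
      using smul_hom by simp
  qed (use kstar_bialgebra_iff kstar_bialgebra_axioms in simp)
qed

text \<open>At a pair of characters of \<open>B\<close>, the two sides of the compatibility
  condition for an element \<open>a\<close> are the two sides of multiplicativity of
  \<open>X_map A B u\<close>, evaluated at \<open>a\<close>.\<close>

theorem kbialg_hom_iff:
  assumes A: "kstar_comultiplication A" and B: "kstar_comultiplication B"
  shows "u \<in> kbialg_hom A B \<longleftrightarrow> u \<in> kalg_hom A B \<and>
    (\<forall>\<xi>\<in>kalg_hom B complex_kalg. \<forall>\<eta>\<in>kalg_hom B complex_kalg.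
       X_map A B u (smul (X_sgp B) (\<xi>, \<eta>)) = smul (X_sgp A) (X_map A B u \<xi>, X_map A B u \<eta>))"
proof (cases "u \<in> kalg_hom A B")
  case u: True
  interpret A: kstar_comultiplication A by fact
  interpret B: kstar_comultiplication B by fact
  interpret BB: kstar_pair B B ..
  note map = tensor_map_hom[OF A.kstar_algebra_axioms A.kstar_algebra_axioms B.kstar_algebra_axioms B.kstar_algebra_axioms u u]
  have chars: "X_map A B u \<xi> \<in> A.chars" if "\<xi> \<in> B.chars" for \<xi>
    using compose_character[OF A.kstar_algebra_axioms u that] by (simp add: X_map_apply[OF that])
  have lhs: "X_map A B u (smul (X_sgp B) (\<xi>, \<eta>)) a = comult B (u a) (\<xi>, \<eta>)"
    if "\<xi> \<in> B.chars" "\<eta> \<in> B.chars" "a \<in> carrier A" for \<xi> \<eta> a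
    using B.smul_apply[OF that(1,2) kalg_hom_closed[OF u that(3)]] that
    by (simp add: X_map_apply[OF B.smul_in_chars] compose_eq)
  have rhs: "smul (X_sgp A) (X_map A B u \<xi>, X_map A B u \<eta>) a = tensor_map A A B B u u (comult A a) (\<xi>, \<eta>)"
    if "\<xi> \<in> B.chars" "\<eta> \<in> B.chars" "a \<in> carrier A" for \<xi> \<eta> a
    using A.smul_apply[OF chars[OF that(1)] chars[OF that(2)] that(3)] map(2)[OF that(1,2) A.comult_closed[OF that(3)]]
    by (simp add: X_map_apply that(1,2))
  show ?thesis
  proof
    assume "u \<in> kbialg_hom A B"
    then have comm: "comult B (u a) = tensor_map A A B B u u (comult A a)" if "a \<in> carrier A" for a
      using that by (simp add: kbialg_hom_def)
    have "X_map A B u (smul (X_sgp B) (\<xi>, \<eta>)) = smul (X_sgp A) (X_map A B u \<xi>, X_map A B u \<eta>)"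
      if w: "\<xi> \<in> B.chars" "\<eta> \<in> B.chars" for \<xi> \<eta>
    proof (rule extensionalityI)
      show "X_map A B u (smul (X_sgp B) (\<xi>, \<eta>)) \<in> extensional (carrier A)"
        by (rule kalg_hom_extensional[OF chars[OF B.smul_in_chars[OF w]]])
      show "smul (X_sgp A) (X_map A B u \<xi>, X_map A B u \<eta>) \<in> extensional (carrier A)"
        by (rule kalg_hom_extensional[OF A.smul_in_chars[OF chars[OF w(1)] chars[OF w(2)]]])
      show "X_map A B u (smul (X_sgp B) (\<xi>, \<eta>)) a = smul (X_sgp A) (X_map A B u \<xi>, X_map A B u \<eta>) a"
        if "a \<in> carrier A" for a
        unfolding lhs[OF w that] rhs[OF w that] comm[OF that] ..
    qed
    then show "u \<in> kalg_hom A B \<and> (\<forall>\<xi>\<in>B.chars. \<forall>\<eta>\<in>B.chars.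
        X_map A B u (smul (X_sgp B) (\<xi>, \<eta>)) = smul (X_sgp A) (X_map A B u \<xi>, X_map A B u \<eta>))"
      using u by blast
  next
    assume "u \<in> kalg_hom A B \<and> (\<forall>\<xi>\<in>B.chars. \<forall>\<eta>\<in>B.chars.
        X_map A B u (smul (X_sgp B) (\<xi>, \<eta>)) = smul (X_sgp A) (X_map A B u \<xi>, X_map A B u \<eta>))"
    then have mult: "X_map A B u (smul (X_sgp B) (\<xi>, \<eta>)) = smul (X_sgp A) (X_map A B u \<xi>, X_map A B u \<eta>)"
      if "\<xi> \<in> B.chars" "\<eta> \<in> B.chars" for \<xi> \<eta> using that by blast
    have "comult B (u a) = tensor_map A A B B u u (comult A a)" if a: "a \<in> carrier A" for a
    proof (rule BB.tensor_eqI)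
      show "comult B (u a) \<in> tensor_carrier B B" by (rule B.comult_closed[OF kalg_hom_closed[OF u a]])
      show "tensor_map A A B B u u (comult A a) \<in> tensor_carrier B B"
        using kalg_hom_closed[OF map(1)] A.comult_closed[OF a] by simp
      show "comult B (u a) (\<xi>, \<eta>) = tensor_map A A B B u u (comult A a) (\<xi>, \<eta>)"
        if w: "\<xi> \<in> B.chars" "\<eta> \<in> B.chars" for \<xi> \<eta>
        unfolding lhs[OF w a, symmetric] rhs[OF w a, symmetric] mult[OF w] ..
    qed
    then show "u \<in> kbialg_hom A B" using u by (simp add: kbialg_hom_def)
  qed
qed (simp add: kbialg_hom_def)

section \<open>Counit and antipode on characters\<close>

context kstar_bialgebra
begin

interpretation AA: kstar_pair A A ..

text \<open>The complex numbers have the identity as their only character, so a tensor with one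
  scalar factor is determined by its values at pairs containing
  \<open>\<lambda>z. z\<close>.\<close>

lemma counit_apply:
  assumes \<epsilon>: "\<epsilon> \<in> chars" and \<xi>: "\<xi> \<in> chars" and a: "a \<in> carrier A"
  shows "tensor_map A A complex_kalg A \<epsilon> (kalg_id A) (comult A a) (\<lambda>z. z, \<xi>) = smul (X_sgp A) (\<epsilon>, \<xi>) a"
    "tensor_map A A A complex_kalg (kalg_id A) \<epsilon> (comult A a) (\<xi>, \<lambda>z. z) = smul (X_sgp A) (\<xi>, \<epsilon>) a"
proof -
  have ext: "\<epsilon> \<in> extensional (carrier A)" "\<xi> \<in> extensional (carrier A)"
    using \<epsilon> \<xi> kalg_hom_extensional by auto
  show "tensor_map A A complex_kalg A \<epsilon> (kalg_id A) (comult A a) (\<lambda>z. z, \<xi>) = smul (X_sgp A) (\<epsilon>, \<xi>) a"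
    using tensor_map_hom(2)[OF kstar_algebra_axioms kstar_algebra_axioms kstar_algebra_complex kstar_algebra_axioms
        \<epsilon> kalg_id_hom[OF kstar_algebra_axioms] kalg_id_complex_char \<xi> comult_closed[OF a]]
    unfolding compose_identity[OF ext(1)] compose_kalg_id[OF ext(2)] smul_apply[OF \<epsilon> \<xi> a] .
  show "tensor_map A A A complex_kalg (kalg_id A) \<epsilon> (comult A a) (\<xi>, \<lambda>z. z) = smul (X_sgp A) (\<xi>, \<epsilon>) a"
    using tensor_map_hom(2)[OF kstar_algebra_axioms kstar_algebra_axioms kstar_algebra_axioms kstar_algebra_complex
        kalg_id_hom[OF kstar_algebra_axioms] \<epsilon> \<xi> kalg_id_complex_char comult_closed[OF a]]
    unfolding compose_identity[OF ext(1)] compose_kalg_id[OF ext(2)] smul_apply[OF \<xi> \<epsilon> a] .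
qed

text \<open>The multiplication map is the lift of two identity morphisms; dually it is the diagonal
  map on characters.\<close>

lemma multiplication_lift:
  assumes F: "F \<in> tensor_carrier A A"
  shows "tensor_lift A A A (\<lambda>x y. x \<otimes> y) F \<in> carrier A"
    and "\<And>\<xi>. \<xi> \<in> chars \<Longrightarrow> \<xi> (tensor_lift A A A (\<lambda>x y. x \<otimes> y) F) = F (\<xi>, \<xi>)"
proof -
  note id = kalg_id_hom[OF kstar_algebra_axioms]
  have \<beta>: "x \<otimes> y = kalg_id A x \<otimes> kalg_id A y" if "x \<in> carrier A" "y \<in> carrier A" for x y
    using that by (simp add: kalg_id_def)
  have "tensor_lift A A A (\<lambda>x y. x \<otimes> y) \<in> kalg_hom (tensor A A) A"
    by (rule AA.tensor_lift_hom(1)[OF kstar_algebra_axioms id id]) (rule \<beta>)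
  then show "tensor_lift A A A (\<lambda>x y. x \<otimes> y) F \<in> carrier A"
    using F by (simp add: kalg_hom_closed)
  fix \<xi> assume \<xi>: "\<xi> \<in> chars"
  have "\<xi> (tensor_lift A A A (\<lambda>x y. x \<otimes> y) F) =
      F (compose (carrier A) \<xi> (kalg_id A), compose (carrier A) \<xi> (kalg_id A))"
    by (rule AA.tensor_lift_hom(2)[OF kstar_algebra_axioms id id _ \<xi> F]) (rule \<beta>)
  then show "\<xi> (tensor_lift A A A (\<lambda>x y. x \<otimes> y) F) = F (\<xi>, \<xi>)"
    unfolding compose_kalg_id[OF kalg_hom_extensional[OF \<xi>]] .
qed

lemma antipode_apply:
  assumes \<alpha>: "\<alpha> \<in> kalg_hom A A" and \<xi>: "\<xi> \<in> chars" and a: "a \<in> carrier A"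
  shows "\<xi> (tensor_lift A A A (\<lambda>x y. x \<otimes> y) (tensor_map A A A A \<alpha> (kalg_id A) (comult A a))) =
      smul (X_sgp A) (X_map A A \<alpha> \<xi>, \<xi>) a"
    "\<xi> (tensor_lift A A A (\<lambda>x y. x \<otimes> y) (tensor_map A A A A (kalg_id A) \<alpha> (comult A a))) =
      smul (X_sgp A) (\<xi>, X_map A A \<alpha> \<xi>) a"
proof -
  note id = kalg_id_hom[OF kstar_algebra_axioms]
  note map = tensor_map_hom[OF kstar_algebra_axioms kstar_algebra_axioms kstar_algebra_axioms kstar_algebra_axioms]
  have \<alpha>\<xi>: "X_map A A \<alpha> \<xi> \<in> chars" "X_map A A \<alpha> \<xi> = compose (carrier A) \<xi> \<alpha>"
    using compose_character[OF kstar_algebra_axioms \<alpha> \<xi>] X_map_apply[OF \<xi>, of A \<alpha>] by simp_all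
  have F: "tensor_map A A A A \<alpha> (kalg_id A) (comult A a) \<in> tensor_carrier A A"
    "tensor_map A A A A (kalg_id A) \<alpha> (comult A a) \<in> tensor_carrier A A"
    using kalg_hom_closed[OF map(1)[OF \<alpha> id]] kalg_hom_closed[OF map(1)[OF id \<alpha>]] comult_closed[OF a] by simp_all
  show "\<xi> (tensor_lift A A A (\<lambda>x y. x \<otimes> y) (tensor_map A A A A \<alpha> (kalg_id A) (comult A a))) =
      smul (X_sgp A) (X_map A A \<alpha> \<xi>, \<xi>) a"
    unfolding multiplication_lift(2)[OF F(1) \<xi>] map(2)[OF \<alpha> id \<xi> \<xi> comult_closed[OF a]]
      compose_kalg_id[OF kalg_hom_extensional[OF \<xi>]] \<alpha>\<xi>(2)[symmetric]
    by (rule smul_apply[OF \<alpha>\<xi>(1) \<xi> a, symmetric])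
  show "\<xi> (tensor_lift A A A (\<lambda>x y. x \<otimes> y) (tensor_map A A A A (kalg_id A) \<alpha> (comult A a))) =
      smul (X_sgp A) (\<xi>, X_map A A \<alpha> \<xi>) a"
    unfolding multiplication_lift(2)[OF F(2) \<xi>] map(2)[OF id \<alpha> \<xi> \<xi> comult_closed[OF a]]
      compose_kalg_id[OF kalg_hom_extensional[OF \<xi>]] \<alpha>\<xi>(2)[symmetric]
    by (rule smul_apply[OF \<xi> \<alpha>\<xi>(1) a, symmetric])
qed

text \<open>Both sides of each tensor equation are compared at the characters of its algebra. The
  equivalence holds element by element, with \<epsilon> and \<alpha> fixed, as the quantifiers in
  the Hopf axiom require.\<close>

lemma counit_antipode_iff:
  assumes \<epsilon>: "\<epsilon> \<in> chars" and \<alpha>: "\<alpha> \<in> kalg_hom A A" and a: "a \<in> carrier A"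
  shows "tensor_map A A complex_kalg A \<epsilon> (kalg_id A) (comult A a) = elem_tensor complex_kalg A 1 a \<and>
       tensor_map A A A complex_kalg (kalg_id A) \<epsilon> (comult A a) = elem_tensor A complex_kalg a 1 \<and>
       tensor_lift A A A (\<lambda>x y. x \<otimes> y) (tensor_map A A A A \<alpha> (kalg_id A) (comult A a)) = \<epsilon> a \<odot> \<one> \<and>
       tensor_lift A A A (\<lambda>x y. x \<otimes> y) (tensor_map A A A A (kalg_id A) \<alpha> (comult A a)) = \<epsilon> a \<odot> \<one> \<longleftrightarrow>
     (\<forall>\<xi>\<in>chars. smul (X_sgp A) (\<epsilon>, \<xi>) a = \<xi> a \<and> smul (X_sgp A) (\<xi>, \<epsilon>) a = \<xi> a \<and>
       smul (X_sgp A) (X_map A A \<alpha> \<xi>, \<xi>) a = \<epsilon> a \<and> smul (X_sgp A) (\<xi>, X_map A A \<alpha> \<xi>) a = \<epsilon> a)"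
    (is "?c1 = ?d1 \<and> ?c2 = ?d2 \<and> ?c3 = ?d \<and> ?c4 = ?d \<longleftrightarrow> _")
proof -
  interpret CA: kstar_pair complex_kalg A by (rule kstar_pairI[OF kstar_algebra_complex kstar_algebra_axioms])
  interpret AC: kstar_pair A complex_kalg by (rule kstar_pairI[OF kstar_algebra_axioms kstar_algebra_complex])
  note id = kalg_id_hom[OF kstar_algebra_axioms]
  note F = comult_closed[OF a]
  have one: "(1::complex) \<in> carrier complex_kalg" by simp
  have d: "?d1 (\<lambda>z. z, \<xi>) = \<xi> a" "?d2 (\<xi>, \<lambda>z. z) = \<xi> a" "\<xi> ?d = \<epsilon> a" if "\<xi> \<in> chars" for \<xi>
  proof -
    have "\<xi> \<in> hermitian_hom A complex_kalg" using that by (simp add: kalg_hom_def)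
    then show "\<xi> ?d = \<epsilon> a" by (simp add: characterD)
  qed (simp_all add: CA.elem_tensor_apply[OF kalg_id_complex_char that] AC.elem_tensor_apply[OF that kalg_id_complex_char])
  have "?c1 = ?d1 \<longleftrightarrow> (\<forall>\<xi>\<in>chars. ?c1 (\<lambda>z. z, \<xi>) = ?d1 (\<lambda>z. z, \<xi>))"
  proof (intro iffI ballI)
    assume *: "\<forall>\<xi>\<in>chars. ?c1 (\<lambda>z. z, \<xi>) = ?d1 (\<lambda>z. z, \<xi>)"
    show "?c1 = ?d1"
    proof (rule CA.tensor_eqI)
      show "?c1 \<in> tensor_carrier complex_kalg A"
        using kalg_hom_closed[OF tensor_map_hom(1)[OF kstar_algebra_axioms kstar_algebra_axioms kstar_algebra_complex
          kstar_algebra_axioms \<epsilon> id]] F by simp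
      show "?d1 \<in> tensor_carrier complex_kalg A" by (rule CA.elem_tensor_in_carrier[OF one a])
      show "?c1 (\<zeta>, \<xi>) = ?d1 (\<zeta>, \<xi>)" if "\<zeta> \<in> CA.A.chars" "\<xi> \<in> chars" for \<zeta> \<xi>
        using * that(2) unfolding complex_character_eq[OF that(1)] by blast
    qed
  qed simp
  moreover have "?c2 = ?d2 \<longleftrightarrow> (\<forall>\<xi>\<in>chars. ?c2 (\<xi>, \<lambda>z. z) = ?d2 (\<xi>, \<lambda>z. z))"
  proof (intro iffI ballI)
    assume *: "\<forall>\<xi>\<in>chars. ?c2 (\<xi>, \<lambda>z. z) = ?d2 (\<xi>, \<lambda>z. z)"
    show "?c2 = ?d2"
    proof (rule AC.tensor_eqI)
      show "?c2 \<in> tensor_carrier A complex_kalg"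
        using kalg_hom_closed[OF tensor_map_hom(1)[OF kstar_algebra_axioms kstar_algebra_axioms kstar_algebra_axioms
          kstar_algebra_complex id \<epsilon>]] F by simp
      show "?d2 \<in> tensor_carrier A complex_kalg" by (rule AC.elem_tensor_in_carrier[OF a one])
      show "?c2 (\<xi>, \<zeta>) = ?d2 (\<xi>, \<zeta>)" if "\<xi> \<in> chars" "\<zeta> \<in> CA.A.chars" for \<xi> \<zeta>
        using * that(1) unfolding complex_character_eq[OF that(2)] by blast
    qed
  qed simp
  moreover have in_A: "?c3 \<in> carrier A" "?c4 \<in> carrier A"
    using kalg_hom_closed[OF tensor_map_hom(1)[OF kstar_algebra_axioms kstar_algebra_axioms kstar_algebra_axioms
        kstar_algebra_axioms \<alpha> id]] kalg_hom_closed[OF tensor_map_hom(1)[OF kstar_algebra_axioms kstar_algebra_axioms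
        kstar_algebra_axioms kstar_algebra_axioms id \<alpha>]] F
    by (simp_all add: multiplication_lift(1))
  have d_in: "?d \<in> carrier A" by simp
  have "?c3 = ?d \<longleftrightarrow> (\<forall>\<xi>\<in>chars. \<xi> ?c3 = \<xi> ?d)" "?c4 = ?d \<longleftrightarrow> (\<forall>\<xi>\<in>chars. \<xi> ?c4 = \<xi> ?d)"
    by (auto intro: eqI_chars[OF in_A(1) d_in] eqI_chars[OF in_A(2) d_in])
  moreover have "\<xi> ?c3 = \<xi> ?d \<longleftrightarrow> smul (X_sgp A) (X_map A A \<alpha> \<xi>, \<xi>) a = \<epsilon> a"
    "\<xi> ?c4 = \<xi> ?d \<longleftrightarrow> smul (X_sgp A) (\<xi>, X_map A A \<alpha> \<xi>) a = \<epsilon> a" if "\<xi> \<in> chars" for \<xi>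
    unfolding antipode_apply[OF \<alpha> that a] d(3)[OF that] by (rule refl)+
  ultimately show ?thesis
    using d(1,2) counit_apply[OF \<epsilon> _ a] by (simp add: ball_conj_distrib)
qed

text \<open>A counit is a continuous character, hence already a point of the dual semigroup, and it
  becomes the unit. An antipode and an inversion are dual to each other: \<open>X_map\<close> turns
  the former into the latter.\<close>

theorem hopf_kstar_algebra_iff: "hopf_kstar_algebra A \<longleftrightarrow> compactological_group (X_sgp A)"
proof
  have ext: "\<xi> = \<eta>" if "\<xi> \<in> chars" "\<eta> \<in> chars" "\<And>a. a \<in> carrier A \<Longrightarrow> \<xi> a = \<eta> a" for \<xi> \<eta>
    by (rule extensionalityI[OF kalg_hom_extensional[OF that(1)] kalg_hom_extensional[OF that(2)] that(3)])
  assume "hopf_kstar_algebra A"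
  then interpret H: hopf_kstar_algebra A .
  interpret S: compactological_semigroup "X_sgp A" by (rule compactological_semigroup_X)
  obtain \<epsilon> \<alpha> where \<epsilon>: "\<epsilon> \<in> chars" and \<alpha>: "\<alpha> \<in> kalg_hom A A" and *: "\<forall>a\<in>carrier A.
       tensor_map A A complex_kalg A \<epsilon> (kalg_id A) (comult A a) = elem_tensor complex_kalg A 1 a \<and>
       tensor_map A A A complex_kalg (kalg_id A) \<epsilon> (comult A a) = elem_tensor A complex_kalg a 1 \<and>
       tensor_lift A A A (\<lambda>x y. x \<otimes> y) (tensor_map A A A A \<alpha> (kalg_id A) (comult A a)) = \<epsilon> a \<odot> \<one> \<and>
       tensor_lift A A A (\<lambda>x y. x \<otimes> y) (tensor_map A A A A (kalg_id A) \<alpha> (comult A a)) = \<epsilon> a \<odot> \<one>"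
    using H.counit_antipode by (elim bexE)
  have eq: "smul (X_sgp A) (\<epsilon>, \<xi>) a = \<xi> a" "smul (X_sgp A) (\<xi>, \<epsilon>) a = \<xi> a"
    "smul (X_sgp A) (X_map A A \<alpha> \<xi>, \<xi>) a = \<epsilon> a" "smul (X_sgp A) (\<xi>, X_map A A \<alpha> \<xi>) a = \<epsilon> a"
    if "\<xi> \<in> chars" "a \<in> carrier A" for \<xi> a
    using counit_antipode_iff[OF \<epsilon> \<alpha> that(2)] bspec[OF * that(2)] that(1) by simp_all
  have \<alpha>_hom: "X_map A A \<alpha> \<in> compactological_hom (X_space A) (X_space A)"
    by (rule X_map_hom[OF kstar_algebra_axioms kstar_algebra_axioms \<alpha>])
  have \<alpha>\<xi>: "X_map A A \<alpha> \<xi> \<in> chars" if "\<xi> \<in> chars" for \<xi>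
    using compactological_hom_in_points[OF \<alpha>_hom] that by simp
  show "compactological_group (X_sgp A)"
  proof
    show "\<exists>e\<in>points (X_sgp A). \<exists>i\<in>compactological_hom (X_sgp A) (X_sgp A). \<forall>\<xi>\<in>points (X_sgp A).
        smul (X_sgp A) (e, \<xi>) = \<xi> \<and> smul (X_sgp A) (\<xi>, e) = \<xi> \<and>
        smul (X_sgp A) (i \<xi>, \<xi>) = e \<and> smul (X_sgp A) (\<xi>, i \<xi>) = e"
    proof (intro bexI[of _ \<epsilon>] bexI[of _ "X_map A A \<alpha>"] ballI conjI)
      fix \<xi> assume "\<xi> \<in> points (X_sgp A)"
      then have \<xi>: "\<xi> \<in> chars" by simp
      show "smul (X_sgp A) (\<epsilon>, \<xi>) = \<xi>" by (rule ext[OF smul_in_chars[OF \<epsilon> \<xi>] \<xi> eq(1)[OF \<xi>]])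
      show "smul (X_sgp A) (\<xi>, \<epsilon>) = \<xi>" by (rule ext[OF smul_in_chars[OF \<xi> \<epsilon>] \<xi> eq(2)[OF \<xi>]])
      show "smul (X_sgp A) (X_map A A \<alpha> \<xi>, \<xi>) = \<epsilon>" by (rule ext[OF smul_in_chars[OF \<alpha>\<xi>[OF \<xi>] \<xi>] \<epsilon> eq(3)[OF \<xi>]])
      show "smul (X_sgp A) (\<xi>, X_map A A \<alpha> \<xi>) = \<epsilon>" by (rule ext[OF smul_in_chars[OF \<xi> \<alpha>\<xi>[OF \<xi>]] \<epsilon> eq(4)[OF \<xi>]])
    qed (use \<epsilon> \<alpha>_hom in simp_all)
  qed
next
  assume "compactological_group (X_sgp A)"
  then interpret G: compactological_group "X_sgp A" .
  obtain \<epsilon> i where "\<epsilon> \<in> points (X_sgp A)" "i \<in> compactological_hom (X_sgp A) (X_sgp A)"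
    and *: "\<forall>\<xi>\<in>points (X_sgp A). smul (X_sgp A) (\<epsilon>, \<xi>) = \<xi> \<and> smul (X_sgp A) (\<xi>, \<epsilon>) = \<xi> \<and>
        smul (X_sgp A) (i \<xi>, \<xi>) = \<epsilon> \<and> smul (X_sgp A) (\<xi>, i \<xi>) = \<epsilon>"
    using G.unit_inverse by (elim bexE)
  then have \<epsilon>: "\<epsilon> \<in> chars" and i: "i \<in> compactological_hom (X_space A) (X_space A)" by simp_all
  have i_maps: "\<exists>p\<in>CS. i ` X_p A r \<subseteq> X_p A p \<and> continuous_map (ktop (X_space A) (X_p A r)) (ktop (X_space A) (X_p A p)) i"
    if "r \<in> CS" for r
    using i that by (force simp: compactological_hom_def)
  \<comment> \<open>The inversion is a morphism of compactological spaces, which is just what is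
    needed for it to be dual to a morphism of the algebra.\<close>
  obtain \<alpha> where \<alpha>: "\<alpha> \<in> kalg_hom A A" "\<And>\<xi> a. \<xi> \<in> chars \<Longrightarrow> a \<in> carrier A \<Longrightarrow> \<xi> (\<alpha> a) = i \<xi> a"
  proof (rule kalg_hom_of_character_map[OF kstar_algebra_axioms kstar_algebra_axioms, of i])
    fix r assume r: "r \<in> CS"
    show "\<exists>p\<in>CS. i ` X_p A r \<subseteq> X_p A p" using i_maps[OF r] by blast
    fix a assume "a \<in> carrier A"
    obtain p where "continuous_map (ktop (X_space A) (X_p A r)) (ktop (X_space A) (X_p A p)) i" using i_maps[OF r] by blast
    then have "continuous_on (X_p A r) i" by (simp add: ktop_X_p continuous_map_in_subtopology)
    then show "continuous_on (X_p A r) (\<lambda>\<xi>. i \<xi> a)"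
      by (rule continuous_on_product_then_coordinatewise)
  qed (rule that)
  have "X_map A A \<alpha> \<xi> = i \<xi>" if \<xi>: "\<xi> \<in> chars" for \<xi>
  proof (rule extensionalityI)
    show "X_map A A \<alpha> \<xi> \<in> extensional (carrier A)" by (simp add: X_map_apply[OF \<xi>])
    have "i \<xi> \<in> chars" using compactological_hom_in_points[OF i, of \<xi>] \<xi> by simp
    then show "i \<xi> \<in> extensional (carrier A)" by (rule kalg_hom_extensional)
    show "X_map A A \<alpha> \<xi> a = i \<xi> a" if "a \<in> carrier A" for a
      using \<alpha>(2)[OF \<xi> that] that by (simp add: X_map_apply[OF \<xi>] compose_eq)
  qed
  then have "\<forall>\<xi>\<in>chars. smul (X_sgp A) (\<epsilon>, \<xi>) a = \<xi> a \<and> smul (X_sgp A) (\<xi>, \<epsilon>) a = \<xi> a \<and>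
       smul (X_sgp A) (X_map A A \<alpha> \<xi>, \<xi>) a = \<epsilon> a \<and> smul (X_sgp A) (\<xi>, X_map A A \<alpha> \<xi>) a = \<epsilon> a" for a
    using * by simp
  then show "hopf_kstar_algebra A"
    using counit_antipode_iff[OF \<epsilon> \<alpha>(1)] \<epsilon> \<alpha>(1) by unfold_locales blast
qed

end

section \<open>The comultiplication of continuous functions\<close>

context compactological_semigroup
begin

interpretation C: function_algebra "C_alg S" "compacta S"
  by (rule function_algebra_C)

interpretation P: compactological_pair S S ..

interpretation prod: compactological_space "compactological_prod S S"
  by (rule P.compactological_space_prod)

interpretation CC: kstar_pair "C_alg S" "C_alg S" ..

interpretation T: function_algebra "tensor (C_alg S) (C_alg S)" "polar_products (C_alg S) (C_alg S)"
  by (rule CC.function_algebra_tensor)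

text \<open>The function (s, t) \<mapsto> \<phi>(s) \<psi>(t) is the product of the pullbacks of
  \<phi> and \<psi> along the projections, so the canonical map is a lift and its values follow by
  testing at point evaluations.\<close>

lemma C_prod_iso_apply:
  assumes F: "F \<in> tensor_carrier (C_alg S) (C_alg S)"
  shows "C_prod_iso S F \<in> compactological_hom (compactological_prod S S) complex_space"
    and "\<And>s t. s \<in> points S \<Longrightarrow> t \<in> points S \<Longrightarrow> C_prod_iso S F (s, t) = F (eval_space S s, eval_space S t)"
proof -
  let ?P = "compactological_prod S S"
  let ?u = "C_map ?P S (\<lambda>z\<in>points S \<times> points S. fst z)" and ?v = "C_map ?P S (\<lambda>z\<in>points S \<times> points S. snd z)"
  have u: "?u \<in> kalg_hom (C_alg S) (C_alg ?P)"
    by (rule C_map_kalg_hom[OF prod.compactological_space_axioms compactological_space_axioms P.fst_hom])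
  have v: "?v \<in> kalg_hom (C_alg S) (C_alg ?P)"
    by (rule C_map_kalg_hom[OF prod.compactological_space_axioms compactological_space_axioms P.snd_hom])
  have \<beta>: "(\<lambda>(s, t) \<in> points S \<times> points S. \<phi> s * \<psi> t) = ?u \<phi> \<otimes>\<^bsub>C_alg ?P\<^esub> ?v \<psi>"
    if "\<phi> \<in> carrier (C_alg S)" "\<psi> \<in> carrier (C_alg S)" for \<phi> \<psi>
    using that by (auto simp: C_map_apply compose_def restrict_def fun_eq_iff)
  have hom: "C_prod_iso S \<in> kalg_hom (tensor (C_alg S) (C_alg S)) (C_alg ?P)"
    unfolding C_prod_iso_def by (rule CC.tensor_lift_hom(1)[OF prod.kstar_algebra_C u v]) (rule \<beta>)
  show closed: "C_prod_iso S F \<in> compactological_hom ?P complex_space"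
    using kalg_hom_closed[OF hom] F by simp
  fix s t assume st: "s \<in> points S" "t \<in> points S"
  let ?\<tau> = "eval_space ?P (s, t)"
  have \<tau>: "?\<tau> \<in> kalg_hom (C_alg ?P) complex_kalg" using prod.eval_space_in_chars[of "(s, t)"] st by simp
  have "?\<tau> (C_prod_iso S F) = F (compose (carrier (C_alg S)) ?\<tau> ?u, compose (carrier (C_alg S)) ?\<tau> ?v)"
    unfolding C_prod_iso_def by (rule CC.tensor_lift_hom(2)[OF prod.kstar_algebra_C u v _ \<tau> F]) (rule \<beta>)
  moreover have "compose (carrier (C_alg S)) ?\<tau> ?u = eval_space S s"
    using kalg_hom_closed[OF u] st
    by (intro extensionalityI[of _ "carrier (C_alg S)"]) (simp_all add: compose_def eval_space_def C_map_apply)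
  moreover have "compose (carrier (C_alg S)) ?\<tau> ?v = eval_space S t"
    using kalg_hom_closed[OF v] st
    by (intro extensionalityI[of _ "carrier (C_alg S)"]) (simp_all add: compose_def eval_space_def C_map_apply)
  moreover have "?\<tau> (C_prod_iso S F) = C_prod_iso S F (s, t)" using closed st by simp
  ultimately show "C_prod_iso S F (s, t) = F (eval_space S s, eval_space S t)" by simp
qed

lemma tensor_C_eqI:
  assumes "F \<in> tensor_carrier (C_alg S) (C_alg S)" "G \<in> tensor_carrier (C_alg S) (C_alg S)"
    and "\<And>s t. s \<in> points S \<Longrightarrow> t \<in> points S \<Longrightarrow>
      F (eval_space S s, eval_space S t) = G (eval_space S s, eval_space S t)"
  shows "F = G"
  by (rule CC.tensor_eqI) (use assms in \<open>auto simp: chars_C_alg\<close>)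

text \<open>Characters are point evaluations, so \<open>f\<close> can be read as a function of pairs
  of characters through \<open>eval_space_inv\<close>; it is continuous on compact sets of pairs,
  and \<open>tensor_of_function\<close> provides the preimage.\<close>

lemma C_prod_iso_surj:
  assumes f: "f \<in> compactological_hom (compactological_prod S S) complex_space"
  shows "f \<in> C_prod_iso S ` tensor_carrier (C_alg S) (C_alg S)"
proof -
  let ?P = "compactological_prod S S"
  let ?g = "\<lambda>w. f (eval_space_inv S (fst w), eval_space_inv S (snd w))"
  have "continuous_on (X_p (C_alg S) p \<times> X_p (C_alg S) q) ?g" if pq: "p \<in> C.CS" "q \<in> C.CS" for p q
  proof -
    obtain K where K: "K \<in> compacta S" "X_p (C_alg S) p \<subseteq> eval_space S ` K" by (rule X_p_C_alg_subset[OF pq(1)])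
    obtain L where L: "L \<in> compacta S" "X_p (C_alg S) q \<subseteq> eval_space S ` L" by (rule X_p_C_alg_subset[OF pq(2)])
    let ?E = "prod_topology (top_of_set (eval_space S ` K)) (top_of_set (eval_space S ` L))"
    have "continuous_map ?E (P.product_top K L) (\<lambda>w. (eval_space_inv S (fst w), eval_space_inv S (snd w)))"
      using continuous_map_compose[OF continuous_map_fst eval_space_inv_continuous[OF K(1)]]
        continuous_map_compose[OF continuous_map_snd eval_space_inv_continuous[OF L(1)]]
      unfolding o_def by (rule continuous_map_pairedI)
    moreover have "continuous_map (P.product_top K L) euclidean f"
      using prod.C_alg_continuous[OF f P.Times_compacta(1)[OF K(1) L(1)]] P.Times_compacta(2)[OF K(1) L(1)] by simp
    ultimately have "continuous_map ?E euclidean (f \<circ> (\<lambda>w. (eval_space_inv S (fst w), eval_space_inv S (snd w))))"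
      by (rule continuous_map_compose)
    then have "continuous_on (eval_space S ` K \<times> eval_space S ` L) ?g"
      by (simp add: o_def prod_topology_subtopology_eu)
    then show ?thesis by (rule continuous_on_subset) (use K(2) L(2) in blast)
  qed
  then obtain F where F: "F \<in> tensor_carrier (C_alg S) (C_alg S)" "\<forall>\<xi>\<in>C.chars. \<forall>\<eta>\<in>C.chars. F (\<xi>, \<eta>) = ?g (\<xi>, \<eta>)"
    using CC.tensor_of_function[of ?g] by blast
  have "C_prod_iso S F = f"
  proof (rule extensionalityI)
    show "C_prod_iso S F \<in> extensional (points ?P)" "f \<in> extensional (points ?P)"
      by (rule compactological_hom_extensional[OF C_prod_iso_apply(1)[OF F(1)]] compactological_hom_extensional[OF f])+
    fix z assume "z \<in> points ?P"
    then obtain s t where z: "z = (s, t)" "s \<in> points S" "t \<in> points S" by auto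
    show "C_prod_iso S F z = f z"
      unfolding z(1) C_prod_iso_apply(2)[OF F(1) z(2,3)] using F(2) eval_space_in_chars z(2,3) by simp
  qed
  then show ?thesis using F(1) by blast
qed

text \<open>Surjectivity of the canonical map allows \<open>inv_into\<close> to be cancelled, after
  which the comultiplication is composition with the multiplication of \<open>S\<close>.\<close>

lemma comult_C:
  assumes \<phi>: "\<phi> \<in> compactological_hom S complex_space"
  shows "comult (C_bialg S) \<phi> \<in> tensor_carrier (C_alg S) (C_alg S)"
    and "\<And>s t. s \<in> points S \<Longrightarrow> t \<in> points S \<Longrightarrow>
      comult (C_bialg S) \<phi> (eval_space S s, eval_space S t) = \<phi> (smul S (s, t))"
proof -
  let ?P = "compactological_prod S S"
  let ?f = "compose (points ?P) \<phi> (smul S)"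
  have f: "?f \<in> C_prod_iso S ` tensor_carrier (C_alg S) (C_alg S)"
    by (rule C_prod_iso_surj[OF compactological_hom_compose[OF smul_hom \<phi> prod.compactological_space_axioms]])
  have eq: "comult (C_bialg S) \<phi> = inv_into (tensor_carrier (C_alg S) (C_alg S)) (C_prod_iso S) ?f"
    using \<phi> by (simp add: comult_C_bialg compose_eq C_map_apply)
  show closed: "comult (C_bialg S) \<phi> \<in> tensor_carrier (C_alg S) (C_alg S)"
    unfolding eq by (rule inv_into_into[OF f])
  show "comult (C_bialg S) \<phi> (eval_space S s, eval_space S t) = \<phi> (smul S (s, t))"
    if "s \<in> points S" "t \<in> points S" for s t
    unfolding C_prod_iso_apply(2)[OF closed that, symmetric] unfolding eq f_inv_into_f[OF f]
    using that by (simp add: compose_eq)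
qed

lemma smul_points: "s \<in> points S \<Longrightarrow> t \<in> points S \<Longrightarrow> smul S (s, t) \<in> points S"
  using compactological_hom_in_points[OF smul_hom] by simp

lemma comult_C_hom: "comult (C_bialg S) \<in> kalg_hom (C_alg S) (tensor (C_alg S) (C_alg S))"
proof (rule kalg_homI[OF kstar_algebra_C T.involutive_algebra_axioms _ _ T.topol_sup])
  note in_chars = eval_space_in_chars
  have D: "eval_space S s \<in> dual_ball (C_alg S)" if "s \<in> points S" for s
    using that CC.chars_dual_ball(1) in_chars by blast
  have closed: "\<one>\<^bsub>C_alg S\<^esub> \<in> carrier (C_alg S)"
    "\<And>f g. f \<in> carrier (C_alg S) \<Longrightarrow> g \<in> carrier (C_alg S) \<Longrightarrow> f \<oplus>\<^bsub>C_alg S\<^esub> g \<in> carrier (C_alg S)"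
    "\<And>f g. f \<in> carrier (C_alg S) \<Longrightarrow> g \<in> carrier (C_alg S) \<Longrightarrow> f \<otimes>\<^bsub>C_alg S\<^esub> g \<in> carrier (C_alg S)"
    "\<And>c f. f \<in> carrier (C_alg S) \<Longrightarrow> c \<odot>\<^bsub>C_alg S\<^esub> f \<in> carrier (C_alg S)"
    "\<And>f. f \<in> carrier (C_alg S) \<Longrightarrow> invol (C_alg S) f \<in> carrier (C_alg S)"
    by (simp_all del: C_alg_simps)
  note closed' = closed[unfolded C_alg_simps]
  have ext: "comult (C_bialg S) \<in> extensional (compactological_hom S complex_space)"
    by (simp add: comult_C_bialg)
  have one: "elem_tensor (C_alg S) (C_alg S) (\<lambda>x\<in>points S. 1) (\<lambda>x\<in>points S. 1) \<in> tensor_carrier (C_alg S) (C_alg S)"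
    using CC.elem_tensor_in_carrier[OF closed(1) closed(1)] by simp
  show "comult (C_bialg S) \<in> hermitian_hom (C_alg S) (tensor (C_alg S) (C_alg S))"
    unfolding hermitian_hom_iff tensor_simps C_alg_simps
    by (intro conjI ballI allI tensor_C_eqI)
      (simp_all add: ext one comult_C closed' CC.tensor_closed CC.tensor_add_in_carrier CC.tensor_smult_in_carrier
        CC.elem_tensor_apply CC.tensor_mult_apply CC.tensor_invol_apply D in_chars smul_points)
  fix r assume "r \<in> sup_seminorm ` polar_products (C_alg S) (C_alg S)"
  then obtain K where K: "K \<in> polar_products (C_alg S) (C_alg S)" "r = sup_seminorm K" by blast
  then show "cstar_seminorm (tensor (C_alg S) (C_alg S)) r" using T.cstar_sup by blast
  obtain p q where pq: "K = polar (C_alg S) p \<times> polar (C_alg S) q" "p \<in> C.CS" "q \<in> C.CS"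
    using K(1) by (auto simp: polar_products_def)
  obtain L where L: "L \<in> compacta S" "X_p (C_alg S) p \<subseteq> eval_space S ` L" by (rule X_p_C_alg_subset[OF pq(2)])
  obtain M where M: "M \<in> compacta S" "X_p (C_alg S) q \<subseteq> eval_space S ` M" by (rule X_p_C_alg_subset[OF pq(3)])
  \<comment> \<open>The multiplication carries the compact set \<open>L \<times> M\<close> into a
    single member of the compactology; the supremum over it gives the continuity estimate.\<close>
  obtain N where N: "N \<in> compacta S" "smul S ` (L \<times> M) \<subseteq> N"
    using smul_hom P.Times_compacta(1)[OF L(1) M(1)] by (auto simp: compactological_hom_def)
  have "r (comult (C_bialg S) \<phi>) \<le> sup_seminorm N \<phi>" if \<phi>: "\<phi> \<in> carrier (C_alg S)" for \<phi>
  proof -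
    have \<phi>': "\<phi> \<in> compactological_hom S complex_space" using \<phi> by simp
    have "sup_seminorm (X_p (C_alg S) p \<times> X_p (C_alg S) q) (comult (C_bialg S) \<phi>) \<le> sup_seminorm N \<phi>"
    proof (rule sup_seminorm_least)
      show "0 \<le> sup_seminorm N \<phi>" by (rule cstar_seminorm_on.nonneg[OF C.cstar_on[OF C.cstar_sup[OF N(1)]] \<phi>])
      fix w assume "w \<in> X_p (C_alg S) p \<times> X_p (C_alg S) q"
      then obtain s t where st: "w = (eval_space S s, eval_space S t)" "s \<in> L" "t \<in> M" using L(2) M(2) by blast
      have "s \<in> points S" "t \<in> points S"
        using st compacta_subset_points[OF L(1)] compacta_subset_points[OF M(1)] by blast+
      moreover have "smul S (s, t) \<in> N" using N(2) st(2,3) by blast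
      ultimately show "norm (comult (C_bialg S) \<phi> w) \<le> sup_seminorm N \<phi>"
        using C.norm_le_sup[OF \<phi> N(1)] by (simp add: st(1) comult_C(2)[OF \<phi>'])
    qed
    then show ?thesis using CC.sup_polar_eq[OF comult_C(1)[OF \<phi>'] pq(2,3)] by (simp add: K(2) pq(1))
  qed
  then show "\<exists>p\<in>C.CS. \<forall>\<phi>\<in>carrier (C_alg S). r (comult (C_bialg S) \<phi>) \<le> p \<phi>"
    using C.sup_seminorm_in_CS[OF N(1)] by blast
qed

lemma kstar_comultiplication_C: "kstar_comultiplication (C_bialg S)"
proof -
  interpret kstar_algebra "C_bialg S" using kstar_algebra_C by (simp only: kstar_algebra_C_bialg_iff)
  show ?thesis by unfold_locales (simp add: comult_C_hom del: C_bialg_simps C_alg_simps)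
qed

interpretation CB: kstar_comultiplication "C_bialg S"
  by (rule kstar_comultiplication_C)

text \<open>The semigroup law of \<open>S\<close> seen through point evaluations. As these are all
  the characters, associativity in \<open>S\<close> becomes coassociativity of the function algebra
  by \<open>kstar_bialgebra_iff\<close>.\<close>

lemma smul_eval_space:
  assumes st: "s \<in> points S" "t \<in> points S"
  shows "smul (X_sgp (C_bialg S)) (eval_space S s, eval_space S t) = eval_space S (smul S (s, t))"
proof (rule extensionalityI)
  have chars: "eval_space S s \<in> CB.chars" "eval_space S t \<in> CB.chars" using st eval_space_in_chars by simp_all
  show "smul (X_sgp (C_bialg S)) (eval_space S s, eval_space S t) \<in> extensional (carrier (C_bialg S))"
    by (rule kalg_hom_extensional[OF CB.smul_in_chars[OF chars]])
  show "eval_space S (smul S (s, t)) \<in> extensional (carrier (C_bialg S))"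
    using smul_points[OF st] by (simp add: eval_space_def)
  fix \<phi> assume \<phi>: "\<phi> \<in> carrier (C_bialg S)"
  then have \<phi>': "\<phi> \<in> compactological_hom S complex_space" by simp
  show "smul (X_sgp (C_bialg S)) (eval_space S s, eval_space S t) \<phi> = eval_space S (smul S (s, t)) \<phi>"
    unfolding CB.smul_apply[OF chars \<phi>] comult_C(2)[OF \<phi>' st] using \<phi>' smul_points[OF st] by simp
qed

theorem kstar_bialgebra_C: "kstar_bialgebra (C_bialg S)"
  unfolding CB.kstar_bialgebra_iff kalg_hom_C_bialg chars_C_alg
  using smul_assoc smul_points by (simp add: smul_eval_space)

end

section \<open>The duality\<close>

text \<open>The source of both the naturality of \<open>eval_space\<close> and the compatibility of
  \<open>C_map\<close> with comultiplications.\<close>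

lemma X_map_C_map:
  assumes S: "compactological_space S" and T: "compactological_space T" and u: "u \<in> compactological_hom S T"
    and s: "s \<in> points S"
  shows "X_map (C_alg T) (C_alg S) (C_map S T u) (eval_space S s) = eval_space T (u s)"
proof -
  interpret S: compactological_space S by fact
  interpret T: compactological_space T by fact
  show ?thesis
    using s compactological_hom_in_points[OF u s] kalg_hom_closed[OF C_map_kalg_hom[OF S T u]] S.eval_space_in_chars[OF s]
    by (intro extensionalityI[of _ "carrier (C_alg T)"])
      (simp_all add: X_map_apply compose_def eval_space_def C_map_apply)
qed

text \<open>By \<open>kbialg_hom_iff\<close> the condition can be tested on characters, that is, on
  points of \<open>S\<close>, where it is multiplicativity of \<open>u\<close>.\<close>

theorem C_map_bialg:
  assumes S: "compactological_semigroup S" and T: "compactological_semigroup T" and u: "u \<in> csgp_hom S T"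
  shows "C_map S T u \<in> kbialg_hom (C_bialg T) (C_bialg S)"
proof -
  interpret S: compactological_semigroup S by fact
  interpret T: compactological_semigroup T by fact
  have u_hom: "u \<in> compactological_hom S T" using u by (simp add: csgp_hom_def)
  note spaces = S.compactological_space_axioms T.compactological_space_axioms
  have X: "X_map (C_bialg T) (C_bialg S) (C_map S T u) (eval_space S s) = eval_space T (u s)" if "s \<in> points S" for s
    using X_map_C_map[OF spaces u_hom that] by (simp add: X_map_def)
  have in_T: "u s \<in> points T" if "s \<in> points S" for s using u_hom that by (rule compactological_hom_in_points)
  show ?thesis
    unfolding kbialg_hom_iff[OF T.kstar_comultiplication_C S.kstar_comultiplication_C]
      kalg_hom_C_bialg S.chars_C_alg
    using C_map_kalg_hom[OF spaces u_hom] u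
    by (auto simp: X S.smul_eval_space T.smul_eval_space S.smul_points in_T csgp_hom_def)
qed

theorem C_map_id:
  "C_map S S (compactological_id S) = kalg_id (C_bialg S)"
  by (auto simp: C_map_def kalg_id_def compactological_id_def compose_def restrict_def fun_eq_iff
      dest: compactological_hom_extensional[THEN extensional_arb])

theorem C_map_compose:
  assumes "compactological_space S" "compactological_space T"
    and u: "u \<in> compactological_hom S T" and v: "v \<in> compactological_hom T R"
  shows "C_map S R (compose (points S) v u) = compose (carrier (C_bialg R)) (C_map S T u) (C_map T R v)"
proof (rule extensionalityI)
  fix f assume "f \<in> carrier (C_bialg R)"
  then have f: "f \<in> compactological_hom R complex_space" by simp
  have "compose (points T) f v \<in> compactological_hom T complex_space"
    by (rule compactological_hom_compose[OF v f assms(2)])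
  then show "C_map S R (compose (points S) v u) f = compose (carrier (C_bialg R)) (C_map S T u) (C_map T R v) f"
    using f compactological_hom_in_points[OF u] by (auto simp: C_map_apply compose_def restrict_def fun_eq_iff)
qed (simp_all add: C_map_def)

theorem X_map_sgp:
  assumes A: "kstar_bialgebra A" and B: "kstar_bialgebra B" and u: "u \<in> kbialg_hom A B"
  shows "X_map A B u \<in> csgp_hom (X_sgp B) (X_sgp A)"
proof -
  interpret A: kstar_bialgebra A by fact
  interpret B: kstar_bialgebra B by fact
  show ?thesis
    using u X_map_hom[OF A.kstar_algebra_axioms B.kstar_algebra_axioms, of u]
    by (simp add: kbialg_hom_iff[OF A.kstar_comultiplication_axioms B.kstar_comultiplication_axioms] csgp_hom_def)
qed

theorem X_map_id: "X_map A A (kalg_id A) = compactological_id (X_sgp A)"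
  by (auto simp: X_map_def compactological_id_def fun_eq_iff restrict_def compose_kalg_id kalg_hom_extensional)

theorem X_map_compose:
  assumes B: "kstar_algebra B" and u: "u \<in> kalg_hom A B" and v: "v \<in> kalg_hom B D"
  shows "X_map A D (compose (carrier A) v u) = compose (points (X_sgp D)) (X_map A B u) (X_map B D v)"
proof (rule extensionalityI)
  fix \<xi> assume "\<xi> \<in> points (X_sgp D)"
  then have \<xi>: "\<xi> \<in> kalg_hom D complex_kalg" by simp
  show "X_map A D (compose (carrier A) v u) \<xi> = compose (points (X_sgp D)) (X_map A B u) (X_map B D v) \<xi>"
    using \<xi> kalg_hom_closed[OF u] compose_character[OF B v \<xi>]
    by (auto simp: X_map_apply compose_def restrict_def fun_eq_iff)
qed (simp_all add: X_map_def)

theorem (in compactological_semigroup) eval_space_iso: "eval_space S \<in> csgp_iso S (X_sgp (C_bialg S))"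
proof -
  have inv: "eval_space_inv S \<in> csgp_hom (X_sgp (C_bialg S)) S"
    using eval_space_inv_hom by (auto simp: csgp_hom_def chars_C_alg smul_eval_space smul_points)
  have "eval_space S \<in> csgp_hom S (X_sgp (C_bialg S))"
    using eval_space_hom by (auto simp: csgp_hom_def smul_eval_space)
  moreover have "compose (points S) (eval_space_inv S) (eval_space S) = compactological_id S"
    by (auto simp: compose_def compactological_id_def)
  moreover have "compose (points (X_sgp (C_bialg S))) (eval_space S) (eval_space_inv S) =
      compactological_id (X_sgp (C_bialg S))"
    by (auto simp: compose_def compactological_id_def chars_C_alg restrict_def fun_eq_iff)
  ultimately show ?thesis using inv by (auto simp: csgp_iso_def)
qed

theorem eval_space_natural:
  assumes "compactological_space S" "compactological_space T" "u \<in> compactological_hom S T"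
  shows "compose (points S) (eval_space T) u =
    compose (points S) (X_map (C_bialg T) (C_bialg S) (C_map S T u)) (eval_space S)"
proof (rule extensionalityI)
  fix s assume s: "s \<in> points S"
  have "X_map (C_bialg T) (C_bialg S) (C_map S T u) (eval_space S s) = eval_space T (u s)"
    using X_map_C_map[OF assms s] by (simp add: X_map_def)
  then show "compose (points S) (eval_space T) u s =
      compose (points S) (X_map (C_bialg T) (C_bialg S) (C_map S T u)) (eval_space S) s"
    using s by (simp add: compose_eq)
qed simp_all

context kstar_algebra
begin

lemma eval_alg_closed: "a \<in> carrier A \<Longrightarrow> eval_alg A a \<in> compactological_hom (X_space A) complex_space"
  unfolding C_X_iff
proof (intro conjI ballI)
  assume a: "a \<in> carrier A"
  then show "eval_alg A a \<in> extensional chars" by (simp add: eval_alg_def)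
  fix p assume "p \<in> CS"
  then have "X_p A p \<subseteq> chars" by (rule X_p_subset_chars)
  then show "continuous_on (X_p A p) (eval_alg A a)"
    using a by (intro continuous_on_eq[OF continuous_on_coordinate[of _ a]]) (auto simp: eval_alg_def)
qed

lemma eval_alg_apply: "a \<in> carrier A \<Longrightarrow> \<xi> \<in> chars \<Longrightarrow> eval_alg A a \<xi> = \<xi> a"
  by (simp add: eval_alg_def)

interpretation CX: function_algebra "C_alg (X_space A)" "compacta (X_space A)"
  by (rule X.function_algebra_C)

lemma eval_alg_hom: "eval_alg A \<in> kalg_hom A (C_alg (X_space A))"
proof (rule kalg_homI[OF kstar_algebra_axioms CX.involutive_algebra_axioms _ _ CX.topol_sup])
  have char: "\<xi> \<in> hermitian_hom A complex_kalg" if "\<xi> \<in> chars" for \<xi> using that by (simp add: kalg_hom_def)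
  show "eval_alg A \<in> hermitian_hom A (C_alg (X_space A))"
    unfolding hermitian_hom_iff C_alg_simps
    by (auto simp: eval_alg_closed) (auto simp: eval_alg_def restrict_def extensional_def fun_eq_iff characterD[OF char])
  fix r assume "r \<in> sup_seminorm ` compacta (X_space A)"
  then obtain p where p: "p \<in> CS" "r = sup_seminorm (X_p A p)" by auto
  then show "cstar_seminorm (C_alg (X_space A)) r" using CX.cstar_sup by auto
  have "r (eval_alg A a) \<le> p a" if a: "a \<in> carrier A" for a
    unfolding p(2)
  proof (rule sup_seminorm_least)
    show "norm (eval_alg A a \<xi>) \<le> p a" if "\<xi> \<in> X_p A p" for \<xi>
    proof -
      have "\<xi> \<in> chars" using X_p_subset_chars[OF p(1)] that by blast
      then show ?thesis using norm_le_of_X_p[OF p(1) that a] by (simp add: eval_alg_apply a)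
    qed
  qed (rule cstar_seminorm_on.nonneg[OF CS_on[OF p(1)] a])
  then show "\<exists>p\<in>CS. \<forall>a\<in>carrier A. r (eval_alg A a) \<le> p a" using p(1) by blast
qed

text \<open>Bijectivity of the Gelfand transform would not make its inverse continuous. The inverse
  is constructed as the morphism dual to \<open>eval_space (X_space A)\<close>, which comes with
  continuity.\<close>

lemma eval_alg_inverse:
  obtains v where "v \<in> kalg_hom (C_alg (X_space A)) A"
    "\<And>\<xi> f. \<xi> \<in> chars \<Longrightarrow> f \<in> compactological_hom (X_space A) complex_space \<Longrightarrow> \<xi> (v f) = f \<xi>"
proof (rule kalg_hom_of_character_map[OF X.kstar_algebra_C kstar_algebra_axioms, of "eval_space (X_space A)"])
  fix r assume r: "r \<in> CS"
  then have K: "X_p A r \<in> compacta (X_space A)" by simp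
  show "\<exists>p\<in>cont_cstar_seminorms (C_alg (X_space A)). eval_space (X_space A) ` X_p A r \<subseteq> X_p (C_alg (X_space A)) p"
    by (rule bexI[OF _ CX.sup_seminorm_in_CS[OF K]]) (simp only: X.X_p_sup_seminorm[OF K] order_refl)
  show "continuous_on (X_p A r) (\<lambda>\<xi>. eval_space (X_space A) \<xi> f)" for f
    using X.eval_space_continuous[OF K]
    by (intro continuous_on_product_then_coordinatewise[where f = "eval_space (X_space A)"]) (simp add: ktop_X_p)
next
  fix v assume v: "v \<in> kalg_hom (C_alg (X_space A)) A"
    "\<And>\<xi> f. \<xi> \<in> chars \<Longrightarrow> f \<in> carrier (C_alg (X_space A)) \<Longrightarrow> \<xi> (v f) = eval_space (X_space A) \<xi> f"
  show thesis by (rule that[OF v(1)]) (use v(2) in simp)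
qed

end

context kstar_bialgebra
begin

text \<open>On characters, \<open>eval_alg A\<close> induces the inverse of
  \<open>eval_space (X_space A)\<close> and \<open>v\<close> induces
  \<open>eval_space (X_space A)\<close> itself. Both respect multiplication by
  \<open>smul_eval_space\<close>, so \<open>kbialg_hom_iff\<close> makes both maps bialgebra
  morphisms.\<close>

theorem eval_alg_iso: "eval_alg A \<in> kbialg_iso A (C_bialg (X_sgp A))"
proof -
  interpret S: compactological_semigroup "X_sgp A" by (rule compactological_semigroup_X)
  let ?C = "C_bialg (X_sgp A)"
  have eval_space: "eval_space (X_sgp A) = eval_space (X_space A)" by (simp add: eval_space_def)
  have chars: "kalg_hom ?C complex_kalg = eval_space (X_space A) ` chars"
    using X.chars_C_alg by simp
  have smul: "smul (X_sgp ?C) (eval_space (X_space A) \<xi>, eval_space (X_space A) \<eta>) =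
      eval_space (X_space A) (smul (X_sgp A) (\<xi>, \<eta>))" if "\<xi> \<in> chars" "\<eta> \<in> chars" for \<xi> \<eta>
    using S.smul_eval_space[of \<xi> \<eta>] that by (simp add: eval_space)
  obtain v where v: "v \<in> kalg_hom (C_alg (X_space A)) A"
    "\<And>\<xi> f. \<xi> \<in> chars \<Longrightarrow> f \<in> compactological_hom (X_space A) complex_space \<Longrightarrow> \<xi> (v f) = f \<xi>"
    by (rule eval_alg_inverse) (rule that)
  have X_eval: "X_map A ?C (eval_alg A) (eval_space (X_space A) \<xi>) = \<xi>" if \<xi>: "\<xi> \<in> chars" for \<xi>
  proof (rule extensionalityI)
    have \<tau>: "eval_space (X_space A) \<xi> \<in> kalg_hom ?C complex_kalg" using \<xi> by (simp only: chars) blast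
    show "X_map A ?C (eval_alg A) (eval_space (X_space A) \<xi>) \<in> extensional (carrier A)" by (simp add: X_map_apply[OF \<tau>])
    show "\<xi> \<in> extensional (carrier A)" by (rule kalg_hom_extensional[OF \<xi>])
    show "X_map A ?C (eval_alg A) (eval_space (X_space A) \<xi>) a = \<xi> a" if "a \<in> carrier A" for a
      using \<xi> eval_alg_closed[OF that] that by (simp add: X_map_apply[OF \<tau>] compose_eq eval_alg_apply)
  qed
  have X_v: "X_map ?C A v \<xi> = eval_space (X_space A) \<xi>" if \<xi>: "\<xi> \<in> chars" for \<xi>
    using \<xi> v(2)[OF \<xi>] by (auto simp: X_map_apply[OF \<xi>] compose_def eval_space_def restrict_def fun_eq_iff)
  have "eval_alg A \<in> kbialg_hom A ?C"
    unfolding kbialg_hom_iff[OF kstar_comultiplication_axioms S.kstar_comultiplication_C] chars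
    using eval_alg_hom by (auto simp: smul X_eval smul_in_chars)
  moreover have "v \<in> kbialg_hom ?C A"
    unfolding kbialg_hom_iff[OF S.kstar_comultiplication_C kstar_comultiplication_axioms]
    using v(1) by (auto simp: smul X_v smul_in_chars)
  moreover have "compose (carrier A) v (eval_alg A) = kalg_id A"
  proof (rule extensionalityI)
    fix a assume a: "a \<in> carrier A"
    have "v (eval_alg A a) = a"
    proof (rule eqI_chars)
      show "v (eval_alg A a) \<in> carrier A" using kalg_hom_closed[OF v(1)] eval_alg_closed[OF a] by simp
      show "\<xi> (v (eval_alg A a)) = \<xi> a" if "\<xi> \<in> chars" for \<xi>
        using v(2)[OF that eval_alg_closed[OF a]] that a by (simp add: eval_alg_apply)
    qed (rule a)
    then show "compose (carrier A) v (eval_alg A) a = kalg_id A a" using a by (simp add: compose_eq kalg_id_def)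
  qed (simp_all add: kalg_id_def)
  moreover have "compose (carrier ?C) (eval_alg A) v = kalg_id ?C"
  proof (rule extensionalityI)
    fix f assume "f \<in> carrier ?C"
    then have f: "f \<in> compactological_hom (X_space A) complex_space" by simp
    have "v f \<in> carrier A" using kalg_hom_closed[OF v(1)] f by simp
    then have "eval_alg A (v f) = f"
      using compactological_hom_extensional[OF f] v(2)[OF _ f]
      by (intro extensionalityI[of _ chars]) (simp_all add: eval_alg_def)
    then show "compose (carrier ?C) (eval_alg A) v f = kalg_id ?C f" using f by (simp add: compose_eq kalg_id_def)
  qed (simp_all add: kalg_id_def)
  ultimately show ?thesis unfolding kbialg_iso_def by blast
qed

end

theorem eval_alg_natural:
  assumes A: "kstar_algebra A" and B: "kstar_algebra B" and u: "u \<in> kalg_hom A B"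
  shows "compose (carrier A) (eval_alg B) u =
    compose (carrier A) (C_map (X_sgp B) (X_sgp A) (X_map A B u)) (eval_alg A)"
proof (rule extensionalityI)
  fix a assume a: "a \<in> carrier A"
  interpret A: kstar_algebra A by fact
  have "eval_alg B (u a) = compose (kalg_hom B complex_kalg) (eval_alg A a) (X_map A B u)"
  proof (rule extensionalityI)
    fix \<eta> assume \<eta>: "\<eta> \<in> kalg_hom B complex_kalg"
    have "compose (carrier A) \<eta> u \<in> A.chars" by (rule compose_character[OF A u \<eta>])
    then show "eval_alg B (u a) \<eta> = compose (kalg_hom B complex_kalg) (eval_alg A a) (X_map A B u) \<eta>"
      using \<eta> a kalg_hom_closed[OF u a] by (simp add: eval_alg_def X_map_apply compose_eq)
  qed (use kalg_hom_closed[OF u a] in \<open>simp_all add: eval_alg_def\<close>)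
  then show "compose (carrier A) (eval_alg B) u a =
      compose (carrier A) (C_map (X_sgp B) (X_sgp A) (X_map A B u)) (eval_alg A) a"
    using a A.eval_alg_closed[OF a] by (simp add: compose_eq C_map_def)
qed simp_all

text \<open>Unit and inversion are transported along the identification of \<open>S\<close> with the
  characters of its function algebra; \<open>hopf_kstar_algebra_iff\<close> then supplies counit and
  antipode without computing in tensor products.\<close>

theorem (in compactological_group) hopf_kstar_algebra_C: "hopf_kstar_algebra (C_bialg S)"
proof -
  let ?C = "C_bialg S"
  interpret C: kstar_bialgebra ?C by (rule kstar_bialgebra_C)
  interpret X: compactological_semigroup "X_sgp ?C" by (rule C.compactological_semigroup_X)
  have points: "points (X_sgp ?C) = eval_space S ` points S" using chars_C_alg by simp
  obtain e i where e: "e \<in> points S" and i: "i \<in> compactological_hom S S"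
    and group: "\<And>s. s \<in> points S \<Longrightarrow>
      smul S (e, s) = s \<and> smul S (s, e) = s \<and> smul S (i s, s) = e \<and> smul S (s, i s) = e"
    using unit_inverse by blast
  let ?i = "compose (points (X_sgp ?C)) (compose (points S) (eval_space S) i) (eval_space_inv S)"
  have "?i \<in> compactological_hom (X_sgp ?C) (X_sgp ?C)"
  proof (rule compactological_hom_compose)
    show "eval_space_inv S \<in> compactological_hom (X_sgp ?C) S" using eval_space_inv_hom by simp
    show "compose (points S) (eval_space S) i \<in> compactological_hom S (X_sgp ?C)"
      using compactological_hom_compose[OF i eval_space_hom compactological_space_axioms] by simp
  qed (rule X.compactological_space_axioms)
  moreover have "smul (X_sgp ?C) (eval_space S e, \<xi>) = \<xi> \<and> smul (X_sgp ?C) (\<xi>, eval_space S e) = \<xi> \<and>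
      smul (X_sgp ?C) (?i \<xi>, \<xi>) = eval_space S e \<and> smul (X_sgp ?C) (\<xi>, ?i \<xi>) = eval_space S e"
    if "\<xi> \<in> points (X_sgp ?C)" for \<xi>
  proof -
    obtain s where s: "s \<in> points S" "\<xi> = eval_space S s" using \<open>\<xi> \<in> points (X_sgp ?C)\<close> unfolding points by blast
    have "i s \<in> points S" by (rule compactological_hom_in_points[OF i s(1)])
    moreover have "?i \<xi> = eval_space S (i s)"
      using s eval_space_in_chars by (simp add: compose_def)
    ultimately show ?thesis using group[OF s(1)] s e by (simp add: smul_eval_space)
  qed
  moreover have "eval_space S e \<in> points (X_sgp ?C)" using e unfolding points by blast
  ultimately have "compactological_group (X_sgp ?C)" by unfold_locales blast
  then show ?thesis by (simp only: C.hopf_kstar_algebra_iff)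
qed

theorem theorem2p5:
  shows "(\<comment> \<open>functor C\<close>
     (\<forall>S :: 's compactological_sgp. compactological_semigroup S \<longrightarrow> kstar_bialgebra (C_bialg S)) \<and>
     (\<forall>(S :: 's compactological_sgp) (T :: 't compactological_sgp) u.
        compactological_semigroup S \<and> compactological_semigroup T \<and> u \<in> csgp_hom S T \<longrightarrow>
        C_map S T u \<in> kbialg_hom (C_bialg T) (C_bialg S)) \<and>
     (\<forall>S :: 's compactological_sgp. compactological_semigroup S \<longrightarrow>
        C_map S S (compactological_id S) = kalg_id (C_bialg S)) \<and>
     (\<forall>(S :: 's compactological_sgp) (T :: 't compactological_sgp) (R :: 'r compactological_sgp) u v.
        compactological_semigroup S \<and> compactological_semigroup T \<and> compactological_semigroup R \<and>
        u \<in> csgp_hom S T \<and> v \<in> csgp_hom T R \<longrightarrow>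
        C_map S R (compose (points S) v u) =
        compose (carrier (C_bialg R)) (C_map S T u) (C_map T R v)) \<and>
     \<comment> \<open>functor X\<close>
     (\<forall>A :: 'a kbialg. kstar_bialgebra A \<longrightarrow> compactological_semigroup (X_sgp A)) \<and>
     (\<forall>(A :: 'a kbialg) (B :: 'b kbialg) u.
        kstar_bialgebra A \<and> kstar_bialgebra B \<and> u \<in> kbialg_hom A B \<longrightarrow>
        X_map A B u \<in> csgp_hom (X_sgp B) (X_sgp A)) \<and>
     (\<forall>A :: 'a kbialg. kstar_bialgebra A \<longrightarrow>
        X_map A A (kalg_id A) = compactological_id (X_sgp A)) \<and>
     (\<forall>(A :: 'a kbialg) (B :: 'b kbialg) (D :: 'd kbialg) u v.
        kstar_bialgebra A \<and> kstar_bialgebra B \<and> kstar_bialgebra D \<and>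
        u \<in> kbialg_hom A B \<and> v \<in> kbialg_hom B D \<longrightarrow>
        X_map A D (compose (carrier A) v u) =
        compose (points (X_sgp D)) (X_map A B u) (X_map B D v)) \<and>
     \<comment> \<open>natural isomorphism from the identity to X after C\<close>
     (\<forall>S :: 's compactological_sgp. compactological_semigroup S \<longrightarrow>
        eval_space S \<in> csgp_iso S (X_sgp (C_bialg S))) \<and>
     (\<forall>(S :: 's compactological_sgp) (T :: 't compactological_sgp) u.
        compactological_semigroup S \<and> compactological_semigroup T \<and> u \<in> csgp_hom S T \<longrightarrow>
        compose (points S) (eval_space T) u =
        compose (points S) (X_map (C_bialg T) (C_bialg S) (C_map S T u)) (eval_space S)) \<and>
     \<comment> \<open>natural isomorphism from the identity to C after X\<close>
     (\<forall>A :: 'a kbialg. kstar_bialgebra A \<longrightarrow>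
        eval_alg A \<in> kbialg_iso A (C_bialg (X_sgp A))) \<and>
     (\<forall>(A :: 'a kbialg) (B :: 'b kbialg) u.
        kstar_bialgebra A \<and> kstar_bialgebra B \<and> u \<in> kbialg_hom A B \<longrightarrow>
        compose (carrier A) (eval_alg B) u =
        compose (carrier A) (C_map (X_sgp B) (X_sgp A) (X_map A B u)) (eval_alg A))) \<and>
    (\<comment> \<open>functor C\<close>
     (\<forall>S :: 's compactological_sgp. compactological_group S \<longrightarrow> hopf_kstar_algebra (C_bialg S)) \<and>
     (\<forall>(S :: 's compactological_sgp) (T :: 't compactological_sgp) u.
        compactological_group S \<and> compactological_group T \<and> u \<in> csgp_hom S T \<longrightarrow>
        C_map S T u \<in> kbialg_hom (C_bialg T) (C_bialg S)) \<and>
     (\<forall>S :: 's compactological_sgp. compactological_group S \<longrightarrow>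
        C_map S S (compactological_id S) = kalg_id (C_bialg S)) \<and>
     (\<forall>(S :: 's compactological_sgp) (T :: 't compactological_sgp) (R :: 'r compactological_sgp) u v.
        compactological_group S \<and> compactological_group T \<and> compactological_group R \<and>
        u \<in> csgp_hom S T \<and> v \<in> csgp_hom T R \<longrightarrow>
        C_map S R (compose (points S) v u) =
        compose (carrier (C_bialg R)) (C_map S T u) (C_map T R v)) \<and>
     \<comment> \<open>functor X\<close>
     (\<forall>A :: 'a kbialg. hopf_kstar_algebra A \<longrightarrow> compactological_group (X_sgp A)) \<and>
     (\<forall>(A :: 'a kbialg) (B :: 'b kbialg) u.
        hopf_kstar_algebra A \<and> hopf_kstar_algebra B \<and> u \<in> kbialg_hom A B \<longrightarrow>
        X_map A B u \<in> csgp_hom (X_sgp B) (X_sgp A)) \<and>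
     (\<forall>A :: 'a kbialg. hopf_kstar_algebra A \<longrightarrow>
        X_map A A (kalg_id A) = compactological_id (X_sgp A)) \<and>
     (\<forall>(A :: 'a kbialg) (B :: 'b kbialg) (D :: 'd kbialg) u v.
        hopf_kstar_algebra A \<and> hopf_kstar_algebra B \<and> hopf_kstar_algebra D \<and>
        u \<in> kbialg_hom A B \<and> v \<in> kbialg_hom B D \<longrightarrow>
        X_map A D (compose (carrier A) v u) =
        compose (points (X_sgp D)) (X_map A B u) (X_map B D v)) \<and>
     \<comment> \<open>natural isomorphism from the identity to X after C\<close>
     (\<forall>S :: 's compactological_sgp. compactological_group S \<longrightarrow>
        eval_space S \<in> csgp_iso S (X_sgp (C_bialg S))) \<and>
     (\<forall>(S :: 's compactological_sgp) (T :: 't compactological_sgp) u.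
        compactological_group S \<and> compactological_group T \<and> u \<in> csgp_hom S T \<longrightarrow>
        compose (points S) (eval_space T) u =
        compose (points S) (X_map (C_bialg T) (C_bialg S) (C_map S T u)) (eval_space S)) \<and>
     \<comment> \<open>natural isomorphism from the identity to C after X\<close>
     (\<forall>A :: 'a kbialg. hopf_kstar_algebra A \<longrightarrow>
        eval_alg A \<in> kbialg_iso A (C_bialg (X_sgp A))) \<and>
     (\<forall>(A :: 'a kbialg) (B :: 'b kbialg) u.
        hopf_kstar_algebra A \<and> hopf_kstar_algebra B \<and> u \<in> kbialg_hom A B \<longrightarrow>
        compose (carrier A) (eval_alg B) u =
        compose (carrier A) (C_map (X_sgp B) (X_sgp A) (X_map A B u)) (eval_alg A)))"
proof -
  have semigroup: "compactological_group S \<Longrightarrow> compactological_semigroup S" for S :: "'x compactological_sgp"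
    by (rule compactological_group.axioms(1))
  have bialgebra: "hopf_kstar_algebra A \<Longrightarrow> kstar_bialgebra A" for A :: "'x kbialg"
    by (rule hopf_kstar_algebra.axioms(1))
  have space: "compactological_semigroup S \<Longrightarrow> compactological_space S" for S :: "'x compactological_sgp"
    by (intro regular_compactological_space.axioms(1) compactological_semigroup.axioms(1))
  have kstar: "kstar_bialgebra A \<Longrightarrow> kstar_algebra A" for A :: "'x kbialg"
    by (rule kstar_bialgebra.axioms(1))
  have csgp: "u \<in> csgp_hom S T \<Longrightarrow> u \<in> compactological_hom S T"
    for S :: "'x compactological_sgp" and T :: "'y compactological_sgp" and u
    by (simp add: csgp_hom_def)
  have kbialg: "u \<in> kbialg_hom A B \<Longrightarrow> u \<in> kalg_hom A B" for A :: "'x kbialg" and B :: "'y kbialg" and u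
    by (simp add: kbialg_hom_def)
  have group_X: "compactological_group (X_sgp A)" if "hopf_kstar_algebra A" for A :: "'x kbialg"
    using that kstar_bialgebra.hopf_kstar_algebra_iff[OF bialgebra[OF that]] by simp
  show ?thesis
    \<comment> \<open>Groups and Hopf algebras have the same morphisms as semigroups and bialgebras.
      In the second half the new facts are therefore those on objects,
      \<open>hopf_kstar_algebra_C\<close> and \<open>group_X\<close>; the rest is inherited.\<close>
    apply (intro conjI allI impI; (elim conjE)?)
    subgoal by (rule compactological_semigroup.kstar_bialgebra_C)
    subgoal by (rule C_map_bialg)
    subgoal by (rule C_map_id)
    subgoal by (rule C_map_compose[OF space space csgp csgp])
    subgoal by (rule kstar_bialgebra.compactological_semigroup_X)
    subgoal by (rule X_map_sgp)
    subgoal by (rule X_map_id)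
    subgoal by (rule X_map_compose[OF kstar kbialg kbialg])
    subgoal by (rule compactological_semigroup.eval_space_iso)
    subgoal by (rule eval_space_natural[OF space space csgp])
    subgoal by (rule kstar_bialgebra.eval_alg_iso)
    subgoal by (rule eval_alg_natural[OF kstar kstar kbialg])
    subgoal by (rule compactological_group.hopf_kstar_algebra_C)
    subgoal by (rule C_map_bialg[OF semigroup semigroup])
    subgoal by (rule C_map_id)
    subgoal by (rule C_map_compose[OF space[OF semigroup] space[OF semigroup] csgp csgp])
    subgoal by (rule group_X)
    subgoal by (rule X_map_sgp[OF bialgebra bialgebra])
    subgoal by (rule X_map_id)
    subgoal by (rule X_map_compose[OF kstar[OF bialgebra] kbialg kbialg])
    subgoal by (rule compactological_semigroup.eval_space_iso[OF semigroup])
    subgoal by (rule eval_space_natural[OF space[OF semigroup] space[OF semigroup] csgp])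
    subgoal by (rule kstar_bialgebra.eval_alg_iso[OF bialgebra])
    subgoal by (rule eval_alg_natural[OF kstar[OF bialgebra] kstar[OF bialgebra] kbialg])
    done
qed

end
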